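(* Let $T\in(0,+\infty)$. For each $\mathcal F_0$-measurable random variable $\xi$ with $\xi>0$ $\mathbb P$-a.s. and $0<\mathbb E[\xi]<+\infty$, there exists a unique equilibrium $(\widehat{\mathbf u},\widehat q)$ of the mean-field game with finite time horizon $T$ among all equilibria $(\widetilde{\mathbf u},\widetilde q)\in\mathcal U_T\times\mathcal Q_T$. More precisely, $\widehat{\mathbf u}=z^{(T,\widehat q)}$, and $\widehat q$ is the unique solution $y:[0,T]\to(0,+\infty)$ to $$\frac{\mathrm d}{\mathrm ds}y_s=-\delta y_s+\int_s^T e^{-(\rho+\delta)(u-s)}y_u^{-\beta}\,\mathrm du,\quad s\in[0,T],\qquad y_0=\mathbb E[\xi].$$
   Context: Fixed constants $\delta,\sigma,\rho,\beta>0$ and $T\in(0,+\infty)$. $(\Omega,\mathcal F,\mathbb F=(\mathcal F_s)_{s\ge0},\mathbb P)$ is a complete filtered probability space satisfying the usual assumptions and supporting a standard Brownian motion $B$ with respect to $\mathbb F$. Admissible controls: $\mathcal U_T$ is the set of $(\mathcal F_s)_{s\in[0,T]}$-progressively measurable processes $\mathbf u:\Omega\times[0,T]\to[0,+\infty)$ with $\mathbb E\big[\int_0^Tu_s^2\,\mathrm ds\big]<+\infty$. Controls equal $\mathbb P\otimes\mathrm{Leb}$-a.e. are identified. State: $X^{\xi,\mathbf u}$ is the unique strong solution of $\mathrm dX_s=-\delta X_s\,\mathrm ds+\sigma X_s\,\mathrm dB_s+u_s\,\mathrm ds$, $s\in(0,T]$, $X_0=\xi$. Functional: for a deterministic measurable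 $q:[0,T]\to(0,+\infty)$, $J_{T,q}(\xi,\mathbf u)=\mathbb E\big[\int_0^Te^{-\rho s}\{X_s^{\xi,\mathbf u}q_s^{-\beta}-\tfrac12u_s^2\}\,\mathrm ds\big]$. Equilibrium: a pair $(\widehat{\mathbf u},\widehat q)$ with $\widehat{\mathbf u}\in\mathcal U_T$ and $\widehat q:[0,T]\to(0,+\infty)$ measurable such that (i) $J_{T,\widehat q}(\xi,\widehat{\mathbf u})\ge J_{T,\widehat q}(\xi,\mathbf u)$ for all $\mathbf u\in\mathcal U_T$; (ii) $\widehat q_s=\mathbb E[X_s^{\xi,\widehat{\mathbf u}}]$ for all $s\in[0,T]$. $\mathcal Q_T$ is the set of measurable $q:[0,T]\to(0,+\infty)$ such that $q^{-\beta}$ is Lebesgue integrable on $(0,T]$. For $q\in\mathcal Q_T$, $z^{(T,q)}_s=\int_s^Te^{-(\rho+\delta)(r-s)}q_r^{-\beta}\,\mathrm dr$, $s\in[0,T]$. A solution of the integro-differential equation with initial value $y_0=x$ is a function $y\in C^1([0,T];(0,+\infty))$ satisfying it for all $s\in[0,T]$ (classical solution), or equivalently a function $y\in C([0,T];(0,+\infty))$ with $y_s=e^{-\delta s}x+\int_0^se^{-\delta(s-r)}\int_r^Te^{-(\rho+\delta)(u-r)}y_u^{-\beta}\,\mathrm du\,\mathrm dr$ for all $s\in[0,T]$ (mild solution). *)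

theory Defs
  imports "HOL-Probability.Probability"
begin

section \<open>Stochastic basis and Brownian motion\<close>

text \<open>
  Time is \<open>{0..}\<close>; the \<open>F s\<close> with \<open>s < 0\<close> are unconstrained and never used. Of \<open>F s\<close> only the
  space and the sigma-algebra matter, its measure is irrelevant.
\<close>

locale usual_stochastic_basis = prob_space M + complete_measure M
  for M :: "'a measure" and F :: "real \<Rightarrow> 'a measure" +
  assumes subalgebra_F: "0 \<le> s \<Longrightarrow> subalgebra M (F s)"
    and mono_F: "0 \<le> s \<Longrightarrow> s \<le> t \<Longrightarrow> sets (F s) \<subseteq> sets (F t)"
    and null_sets_F: "null_sets M \<subseteq> sets (F 0)"
    and right_continuous_F: "0 \<le> s \<Longrightarrow> (\<Inter>t\<in>{s<..}. sets (F t)) = sets (F s)"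

locale brownian_motion = usual_stochastic_basis M F
  for M :: "'a measure" and F :: "real \<Rightarrow> 'a measure" and B :: "real \<Rightarrow> 'a \<Rightarrow> real" +
  assumes adapted_B: "0 \<le> s \<Longrightarrow> B s \<in> borel_measurable (F s)"
    and B_0: "AE \<omega> in M. B 0 \<omega> = 0"
    and continuous_B: "AE \<omega> in M. continuous_on {0..} (\<lambda>s. B s \<omega>)"
    and increments_B: "0 \<le> s \<Longrightarrow> s < t \<Longrightarrow>
        distributed M lborel (\<lambda>\<omega>. B t \<omega> - B s \<omega>) (normal_density 0 (sqrt (t - s)))"
    and indep_increments_B: "0 \<le> s \<Longrightarrow> s < t \<Longrightarrow>
        indep_set (sets (F s)) {(\<lambda>\<omega>. B t \<omega> - B s \<omega>) -` A \<inter> space M |A. A \<in> sets borel}"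

definition progressive :: "(real \<Rightarrow> 'a measure) \<Rightarrow> real \<Rightarrow> (real \<Rightarrow> 'a \<Rightarrow> real) \<Rightarrow> bool" where
  "progressive F T H \<longleftrightarrow>
     (\<forall>t\<in>{0..T}. (\<lambda>(s, \<omega>). H s \<omega>) \<in> borel_measurable (restrict_space borel {0..t} \<Otimes>\<^sub>M F t))"

section \<open>The Ito integral\<close>

definition tendsto_zero_in_prob :: "'a measure \<Rightarrow> (nat \<Rightarrow> 'a \<Rightarrow> ennreal) \<Rightarrow> bool" where
  "tendsto_zero_in_prob M Z \<longleftrightarrow>
     (\<forall>\<epsilon>>0::real. (\<lambda>k. measure M {\<omega> \<in> space M. ennreal \<epsilon> < Z k \<omega>}) \<longlonglongrightarrow> 0)"

text \<open>
  The data \<open>n, t, h\<close> stand for the simple process equal to \<open>h i\<close> on \<open>{t i<..t (Suc i)}\<close>, \<open>i < n\<close>, and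
  to \<open>0\<close> elsewhere.
\<close>

definition simple_integrand ::
  "(real \<Rightarrow> 'a measure) \<Rightarrow> real \<Rightarrow> nat \<Rightarrow> (nat \<Rightarrow> real) \<Rightarrow> (nat \<Rightarrow> 'a \<Rightarrow> real) \<Rightarrow> bool" where
  "simple_integrand F s n t h \<longleftrightarrow>
     0 \<le> t 0 \<and> (\<forall>i<n. t i \<le> t (Suc i)) \<and> t n \<le> s \<and>
     (\<forall>i<n. h i \<in> borel_measurable (F (t i)) \<and> (\<exists>C. \<forall>\<omega>\<in>space (F (t i)). \<bar>h i \<omega>\<bar> \<le> C))"

definition simple_process ::
  "nat \<Rightarrow> (nat \<Rightarrow> real) \<Rightarrow> (nat \<Rightarrow> 'a \<Rightarrow> real) \<Rightarrow> real \<Rightarrow> 'a \<Rightarrow> real" where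
  "simple_process n t h r \<omega> = (\<Sum>i<n. h i \<omega> * indicator {t i<..t (Suc i)} r)"

definition simple_integral ::
  "(real \<Rightarrow> 'a \<Rightarrow> real) \<Rightarrow> nat \<Rightarrow> (nat \<Rightarrow> real) \<Rightarrow> (nat \<Rightarrow> 'a \<Rightarrow> real) \<Rightarrow> 'a \<Rightarrow> real" where
  "simple_integral B n t h \<omega> = (\<Sum>i<n. h i \<omega> * (B (t (Suc i)) \<omega> - B (t i) \<omega>))"

text \<open>
  \<open>has_ito_integral M F B s H Y\<close>: the random variable \<open>Y\<close> is (a version of) the Ito integral of
  \<open>H\<close> against \<open>B\<close> over \<open>[0,s]\<close>. This is the integral for progressively measurable \<open>H\<close> with paths
  a.s. in \<open>L\<^sup>2(0,s)\<close>: the limit in probability of the elementary integrals of simple processes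
  \<open>H\<^sup>k\<close> with \<open>\<integral>\<^sub>0\<^sup>s |H\<^sup>k - H|\<^sup>2 dr \<longlonglongrightarrow> 0\<close> in probability. No moment of \<open>H\<close> is required, as is needed
  for initial conditions that are merely integrable.
\<close>

definition has_ito_integral ::
  "'a measure \<Rightarrow> (real \<Rightarrow> 'a measure) \<Rightarrow> (real \<Rightarrow> 'a \<Rightarrow> real) \<Rightarrow> real \<Rightarrow>
   (real \<Rightarrow> 'a \<Rightarrow> real) \<Rightarrow> ('a \<Rightarrow> real) \<Rightarrow> bool" where
  "has_ito_integral M F B s H Y \<longleftrightarrow>
     progressive F s H \<and> Y \<in> borel_measurable M \<and>
     (\<exists>n t h. (\<forall>k. simple_integrand F s (n k) (t k) (h k)) \<and>
        tendsto_zero_in_prob M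
          (\<lambda>k \<omega>. \<integral>\<^sup>+r\<in>{0..s}. ennreal ((simple_process (n k) (t k) (h k) r \<omega> - H r \<omega>)\<^sup>2) \<partial>lborel) \<and>
        tendsto_zero_in_prob M
          (\<lambda>k \<omega>. ennreal \<bar>simple_integral B (n k) (t k) (h k) \<omega> - Y \<omega>\<bar>))"

section \<open>Controls and controlled state\<close>

definition admissible ::
  "'a measure \<Rightarrow> (real \<Rightarrow> 'a measure) \<Rightarrow> real \<Rightarrow> (real \<Rightarrow> 'a \<Rightarrow> real) set" where
  "admissible M F T =
     {u. progressive F T u \<and> (\<forall>s\<in>{0..T}. \<forall>\<omega>\<in>space M. 0 \<le> u s \<omega>) \<and>
         (\<integral>\<^sup>+\<omega>. (\<integral>\<^sup>+s\<in>{0..T}. ennreal ((u s \<omega>)\<^sup>2) \<partial>lborel) \<partial>M) < \<infinity>}"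

definition control_eq ::
  "'a measure \<Rightarrow> real \<Rightarrow> (real \<Rightarrow> 'a \<Rightarrow> real) \<Rightarrow> (real \<Rightarrow> 'a \<Rightarrow> real) \<Rightarrow> bool" where
  "control_eq M T u v \<longleftrightarrow>
     (AE p in M \<Otimes>\<^sub>M restrict_space lborel {0..T}. u (snd p) (fst p) = v (snd p) (fst p))"

definition strong_solution ::
  "'a measure \<Rightarrow> (real \<Rightarrow> 'a measure) \<Rightarrow> (real \<Rightarrow> 'a \<Rightarrow> real) \<Rightarrow> real \<Rightarrow> real \<Rightarrow> real \<Rightarrow>
   ('a \<Rightarrow> real) \<Rightarrow> (real \<Rightarrow> 'a \<Rightarrow> real) \<Rightarrow> (real \<Rightarrow> 'a \<Rightarrow> real) \<Rightarrow> bool" where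
  "strong_solution M F B \<delta> \<sigma> T \<xi> u X \<longleftrightarrow>
     (\<forall>s\<in>{0..T}. X s \<in> borel_measurable (F s)) \<and>
     (\<forall>\<omega>\<in>space M. continuous_on {0..T} (\<lambda>s. X s \<omega>)) \<and>
     (AE \<omega> in M. X 0 \<omega> = \<xi> \<omega>) \<and>
     (\<forall>s\<in>{0<..T}. \<exists>Y. has_ito_integral M F B s (\<lambda>r \<omega>. \<sigma> * X r \<omega>) Y \<and>
        (AE \<omega> in M. X s \<omega> = \<xi> \<omega> + (LBINT r:{0..s}. - \<delta> * X r \<omega> + u r \<omega>) + Y \<omega>))"

text \<open>
  The SDE determines \<open>X\<close> on \<open>{0..T}\<close> up to indistinguishability only, so a version has to be
  selected; nothing below depends on which one.
\<close>

definition controlled_state ::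
  "'a measure \<Rightarrow> (real \<Rightarrow> 'a measure) \<Rightarrow> (real \<Rightarrow> 'a \<Rightarrow> real) \<Rightarrow> real \<Rightarrow> real \<Rightarrow> real \<Rightarrow>
   ('a \<Rightarrow> real) \<Rightarrow> (real \<Rightarrow> 'a \<Rightarrow> real) \<Rightarrow> real \<Rightarrow> 'a \<Rightarrow> real" where
  "controlled_state M F B \<delta> \<sigma> T \<xi> u = (SOME X. strong_solution M F B \<delta> \<sigma> T \<xi> u X)"

section \<open>Objective functional and equilibria\<close>

text \<open>
  Integral of a function whose positive or negative part has finite integral. It is needed since the
  objective may be \<open>\<infinity>\<close> when \<open>q powr -\<beta>\<close> is not integrable, where the Bochner integral would
  return \<open>0\<close>.
\<close>

definition quasi_integral :: "'b measure \<Rightarrow> ('b \<Rightarrow> ereal) \<Rightarrow> ereal" where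
  "quasi_integral N f =
     enn2ereal (\<integral>\<^sup>+x. e2ennreal (f x) \<partial>N) - enn2ereal (\<integral>\<^sup>+x. e2ennreal (- f x) \<partial>N)"

definition objective ::
  "'a measure \<Rightarrow> (real \<Rightarrow> 'a measure) \<Rightarrow> (real \<Rightarrow> 'a \<Rightarrow> real) \<Rightarrow>
   real \<Rightarrow> real \<Rightarrow> real \<Rightarrow> real \<Rightarrow> real \<Rightarrow> (real \<Rightarrow> real) \<Rightarrow>
   ('a \<Rightarrow> real) \<Rightarrow> (real \<Rightarrow> 'a \<Rightarrow> real) \<Rightarrow> ereal" where
  "objective M F B \<delta> \<sigma> \<rho> \<beta> T q \<xi> u =
     quasi_integral M (\<lambda>\<omega>. quasi_integral (restrict_space lborel {0..T}) (\<lambda>s.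
       ereal (exp (- \<rho> * s) *
         (controlled_state M F B \<delta> \<sigma> T \<xi> u s \<omega> * q s powr (- \<beta>) - (u s \<omega>)\<^sup>2 / 2))))"

definition positive_measurable :: "real \<Rightarrow> (real \<Rightarrow> real) set" where
  "positive_measurable T =
     {q. q \<in> borel_measurable (restrict_space borel {0..T}) \<and> (\<forall>s\<in>{0..T}. 0 < q s)}"

definition equilibrium ::
  "'a measure \<Rightarrow> (real \<Rightarrow> 'a measure) \<Rightarrow> (real \<Rightarrow> 'a \<Rightarrow> real) \<Rightarrow>
   real \<Rightarrow> real \<Rightarrow> real \<Rightarrow> real \<Rightarrow> real \<Rightarrow> ('a \<Rightarrow> real) \<Rightarrow>
   (real \<Rightarrow> 'a \<Rightarrow> real) \<Rightarrow> (real \<Rightarrow> real) \<Rightarrow> bool" where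
  "equilibrium M F B \<delta> \<sigma> \<rho> \<beta> T \<xi> u q \<longleftrightarrow>
     u \<in> admissible M F T \<and> q \<in> positive_measurable T \<and>
     (\<forall>v\<in>admissible M F T.
        objective M F B \<delta> \<sigma> \<rho> \<beta> T q \<xi> v \<le> objective M F B \<delta> \<sigma> \<rho> \<beta> T q \<xi> u) \<and>
     (\<forall>s\<in>{0..T}. q s = (\<integral>\<omega>. controlled_state M F B \<delta> \<sigma> T \<xi> u s \<omega> \<partial>M))"

definition Q_class :: "real \<Rightarrow> real \<Rightarrow> (real \<Rightarrow> real) set" where
  "Q_class \<beta> T =
     {q \<in> positive_measurable T. set_integrable lborel {0<..T} (\<lambda>s. q s powr (- \<beta>))}"

definition z_control :: "real \<Rightarrow> real \<Rightarrow> real \<Rightarrow> real \<Rightarrow> (real \<Rightarrow> real) \<Rightarrow> real \<Rightarrow> real" where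
  "z_control \<delta> \<rho> \<beta> T q s =
     (LBINT r:{s..T}. exp (- (\<rho> + \<delta>) * (r - s)) * q r powr (- \<beta>))"

text \<open>Classical solutions; the derivative at the end points of \<open>[0,T]\<close> is one-sided.\<close>

definition ide_solution ::
  "real \<Rightarrow> real \<Rightarrow> real \<Rightarrow> real \<Rightarrow> real \<Rightarrow> (real \<Rightarrow> real) \<Rightarrow> bool" where
  "ide_solution \<delta> \<rho> \<beta> T x y \<longleftrightarrow>
     (\<forall>s\<in>{0..T}. 0 < y s) \<and> y 0 = x \<and>
     (\<exists>y'. continuous_on {0..T} y' \<and>
        (\<forall>s\<in>{0..T}. (y has_real_derivative y' s) (at s within {0..T}) \<and>
           y' s = - \<delta> * y s +
             (LBINT r:{s..T}. exp (- (\<rho> + \<delta>) * (r - s)) * y r powr (- \<beta>))))"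

end

theory Submission
  imports Defs
begin

text \<open>
  The state equation is linear and only the mean of the state enters the game, so the game can be
  solved by computing means.

  With the stochastic exponential \<open>E\<close> of the uncontrolled dynamics, the controlled state
  is \<open>X s = E s * (\<xi> + \<integral>\<^sub>0\<^sup>s u r / E r dr)\<close>. Everything here is nonnegative, and \<open>E s / E r\<close> is
  independent of \<open>F r\<close> with mean \<open>exp (- \<delta> (s - r))\<close>; hence Tonelli's theorem yields
  \<open>E[X s] = exp (- \<delta> s) E[\<xi>] + \<integral>\<^sub>0\<^sup>s exp (- \<delta> (s - r)) E[u r] dr\<close> although \<open>\<xi>\<close> is merely integrable
  and \<open>\<sigma> X\<close> need not be square integrable (\<open>nn_integral_X\<close>). That this formula gives a strong solution is checked on
  Riemann sums (\<open>strong_solution_exists\<close>): linearising the exponential on an interval of length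
  \<open>\<Delta>\<close> leaves martingale differences of variance \<open>O(\<Delta>\<^sup>2)\<close>, whose sum vanishes in the limit. The game
  is posed for an arbitrary strong solution, so pathwise uniqueness is needed as well
  (\<open>strong_solution_unique\<close>). It is a Gronwall argument on the events that the difference of two
  solutions has stayed bounded. No stopping times occur: by \<open>simple_integral_tail\<close> two elementary
  integrals are close on \<^emph>\<open>every\<close> event on which their integrands are close, and this lets the Ito
  integral be restricted to arbitrary events.

  For fixed \<open>q\<close>, inserting the mean of the state and exchanging the order of
  integration turns the objective into a constant minus
  \<open>1/2 E[\<integral>\<^sub>0\<^sup>T exp (- \<rho> s) (u s - z s)\<^sup>2 ds]\<close> with \<open>z = z_control \<delta> \<rho> \<beta> T q\<close>
  (\<open>objective_eq_square\<close>). So \<open>z\<close> is the best reply, unique up to null sets, and the consistency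
  condition \<open>q s = E[X s]\<close> becomes the mild form of the integro-differential equation
  (\<open>equilibrium_iff\<close>). It remains to solve this equation uniquely.

  With \<open>z\<close> as a second unknown it is the boundary value problem
  \<open>y' = - \<delta> y + z\<close>, \<open>z' = (\<rho> + \<delta>) z - y powr - \<beta>\<close>, \<open>y 0 = x\<close>, \<open>z T = 0\<close>. For two solutions, since the
  price \<open>y powr - \<beta>\<close> is decreasing in \<open>y\<close>, the function \<open>exp (- \<rho> s) (y - y') (z - z')\<close> is
  nondecreasing; it vanishes at both ends, which forces the solutions to agree
  (\<open>ide_solution_unique\<close>). Existence is by shooting in \<open>z 0\<close>, after truncating the price near \<open>0\<close> at
  a level that solutions do not reach (\<open>ide_solution_exists\<close>).
\<close>

section \<open>The integro-differential equation\<close>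

text \<open>
  Picard's theorem on the whole interval at once: in the supremum norm weighted by \<open>exp (- 2 L s)\<close> the
  integral operator is a contraction with factor \<open>1/2\<close>. The same contraction compares the fixed points
  for two initial values, which is the Lipschitz dependence that shooting needs.
\<close>

lemma lipschitz_ode_flow:
  fixes f :: "'b::banach \<Rightarrow> 'b" and L T :: real
  assumes lip: "\<And>x y. norm (f x - f y) \<le> L * norm (x - y)" and L: "0 < L" and T: "0 \<le> T"
  shows "\<exists>Y C. (\<forall>a. continuous_on {0..T} (Y a) \<and>
             (\<forall>s\<in>{0..T}. Y a s = a + integral {0..s} (\<lambda>r. f (Y a r)))) \<and>
           (\<forall>a b. \<forall>s\<in>{0..T}. norm (Y a s - Y b s) \<le> C * norm (a - b))"
proof -
  \<comment> \<open>functions on \<open>{0..T}\<close> are extended by constants, to live in the complete space of bounded continuous functions\<close>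
  define c where "c s = max 0 (min T s)" for s :: real
  have c_in: "c s \<in> {0..T}" for s using T by (auto simp: c_def)
  have c_id: "c s = s" if "s \<in> {0..T}" for s using that by (auto simp: c_def)
  have c_cont: "continuous_on UNIV c" unfolding c_def by (intro continuous_intros)
  have f_cont: "continuous_on UNIV f"
    by (rule lipschitz_on_continuous_on[of L], rule lipschitz_onI) (use lip L in \<open>auto simp: dist_norm\<close>)
  have ext: "(\<lambda>s. h (c s)) \<in> bcontfun" if h: "continuous_on {0..T} h" for h :: "real \<Rightarrow> 'b"
  proof -
    have "continuous_on UNIV (\<lambda>s. h (c s))"
      by (rule continuous_on_compose2[OF h c_cont]) (use c_in in auto)
    moreover have "bounded (range (\<lambda>s. h (c s)))"
      by (rule bounded_subset[OF compact_imp_bounded[OF compact_continuous_image[OF h compact_Icc]]])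
         (use c_in in auto)
    ultimately show ?thesis by (simp add: bcontfun_def)
  qed
  define g where "g \<phi> r = f (exp (2 * L * r) *\<^sub>R apply_bcontfun \<phi> r)" for \<phi> :: "real \<Rightarrow>\<^sub>C 'b" and r
  have g_cont: "continuous_on A (g \<phi>)" for A \<phi>
    unfolding g_def
    by (rule continuous_on_compose2[OF f_cont]) (auto intro!: continuous_intros)
  have g_int: "g \<phi> integrable_on {0..s}" for \<phi> s
    by (rule integrable_continuous_real[OF g_cont])
  define h where "h a \<phi> s = exp (- (2 * L * s)) *\<^sub>R (a + integral {0..s} (g \<phi>))" for a \<phi> s
  have h_cont: "continuous_on {0..T} (h a \<phi>)" for a \<phi>
    unfolding h_def by (intro continuous_intros indefinite_integral_continuous_1 g_int)
  define G where "G a \<phi> = Bcontfun (\<lambda>s. h a \<phi> (c s))" for a \<phi>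
  have G: "apply_bcontfun (G a \<phi>) s = h a \<phi> (c s)" for a \<phi> s
    unfolding G_def by (subst Bcontfun_inverse[OF ext[OF h_cont]]) simp
  have G_contr: "dist (G a \<phi>) (G a \<psi>) \<le> 1/2 * dist \<phi> \<psi>" for a \<phi> \<psi>
  proof (rule dist_bound)
    fix s
    let ?t = "c s" and ?d = "dist \<phi> \<psi>"
    have t: "0 \<le> ?t" using c_in[of s] by simp
    have bnd: "norm (g \<phi> r - g \<psi> r) \<le> L * exp (2 * L * r) * ?d" for r
    proof -
      have "norm (g \<phi> r - g \<psi> r) \<le> L * norm (exp (2 * L * r) *\<^sub>R apply_bcontfun \<phi> r - exp (2 * L * r) *\<^sub>R apply_bcontfun \<psi> r)"
        unfolding g_def by (rule lip)
      also have "\<dots> = L * exp (2 * L * r) * dist (apply_bcontfun \<phi> r) (apply_bcontfun \<psi> r)"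
        by (simp add: dist_norm flip: scaleR_diff_right)
      also have "\<dots> \<le> L * exp (2 * L * r) * ?d"
        using dist_bounded[of \<phi> r \<psi>] L by (intro mult_left_mono) auto
      finally show ?thesis .
    qed
    have prim: "((\<lambda>r. L * exp (2 * L * r) * ?d) has_integral
        (exp (2 * L * ?t) / 2 * ?d - exp (2 * L * 0) / 2 * ?d)) {0..?t}"
      by (rule fundamental_theorem_of_calculus[OF t])
         (auto intro!: derivative_eq_intros simp: L has_real_derivative_iff_has_vector_derivative[symmetric])
    have "norm (integral {0..?t} (g \<phi>) - integral {0..?t} (g \<psi>))
        = norm (integral {0..?t} (\<lambda>r. g \<phi> r - g \<psi> r))"
      by (simp add: integral_diff[OF g_int g_int])
    also have "\<dots> \<le> integral {0..?t} (\<lambda>r. L * exp (2 * L * r) * ?d)"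
      by (intro Henstock_Kurzweil_Integration.integral_norm_bound_integral integrable_diff g_int bnd)
         (use prim in blast)
    also have "\<dots> = exp (2 * L * ?t) / 2 * ?d - ?d / 2"
      using integral_unique[OF prim] by simp
    also have "\<dots> \<le> exp (2 * L * ?t) / 2 * ?d" by simp
    finally have I: "norm (integral {0..?t} (g \<phi>) - integral {0..?t} (g \<psi>)) \<le> exp (2 * L * ?t) / 2 * ?d" .
    have "dist (apply_bcontfun (G a \<phi>) s) (apply_bcontfun (G a \<psi>) s)
      = exp (- (2 * L * ?t)) * norm (integral {0..?t} (g \<phi>) - integral {0..?t} (g \<psi>))"
      unfolding G h_def dist_norm by (simp flip: scaleR_diff_right)
    also have "\<dots> \<le> exp (- (2 * L * ?t)) * (exp (2 * L * ?t) / 2 * ?d)"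
      by (intro mult_left_mono I) auto
    also have "\<dots> = 1/2 * ?d" by (simp add: exp_minus field_simps)
    finally show "dist (apply_bcontfun (G a \<phi>) s) (apply_bcontfun (G a \<psi>) s) \<le> 1/2 * ?d" .
  qed
  have "\<exists>\<phi>. G a \<phi> = \<phi>" for a
    using banach_fix_type[of "1/2" "G a"] G_contr[of a] by auto
  then obtain \<Phi> where \<Phi>: "\<And>a. G a (\<Phi> a) = \<Phi> a" by metis
  have G_init: "dist (G a \<phi>) (G b \<phi>) \<le> norm (a - b)" for a b \<phi>
  proof (rule dist_bound)
    fix s
    have "dist (apply_bcontfun (G a \<phi>) s) (apply_bcontfun (G b \<phi>) s) = exp (- (2 * L * c s)) * norm (a - b)"
      unfolding G h_def dist_norm by (simp flip: scaleR_diff_right)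
    also have "\<dots> \<le> 1 * norm (a - b)"
      using c_in[of s] L by (intro mult_right_mono) auto
    finally show "dist (apply_bcontfun (G a \<phi>) s) (apply_bcontfun (G b \<phi>) s) \<le> norm (a - b)" by simp
  qed
  have \<Phi>_init: "dist (\<Phi> a) (\<Phi> b) \<le> 2 * norm (a - b)" for a b
  proof -
    have "dist (\<Phi> a) (\<Phi> b) \<le> dist (G a (\<Phi> a)) (G a (\<Phi> b)) + dist (G a (\<Phi> b)) (G b (\<Phi> b))"
      using dist_triangle[of "G a (\<Phi> a)" "G b (\<Phi> b)" "G a (\<Phi> b)"] by (simp add: \<Phi>)
    then show ?thesis using G_contr[of a "\<Phi> a" "\<Phi> b"] G_init[of a "\<Phi> b" b] by simp
  qed
  define Y where "Y a s = exp (2 * L * s) *\<^sub>R apply_bcontfun (\<Phi> a) s" for a s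
  have "Y a s = a + integral {0..s} (\<lambda>r. f (Y a r))" if s: "s \<in> {0..T}" for a s
  proof -
    have "apply_bcontfun (\<Phi> a) s = h a (\<Phi> a) s" using G[of a "\<Phi> a" s] c_id[OF s] \<Phi> by simp
    then have "Y a s = a + integral {0..s} (g (\<Phi> a))"
      by (simp add: Y_def h_def exp_minus)
    then show ?thesis by (simp add: g_def[abs_def] Y_def)
  qed
  moreover have "continuous_on {0..T} (Y a)" for a
    unfolding Y_def by (auto intro!: continuous_intros)
  moreover have "norm (Y a s - Y b s) \<le> (2 * exp (2 * L * T)) * norm (a - b)" if s: "s \<in> {0..T}" for a b s
  proof -
    have "norm (Y a s - Y b s) = exp (2 * L * s) * dist (apply_bcontfun (\<Phi> a) s) (apply_bcontfun (\<Phi> b) s)"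
      by (simp add: Y_def dist_norm flip: scaleR_diff_right)
    also have "\<dots> \<le> exp (2 * L * T) * (2 * norm (a - b))"
      using s L order_trans[OF dist_bounded \<Phi>_init, of a s b] by (intro mult_mono) auto
    finally show ?thesis by simp
  qed
  ultimately show ?thesis by blast
qed

text \<open>
  Below \<open>c\<close> the price \<open>x powr - \<beta>\<close> is frozen, which removes its singularity at \<open>0\<close>; above \<open>c\<close> this is the mean
  value theorem.
\<close>

lemma max_powr_neg_lipschitz:
  fixes c \<beta> x y :: real
  assumes c: "0 < c" and \<beta>: "0 < \<beta>"
  shows "\<bar>max c x powr (- \<beta>) - max c y powr (- \<beta>)\<bar> \<le> \<beta> * c powr (- \<beta> - 1) * \<bar>x - y\<bar>"
proof -
  have main: "\<bar>u powr (- \<beta>) - v powr (- \<beta>)\<bar> \<le> \<beta> * c powr (- \<beta> - 1) * (v - u)" if uv: "c \<le> u" "u < v" for u v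
  proof -
    have "\<exists>z>u. z < v \<and> v powr (- \<beta>) - u powr (- \<beta>) = (v - u) * (- \<beta> * z powr (- \<beta> - 1))"
      by (rule MVT2[OF uv(2)]) (use c uv in \<open>auto intro!: derivative_eq_intros\<close>)
    then obtain z where z: "u < z" "v powr (- \<beta>) - u powr (- \<beta>) = (v - u) * (- \<beta> * z powr (- \<beta> - 1))"
      by blast
    then have "\<bar>u powr (- \<beta>) - v powr (- \<beta>)\<bar> = (v - u) * (\<beta> * z powr (- \<beta> - 1))"
      using uv \<beta> by (subst abs_minus_commute) (simp add: abs_mult)
    also have "\<dots> \<le> (v - u) * (\<beta> * c powr (- \<beta> - 1))"
      using uv \<beta> z c by (intro mult_left_mono powr_mono2') auto
    finally show ?thesis by (simp add: mult_ac)
  qed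
  have *: "0 \<le> \<beta> * c powr (- \<beta> - 1)" using \<beta> by simp
  consider "max c x < max c y" | "max c y < max c x" | "max c x = max c y" by linarith
  then show ?thesis
  proof cases
    case 1
    have "\<bar>max c x powr (- \<beta>) - max c y powr (- \<beta>)\<bar> \<le> \<beta> * c powr (- \<beta> - 1) * (max c y - max c x)"
      by (rule main) (use 1 in auto)
    also have "\<dots> \<le> \<beta> * c powr (- \<beta> - 1) * \<bar>x - y\<bar>" by (intro mult_left_mono *) auto
    finally show ?thesis .
  next
    case 2
    have "\<bar>max c y powr (- \<beta>) - max c x powr (- \<beta>)\<bar> \<le> \<beta> * c powr (- \<beta> - 1) * (max c x - max c y)"
      by (rule main) (use 2 in auto)
    also have "\<dots> \<le> \<beta> * c powr (- \<beta> - 1) * \<bar>x - y\<bar>" by (intro mult_left_mono *) auto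
    finally show ?thesis by (simp add: abs_minus_commute)
  next
    case 3
    show ?thesis unfolding 3 using * by simp
  qed
qed

lemma LBINT_eq_integral_continuous:
  fixes f :: "real \<Rightarrow> real"
  assumes "continuous_on {a..b} f"
  shows "(LBINT r:{a..b}. f r) = integral {a..b} f"
  by (rule set_borel_integral_eq_integral(2)[OF borel_integrable_atLeastAtMost'[OF assms]])

lemma z_control_eq:
  "z_control \<delta> \<rho> \<beta> T q s = exp ((\<rho> + \<delta>) * s) * (LBINT r:{s..T}. exp (- (\<rho> + \<delta>) * r) * q r powr (- \<beta>))"
proof -
  have *: "exp (- (\<rho> + \<delta>) * (r - s)) = exp ((\<rho> + \<delta>) * s) * exp (- (\<rho> + \<delta>) * r)" for r
    by (simp add: exp_add[symmetric] algebra_simps)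
  show ?thesis unfolding z_control_def * mult.assoc by (rule set_integral_mult_right)
qed

text \<open>
  The second equation of the boundary value problem. It needs continuity of \<open>y\<close>, whereas
  \<open>z_control\<close> itself makes sense for integrable prices.
\<close>

lemma z_control_deriv:
  assumes cont: "continuous_on {0..T} y" and pos: "\<And>s. s \<in> {0..T} \<Longrightarrow> 0 < y s" and s: "s \<in> {0..T}"
  shows "(z_control \<delta> \<rho> \<beta> T y has_real_derivative
      (\<rho> + \<delta>) * z_control \<delta> \<rho> \<beta> T y s - y s powr (- \<beta>)) (at s within {0..T})"
proof -
  let ?g = "\<lambda>r. exp (- (\<rho> + \<delta>) * r) * y r powr (- \<beta>)"
  have g: "continuous_on {0..T} ?g"
    using pos by (intro continuous_intros cont) force+
  have I: "(LBINT r:{s..T}. ?g r) = integral {s..T} ?g" if "s \<in> {0..T}" for s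
    by (rule LBINT_eq_integral_continuous, rule continuous_on_subset[OF g]) (use that in auto)
  have "((\<lambda>s. exp ((\<rho> + \<delta>) * s) * integral {s..T} ?g) has_real_derivative
      (\<rho> + \<delta>) * (exp ((\<rho> + \<delta>) * s) * integral {s..T} ?g) - y s powr (- \<beta>)) (at s within {0..T})"
    by (rule derivative_eq_intros integral_has_real_derivative'[OF g s] refl)+
       (simp add: algebra_simps exp_add[symmetric])
  then have "((\<lambda>s. exp ((\<rho> + \<delta>) * s) * integral {s..T} ?g) has_real_derivative
      (\<rho> + \<delta>) * z_control \<delta> \<rho> \<beta> T y s - y s powr (- \<beta>)) (at s within {0..T})"
    by (simp only: z_control_eq I[OF s])
  then show ?thesis
  proof (rule has_field_derivative_transform_within[where d = 1])
    fix s' assume "s' \<in> {0..T}"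
    then show "exp ((\<rho> + \<delta>) * s') * integral {s'..T} ?g = z_control \<delta> \<rho> \<beta> T y s'"
      by (simp only: z_control_eq I)
  qed (use s in auto)
qed

lemma within_deriv_nonneg_mono:
  fixes f f' :: "real \<Rightarrow> real"
  assumes d: "\<And>s. s \<in> {0..T} \<Longrightarrow> (f has_real_derivative f' s) (at s within {0..T})"
    and nn: "\<And>s. s \<in> {0..T} \<Longrightarrow> 0 \<le> f' s" and ab: "0 \<le> a" "a \<le> b" "b \<le> T"
  shows "f a \<le> f b"
proof (cases "a = b")
  case False
  have "continuous_on {0..T} f"
    by (rule DERIV_continuous_on[OF d]) auto
  then have c: "continuous_on {a..b} f" by (rule continuous_on_subset) (use ab in auto)
  have "DERIV f x :> f' x" if "a < x" "x < b" for x
    using d[of x] that ab by (simp add: at_within_Icc_at)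
  then have "\<exists>l z. a < z \<and> z < b \<and> DERIV f z :> l \<and> f b - f a = (b - a) * l"
    by (intro MVT) (use False ab c in \<open>auto simp: real_differentiable_def\<close>)
  then obtain l z where z: "a < z" "z < b" "DERIV f z :> l" "f b - f a = (b - a) * l" by blast
  then have "l = f' z" using d[of z] ab by (auto simp: at_within_Icc_at intro: DERIV_unique)
  then have "0 \<le> (b - a) * l" using nn[of z] z ab by simp
  then show ?thesis using z(4) by linarith
qed simp

lemma within_deriv_zero_const:
  fixes f :: "real \<Rightarrow> real"
  assumes d: "\<And>s. s \<in> {0..T} \<Longrightarrow> (f has_real_derivative 0) (at s within {0..T})" and s: "s \<in> {0..T}"
  shows "f s = f 0"
proof (rule antisym)
  have "- f 0 \<le> - f s"
    by (rule within_deriv_nonneg_mono[where f = "\<lambda>s. - f s" and f' = "\<lambda>_. 0" and T = T])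
       (use s DERIV_minus[OF d] in auto)
  then show "f s \<le> f 0" by simp
  show "f 0 \<le> f s"
    by (rule within_deriv_nonneg_mono[where f' = "\<lambda>_. 0" and T = T]) (use s d in auto)
qed

lemma ide_solutionD:
  assumes "ide_solution \<delta> \<rho> \<beta> T x y"
  shows "\<And>s. s \<in> {0..T} \<Longrightarrow> 0 < y s" "y 0 = x"
    and "\<And>s. s \<in> {0..T} \<Longrightarrow>
      (y has_real_derivative - \<delta> * y s + z_control \<delta> \<rho> \<beta> T y s) (at s within {0..T})"
    and "continuous_on {0..T} y"
proof -
  show "\<And>s. s \<in> {0..T} \<Longrightarrow> 0 < y s" "y 0 = x" using assms by (auto simp: ide_solution_def)
  show d: "\<And>s. s \<in> {0..T} \<Longrightarrow>
      (y has_real_derivative - \<delta> * y s + z_control \<delta> \<rho> \<beta> T y s) (at s within {0..T})"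
    using assms unfolding ide_solution_def z_control_def by force
  show "continuous_on {0..T} y" by (rule DERIV_continuous_on[OF d]) auto
qed

lemma z_control_T: "z_control \<delta> \<rho> \<beta> T y T = 0"
proof -
  have "AE r in lborel. indicator {T..T} r *\<^sub>R (exp (- (\<rho> + \<delta>) * (r - T)) * y r powr (- \<beta>)) = 0"
    by (rule AE_mp[OF AE_lborel_singleton[of T]]) auto
  then show ?thesis unfolding z_control_def set_lebesgue_integral_def
    by (rule integral_eq_zero_AE)
qed

text \<open>
  The derivative of \<open>\<phi> s = exp (- \<rho> s) (y s - y' s) (z s - z' s)\<close> is the sum of \<open>exp (- \<rho> s) (z s - z' s)\<^sup>2\<close> and of a
  second term that is nonnegative because the price is decreasing. As \<open>\<phi>\<close> vanishes at both ends it vanishes identically, hence so does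
  the square; once \<open>z = z'\<close>, both \<open>y\<close> and \<open>y'\<close> solve the same linear equation.
\<close>

theorem ide_solution_unique:
  assumes \<beta>: "0 < \<beta>" and T: "0 < T"
    and y: "ide_solution \<delta> \<rho> \<beta> T x y" and y': "ide_solution \<delta> \<rho> \<beta> T x y'" and s: "s \<in> {0..T}"
  shows "y s = y' s"
proof -
  note y = ide_solutionD[OF y] and y' = ide_solutionD[OF y']
  define z where "z = z_control \<delta> \<rho> \<beta> T y"
  define z' where "z' = z_control \<delta> \<rho> \<beta> T y'"
  define \<phi> where "\<phi> s = exp (- \<rho> * s) * ((y s - y' s) * (z s - z' s))" for s
  define \<phi>' where "\<phi>' s = exp (- \<rho> * s) *
      ((z s - z' s)\<^sup>2 - (y s - y' s) * (y s powr (- \<beta>) - y' s powr (- \<beta>)))" for s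
  have z_d: "(z has_real_derivative (\<rho> + \<delta>) * z s - y s powr (- \<beta>)) (at s within {0..T})"
    "(z' has_real_derivative (\<rho> + \<delta>) * z' s - y' s powr (- \<beta>)) (at s within {0..T})" if "s \<in> {0..T}" for s
    unfolding z_def z'_def by (rule z_control_deriv[OF y(4) y(1) that] z_control_deriv[OF y'(4) y'(1) that]; assumption)+
  have y_d: "(y has_real_derivative - \<delta> * y s + z s) (at s within {0..T})"
    "(y' has_real_derivative - \<delta> * y' s + z' s) (at s within {0..T})" if "s \<in> {0..T}" for s
    unfolding z_def z'_def by (rule y(3)[OF that] y'(3)[OF that])+
  have \<phi>_d: "(\<phi> has_real_derivative \<phi>' s) (at s within {0..T})" if s: "s \<in> {0..T}" for s
    unfolding \<phi>_def
    by (rule derivative_eq_intros z_d[OF s] y_d[OF s] refl)+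
       (simp add: \<phi>'_def algebra_simps power2_eq_square)
  have anti: "(y s - y' s) * (y s powr (- \<beta>) - y' s powr (- \<beta>)) \<le> 0" if s: "s \<in> {0..T}" for s
  proof (cases "y s \<le> y' s")
    case True
    have "y' s powr (- \<beta>) \<le> y s powr (- \<beta>)" by (rule powr_mono2') (use True \<beta> y(1)[OF s] in auto)
    with True show ?thesis by (intro mult_nonpos_nonneg) auto
  next
    case False
    have "y s powr (- \<beta>) \<le> y' s powr (- \<beta>)" by (rule powr_mono2') (use False \<beta> y'(1)[OF s] in auto)
    with False show ?thesis by (intro mult_nonneg_nonpos) auto
  qed
  have \<phi>'_ge: "exp (- \<rho> * s) * (z s - z' s)\<^sup>2 \<le> \<phi>' s" if s: "s \<in> {0..T}" for s
    unfolding \<phi>'_def using anti[OF s] by (intro mult_left_mono) auto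
  have \<phi>'_nn: "0 \<le> \<phi>' s" if s: "s \<in> {0..T}" for s
    by (rule order_trans[OF _ \<phi>'_ge[OF s]]) simp
  have ends: "\<phi> 0 = 0" "\<phi> T = 0" by (auto simp: \<phi>_def y y' z_def z'_def z_control_T)
  have \<phi>0: "\<phi> s = 0" if s: "s \<in> {0..T}" for s
    using within_deriv_nonneg_mono[OF \<phi>_d \<phi>'_nn, of 0 s] within_deriv_nonneg_mono[OF \<phi>_d \<phi>'_nn, of s T]
      s ends by auto
  have z_eq: "z s = z' s" if s: "s \<in> {0..T}" for s
  proof -
    have "(\<phi> has_real_derivative 0) (at s within {0..T})"
      by (rule has_field_derivative_transform_within[where f = "\<lambda>_. 0" and d = 1]) (use s \<phi>0 in auto)
    moreover have "at s within {0..T} \<noteq> bot"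
      using s T by (simp add: at_within_Icc_at trivial_limit_within islimpt_Icc)
    ultimately have "\<phi>' s = 0"
      using \<phi>_d[OF s] unfolding has_real_derivative_iff_has_vector_derivative
      by (metis vector_derivative_unique_within)
    with \<phi>'_ge[OF s] have "exp (- \<rho> * s) * (z s - z' s)\<^sup>2 \<le> 0" by simp
    then show ?thesis by (simp add: mult_le_0_iff)
  qed
  have "((\<lambda>s. exp (\<delta> * s) * (y s - y' s)) has_real_derivative 0) (at s within {0..T})" if s: "s \<in> {0..T}" for s
    by (rule derivative_eq_intros y_d[OF s] refl)+ (simp add: z_eq[OF s] algebra_simps)
  from within_deriv_zero_const[OF this s] show ?thesis by (simp add: y y')
qed

text \<open>
  Variation of constants in both directions: this passes between classical and mild solutions.
\<close>

lemma linear_ode_solution: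
  fixes y z :: "real \<Rightarrow> real"
  assumes z: "continuous_on {0..T} z"
  shows "(\<forall>s\<in>{0..T}. (y has_real_derivative - \<delta> * y s + z s) (at s within {0..T})) \<longleftrightarrow>
    (\<forall>s\<in>{0..T}. y s = exp (- \<delta> * s) * y 0 + (LBINT r:{0..s}. exp (- \<delta> * (s - r)) * z r))" (is "?L \<longleftrightarrow> ?R")
proof -
  let ?w = "\<lambda>r. exp (\<delta> * r) * z r"
  have w: "continuous_on {0..T} ?w" by (intro continuous_intros z)
  have I: "(LBINT r:{0..s}. exp (- \<delta> * (s - r)) * z r) = exp (- \<delta> * s) * integral {0..s} ?w" if s: "s \<in> {0..T}" for s
  proof -
    have *: "exp (- \<delta> * (s - r)) * z r = exp (- \<delta> * s) * ?w r" for r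
    proof -
      have "exp (- \<delta> * (s - r)) = exp (- \<delta> * s) * exp (\<delta> * r)"
        by (simp add: exp_add[symmetric] algebra_simps)
      then show ?thesis by simp
    qed
    show ?thesis unfolding *
      by (subst set_integral_mult_right, subst LBINT_eq_integral_continuous)
         (use s in \<open>auto intro!: continuous_on_subset[OF w]\<close>)
  qed
  have d: "((\<lambda>s. integral {0..s} ?w) has_real_derivative ?w s) (at s within {0..T})" if "s \<in> {0..T}" for s
    by (rule integral_has_real_derivative[OF w that])
  show ?thesis
  proof
    assume L: ?L
    have "exp (\<delta> * s) * y s - integral {0..s} ?w = y 0" if s: "s \<in> {0..T}" for s
    proof -
      have "((\<lambda>s. exp (\<delta> * s) * y s - integral {0..s} ?w) has_real_derivative 0) (at s within {0..T})"
        if s: "s \<in> {0..T}" for s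
        by (rule derivative_eq_intros L[rule_format, OF s] d[OF s] refl)+ (simp add: algebra_simps)
      from within_deriv_zero_const[OF this s] show ?thesis by simp
    qed
    then have eq: "exp (\<delta> * s) * y s = y 0 + integral {0..s} ?w" if "s \<in> {0..T}" for s
      using that by (simp add: diff_eq_eq)
    show ?R
    proof
      fix s assume s: "s \<in> {0..T}"
      have "y s = exp (- \<delta> * s) * (exp (\<delta> * s) * y s)" by (simp add: exp_minus)
      also have "\<dots> = exp (- \<delta> * s) * y 0 + exp (- \<delta> * s) * integral {0..s} ?w"
        unfolding eq[OF s] by (rule distrib_left)
      finally show "y s = exp (- \<delta> * s) * y 0 + (LBINT r:{0..s}. exp (- \<delta> * (s - r)) * z r)"
        by (simp only: I[OF s])
    qed
  next
    assume R: ?R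
    show ?L
    proof
      fix s assume s: "s \<in> {0..T}"
      have "((\<lambda>s. exp (- \<delta> * s) * y 0 + exp (- \<delta> * s) * integral {0..s} ?w) has_real_derivative
          - \<delta> * (exp (- \<delta> * s) * y 0 + exp (- \<delta> * s) * integral {0..s} ?w) + z s) (at s within {0..T})"
        by (rule derivative_eq_intros d[OF s] refl)+ (simp add: algebra_simps exp_minus)
      also have "exp (- \<delta> * s) * y 0 + exp (- \<delta> * s) * integral {0..s} ?w = y s"
        by (simp only: R[rule_format, OF s] I[OF s])
      finally show "(y has_real_derivative - \<delta> * y s + z s) (at s within {0..T})"
      proof (rule has_field_derivative_transform_within[where d = 1])
        fix s' assume "s' \<in> {0..T}"
        then show "exp (- \<delta> * s') * y 0 + exp (- \<delta> * s') * integral {0..s'} ?w = y s'"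
          using R[rule_format, of s'] by (simp only: I)
      qed (use s in auto)
    qed
  qed
qed

text \<open>
  Shooting. For the truncated price the initial value problem with \<open>y 0 = x\<close>, \<open>z 0 = a\<close> is globally Lipschitz,
  and \<open>z T\<close> depends continuously on \<open>a\<close>. Since the price is positive and at most \<open>c powr - \<beta>\<close>, the value \<open>z T\<close> is
  nonpositive for \<open>a = 0\<close> and nonnegative for \<open>a = c powr - \<beta> * T\<close>, so some \<open>a\<close> gives \<open>z T = 0\<close>. For this
  \<open>a\<close> the function \<open>z\<close> is the integral of a positive price, so \<open>y\<close> stays above \<open>exp (- \<delta> s) x\<close> and hence
  above \<open>c\<close>.
\<close>

theorem ide_solution_exists:
  assumes \<delta>: "0 < \<delta>" and \<rho>: "0 < \<rho>" and \<beta>: "0 < \<beta>" and T: "0 < T" and x: "0 < x"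
  shows "\<exists>y. ide_solution \<delta> \<rho> \<beta> T x y"
proof -
  \<comment> \<open>the least value on \<open>{0..T}\<close> of \<open>exp (- \<delta> s) x\<close>, which is a lower bound for every solution\<close>
  define c where "c = exp (- \<delta> * T) * x"
  have c: "0 < c" using x by (simp add: c_def)
  define g where "g t = max c t powr (- \<beta>)" for t
  define K where "K = \<beta> * c powr (- \<beta> - 1)"
  have K: "0 \<le> K" using \<beta> by (simp add: K_def)
  have g_nn: "0 < g t" for t using c by (simp add: g_def)
  have g_le: "g t \<le> c powr (- \<beta>)" for t unfolding g_def by (rule powr_mono2') (use c \<beta> in auto)
  have g_lip: "\<bar>g s - g t\<bar> \<le> K * \<bar>s - t\<bar>" for s t
    unfolding g_def K_def by (rule max_powr_neg_lipschitz[OF c \<beta>])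
  have g_cont: "continuous_on A g" for A
    unfolding g_def using c by (intro continuous_intros) auto
  define f where "f p = (- \<delta> * fst p + snd p, (\<rho> + \<delta>) * snd p - g (fst p))" for p :: "real \<times> real"
  define L where "L = \<delta> + 1 + (\<rho> + \<delta>) + K"
  have L: "0 < L" using \<delta> \<rho> K by (simp add: L_def)
  have f_lip: "norm (f p - f q) \<le> L * norm (p - q)" for p q
  proof -
    have fs: "\<bar>fst p - fst q\<bar> \<le> norm (p - q)" "\<bar>snd p - snd q\<bar> \<le> norm (p - q)"
      using norm_fst_le[of "fst (p - q)" "snd (p - q)"] norm_snd_le[of "snd (p - q)" "fst (p - q)"]
    by (simp_all del: fst_diff snd_diff add: fst_diff[symmetric] snd_diff[symmetric])
    have "f p - f q = (- \<delta> * (fst p - fst q) + (snd p - snd q),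
        (\<rho> + \<delta>) * (snd p - snd q) - (g (fst p) - g (fst q)))"
      by (simp add: f_def algebra_simps)
    then have "norm (f p - f q) \<le> \<bar>- \<delta> * (fst p - fst q) + (snd p - snd q)\<bar>
        + \<bar>(\<rho> + \<delta>) * (snd p - snd q) - (g (fst p) - g (fst q))\<bar>"
      using norm_Pair_le[of "- \<delta> * (fst p - fst q) + (snd p - snd q)"
        "(\<rho> + \<delta>) * (snd p - snd q) - (g (fst p) - g (fst q))"] by (simp only: real_norm_def)
    also have "\<dots> \<le> (\<delta> * \<bar>fst p - fst q\<bar> + \<bar>snd p - snd q\<bar>)
        + ((\<rho> + \<delta>) * \<bar>snd p - snd q\<bar> + K * \<bar>fst p - fst q\<bar>)"
    proof (intro add_mono)
      show "\<bar>- \<delta> * (fst p - fst q) + (snd p - snd q)\<bar> \<le> \<delta> * \<bar>fst p - fst q\<bar> + \<bar>snd p - snd q\<bar>"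
        using abs_triangle_ineq[of "- \<delta> * (fst p - fst q)" "snd p - snd q"] \<delta> by (simp add: abs_mult)
      show "\<bar>(\<rho> + \<delta>) * (snd p - snd q) - (g (fst p) - g (fst q))\<bar>
          \<le> (\<rho> + \<delta>) * \<bar>snd p - snd q\<bar> + K * \<bar>fst p - fst q\<bar>"
        using abs_triangle_ineq4[of "(\<rho> + \<delta>) * (snd p - snd q)" "g (fst p) - g (fst q)"]
          g_lip[of "fst p" "fst q"] \<delta> \<rho> by (simp add: abs_mult)
    qed
    also have "\<dots> \<le> (\<delta> * norm (p - q) + norm (p - q)) + ((\<rho> + \<delta>) * norm (p - q) + K * norm (p - q))"
      using fs \<delta> \<rho> K by (intro add_mono mult_left_mono) auto
    also have "\<dots> = L * norm (p - q)" by (simp add: L_def algebra_simps)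
    finally show ?thesis .
  qed
  obtain Y C where Y: "\<forall>a. continuous_on {0..T} (Y a) \<and>
        (\<forall>s\<in>{0..T}. Y a s = a + integral {0..s} (\<lambda>r. f (Y a r)))"
      "\<forall>a b. \<forall>s\<in>{0..T}. norm (Y a s - Y b s) \<le> C * norm (a - b)"
    using lipschitz_ode_flow[of f L T, OF f_lip L less_imp_le[OF T]] by (elim exE conjE)
  have Y_cont: "\<And>a. continuous_on {0..T} (Y a)"
    and Y_eq: "\<And>a s. s \<in> {0..T} \<Longrightarrow> Y a s = a + integral {0..s} (\<lambda>r. f (Y a r))"
    and Y_lip: "\<And>a b s. s \<in> {0..T} \<Longrightarrow> norm (Y a s - Y b s) \<le> C * norm (a - b)"
    using Y by (blast, blast, blast)
  have f_cont: "continuous_on {0..T} (\<lambda>r. f (Y a r))" for a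
    unfolding f_def by (intro continuous_intros Y_cont continuous_on_compose2[OF g_cont[of UNIV]]) auto
  have Y_d: "(Y a has_vector_derivative f (Y a s)) (at s within {0..T})" if s: "s \<in> {0..T}" for a s
  proof (rule has_vector_derivative_transform[where f = "\<lambda>s. a + integral {0..s} (\<lambda>r. f (Y a r))"])
    show "((\<lambda>s. a + integral {0..s} (\<lambda>r. f (Y a r))) has_vector_derivative f (Y a s)) (at s within {0..T})"
      using has_vector_derivative_add[OF has_vector_derivative_const integral_has_vector_derivative[OF f_cont s]] by simp
  qed (use s Y_eq in auto)
  have fst_d: "((\<lambda>s. fst (Y a s)) has_real_derivative - \<delta> * fst (Y a s) + snd (Y a s)) (at s within {0..T})"
    and snd_d: "((\<lambda>s. snd (Y a s)) has_real_derivative (\<rho> + \<delta>) * snd (Y a s) - g (fst (Y a s))) (at s within {0..T})"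
    if s: "s \<in> {0..T}" for a s
    using bounded_linear.has_vector_derivative[OF bounded_linear_fst Y_d[OF s, of a]]
      bounded_linear.has_vector_derivative[OF bounded_linear_snd Y_d[OF s, of a]]
    by (auto simp: f_def has_real_derivative_iff_has_vector_derivative)
  have Y0: "Y a 0 = a" for a using Y_eq[of 0 a] T by simp
  let ?e = "\<lambda>r. exp (- (\<rho> + \<delta>) * r)"
  let ?k = "\<lambda>a r. ?e r * g (fst (Y a r))"
  have k_cont: "continuous_on {0..T} (?k a)" for a
    by (intro continuous_intros continuous_on_compose2[OF g_cont[of UNIV]] Y_cont) auto
  \<comment> \<open>variation of constants for the second component\<close>
  have z_eq: "?e s * snd (Y a s) + integral {0..s} (?k a) = snd a" if s: "s \<in> {0..T}" for a s
  proof -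
    have "((\<lambda>s. ?e s * snd (Y a s) + integral {0..s} (?k a)) has_real_derivative 0) (at s within {0..T})"
      if s: "s \<in> {0..T}" for s
      by (rule derivative_eq_intros snd_d[OF s] integral_has_real_derivative[OF k_cont s] refl)+ (simp add: algebra_simps)
    from within_deriv_zero_const[OF this s] show ?thesis by (simp add: Y0)
  qed
  have k_nn: "0 \<le> integral {s..t} (?k a)" for a s t
  proof (cases "?k a integrable_on {s..t}")
    case True
    then show ?thesis
      by (rule Henstock_Kurzweil_Integration.integral_nonneg) (simp add: g_nn less_imp_le)
  qed (simp add: not_integrable_integral)
  define \<zeta> where "\<zeta> a = snd (Y (x, a) T)" for a
  have "continuous_on UNIV \<zeta>"
  proof (rule lipschitz_on_continuous_on[of "max C 0"], rule lipschitz_onI)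
    fix a b
    have "dist (\<zeta> a) (\<zeta> b) \<le> norm (Y (x, a) T - Y (x, b) T)"
      unfolding \<zeta>_def dist_norm using norm_snd_le[of "snd (Y (x, a) T - Y (x, b) T)" "fst (Y (x, a) T - Y (x, b) T)"]
      by (simp del: fst_diff snd_diff add: snd_diff[symmetric])
    also have "\<dots> \<le> C * norm ((x, a) - (x, b))" by (rule Y_lip) (use T in auto)
    also have "\<dots> \<le> max C 0 * dist a b" by (auto simp: dist_norm norm_Pair intro: mult_right_mono)
    finally show "dist (\<zeta> a) (\<zeta> b) \<le> max C 0 * dist a b" .
  qed simp
  then have \<zeta>_cont: "continuous_on {0..c powr (- \<beta>) * T} \<zeta>" by (rule continuous_on_subset) auto
  have "\<zeta> 0 \<le> 0"
  proof -
    have "?e T * \<zeta> 0 \<le> 0"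
      using z_eq[of T "(x, 0)"] k_nn[of 0 T "(x, 0)"] T unfolding \<zeta>_def by simp
    then show ?thesis by (simp add: mult_le_0_iff)
  qed
  moreover have "0 \<le> \<zeta> (c powr (- \<beta>) * T)"
  proof -
    let ?a = "(x, c powr (- \<beta>) * T)"
    have "integral {0..T} (?k ?a) \<le> integral {0..T} (\<lambda>_. c powr (- \<beta>))"
    proof (rule integral_le)
      show "?k ?a integrable_on {0..T}" by (rule integrable_continuous_real[OF k_cont])
      fix r assume "r \<in> {0..T}"
      then have "0 \<le> (\<rho> + \<delta>) * r" using \<delta> \<rho> by simp
      then have "?e r \<le> 1" by (simp add: algebra_simps)
      then have "?k ?a r \<le> 1 * c powr (- \<beta>)" by (intro mult_mono g_le) (use g_nn less_imp_le in auto)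
      then show "?k ?a r \<le> c powr (- \<beta>)" by simp
    qed auto
    then have "integral {0..T} (?k ?a) \<le> c powr (- \<beta>) * T" using T by (simp add: mult.commute)
    then have "0 \<le> ?e T * \<zeta> (c powr (- \<beta>) * T)" using z_eq[of T ?a] T unfolding \<zeta>_def by simp
    then show ?thesis by (simp add: zero_le_mult_iff)
  qed
  ultimately obtain a where a: "\<zeta> a = 0"
    using IVT'[of \<zeta> 0 0 "c powr (- \<beta>) * T", OF _ _ _ \<zeta>_cont] T by (meson mult_nonneg_nonneg less_imp_le powr_ge_zero)
  define y where "y s = fst (Y (x, a) s)" for s
  define z where "z s = snd (Y (x, a) s)" for s
  let ?h = "\<lambda>r. ?e r * g (y r)"
  have h: "?k (x, a) = ?h" by (simp add: y_def)
  have z_int: "z s = exp ((\<rho> + \<delta>) * s) * integral {s..T} ?h" if s: "s \<in> {0..T}" for s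
  proof -
    have "integral {0..s} ?h + integral {s..T} ?h = integral {0..T} ?h"
      using s by (intro Henstock_Kurzweil_Integration.integral_combine integrable_continuous_real k_cont[of "(x, a)", unfolded h]) auto
    moreover have "?e s * z s + integral {0..s} ?h = integral {0..T} ?h"
      using z_eq[OF s, of "(x, a)"] z_eq[of T "(x, a)"] a T unfolding h z_def \<zeta>_def by simp
    ultimately have "?e s * z s = integral {s..T} ?h" by simp
    moreover have "exp ((\<rho> + \<delta>) * s) * ?e s = 1" by (simp add: exp_add[symmetric] algebra_simps)
    ultimately show ?thesis by (metis mult.assoc mult_1)
  qed
  have z_nn: "0 \<le> z s" if s: "s \<in> {0..T}" for s
    unfolding z_int[OF s] using k_nn[of s T "(x, a)", unfolded h] by simp
  have y_d: "(y has_real_derivative - \<delta> * y s + z s) (at s within {0..T})" if s: "s \<in> {0..T}" for s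
    using fst_d[OF s, of "(x, a)"] by (simp add: y_def[abs_def] z_def)
  have y0: "y 0 = x" by (simp add: y_def Y0)
  \<comment> \<open>the solution never reaches the region where the nonlinearity was truncated\<close>
  have y_ge: "c \<le> y s" if s: "s \<in> {0..T}" for s
  proof -
    have "exp (\<delta> * 0) * y 0 \<le> exp (\<delta> * s) * y s"
    proof (rule within_deriv_nonneg_mono[where f = "\<lambda>s. exp (\<delta> * s) * y s" and f' = "\<lambda>s. exp (\<delta> * s) * z s" and T = T])
      fix s assume s: "s \<in> {0..T}"
      show "((\<lambda>s. exp (\<delta> * s) * y s) has_real_derivative exp (\<delta> * s) * z s) (at s within {0..T})"
        by (rule derivative_eq_intros y_d[OF s] refl)+ (simp add: algebra_simps)
      show "0 \<le> exp (\<delta> * s) * z s" using z_nn[OF s] by simp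
    qed (use s in auto)
    then have "exp (- \<delta> * s) * x \<le> y s" by (simp add: y0 exp_minus field_simps)
    moreover have "c \<le> exp (- \<delta> * s) * x" unfolding c_def using s \<delta> x by (intro mult_right_mono) auto
    ultimately show ?thesis by linarith
  qed
  have g_y: "g (y s) = y s powr (- \<beta>)" if "s \<in> {0..T}" for s
    unfolding g_def using y_ge[OF that] by (simp add: max_absorb2)
  have z_ctrl: "z s = z_control \<delta> \<rho> \<beta> T y s" if s: "s \<in> {0..T}" for s
  proof -
    have "(LBINT r:{s..T}. ?e r * y r powr (- \<beta>)) = (LBINT r:{s..T}. ?h r)"
      by (rule set_lebesgue_integral_cong) (use s g_y in auto)
    also have "\<dots> = integral {s..T} ?h"
      by (rule LBINT_eq_integral_continuous, rule continuous_on_subset[OF k_cont[of "(x, a)", unfolded h]]) (use s in auto)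
    finally show ?thesis by (simp add: z_int[OF s] z_control_eq)
  qed
  have "ide_solution \<delta> \<rho> \<beta> T x y"
    unfolding ide_solution_def z_control_def[symmetric]
  proof (intro conjI ballI exI[of _ "\<lambda>s. - \<delta> * y s + z s"])
    show "0 < y s" if "s \<in> {0..T}" for s using y_ge[OF that] c by linarith
    show "continuous_on {0..T} (\<lambda>s. - \<delta> * y s + z s)"
      unfolding y_def z_def by (intro continuous_intros Y_cont)
  qed (use y0 y_d z_ctrl in auto)
  then show ?thesis by blast
qed

section \<open>Convergence in probability\<close>

context prob_space
begin

lemma tendsto_zero_in_probI:
  assumes "\<And>\<epsilon>::real. 0 < \<epsilon> \<Longrightarrow> (\<lambda>k. prob {\<omega> \<in> space M. ennreal \<epsilon> < Z k \<omega>}) \<longlonglongrightarrow> 0"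
  shows "tendsto_zero_in_prob M Z"
  using assms unfolding tendsto_zero_in_prob_def by blast

lemma tendsto_zero_in_probD:
  "tendsto_zero_in_prob M Z \<Longrightarrow> 0 < \<epsilon> \<Longrightarrow> (\<lambda>k. prob {\<omega> \<in> space M. ennreal \<epsilon> < Z k \<omega>}) \<longlonglongrightarrow> 0"
  unfolding tendsto_zero_in_prob_def by blast

lemma tendsto_zero_in_prob_bound:
  assumes [measurable]: "\<And>k. Z k \<in> borel_measurable M" "\<And>k. W k \<in> borel_measurable M"
    and le: "\<And>k. AE \<omega> in M. Z k \<omega> \<le> W k \<omega>" and W: "tendsto_zero_in_prob M W"
  shows "tendsto_zero_in_prob M Z"
proof (rule tendsto_zero_in_probI)
  fix \<epsilon> :: real assume "0 < \<epsilon>"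
  show "(\<lambda>k. prob {\<omega> \<in> space M. ennreal \<epsilon> < Z k \<omega>}) \<longlonglongrightarrow> 0"
  proof (rule tendsto_sandwich[OF _ _ tendsto_const tendsto_zero_in_probD[OF W \<open>0 < \<epsilon>\<close>]])
    show "\<forall>\<^sub>F k in sequentially. prob {\<omega> \<in> space M. ennreal \<epsilon> < Z k \<omega>} \<le> prob {\<omega> \<in> space M. ennreal \<epsilon> < W k \<omega>}"
    proof (rule always_eventually, rule allI, rule finite_measure_mono_AE)
      fix k show "AE \<omega> in M. \<omega> \<in> {\<omega> \<in> space M. ennreal \<epsilon> < Z k \<omega>} \<longrightarrow> \<omega> \<in> {\<omega> \<in> space M. ennreal \<epsilon> < W k \<omega>}"
        using le[of k] by eventually_elim auto
    qed auto
  qed auto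
qed

lemma tendsto_zero_in_prob_add:
  assumes [measurable]: "\<And>k. Z k \<in> borel_measurable M" "\<And>k. W k \<in> borel_measurable M"
    and Z: "tendsto_zero_in_prob M Z" and W: "tendsto_zero_in_prob M W"
  shows "tendsto_zero_in_prob M (\<lambda>k \<omega>. Z k \<omega> + W k \<omega>)"
proof (rule tendsto_zero_in_probI)
  fix \<epsilon> :: real assume "0 < \<epsilon>"
  then have \<epsilon>: "0 < \<epsilon> / 2" by simp
  have lim: "(\<lambda>k. prob {\<omega> \<in> space M. ennreal (\<epsilon> / 2) < Z k \<omega>} + prob {\<omega> \<in> space M. ennreal (\<epsilon> / 2) < W k \<omega>})
      \<longlonglongrightarrow> 0"
    using tendsto_add[OF tendsto_zero_in_probD[OF Z \<epsilon>] tendsto_zero_in_probD[OF W \<epsilon>]] by simp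
  show "(\<lambda>k. prob {\<omega> \<in> space M. ennreal \<epsilon> < Z k \<omega> + W k \<omega>}) \<longlonglongrightarrow> 0"
  proof (rule tendsto_sandwich[OF _ _ tendsto_const lim])
    have "prob {\<omega> \<in> space M. ennreal \<epsilon> < Z k \<omega> + W k \<omega>}
        \<le> prob ({\<omega> \<in> space M. ennreal (\<epsilon> / 2) < Z k \<omega>} \<union> {\<omega> \<in> space M. ennreal (\<epsilon> / 2) < W k \<omega>})" for k
    proof (rule finite_measure_mono)
      show "{\<omega> \<in> space M. ennreal \<epsilon> < Z k \<omega> + W k \<omega>}
          \<subseteq> {\<omega> \<in> space M. ennreal (\<epsilon> / 2) < Z k \<omega>} \<union> {\<omega> \<in> space M. ennreal (\<epsilon> / 2) < W k \<omega>}"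
      proof
        fix \<omega> assume \<omega>: "\<omega> \<in> {\<omega> \<in> space M. ennreal \<epsilon> < Z k \<omega> + W k \<omega>}"
        have "ennreal \<epsilon> = ennreal (\<epsilon> / 2) + ennreal (\<epsilon> / 2)"
          using \<epsilon> by (simp flip: ennreal_plus)
        then have "\<not> (Z k \<omega> \<le> ennreal (\<epsilon> / 2) \<and> W k \<omega> \<le> ennreal (\<epsilon> / 2))"
          using \<omega> add_mono[of "Z k \<omega>" "ennreal (\<epsilon> / 2)" "W k \<omega>" "ennreal (\<epsilon> / 2)"] by auto
        then show "\<omega> \<in> {\<omega> \<in> space M. ennreal (\<epsilon> / 2) < Z k \<omega>} \<union> {\<omega> \<in> space M. ennreal (\<epsilon> / 2) < W k \<omega>}"
          using \<omega> by (auto simp: not_le)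
      qed
    qed measurable
    then show "\<forall>\<^sub>F k in sequentially. prob {\<omega> \<in> space M. ennreal \<epsilon> < Z k \<omega> + W k \<omega>}
        \<le> prob {\<omega> \<in> space M. ennreal (\<epsilon> / 2) < Z k \<omega>} + prob {\<omega> \<in> space M. ennreal (\<epsilon> / 2) < W k \<omega>}"
      by (intro always_eventually allI) (rule order_trans[OF _ measure_Un_le], auto)
  qed auto
qed

lemma tendsto_zero_in_prob_cmult:
  assumes "tendsto_zero_in_prob M Z" and c: "0 < c"
  shows "tendsto_zero_in_prob M (\<lambda>k \<omega>. ennreal c * Z k \<omega>)"
proof (rule tendsto_zero_in_probI)
  fix \<epsilon> :: real assume "0 < \<epsilon>"
  then have "(\<lambda>k. prob {\<omega> \<in> space M. ennreal (\<epsilon> / c) < Z k \<omega>}) \<longlonglongrightarrow> 0"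
    using tendsto_zero_in_probD[OF assms(1), of "\<epsilon> / c"] c by simp
  moreover have "ennreal (\<epsilon> / c) < z \<longleftrightarrow> ennreal \<epsilon> < ennreal c * z" for z
  proof -
    have "ennreal \<epsilon> = ennreal c * ennreal (\<epsilon> / c)" using c \<open>0 < \<epsilon>\<close> by (simp flip: ennreal_mult)
    moreover have "ennreal c * z \<le> ennreal c * ennreal (\<epsilon> / c) \<longleftrightarrow> z \<le> ennreal (\<epsilon> / c)"
      by (rule ennreal_mult_le_mult_iff) (use c in auto)
    ultimately show ?thesis by (simp only: not_le[symmetric])
  qed
  ultimately show "(\<lambda>k. prob {\<omega> \<in> space M. ennreal \<epsilon> < ennreal c * Z k \<omega>}) \<longlonglongrightarrow> 0" by simp
qed

text \<open>
  Markov's inequality.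
\<close>

lemma tendsto_zero_in_prob_nn_integral:
  assumes [measurable]: "\<And>k. Z k \<in> borel_measurable M" and Z: "(\<lambda>k. \<integral>\<^sup>+\<omega>. Z k \<omega> \<partial>M) \<longlonglongrightarrow> 0"
  shows "tendsto_zero_in_prob M Z"
proof (rule tendsto_zero_in_probI)
  fix \<epsilon> :: real assume \<epsilon>: "0 < \<epsilon>"
  have "(\<lambda>k. ennreal (1 / \<epsilon>) * (\<integral>\<^sup>+\<omega>. Z k \<omega> \<partial>M)) \<longlonglongrightarrow> ennreal (1 / \<epsilon>) * 0"
    by (intro ennreal_tendsto_cmult Z) simp
  then have lim: "(\<lambda>k. ennreal (1 / \<epsilon>) * (\<integral>\<^sup>+\<omega>. Z k \<omega> \<partial>M)) \<longlonglongrightarrow> 0" by simp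
  have le: "emeasure M {\<omega> \<in> space M. ennreal \<epsilon> < Z k \<omega>} \<le> ennreal (1 / \<epsilon>) * (\<integral>\<^sup>+\<omega>. Z k \<omega> \<partial>M)" for k
  proof -
    have "emeasure M {\<omega> \<in> space M. ennreal \<epsilon> < Z k \<omega>} \<le> emeasure M {\<omega> \<in> space M. 1 \<le> ennreal (1 / \<epsilon>) * Z k \<omega>}"
    proof (rule emeasure_mono)
      show "{\<omega> \<in> space M. ennreal \<epsilon> < Z k \<omega>} \<subseteq> {\<omega> \<in> space M. 1 \<le> ennreal (1 / \<epsilon>) * Z k \<omega>}"
      proof safe
        fix \<omega> assume "ennreal \<epsilon> < Z k \<omega>"
        then have "ennreal (1 / \<epsilon>) * ennreal \<epsilon> \<le> ennreal (1 / \<epsilon>) * Z k \<omega>" by (intro mult_left_mono) auto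
        then show "1 \<le> ennreal (1 / \<epsilon>) * Z k \<omega>" using \<epsilon> by (simp flip: ennreal_mult)
      qed
    qed measurable
    also have "\<dots> \<le> ennreal (1 / \<epsilon>) * (\<integral>\<^sup>+\<omega>. Z k \<omega> * indicator (space M) \<omega> \<partial>M)"
      by (rule nn_integral_Markov_inequality) auto
    also have "(\<integral>\<^sup>+\<omega>. Z k \<omega> * indicator (space M) \<omega> \<partial>M) = (\<integral>\<^sup>+\<omega>. Z k \<omega> \<partial>M)"
      by (intro nn_integral_cong) auto
    finally show ?thesis .
  qed
  have "(\<lambda>k. emeasure M {\<omega> \<in> space M. ennreal \<epsilon> < Z k \<omega>}) \<longlonglongrightarrow> 0"
    by (rule tendsto_sandwich[OF _ _ tendsto_const lim]) (auto simp: le)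
  then have "(\<lambda>k. ennreal (prob {\<omega> \<in> space M. ennreal \<epsilon> < Z k \<omega>})) \<longlonglongrightarrow> ennreal 0"
    by (simp add: emeasure_eq_measure)
  then show "(\<lambda>k. prob {\<omega> \<in> space M. ennreal \<epsilon> < Z k \<omega>}) \<longlonglongrightarrow> 0"
    by (subst (asm) tendsto_ennreal_iff) auto
qed

lemma tendsto_zero_in_prob_AE:
  assumes [measurable]: "\<And>k. Z k \<in> borel_measurable M" and Z: "AE \<omega> in M. (\<lambda>k. Z k \<omega>) \<longlonglongrightarrow> 0"
  shows "tendsto_zero_in_prob M Z"
proof (rule tendsto_zero_in_probI)
  fix \<epsilon> :: real assume \<epsilon>: "0 < \<epsilon>"
  let ?A = "\<lambda>k. {\<omega> \<in> space M. ennreal \<epsilon> < Z k \<omega>}"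
  have "(\<lambda>k. \<integral>\<omega>. indicator (?A k) \<omega> \<partial>M) \<longlonglongrightarrow> (\<integral>\<omega>. 0 \<partial>M :: real)"
  proof (rule integral_dominated_convergence[where w = "\<lambda>_. 1"])
    show "AE \<omega> in M. (\<lambda>k. indicator (?A k) \<omega> :: real) \<longlonglongrightarrow> 0"
      using Z
    proof eventually_elim
      fix \<omega> assume "(\<lambda>k. Z k \<omega>) \<longlonglongrightarrow> 0"
      then have "\<forall>\<^sub>F k in sequentially. Z k \<omega> < ennreal \<epsilon>" by (rule order_tendstoD) (use \<epsilon> in simp)
      then show "(\<lambda>k. indicator (?A k) \<omega> :: real) \<longlonglongrightarrow> 0"
        by (intro tendsto_eventually) (auto elim!: eventually_mono simp: indicator_def)
    qed
  qed (auto simp: indicator_def)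
  then show "(\<lambda>k. prob (?A k)) \<longlonglongrightarrow> 0" by simp
qed

text \<open>
  It suffices to have the convergence on events whose probability is as close to \<open>1\<close> as desired. This is
  how bounds on paths, which hold on such events only, are put to use.
\<close>

lemma tendsto_zero_in_prob_localize:
  assumes [measurable]: "\<And>k. Z k \<in> borel_measurable M"
    and loc: "\<And>\<eta>::real. 0 < \<eta> \<Longrightarrow> \<exists>A\<in>sets M. prob (space M - A) \<le> \<eta> \<and>
       tendsto_zero_in_prob M (\<lambda>k \<omega>. Z k \<omega> * indicator A \<omega>)"
  shows "tendsto_zero_in_prob M Z"
proof (rule tendsto_zero_in_probI, rule LIMSEQ_I)
  fix \<epsilon> \<eta> :: real assume \<epsilon>: "0 < \<epsilon>" and \<eta>: "0 < \<eta>"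
  let ?P = "\<lambda>k. {\<omega> \<in> space M. ennreal \<epsilon> < Z k \<omega>}"
  obtain A where A[measurable]: "A \<in> sets M" and PA: "prob (space M - A) \<le> \<eta> / 2"
    and ZA: "tendsto_zero_in_prob M (\<lambda>k \<omega>. Z k \<omega> * indicator A \<omega>)"
    using loc[of "\<eta> / 2"] \<eta> by auto
  let ?Q = "\<lambda>k. {\<omega> \<in> space M. ennreal \<epsilon> < Z k \<omega> * indicator A \<omega>}"
  from LIMSEQ_D[OF tendsto_zero_in_probD[OF ZA \<epsilon>], of "\<eta> / 2"] \<eta>
  obtain k0 where k0: "\<And>k. k \<ge> k0 \<Longrightarrow> prob (?Q k) < \<eta> / 2" by auto
  have "prob (?P k) < \<eta>" if "k \<ge> k0" for k
  proof -
    have "prob (?P k) \<le> prob (?Q k \<union> (space M - A))"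
      by (rule finite_measure_mono) (auto simp: indicator_def)
    also have "\<dots> \<le> prob (?Q k) + prob (space M - A)" by (rule measure_Un_le) auto
    finally show ?thesis using k0[OF that] PA by simp
  qed
  then show "\<exists>k0. \<forall>k\<ge>k0. norm (prob (?P k) - 0) < \<eta>" by (auto intro!: exI[of _ k0])
qed

text \<open>
  The truncations \<open>min \<bar>Z k \<omega>\<bar> 1\<close> converge in \<open>L\<^sup>1\<close>, and \<open>L\<^sup>1\<close> convergence gives an almost surely convergent
  subsequence.
\<close>

lemma tendsto_zero_in_prob_AE_subseq:
  fixes Z :: "nat \<Rightarrow> 'a \<Rightarrow> real"
  assumes [measurable]: "\<And>k. Z k \<in> borel_measurable M"
    and Z: "tendsto_zero_in_prob M (\<lambda>k \<omega>. ennreal \<bar>Z k \<omega>\<bar>)"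
  shows "\<exists>r::nat \<Rightarrow> nat. strict_mono r \<and> (AE \<omega> in M. (\<lambda>k. Z (r k) \<omega>) \<longlonglongrightarrow> 0)"
proof -
  let ?m = "\<lambda>k \<omega>. min \<bar>Z k \<omega>\<bar> 1"
  have int: "integrable M (?m k)" for k by (rule integrable_const_bound[where B = 1]) auto
  have "(\<lambda>k. \<integral>\<omega>. norm (?m k \<omega>) \<partial>M) \<longlonglongrightarrow> 0"
  proof (rule LIMSEQ_I)
    fix \<eta> :: real assume \<eta>: "0 < \<eta>"
    let ?P = "\<lambda>k. {\<omega> \<in> space M. ennreal (\<eta> / 2) < ennreal \<bar>Z k \<omega>\<bar>}"
    from LIMSEQ_D[OF tendsto_zero_in_probD[OF Z, of "\<eta> / 2"], of "\<eta> / 2"] \<eta>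
    obtain k0 where k0: "\<And>k. k \<ge> k0 \<Longrightarrow> prob (?P k) < \<eta> / 2" by auto
    have "(\<integral>\<omega>. norm (?m k \<omega>) \<partial>M) < \<eta>" if "k \<ge> k0" for k
    proof -
      have "(\<integral>\<omega>. norm (?m k \<omega>) \<partial>M) \<le> (\<integral>\<omega>. \<eta> / 2 + indicator (?P k) \<omega> \<partial>M)"
      proof (rule integral_mono)
        show "integrable M (\<lambda>\<omega>. \<eta> / 2 + indicator (?P k) \<omega>)" 
          by (rule integrable_const_bound[where B = "\<eta> / 2 + 1"]) (use \<eta> in \<open>auto simp: indicator_def\<close>)
      qed (use \<eta> int in \<open>auto simp: indicator_def ennreal_less_iff not_less\<close>)
      also have "\<dots> = \<eta> / 2 + prob (?P k)"
      proof -
        have "integrable M (indicat_real (?P k))"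
          by (rule integrable_const_bound[where B = 1]) (auto simp: indicator_def)
        then show ?thesis by (simp add: prob_space)
      qed
      finally show ?thesis using k0[OF that] by simp
    qed
    moreover have "0 \<le> (\<integral>\<omega>. norm (?m k \<omega>) \<partial>M)" for k by (rule integral_nonneg_AE) auto
    ultimately show "\<exists>k0. \<forall>k\<ge>k0. norm ((\<integral>\<omega>. norm (?m k \<omega>) \<partial>M) - 0) < \<eta>" by (auto intro!: exI[of _ k0])
  qed
  from tendsto_L1_AE_subseq[OF int this]
  obtain r where r: "strict_mono r" "AE \<omega> in M. (\<lambda>k. ?m (r k) \<omega>) \<longlonglongrightarrow> 0" by auto
  have "AE \<omega> in M. (\<lambda>k. Z (r k) \<omega>) \<longlonglongrightarrow> 0"
    using r(2)
  proof eventually_elim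
    fix \<omega> assume *: "(\<lambda>k. ?m (r k) \<omega>) \<longlonglongrightarrow> 0"
    then have "\<forall>\<^sub>F k in sequentially. ?m (r k) \<omega> < 1" by (rule order_tendstoD) simp
    then have "\<forall>\<^sub>F k in sequentially. ?m (r k) \<omega> = \<bar>Z (r k) \<omega>\<bar>" by eventually_elim auto
    with * have "(\<lambda>k. \<bar>Z (r k) \<omega>\<bar>) \<longlonglongrightarrow> 0" by (rule Lim_transform_eventually)
    then show "(\<lambda>k. Z (r k) \<omega>) \<longlonglongrightarrow> 0" by (rule tendsto_rabs_zero_cancel)
  qed
  with r(1) show ?thesis by blast
qed

end

section \<open>Brownian increments\<close>

text \<open>
  Completing the square: tilting a centred normal density by an exponential shifts its mean.
\<close>

lemma normal_density_exp_shift: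
  assumes "0 < s"
  shows "normal_density 0 s x * exp (l * x) = exp (l\<^sup>2 * s\<^sup>2 / 2) * normal_density (l * s\<^sup>2) s x"
proof -
  have "- (x - 0)\<^sup>2 / (2 * s\<^sup>2) + l * x = l\<^sup>2 * s\<^sup>2 / 2 + - (x - l * s\<^sup>2)\<^sup>2 / (2 * s\<^sup>2)"
    using assms by (simp add: field_simps power2_eq_square)
  then have "exp (- (x - 0)\<^sup>2 / (2 * s\<^sup>2)) * exp (l * x) = exp (l\<^sup>2 * s\<^sup>2 / 2) * exp (- (x - l * s\<^sup>2)\<^sup>2 / (2 * s\<^sup>2))"
    by (simp only: exp_add[symmetric])
  then show ?thesis unfolding normal_density_def by (simp add: mult_ac)
qed

context prob_space
begin

lemma integrable_square_bounded:
  fixes f :: "'a \<Rightarrow> real"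
  assumes [measurable]: "f \<in> borel_measurable M" and bdd: "\<exists>C. \<forall>\<omega>\<in>space M. \<bar>f \<omega>\<bar> \<le> C"
  shows "integrable M (\<lambda>\<omega>. (f \<omega>)\<^sup>2)"
proof -
  obtain C where C: "\<And>\<omega>. \<omega> \<in> space M \<Longrightarrow> \<bar>f \<omega>\<bar> \<le> C" using bdd by auto
  show ?thesis
  proof (rule integrable_const_bound[where B = "C\<^sup>2"], rule AE_I2)
    fix \<omega> assume "\<omega> \<in> space M"
    then show "norm ((f \<omega>)\<^sup>2) \<le> C\<^sup>2" using C[of \<omega>] abs_le_square_iff[of "f \<omega>" C] by simp
  qed measurable
qed

lemma indep_var_nn_integral_mult:
  fixes X Y :: "'a \<Rightarrow> ennreal"
  assumes "indep_var borel X borel Y"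
  shows "(\<integral>\<^sup>+\<omega>. X \<omega> * Y \<omega> \<partial>M) = (\<integral>\<^sup>+\<omega>. X \<omega> \<partial>M) * (\<integral>\<^sup>+\<omega>. Y \<omega> \<partial>M)"
proof -
  have *: "case_bool borel borel = (\<lambda>_. borel)" by (auto split: bool.split)
  have "indep_vars (\<lambda>_. borel) (case_bool X Y) UNIV"
    using assms unfolding indep_var_def * .
  from indep_vars_nn_integral[OF _ this] show ?thesis
    by (simp add: UNIV_bool mult.commute)
qed

text \<open>
  Pythagoras for martingale differences. In the induction the mixed term \<open>2 S (h n) (g n)\<close> has mean \<open>0\<close>
  because \<open>S * h n\<close> is known at time \<open>n\<close> and \<open>g n\<close> is a centred variable independent of the past; boundedness of
  \<open>h n\<close> makes this product integrable.
\<close>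

lemma martingale_differences_square:
  fixes h g :: "nat \<Rightarrow> 'a \<Rightarrow> real" and G :: "nat \<Rightarrow> 'a measure"
  assumes G: "\<And>i. i \<le> n \<Longrightarrow> subalgebra M (G i)" "\<And>i. i < n \<Longrightarrow> sets (G i) \<subseteq> sets (G (Suc i))"
    and h: "\<And>i. i < n \<Longrightarrow> h i \<in> borel_measurable (G i)" "\<And>i. i < n \<Longrightarrow> \<exists>C. \<forall>\<omega>\<in>space M. \<bar>h i \<omega>\<bar> \<le> C"
    and g: "\<And>i. i < n \<Longrightarrow> g i \<in> borel_measurable (G (Suc i))" "\<And>i. i < n \<Longrightarrow> integrable M (\<lambda>\<omega>. (g i \<omega>)\<^sup>2)"
      "\<And>i. i < n \<Longrightarrow> expectation (g i) = 0" "\<And>i. i < n \<Longrightarrow> expectation (\<lambda>\<omega>. (g i \<omega>)\<^sup>2) = v i"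
    and indep: "\<And>i X. i < n \<Longrightarrow> X \<in> borel_measurable (G i) \<Longrightarrow> indep_var borel X borel (g i)"
  shows "(\<lambda>\<omega>. \<Sum>i<n. h i \<omega> * g i \<omega>) \<in> borel_measurable (G n) \<and>
    integrable M (\<lambda>\<omega>. (\<Sum>i<n. h i \<omega> * g i \<omega>)\<^sup>2) \<and>
    expectation (\<lambda>\<omega>. (\<Sum>i<n. h i \<omega> * g i \<omega>)\<^sup>2) = (\<Sum>i<n. expectation (\<lambda>\<omega>. (h i \<omega>)\<^sup>2) * v i)"
  using assms
proof (induction n)
  case 0
  show ?case by (simp add: measurable_const)
next
  case (Suc n)
  let ?S = "\<lambda>\<omega>. \<Sum>i<n. h i \<omega> * g i \<omega>"
  have IH': "?S \<in> borel_measurable (G n) \<and> integrable M (\<lambda>\<omega>. (?S \<omega>)\<^sup>2) \<and>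
      expectation (\<lambda>\<omega>. (?S \<omega>)\<^sup>2) = (\<Sum>i<n. expectation (\<lambda>\<omega>. (h i \<omega>)\<^sup>2) * v i)"
    by (rule Suc.IH; (rule Suc.prems)?) (simp_all add: less_SucI)
  then have IH: "?S \<in> borel_measurable (G n)" "integrable M (\<lambda>\<omega>. (?S \<omega>)\<^sup>2)"
    "expectation (\<lambda>\<omega>. (?S \<omega>)\<^sup>2) = (\<Sum>i<n. expectation (\<lambda>\<omega>. (h i \<omega>)\<^sup>2) * v i)"
    by blast+
  have sub: "subalgebra M (G n)" "subalgebra M (G (Suc n))" using Suc.prems by auto
  have GG: "subalgebra (G (Suc n)) (G n)"
    using Suc.prems(2)[of n] sub unfolding subalgebra_def by auto
  have h_n: "h n \<in> borel_measurable (G n)" and g_n: "g n \<in> borel_measurable (G (Suc n))" using Suc.prems by auto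
  obtain C where C: "\<And>\<omega>. \<omega> \<in> space M \<Longrightarrow> \<bar>h n \<omega>\<bar> \<le> C" using Suc.prems(4)[of n] by auto
  have [measurable]: "?S \<in> borel_measurable M" "h n \<in> borel_measurable M" "g n \<in> borel_measurable M"
    by (rule measurable_from_subalg[OF sub(1) IH(1)] measurable_from_subalg[OF sub(1) h_n]
        measurable_from_subalg[OF sub(2) g_n])+
  have g2: "integrable M (\<lambda>\<omega>. (g n \<omega>)\<^sup>2)" using Suc.prems by auto
  have g1: "integrable M (g n)" by (rule square_integrable_imp_integrable) (use g2 in auto)
  have S1: "integrable M ?S" by (rule square_integrable_imp_integrable) (use IH in auto)
  have Sh: "integrable M (\<lambda>\<omega>. 2 * (?S \<omega> * h n \<omega>))"
  proof (rule Bochner_Integration.integrable_bound[OF integrable_mult_right[OF S1, of "2 * C"]])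
    show "AE \<omega> in M. norm (2 * (?S \<omega> * h n \<omega>)) \<le> norm (2 * C * ?S \<omega>)"
    proof (rule AE_I2)
      fix \<omega> assume "\<omega> \<in> space M"
      then have "\<bar>h n \<omega>\<bar> \<le> \<bar>C\<bar>" using C[of \<omega>] by linarith
      then have "\<bar>?S \<omega>\<bar> * \<bar>h n \<omega>\<bar> \<le> \<bar>?S \<omega>\<bar> * \<bar>C\<bar>" by (rule mult_left_mono) simp
      then show "norm (2 * (?S \<omega> * h n \<omega>)) \<le> norm (2 * C * ?S \<omega>)"
        unfolding real_norm_def abs_mult by (simp only: mult_ac) simp
    qed
  qed measurable
  have h2: "integrable M (\<lambda>\<omega>. (h n \<omega>)\<^sup>2)"
    by (rule integrable_square_bounded) (use Suc.prems(4)[of n] in auto)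
  have ind1: "indep_var borel (\<lambda>\<omega>. 2 * (?S \<omega> * h n \<omega>)) borel (g n)"
    by (rule Suc.prems(9)) (use IH(1) h_n in measurable)
  have ind2: "indep_var borel (\<lambda>\<omega>. (h n \<omega>)\<^sup>2) borel (\<lambda>\<omega>. (g n \<omega>)\<^sup>2)"
    using indep_var_compose[OF Suc.prems(9)[OF lessI h_n], of "\<lambda>x. x\<^sup>2" borel "\<lambda>x. x\<^sup>2" borel]
    by (simp add: comp_def)
  have cross: "integrable M (\<lambda>\<omega>. 2 * (?S \<omega> * h n \<omega>) * g n \<omega>)"
      "expectation (\<lambda>\<omega>. 2 * (?S \<omega> * h n \<omega>) * g n \<omega>) = 0"
    using indep_var_integrable[OF ind1 Sh g1] indep_var_lebesgue_integral[OF ind1 Sh g1] Suc.prems(7)[of n] by auto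
  have diag: "integrable M (\<lambda>\<omega>. (h n \<omega>)\<^sup>2 * (g n \<omega>)\<^sup>2)"
      "expectation (\<lambda>\<omega>. (h n \<omega>)\<^sup>2 * (g n \<omega>)\<^sup>2) = expectation (\<lambda>\<omega>. (h n \<omega>)\<^sup>2) * v n"
    using indep_var_integrable[OF ind2 h2 g2] indep_var_lebesgue_integral[OF ind2 h2 g2] Suc.prems(8)[of n] by auto
  have eq: "(\<Sum>i<Suc n. h i \<omega> * g i \<omega>)\<^sup>2
      = (?S \<omega>)\<^sup>2 + (2 * (?S \<omega> * h n \<omega>) * g n \<omega> + (h n \<omega>)\<^sup>2 * (g n \<omega>)\<^sup>2)" for \<omega>
    by (simp add: power2_sum power_mult_distrib)
  have "(\<lambda>\<omega>. \<Sum>i<Suc n. h i \<omega> * g i \<omega>) \<in> borel_measurable (G (Suc n))"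
    using measurable_from_subalg[OF GG IH(1)] measurable_from_subalg[OF GG h_n] g_n by simp
  then show ?case
    unfolding eq using IH cross diag by simp
qed

end

context brownian_motion
begin

lemma subalgebra_F_mono: "0 \<le> s \<Longrightarrow> s \<le> t \<Longrightarrow> subalgebra (F t) (F s)"
  using subalgebra_F[of s] subalgebra_F[of t] mono_F[of s t] by (auto simp: subalgebra_def)

lemma space_F: "0 \<le> s \<Longrightarrow> space (F s) = space M"
  using subalgebra_F[of s] by (simp add: subalgebra_def)

lemma measurable_F_M: "0 \<le> s \<Longrightarrow> f \<in> measurable (F s) N \<Longrightarrow> f \<in> measurable M N"
  by (rule measurable_from_subalg[OF subalgebra_F])

lemma measurable_F_mono: "0 \<le> s \<Longrightarrow> s \<le> t \<Longrightarrow> f \<in> measurable (F s) N \<Longrightarrow> f \<in> measurable (F t) N"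
  by (rule measurable_from_subalg[OF subalgebra_F_mono])

lemma measurable_B: "0 \<le> s \<Longrightarrow> s \<le> t \<Longrightarrow> B s \<in> borel_measurable (F t)"
  by (rule measurable_F_mono[OF _ _ adapted_B])

lemma measurable_B_M: "0 \<le> s \<Longrightarrow> B s \<in> borel_measurable M"
  by (rule measurable_F_M[OF _ adapted_B])

text \<open>
  The empty increment \<open>s = t\<close> is included since the partitions of simple integrands may repeat points.
\<close>

lemma indep_increment:
  assumes s: "0 \<le> s" "s \<le> t" and X: "X \<in> borel_measurable (F s)"
  shows "indep_var borel X borel (\<lambda>\<omega>. B t \<omega> - B s \<omega>)"
proof -
  let ?D = "\<lambda>\<omega>. B t \<omega> - B s \<omega>"
  have [measurable]: "X \<in> borel_measurable M" "?D \<in> borel_measurable M"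
    using s X measurable_B_M[of s] measurable_B_M[of t] by (auto intro!: borel_measurable_diff measurable_F_M[OF s(1)])
  let ?SD = "{?D -` A \<inter> space M |A. A \<in> sets borel}"
  have ind: "indep_set (sets (F s)) ?SD"
  proof (cases "s < t")
    case True
    then show ?thesis using s by (intro indep_increments_B)
  next
    case False
    then have st: "s = t" using s by simp
    have "prob (a \<inter> b) = prob a * prob b" if "a \<in> sets (F s)" "b \<in> ?SD" for a b
    proof -
      have "a \<inter> b = a \<and> b = space M \<or> b = {}"
        using that sets.sets_into_space[OF that(1)] space_F[OF s(1)] by (auto simp: st split: if_splits)
      then show ?thesis by (auto simp: prob_space)
    qed
    moreover have "sets (F s) \<subseteq> events" using subalgebra_F[OF s(1)] by (auto simp: subalgebra_def)
    moreover have "?SD \<subseteq> events" using measurable_sets[of ?D M borel] by auto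
    ultimately show ?thesis by (intro indep_setI) auto
  qed
  have sX: "sigma_sets (space M) {X -` A \<inter> space M |A. A \<in> sets borel} \<subseteq> sets (F s)"
    using sets.sigma_sets_subset[of "{X -` A \<inter> space M |A. A \<in> sets borel}" "F s"] measurable_sets[OF X]
      space_F[OF s(1)] by auto
  have sD: "sigma_sets (space M) ?SD \<subseteq> ?SD"
  proof -
    have "sets (vimage_algebra (space M) ?D borel) = ?SD" by (rule sets_vimage_algebra2) auto
    then show ?thesis using sets.sigma_sets_eq[of "vimage_algebra (space M) ?D borel"] by simp
  qed
  have "indep_set (sigma_sets (space M) {X -` A \<inter> space M |A. A \<in> sets borel}) (sigma_sets (space M) ?SD)"
    by (rule indep_setI[OF order_trans[OF sX indep_setD_ev1[OF ind]] order_trans[OF sD indep_setD_ev2[OF ind]]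
          indep_setD[OF ind subsetD[OF sX] subsetD[OF sD]]])
  then show ?thesis unfolding indep_var_eq by simp
qed

lemma indep_increment_fun:
  fixes X :: "'a \<Rightarrow> real"
  assumes "0 \<le> s" "s \<le> t" and X: "X \<in> borel_measurable (F s)"
    and g: "g \<in> measurable borel N" and f: "f \<in> measurable borel N"
  shows "indep_var N (\<lambda>\<omega>. g (X \<omega>)) N (\<lambda>\<omega>. f (B t \<omega> - B s \<omega>))"
  using indep_var_compose[OF indep_increment[OF assms(1-3)] g f] by (simp add: comp_def)

lemma increment_moments:
  assumes s: "0 \<le> s" "s \<le> t"
  shows "integrable M (\<lambda>\<omega>. (B t \<omega> - B s \<omega>)\<^sup>2)" "expectation (\<lambda>\<omega>. (B t \<omega> - B s \<omega>)\<^sup>2) = t - s"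
    "integrable M (\<lambda>\<omega>. B t \<omega> - B s \<omega>)" "expectation (\<lambda>\<omega>. B t \<omega> - B s \<omega>) = 0"
    "integrable M (\<lambda>\<omega>. exp (l * (B t \<omega> - B s \<omega>)))"
    "expectation (\<lambda>\<omega>. exp (l * (B t \<omega> - B s \<omega>))) = exp (l\<^sup>2 * (t - s) / 2)"
    "integrable M (\<lambda>\<omega>. exp (l * (B t \<omega> - B s \<omega>)) * (B t \<omega> - B s \<omega>))"
    "expectation (\<lambda>\<omega>. exp (l * (B t \<omega> - B s \<omega>)) * (B t \<omega> - B s \<omega>)) = l * (t - s) * exp (l\<^sup>2 * (t - s) / 2)"
proof -
  have main: "(integrable M (\<lambda>\<omega>. (B t \<omega> - B s \<omega>)\<^sup>2)) \<and> (expectation (\<lambda>\<omega>. (B t \<omega> - B s \<omega>)\<^sup>2) = t - s) \<and> (integrable M (\<lambda>\<omega>. B t \<omega> - B s \<omega>)) \<and> (expectation (\<lambda>\<omega>. B t \<omega> - B s \<omega>) = 0) \<and> (integrable M (\<lambda>\<omega>. exp (l * (B t \<omega> - B s \<omega>)))) \<and> (expectation (\<lambda>\<omega>. exp (l * (B t \<omega> - B s \<omega>))) = exp (l\<^sup>2 * (t - s) / 2)) \<and> (integrable M (\<lambda>\<omega>. exp (l * (B t \<omega> - B s \<omega>)) * (B t \<omega> - B s \<omega>))) \<and> (expectation (\<lambda>\<omega>. exp (l * (B t \<omega> - B s \<omega>)) * (B t \<omega> - B s \<omega>)) = l * (t - s) * exp (l\<^sup>2 * (t - s) / 2))" if "s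 < t"
  proof -
    let ?D = "\<lambda>\<omega>. B t \<omega> - B s \<omega>" and ?r = "sqrt (t - s)"
    have r: "0 < ?r" using that by simp
    have D: "distributed M lborel ?D (normal_density 0 ?r)" by (rule increments_B[OF s(1) that])
    have r2: "?r\<^sup>2 = t - s" using that by simp
    have e: "normal_density 0 ?r x * exp (l * x) = exp (l\<^sup>2 * (t - s) / 2) * normal_density (l * (t - s)) ?r x" for x
      using normal_density_exp_shift[OF r, of x l] unfolding r2 .
    have e': "normal_density 0 ?r x * (exp (l * x) * x) = exp (l\<^sup>2 * (t - s) / 2) * (normal_density (l * (t - s)) ?r x * x)" for x
      using e[of x] by (metis mult.assoc)
    have a1: "integrable lborel (\<lambda>x. normal_density 0 ?r x * x\<^sup>2)" using integrable_normal_moment[OF r, of 0 2] by simp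
    have a2: "(\<integral>x. normal_density 0 ?r x * x\<^sup>2 \<partial>lborel) = t - s"
      using integral_normal_moment_even[OF r, of 0 1] r2 by simp
    have a3: "integrable lborel (\<lambda>x. normal_density 0 ?r x * x)" "(\<integral>x. normal_density 0 ?r x * x \<partial>lborel) = 0"
      using integrable_normal_moment_nz_1[OF r, of 0] integral_normal_moment_nz_1[OF r, of 0] by simp_all
    have a4: "integrable lborel (\<lambda>x. normal_density 0 ?r x * exp (l * x))"
       "(\<integral>x. normal_density 0 ?r x * exp (l * x) \<partial>lborel) = exp (l\<^sup>2 * (t - s) / 2)"
      unfolding e using r by auto
    have a5: "integrable lborel (\<lambda>x. normal_density 0 ?r x * (exp (l * x) * x))"
       "(\<integral>x. normal_density 0 ?r x * (exp (l * x) * x) \<partial>lborel) = l * (t - s) * exp (l\<^sup>2 * (t - s) / 2)"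
      unfolding e' using integrable_normal_moment_nz_1[OF r, of "l * (t - s)"] integral_normal_moment_nz_1[OF r, of "l * (t - s)"]
      by auto
    have iI: "integrable M (\<lambda>\<omega>. g (?D \<omega>))"
      if "integrable lborel (\<lambda>x. normal_density 0 ?r x * g x)" "g \<in> borel_measurable borel"
      for g :: "real \<Rightarrow> real" using distributed_integrable[OF D, of g] that by simp
    have eI: "expectation (\<lambda>\<omega>. g (?D \<omega>)) = (\<integral>x. normal_density 0 ?r x * g x \<partial>lborel)"
      if "g \<in> borel_measurable borel"
      for g :: "real \<Rightarrow> real" using distributed_integral[OF D, of g] that by simp
    show ?thesis
      using iI[OF a1] a2 eI[of "\<lambda>x. x\<^sup>2"] iI[OF a3(1)] a3(2) eI[of "\<lambda>x. x"] iI[OF a4(1)] a4(2) eI[of "\<lambda>x. exp (l * x)"]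
        iI[OF a5(1)] a5(2) eI[of "\<lambda>x. exp (l * x) * x"]
      by (intro conjI) simp_all
  qed
  then show "integrable M (\<lambda>\<omega>. (B t \<omega> - B s \<omega>)\<^sup>2)" "expectation (\<lambda>\<omega>. (B t \<omega> - B s \<omega>)\<^sup>2) = t - s"
    "integrable M (\<lambda>\<omega>. B t \<omega> - B s \<omega>)" "expectation (\<lambda>\<omega>. B t \<omega> - B s \<omega>) = 0"
    "integrable M (\<lambda>\<omega>. exp (l * (B t \<omega> - B s \<omega>)))"
    "expectation (\<lambda>\<omega>. exp (l * (B t \<omega> - B s \<omega>))) = exp (l\<^sup>2 * (t - s) / 2)"
    "integrable M (\<lambda>\<omega>. exp (l * (B t \<omega> - B s \<omega>)) * (B t \<omega> - B s \<omega>))"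
    "expectation (\<lambda>\<omega>. exp (l * (B t \<omega> - B s \<omega>)) * (B t \<omega> - B s \<omega>)) = l * (t - s) * exp (l\<^sup>2 * (t - s) / 2)"
    using s main by (cases "s < t"; simp add: prob_space)+
qed

text \<open>
  For \<open>f i\<close> the identity this is the Ito isometry of elementary integrals; for \<open>f i\<close> a compensated exponential it
  is the estimate behind \<open>compensated_exponential_sum_tendsto\<close>.
\<close>

lemma sum_increments_square:
  fixes h :: "nat \<Rightarrow> 'a \<Rightarrow> real" and t :: "nat \<Rightarrow> real"
  assumes t: "0 \<le> t 0" "\<And>i. i < n \<Longrightarrow> t i \<le> t (Suc i)"
    and h: "\<And>i. i < n \<Longrightarrow> h i \<in> borel_measurable (F (t i))" "\<And>i. i < n \<Longrightarrow> \<exists>C. \<forall>\<omega>\<in>space M. \<bar>h i \<omega>\<bar> \<le> C"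
    and f: "\<And>i. i < n \<Longrightarrow> f i \<in> borel_measurable borel"
      "\<And>i. i < n \<Longrightarrow> integrable M (\<lambda>\<omega>. (f i (B (t (Suc i)) \<omega> - B (t i) \<omega>))\<^sup>2)"
      "\<And>i. i < n \<Longrightarrow> expectation (\<lambda>\<omega>. f i (B (t (Suc i)) \<omega> - B (t i) \<omega>)) = 0"
      "\<And>i. i < n \<Longrightarrow> expectation (\<lambda>\<omega>. (f i (B (t (Suc i)) \<omega> - B (t i) \<omega>))\<^sup>2) = v i"
  shows "integrable M (\<lambda>\<omega>. (\<Sum>i<n. h i \<omega> * f i (B (t (Suc i)) \<omega> - B (t i) \<omega>))\<^sup>2)"
    "expectation (\<lambda>\<omega>. (\<Sum>i<n. h i \<omega> * f i (B (t (Suc i)) \<omega> - B (t i) \<omega>))\<^sup>2) =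
      (\<Sum>i<n. expectation (\<lambda>\<omega>. (h i \<omega>)\<^sup>2) * v i)"
proof -
  have t_nn: "0 \<le> t i" if "i \<le> n" for i
    using that by (induction i) (use t in \<open>auto intro: order_trans\<close>)
  let ?g = "\<lambda>i \<omega>. f i (B (t (Suc i)) \<omega> - B (t i) \<omega>)"
  have "(\<lambda>\<omega>. \<Sum>i<n. h i \<omega> * ?g i \<omega>) \<in> borel_measurable (F (t n)) \<and>
    integrable M (\<lambda>\<omega>. (\<Sum>i<n. h i \<omega> * ?g i \<omega>)\<^sup>2) \<and>
    expectation (\<lambda>\<omega>. (\<Sum>i<n. h i \<omega> * ?g i \<omega>)\<^sup>2) = (\<Sum>i<n. expectation (\<lambda>\<omega>. (h i \<omega>)\<^sup>2) * v i)"
  proof (rule martingale_differences_square)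
    show "?g i \<in> borel_measurable (F (t (Suc i)))" if "i < n" for i
      by (rule measurable_compose[OF borel_measurable_diff[OF measurable_B measurable_B] f(1)[OF that]])
         (use t t_nn[of i] t_nn[of "Suc i"] that in auto)
    show "indep_var borel X borel (?g i)" if "i < n" "X \<in> borel_measurable (F (t i))" for i X
      using indep_increment_fun[OF t_nn t(2) that(2) measurable_ident f(1)] that by simp
    show "sets (F (t i)) \<subseteq> sets (F (t (Suc i)))" if "i < n" for i
      using that t t_nn[of i] by (intro mono_F) auto
  qed (use t_nn h f in \<open>auto intro: subalgebra_F\<close>)
  then show "integrable M (\<lambda>\<omega>. (\<Sum>i<n. h i \<omega> * ?g i \<omega>)\<^sup>2)"
    "expectation (\<lambda>\<omega>. (\<Sum>i<n. h i \<omega> * ?g i \<omega>)\<^sup>2) = (\<Sum>i<n. expectation (\<lambda>\<omega>. (h i \<omega>)\<^sup>2) * v i)"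
    by blast+
qed

end

section \<open>Elementary stochastic integrals\<close>

lemma simple_integrandD:
  assumes "simple_integrand F s n t h"
  shows "\<And>i j. i \<le> j \<Longrightarrow> j \<le> n \<Longrightarrow> t i \<le> t j" "\<And>i. i \<le> n \<Longrightarrow> 0 \<le> t i" "\<And>i. i \<le> n \<Longrightarrow> t i \<le> s"
    "\<And>i. i < n \<Longrightarrow> h i \<in> borel_measurable (F (t i))" "\<And>i. i < n \<Longrightarrow> \<exists>C. \<forall>\<omega>\<in>space (F (t i)). \<bar>h i \<omega>\<bar> \<le> C"
proof -
  show mono: "t i \<le> t j" if "i \<le> j" "j \<le> n" for i j
    using that
  proof (induction j)
    case (Suc j)
    then show ?case using assms unfolding simple_integrand_def
      by (metis Suc_le_lessD le_SucE less_imp_le order_trans order_refl)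
  qed simp
  show "\<And>i. i \<le> n \<Longrightarrow> 0 \<le> t i" "\<And>i. i \<le> n \<Longrightarrow> t i \<le> s"
    using mono[of 0] mono[of _ n] assms unfolding simple_integrand_def by force+
qed (use assms in \<open>auto simp: simple_integrand_def\<close>)

text \<open>
  The tool for refining partitions: the increment of \<open>\<phi>\<close> over \<open>[a, b]\<close> is the sum of its increments over the
  intervals of a finer partition that lie between \<open>a\<close> and \<open>b\<close>.
\<close>

lemma telescope_sorted:
  fixes \<phi> :: "real \<Rightarrow> real"
  assumes xs: "sorted_wrt (<) xs" and a: "a \<in> set xs" and b: "b \<in> set xs" and ab: "a \<le> b"
  shows "\<phi> b - \<phi> a = (\<Sum>j<length xs - 1. of_bool (a \<le> xs ! j \<and> xs ! j < b) * (\<phi> (xs ! Suc j) - \<phi> (xs ! j)))"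
proof -
  obtain p q where p: "p < length xs" "a = xs ! p" and q: "q < length xs" "b = xs ! q"
    using a b by (auto simp: in_set_conv_nth)
  have iff: "xs ! i < xs ! j \<longleftrightarrow> i < j" if "i < length xs" "j < length xs" for i j
    using sorted_wrt_nth_less[OF xs, of i j] sorted_wrt_nth_less[OF xs, of j i] that
    by (metis less_asym linorder_neqE_nat order_less_irrefl)
  have iff': "xs ! i \<le> xs ! j \<longleftrightarrow> i \<le> j" if "i < length xs" "j < length xs" for i j
    using iff[OF that(2,1)] by (simp add: not_less[symmetric])
  have pq: "p \<le> q" using ab iff' p q by simp
  have "(\<Sum>j<length xs - 1. of_bool (a \<le> xs ! j \<and> xs ! j < b) * (\<phi> (xs ! Suc j) - \<phi> (xs ! j)))
      = (\<Sum>j\<in>{p..<q}. \<phi> (xs ! Suc j) - \<phi> (xs ! j))"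
    by (rule sum.mono_neutral_cong_right) (use p q iff iff' in auto)
  also have "\<dots> = \<phi> b - \<phi> a" using sum_Suc_diff'[OF pq, of "\<lambda>j. \<phi> (xs ! j)"] p q by simp
  finally show ?thesis by simp
qed

lemma bounded_sum_const_mult:
  fixes h :: "nat \<Rightarrow> 'a \<Rightarrow> real" and c :: "nat \<Rightarrow> real"
  assumes "\<And>i. i < n \<Longrightarrow> \<exists>C. \<forall>\<omega>\<in>S. \<bar>h i \<omega>\<bar> \<le> C"
  shows "\<exists>C. \<forall>\<omega>\<in>S. \<bar>\<Sum>i<n. h i \<omega> * c i\<bar> \<le> C"
proof -
  obtain C where C: "\<And>i \<omega>. i < n \<Longrightarrow> \<omega> \<in> S \<Longrightarrow> \<bar>h i \<omega>\<bar> \<le> C i" using assms by metis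
  have "\<bar>\<Sum>i<n. h i \<omega> * c i\<bar> \<le> (\<Sum>i<n. C i * \<bar>c i\<bar>)" if "\<omega> \<in> S" for \<omega>
    by (rule order_trans[OF sum_abs]) (use C that in \<open>auto simp: abs_mult intro!: sum_mono mult_right_mono\<close>)
  then show ?thesis by blast
qed

text \<open>
  The sum \<open>\<Sum> h (\<phi>(t') - \<phi>(t))\<close> over the intervals of a partition. For \<open>\<phi>\<close> a path of \<open>B\<close> it is the
  elementary integral, for \<open>\<phi> s = of_bool (r \<le> s)\<close> the value of the simple process at \<open>r\<close>; so a single
  refinement lemma serves for both.
\<close>

definition step_sum :: "nat \<Rightarrow> (nat \<Rightarrow> real) \<Rightarrow> (nat \<Rightarrow> 'a \<Rightarrow> real) \<Rightarrow> 'a \<Rightarrow> (real \<Rightarrow> real) \<Rightarrow> real" where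
  "step_sum n t h \<omega> \<phi> = (\<Sum>i<n. h i \<omega> * (\<phi> (t (Suc i)) - \<phi> (t i)))"

lemma simple_integral_step_sum: "simple_integral B n t h \<omega> = step_sum n t h \<omega> (\<lambda>s. B s \<omega>)"
  unfolding simple_integral_def step_sum_def ..

lemma simple_process_step_sum:
  assumes "\<And>i. i < n \<Longrightarrow> t i \<le> t (Suc i)"
  shows "simple_process n t h r \<omega> = step_sum n t h \<omega> (\<lambda>s. of_bool (r \<le> s))"
  unfolding simple_process_def step_sum_def
  by (rule sum.cong) (use assms in \<open>force simp: indicator_def\<close>)+

lemma step_sum_refine:
  assumes xs: "sorted_wrt (<) xs" and t: "\<And>i. i \<le> n \<Longrightarrow> t i \<in> set xs" "\<And>i. i < n \<Longrightarrow> t i \<le> t (Suc i)"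
  shows "step_sum n t h \<omega> \<phi> = step_sum (length xs - 1) ((!) xs)
     (\<lambda>j \<omega>. \<Sum>i<n. h i \<omega> * of_bool (t i \<le> xs ! j \<and> xs ! j < t (Suc i))) \<omega> \<phi>"
proof -
  have "step_sum n t h \<omega> \<phi> = (\<Sum>i<n. \<Sum>j<length xs - 1.
      h i \<omega> * (of_bool (t i \<le> xs ! j \<and> xs ! j < t (Suc i)) * (\<phi> (xs ! Suc j) - \<phi> (xs ! j))))"
    unfolding step_sum_def
  proof (rule sum.cong[OF refl])
    fix i assume "i \<in> {..<n}"
    then have "\<phi> (t (Suc i)) - \<phi> (t i) = (\<Sum>j<length xs - 1. of_bool (t i \<le> xs ! j \<and> xs ! j < t (Suc i)) * (\<phi> (xs ! Suc j) - \<phi> (xs ! j)))"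
      by (intro telescope_sorted[OF xs] t) auto
    then show "h i \<omega> * (\<phi> (t (Suc i)) - \<phi> (t i)) = (\<Sum>j<length xs - 1.
      h i \<omega> * (of_bool (t i \<le> xs ! j \<and> xs ! j < t (Suc i)) * (\<phi> (xs ! Suc j) - \<phi> (xs ! j))))"
      by (simp only: sum_distrib_left)
  qed
  also have "\<dots> = (\<Sum>j<length xs - 1. \<Sum>i<n.
      h i \<omega> * (of_bool (t i \<le> xs ! j \<and> xs ! j < t (Suc i)) * (\<phi> (xs ! Suc j) - \<phi> (xs ! j))))"
    by (rule sum.swap)
  finally show ?thesis unfolding step_sum_def by (simp only: sum_distrib_right mult.assoc)
qed

text \<open>
  At most one of the intervals contains \<open>r\<close>, so no mixed terms survive.
\<close>

lemma simple_process_square: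
  assumes "\<And>i. i < n \<Longrightarrow> t i \<le> t (Suc i)"
  shows "(simple_process n t h r \<omega>)\<^sup>2 = (\<Sum>i<n. (h i \<omega>)\<^sup>2 * indicator {t i<..t (Suc i)} r)"
proof -
  have "(simple_process n t h r \<omega>)\<^sup>2 = (\<Sum>i<n. (h i \<omega>)\<^sup>2 * indicator {t i<..t (Suc i)} r) \<and>
    (t n < r \<longrightarrow> simple_process n t h r \<omega> = 0)"
    using assms
  proof (induction n)
    case (Suc n)
    have IH: "(simple_process n t h r \<omega>)\<^sup>2 = (\<Sum>i<n. (h i \<omega>)\<^sup>2 * indicator {t i<..t (Suc i)} r)"
      "t n < r \<Longrightarrow> simple_process n t h r \<omega> = 0"
      using Suc.IH Suc.prems by auto
    have S: "simple_process (Suc n) t h r \<omega> = simple_process n t h r \<omega> + h n \<omega> * indicator {t n<..t (Suc n)} r"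
      unfolding simple_process_def by simp
    have tn: "t n \<le> t (Suc n)" using Suc.prems by simp
    show ?case
    proof (cases "t n < r")
      case True
      then show ?thesis unfolding S sum.lessThan_Suc IH(1)[symmetric] using IH(2) tn
        by (auto simp: power_mult_distrib indicator_def)
    next
      case False
      then show ?thesis unfolding S sum.lessThan_Suc IH(1)[symmetric] using tn by auto
    qed
  qed (simp add: simple_process_def)
  then show ?thesis ..
qed

lemma nn_integral_simple_process_square:
  assumes "simple_integrand F s n t h"
  shows "(\<integral>\<^sup>+r\<in>{0..s}. ennreal ((simple_process n t h r \<omega>)\<^sup>2) \<partial>lborel)
    = ennreal (\<Sum>i<n. (h i \<omega>)\<^sup>2 * (t (Suc i) - t i))"
proof -
  note D = simple_integrandD[OF assms]
  have "(\<integral>\<^sup>+r\<in>{0..s}. ennreal ((simple_process n t h r \<omega>)\<^sup>2) \<partial>lborel)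
      = (\<integral>\<^sup>+r. (\<Sum>i<n. ennreal ((h i \<omega>)\<^sup>2) * indicator {t i<..t (Suc i)} r) \<partial>lborel)"
  proof (rule nn_integral_cong)
    fix r
    have "ennreal ((simple_process n t h r \<omega>)\<^sup>2) = (\<Sum>i<n. ennreal ((h i \<omega>)\<^sup>2) * indicator {t i<..t (Suc i)} r)"
    proof -
      have "ennreal ((simple_process n t h r \<omega>)\<^sup>2) = (\<Sum>i<n. ennreal ((h i \<omega>)\<^sup>2 * indicator {t i<..t (Suc i)} r))"
      proof -
        have "(simple_process n t h r \<omega>)\<^sup>2 = (\<Sum>i<n. (h i \<omega>)\<^sup>2 * indicator {t i<..t (Suc i)} r)"
          by (rule simple_process_square) (use D(1) in auto)
        moreover have "ennreal (\<Sum>i<n. (h i \<omega>)\<^sup>2 * indicator {t i<..t (Suc i)} r)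
            = (\<Sum>i<n. ennreal ((h i \<omega>)\<^sup>2 * indicator {t i<..t (Suc i)} r))"
          by (rule sum_ennreal[symmetric]) simp
        ultimately show ?thesis by simp
      qed
      also have "\<dots> = (\<Sum>i<n. ennreal ((h i \<omega>)\<^sup>2) * indicator {t i<..t (Suc i)} r)"
        by (rule sum.cong) (auto simp: indicator_def)
      finally show ?thesis .
    qed
    moreover have "(\<Sum>i<n. ennreal ((h i \<omega>)\<^sup>2) * indicator {t i<..t (Suc i)} r) * indicator {0..s} r
        = (\<Sum>i<n. ennreal ((h i \<omega>)\<^sup>2) * indicator {t i<..t (Suc i)} r)"
      unfolding sum_distrib_right
    proof (rule sum.cong[OF refl])
      fix i assume "i \<in> {..<n}"
      then have "0 \<le> t i" "t (Suc i) \<le> s" using D(2)[of i] D(3)[of "Suc i"] by auto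
      then show "ennreal ((h i \<omega>)\<^sup>2) * indicator {t i<..t (Suc i)} r * indicator {0..s} r
          = ennreal ((h i \<omega>)\<^sup>2) * indicator {t i<..t (Suc i)} r"
        by (auto simp: indicator_def)
    qed
    ultimately show "ennreal ((simple_process n t h r \<omega>)\<^sup>2) * indicator {0..s} r
        = (\<Sum>i<n. ennreal ((h i \<omega>)\<^sup>2) * indicator {t i<..t (Suc i)} r)" by simp
  qed
  also have "\<dots> = (\<Sum>i<n. ennreal ((h i \<omega>)\<^sup>2) * ennreal (t (Suc i) - t i))"
    by (subst nn_integral_sum) (auto simp: nn_integral_cmult_indicator D intro!: sum.cong)
  also have "\<dots> = ennreal (\<Sum>i<n. (h i \<omega>)\<^sup>2 * (t (Suc i) - t i))"
  proof -
    have "(\<Sum>i<n. ennreal ((h i \<omega>)\<^sup>2) * ennreal (t (Suc i) - t i)) = (\<Sum>i<n. ennreal ((h i \<omega>)\<^sup>2 * (t (Suc i) - t i)))"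
      by (intro sum.cong refl ennreal_mult[symmetric]) (use D(1) in auto)
    moreover have "(\<Sum>i<n. ennreal ((h i \<omega>)\<^sup>2 * (t (Suc i) - t i))) = ennreal (\<Sum>i<n. (h i \<omega>)\<^sup>2 * (t (Suc i) - t i))"
      by (rule sum_ennreal) (use D(1) in auto)
    ultimately show ?thesis by simp
  qed
  finally show ?thesis .
qed

lemma measurable_lborel_restrict:
  "f \<in> borel_measurable (restrict_space borel A \<Otimes>\<^sub>M N) \<longleftrightarrow> f \<in> borel_measurable (restrict_space lborel A \<Otimes>\<^sub>M N)"
proof -
  have "sets (restrict_space borel A \<Otimes>\<^sub>M N) = sets (restrict_space lborel A \<Otimes>\<^sub>M N)"
    by (intro sets_pair_measure_cong sets_restrict_space_cong) auto
  then show ?thesis by (simp cong: measurable_cong_sets)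
qed

lemma finite_measure_lborel_Icc: "finite_measure (restrict_space lborel {a..b::real})"
  by (rule finite_measureI) (auto simp: space_restrict_space emeasure_restrict_space emeasure_lborel_Icc_eq)

text \<open>
  The left end point of the interval \<open>]s i / n, s (i + 1) / n]\<close> that contains \<open>r\<close>. It lies strictly to the left
  of \<open>r\<close>, so left-continuity is all that convergence along grids requires.
\<close>

definition grid_left :: "real \<Rightarrow> nat \<Rightarrow> real \<Rightarrow> real" where
  "grid_left s n r = s * real_of_int (\<lceil>r * n / s\<rceil> - 1) / n"

lemma grid_left_bounds:
  assumes r: "0 < r" "r \<le> s" and n: "0 < n"
  shows "0 \<le> grid_left s n r" "grid_left s n r < r" "r \<le> grid_left s n r + s / n"
    "\<exists>i<n. grid_left s n r = s * real i / n \<and> (\<forall>j<n. r \<in> {s * real j / n<..s * real (Suc j) / n} \<longleftrightarrow> j = i)"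
proof -
  have s: "0 < s" using r by simp
  define x where "x = r * n / s"
  have x: "0 < x" "x \<le> n" using r n s by (auto simp: x_def field_simps)
  have r_eq: "r = s * x / n" using n s by (simp add: x_def)
  have c: "1 \<le> \<lceil>x\<rceil>" "\<lceil>x\<rceil> \<le> int n" using x by (auto simp: ceiling_le_iff)
  have gl: "grid_left s n r = s * real_of_int (\<lceil>x\<rceil> - 1) / n" by (simp add: grid_left_def x_def)
  show "0 \<le> grid_left s n r" unfolding gl using c s by simp
  have xc: "real_of_int (\<lceil>x\<rceil> - 1) < x" "x \<le> real_of_int \<lceil>x\<rceil>" by linarith+
  show "grid_left s n r < r" unfolding gl using xc s n by (subst r_eq) (simp add: divide_strict_right_mono)
  have "r \<le> s * (real_of_int (\<lceil>x\<rceil> - 1) + 1) / n" using xc s n by (subst r_eq) (intro divide_right_mono mult_left_mono, auto)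
  then show "r \<le> grid_left s n r + s / n" unfolding gl by (simp add: right_diff_distrib diff_divide_distrib)
  show "\<exists>i<n. grid_left s n r = s * real i / n \<and> (\<forall>j<n. r \<in> {s * real j / n<..s * real (Suc j) / n} \<longleftrightarrow> j = i)"
  proof (intro exI[of _ "nat (\<lceil>x\<rceil> - 1)"] conjI allI impI)
    show "nat (\<lceil>x\<rceil> - 1) < n" using c by linarith
    have ri: "real (nat (\<lceil>x\<rceil> - 1)) = real_of_int (\<lceil>x\<rceil> - 1)" using c by simp
    show "grid_left s n r = s * real (nat (\<lceil>x\<rceil> - 1)) / n" unfolding gl ri ..
    fix j
    have "r \<in> {s * real j / n<..s * real (Suc j) / n} \<longleftrightarrow> real j < x \<and> x \<le> real (Suc j)"
      using s n by (subst r_eq) (simp add: divide_less_cancel divide_le_cancel)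
    also have "\<dots> \<longleftrightarrow> \<lceil>x\<rceil> = int j + 1" by (simp add: ceiling_eq_iff) linarith
    also have "\<dots> \<longleftrightarrow> j = nat (\<lceil>x\<rceil> - 1)" using c by linarith
    finally show "r \<in> {s * real j / n<..s * real (Suc j) / n} \<longleftrightarrow> j = nat (\<lceil>x\<rceil> - 1)" .
  qed
qed

lemma sum_grid_indicator:
  fixes f :: "nat \<Rightarrow> real \<Rightarrow> real"
  assumes r: "0 < r" "r \<le> s" and n: "0 < n"
  shows "(\<Sum>i<n. G (s * real i / n) * indicator {s * real i / n<..s * real (Suc i) / n} r) = (G (grid_left s n r) :: real)"
proof -
  obtain i where i: "i < n" "grid_left s n r = s * real i / n"
    "\<And>j. j < n \<Longrightarrow> r \<in> {s * real j / n<..s * real (Suc j) / n} \<longleftrightarrow> j = i"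
    using grid_left_bounds(4)[OF assms] by blast
  have "(\<Sum>j<n. G (s * real j / n) * indicator {s * real j / n<..s * real (Suc j) / n} r)
      = (\<Sum>j<n. if j = i then G (s * real i / n) else 0)"
    by (rule sum.cong[OF refl]) (use i(3) in \<open>auto simp: indicator_def\<close>)
  then show ?thesis using i(1,2) by simp
qed

lemma sum_grid_indicator_0:
  fixes a :: "nat \<Rightarrow> real"
  assumes "0 \<le> s"
  shows "(\<Sum>i\<in>I. a i * indicator {s * real i / real (Suc k)<..s * real (Suc i) / real (Suc k)} 0) = 0"
proof (rule sum.neutral, rule ballI)
  fix i have "0 \<le> s * real i / real (Suc k)" using assms by simp
  then show "a i * indicator {s * real i / real (Suc k)<..s * real (Suc i) / real (Suc k)} 0 = 0"
    by (simp add: indicator_def)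
qed

lemma filterlim_grid_left:
  assumes r: "0 < r" "r \<le> s"
  shows "filterlim (\<lambda>k. grid_left s (Suc k) r) (at_left r) sequentially"
  unfolding filterlim_at
proof
  show "\<forall>\<^sub>F k in sequentially. grid_left s (Suc k) r \<in> {..<r} \<and> grid_left s (Suc k) r \<noteq> r"
    using grid_left_bounds(2)[OF r] by (auto intro!: always_eventually dest: less_imp_neq)
  show "(\<lambda>k. grid_left s (Suc k) r) \<longlonglongrightarrow> r"
  proof (rule tendsto_sandwich[where f = "\<lambda>k. r - s / Suc k" and h = "\<lambda>_. r"])
    have "(\<lambda>k. r - s * inverse (real (Suc k))) \<longlonglongrightarrow> r - s * 0"
      by (intro tendsto_intros LIMSEQ_inverse_real_of_nat)
    then show "(\<lambda>k. r - s / Suc k) \<longlonglongrightarrow> r" by (simp add: divide_inverse)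
      show "\<forall>\<^sub>F k in sequentially. r - s / real (Suc k) \<le> grid_left s (Suc k) r"
    proof (intro always_eventually allI)
      fix k show "r - s / real (Suc k) \<le> grid_left s (Suc k) r"
        using grid_left_bounds(3)[OF r, of "Suc k"] by linarith
    qed
    show "\<forall>\<^sub>F k in sequentially. grid_left s (Suc k) r \<le> r"
      using grid_left_bounds(2)[OF r] by (intro always_eventually allI less_imp_le) simp
  qed simp
qed

context brownian_motion
begin

lemma simple_integrand_measurable:
  assumes "simple_integrand F s n t h" "i < n"
  shows "h i \<in> borel_measurable M" "\<exists>C. \<forall>\<omega>\<in>space M. \<bar>h i \<omega>\<bar> \<le> C"
  using simple_integrandD(4,5)[OF assms] simple_integrandD(2)[OF assms(1), of i] assms(2)
  by (auto intro: measurable_F_M simp: space_F)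

lemma simple_integral_measurable:
  assumes S: "simple_integrand F s n t h"
  shows "simple_integral B n t h \<in> borel_measurable M"
  unfolding simple_integral_def[abs_def] using simple_integrandD(2)[OF S]
  by (intro borel_measurable_sum borel_measurable_times borel_measurable_diff measurable_B_M simple_integrand_measurable[OF S]) auto

lemma simple_process_measurable:
  assumes S: "simple_integrand F s n t h"
  shows "(\<lambda>p. simple_process n t h (fst p) (snd p)) \<in> borel_measurable (restrict_space lborel A \<Otimes>\<^sub>M M)"
proof -
  have "(\<lambda>p. h i (snd p) * indicator {t i<..t (Suc i)} (fst p)) \<in> borel_measurable (restrict_space lborel A \<Otimes>\<^sub>M M)" if "i < n" for i
  proof -
    have [measurable]: "h i \<in> borel_measurable M" by (rule simple_integrand_measurable[OF S that])
    have [measurable]: "fst \<in> measurable (restrict_space lborel A \<Otimes>\<^sub>M M) borel"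
      by (rule measurable_compose[OF measurable_fst measurable_restrict_space1]) simp
    show ?thesis by measurable
  qed
  then show ?thesis unfolding simple_process_def by (intro borel_measurable_sum) auto
qed

lemma progressive_measurable:
  assumes "progressive F T H" "0 \<le> t" "t \<le> T"
  shows "(\<lambda>p. H (fst p) (snd p)) \<in> borel_measurable (restrict_space lborel {0..t} \<Otimes>\<^sub>M F t)"
  using assms unfolding progressive_def measurable_lborel_restrict by (auto simp: case_prod_unfold)

lemma progressive_measurable_M:
  assumes "progressive F T H" "0 \<le> T"
  shows "(\<lambda>p. H (fst p) (snd p)) \<in> borel_measurable (restrict_space lborel {0..T} \<Otimes>\<^sub>M M)"
proof (rule measurable_compose[OF _ progressive_measurable[OF assms order_refl]])
  have "(\<lambda>x. x) \<in> measurable M (F T)"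
    using subalgebra_F[OF assms(2)] by (auto simp: measurable_def subalgebra_def sets.sets_into_space Int_absorb2)
  then show "(\<lambda>p. p) \<in> measurable (restrict_space lborel {0..T} \<Otimes>\<^sub>M M) (restrict_space lborel {0..T} \<Otimes>\<^sub>M F T)"
    by (intro measurable_pair) (auto simp: comp_def intro: measurable_compose[OF measurable_snd])
qed

lemma nn_integral_path_measurable:
  fixes s :: real
  assumes "f \<in> borel_measurable (restrict_space lborel {0..s} \<Otimes>\<^sub>M N)"
  shows "(\<lambda>\<omega>. \<integral>\<^sup>+r\<in>{0..s}. f (r, \<omega>) \<partial>lborel) \<in> borel_measurable N"
proof -
  interpret L: finite_measure "restrict_space lborel {0..s}" by (rule finite_measure_lborel_Icc)
  have "(\<lambda>p. f (snd p, fst p)) \<in> borel_measurable (N \<Otimes>\<^sub>M restrict_space lborel {0..s})"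
    using measurable_compose[OF measurable_pair_swap' assms] by (simp add: case_prod_unfold)
  from L.borel_measurable_nn_integral_fst[OF this]
  show ?thesis by (subst (asm) nn_integral_restrict_space) auto
qed

lemma simple_error_measurable:
  assumes "simple_integrand F s n t h" "progressive F s H" "0 \<le> s"
  shows "(\<lambda>\<omega>. \<integral>\<^sup>+r\<in>{0..s}. ennreal ((simple_process n t h r \<omega> - H r \<omega>)\<^sup>2) \<partial>lborel) \<in> borel_measurable M"
  using nn_integral_path_measurable[OF measurable_compose[OF borel_measurable_power[OF borel_measurable_diff[OF
    simple_process_measurable[OF assms(1)] progressive_measurable_M[OF assms(2,3)]], of 2] measurable_ennreal]]
  by simp

text \<open>
  Stop the integrand as soon as its accumulated square would exceed \<open>\<eta>\<close>: the square of interval \<open>i\<close> is known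
  at its left end point, so the stopped integrand is again simple, its accumulated square never exceeds
  \<open>\<eta>\<close>, and the isometry together with Markov's inequality applies to it. On the event in question
  nothing has been stopped.
\<close>

lemma simple_integral_tail:
  assumes S: "simple_integrand F s n t h" and \<epsilon>: "0 < \<epsilon>" and \<eta>: "0 \<le> \<eta>"
  shows "prob {\<omega> \<in> space M. \<epsilon> < \<bar>simple_integral B n t h \<omega>\<bar> \<and>
      (\<integral>\<^sup>+r\<in>{0..s}. ennreal ((simple_process n t h r \<omega>)\<^sup>2) \<partial>lborel) \<le> ennreal \<eta>} \<le> \<eta> / \<epsilon>\<^sup>2"
proof -
  note D = simple_integrandD[OF S]
  have \<Delta>: "0 \<le> t (Suc i) - t i" if "i < n" for i using D(1)[of i "Suc i"] that by simp
  define q where "q i \<omega> = (\<Sum>j<i. (h j \<omega>)\<^sup>2 * (t (Suc j) - t j))" for i \<omega>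
  \<comment> \<open>\<open>q (Suc i)\<close> contains the square of interval \<open>i\<close> itself and is still known at time \<open>t i\<close>\<close>
  define h' where "h' i \<omega> = (if q (Suc i) \<omega> \<le> \<eta> then h i \<omega> else 0)" for i \<omega>
  have h_F: "h j \<in> borel_measurable (F (t i))" if "j \<le> i" "i < n" for i j
    by (rule measurable_F_mono[OF D(2) D(1) D(4)]) (use that in auto)
  have h'_F: "h' i \<in> borel_measurable (F (t i))" if "i < n" for i
  proof -
    have [measurable]: "q (Suc i) \<in> borel_measurable (F (t i))" "h i \<in> borel_measurable (F (t i))"
      unfolding q_def using that h_F by (auto intro!: borel_measurable_sum borel_measurable_times borel_measurable_power)
    show ?thesis unfolding h'_def by measurable
  qed
  have h'_le: "\<bar>h' i \<omega>\<bar> \<le> \<bar>h i \<omega>\<bar>" for i \<omega> by (simp add: h'_def)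
  have h'_bdd: "\<exists>C. \<forall>\<omega>\<in>space M. \<bar>h' i \<omega>\<bar> \<le> C" if "i < n" for i
    using simple_integrand_measurable(2)[OF S that] order_trans[OF h'_le] by meson
  let ?S' = "\<lambda>\<omega>. \<Sum>i<n. h' i \<omega> * (B (t (Suc i)) \<omega> - B (t i) \<omega>)"
  have iso: "integrable M (\<lambda>\<omega>. (?S' \<omega>)\<^sup>2)"
    "expectation (\<lambda>\<omega>. (?S' \<omega>)\<^sup>2) = (\<Sum>i<n. expectation (\<lambda>\<omega>. (h' i \<omega>)\<^sup>2) * (t (Suc i) - t i))"
    using sum_increments_square[of t n h' "\<lambda>_ x. x" "\<lambda>i. t (Suc i) - t i"] D h'_F h'_bdd increment_moments(1-4)
    by auto
  have q': "(\<Sum>i<m. (h' i \<omega>)\<^sup>2 * (t (Suc i) - t i)) \<le> \<eta> \<and> (\<Sum>i<m. (h' i \<omega>)\<^sup>2 * (t (Suc i) - t i)) \<le> q m \<omega>"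
    if "m \<le> n" for m \<omega>
    using that
  proof (induction m)
    case (Suc m)
    let ?a = "\<Sum>i<m. (h' i \<omega>)\<^sup>2 * (t (Suc i) - t i)"
    have IH: "?a \<le> \<eta>" "?a \<le> q m \<omega>" using Suc by auto
    have "0 \<le> (h m \<omega>)\<^sup>2 * (t (Suc m) - t m)" using \<Delta>[of m] Suc.prems by simp
    moreover have "q (Suc m) \<omega> = q m \<omega> + (h m \<omega>)\<^sup>2 * (t (Suc m) - t m)" by (simp add: q_def)
    ultimately show ?case using IH by (auto simp: h'_def)
  qed (simp add: \<eta> q_def)
  have h'2: "integrable M (\<lambda>\<omega>. (h' i \<omega>)\<^sup>2)" if i: "i < n" for i
    by (rule integrable_square_bounded[OF measurable_F_M[OF D(2) h'_F[OF i]] h'_bdd[OF i]]) (use i in simp)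
  have E: "expectation (\<lambda>\<omega>. (?S' \<omega>)\<^sup>2) \<le> \<eta>"
  proof -
    have "expectation (\<lambda>\<omega>. (?S' \<omega>)\<^sup>2) = expectation (\<lambda>\<omega>. \<Sum>i<n. (h' i \<omega>)\<^sup>2 * (t (Suc i) - t i))"
      unfolding iso(2) using h'2 by (subst Bochner_Integration.integral_sum) auto
    also have "\<dots> \<le> expectation (\<lambda>\<omega>. \<eta>)"
      by (rule integral_mono) (use h'2 q' in auto)
    finally show ?thesis by (simp add: prob_space)
  qed
  have "h' i \<in> borel_measurable M" if "i < n" for i
    by (rule measurable_F_M[OF D(2) h'_F[OF that]]) (use that in simp)
  then have [measurable]: "?S' \<in> borel_measurable M"
    using D(2) by (intro borel_measurable_sum borel_measurable_times borel_measurable_diff measurable_B_M) auto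
  have "prob {\<omega> \<in> space M. \<epsilon> < \<bar>simple_integral B n t h \<omega>\<bar> \<and>
      (\<integral>\<^sup>+r\<in>{0..s}. ennreal ((simple_process n t h r \<omega>)\<^sup>2) \<partial>lborel) \<le> ennreal \<eta>}
    \<le> prob {\<omega> \<in> space M. \<epsilon>\<^sup>2 \<le> (?S' \<omega>)\<^sup>2}"
  proof (rule finite_measure_mono)
    show "{\<omega> \<in> space M. \<epsilon> < \<bar>simple_integral B n t h \<omega>\<bar> \<and>
      (\<integral>\<^sup>+r\<in>{0..s}. ennreal ((simple_process n t h r \<omega>)\<^sup>2) \<partial>lborel) \<le> ennreal \<eta>}
     \<subseteq> {\<omega> \<in> space M. \<epsilon>\<^sup>2 \<le> (?S' \<omega>)\<^sup>2}"
    proof safe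
      fix \<omega> assume *: "\<epsilon> < \<bar>simple_integral B n t h \<omega>\<bar>"
        "(\<integral>\<^sup>+r\<in>{0..s}. ennreal ((simple_process n t h r \<omega>)\<^sup>2) \<partial>lborel) \<le> ennreal \<eta>"
      have "q n \<omega> \<le> \<eta>" using *(2) \<eta> unfolding nn_integral_simple_process_square[OF S] q_def by simp
      moreover have "q (Suc i) \<omega> \<le> q n \<omega>" if "i < n" for i
        unfolding q_def by (rule sum_mono2) (use that \<Delta> in auto)
      ultimately have "h' i \<omega> = h i \<omega>" if "i < n" for i
        using that unfolding h'_def by (meson order_trans)
      then have "?S' \<omega> = simple_integral B n t h \<omega>" unfolding simple_integral_def by (intro sum.cong) auto
      then show "\<epsilon>\<^sup>2 \<le> (?S' \<omega>)\<^sup>2" using *(1) \<epsilon> abs_le_square_iff[of \<epsilon> "?S' \<omega>"] by simp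
    qed
  qed measurable
  also have "\<dots> \<le> expectation (\<lambda>\<omega>. (?S' \<omega>)\<^sup>2) / \<epsilon>\<^sup>2"
    using \<epsilon> by (intro integral_Markov_inequality_measure[where A = "{}"] iso(1)) auto
  also have "\<dots> \<le> \<eta> / \<epsilon>\<^sup>2" using E by (intro divide_right_mono) auto
  finally show ?thesis .
qed

text \<open>
  Pass to the common refinement of the two partitions.
\<close>

lemma simple_integrand_diff:
  assumes S: "simple_integrand F s n t h" and S': "simple_integrand F s n' t' h'"
  shows "\<exists>m x g. simple_integrand F s m x g \<and>
    (\<forall>r \<omega>. simple_process m x g r \<omega> = simple_process n t h r \<omega> - simple_process n' t' h' r \<omega>) \<and>
    (\<forall>\<omega>. simple_integral B m x g \<omega> = simple_integral B n t h \<omega> - simple_integral B n' t' h' \<omega>)"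
proof -
  note D = simple_integrandD[OF S] and D' = simple_integrandD[OF S']
  define xs where "xs = sorted_list_of_set (t ` {..n} \<union> t' ` {..n'})"
  have xs: "sorted_wrt (<) xs" "set xs = t ` {..n} \<union> t' ` {..n'}" unfolding xs_def by auto
  then have len: "0 < length xs" by auto
  define c where "c t i j = (of_bool (t i \<le> xs ! j \<and> xs ! j < t (Suc i)) :: real)" for t :: "nat \<Rightarrow> real" and i j
  define g where "g j \<omega> = (\<Sum>i<n. h i \<omega> * c t i j) - (\<Sum>i<n'. h' i \<omega> * c t' i j)" for j \<omega>
  have step: "step_sum (length xs - 1) ((!) xs) g \<omega> \<phi> = step_sum n t h \<omega> \<phi> - step_sum n' t' h' \<omega> \<phi>" for \<omega> \<phi>
  proof -
    have "step_sum n t h \<omega> \<phi> = step_sum (length xs - 1) ((!) xs) (\<lambda>j \<omega>. \<Sum>i<n. h i \<omega> * c t i j) \<omega> \<phi>"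
      unfolding c_def by (rule step_sum_refine[OF xs(1)]) (use xs(2) D(1) in auto)
    moreover have "step_sum n' t' h' \<omega> \<phi> = step_sum (length xs - 1) ((!) xs) (\<lambda>j \<omega>. \<Sum>i<n'. h' i \<omega> * c t' i j) \<omega> \<phi>"
      unfolding c_def by (rule step_sum_refine[OF xs(1)]) (use xs(2) D'(1) in auto)
    ultimately show ?thesis unfolding step_sum_def g_def by (simp only: sum_subtractf[symmetric] left_diff_distrib)
  qed
  have x_in: "xs ! j \<in> {0..s}" if "j < length xs" for j
    using nth_mem[OF that] D(2,3) D'(2,3) unfolding xs(2) by auto
  have x_mono: "xs ! j \<le> xs ! Suc j" if "j < length xs - 1" for j
    using that by (intro less_imp_le sorted_wrt_nth_less[OF xs(1)]) auto
  have g_F: "g j \<in> borel_measurable (F (xs ! j))" if j: "j < length xs - 1" for j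
  proof -
    have part: "(\<lambda>\<omega>. h i \<omega> * c t i j) \<in> borel_measurable (F (xs ! j))"
      if S: "simple_integrand F s n t h" and "i < n" for i n t h
    proof (cases "t i \<le> xs ! j")
      case True
      have "h i \<in> borel_measurable (F (xs ! j))"
        by (rule measurable_F_mono[OF _ True simple_integrandD(4)[OF S that(2)]])
           (use simple_integrandD(2)[OF S] that in auto)
      then show ?thesis by simp
    qed (simp add: c_def)
    show ?thesis unfolding g_def by (intro borel_measurable_diff borel_measurable_sum part[OF S] part[OF S']) auto
  qed
  have g_bdd: "\<exists>C. \<forall>\<omega>\<in>space M. \<bar>g j \<omega>\<bar> \<le> C" for j
  proof -
    have "\<exists>C. \<forall>\<omega>\<in>space M. \<bar>\<Sum>i<n. h i \<omega> * c t i j\<bar> \<le> C"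
      by (rule bounded_sum_const_mult) (rule simple_integrand_measurable(2)[OF S])
    moreover have "\<exists>C. \<forall>\<omega>\<in>space M. \<bar>\<Sum>i<n'. h' i \<omega> * c t' i j\<bar> \<le> C"
      by (rule bounded_sum_const_mult) (rule simple_integrand_measurable(2)[OF S'])
    ultimately obtain C C' where CC: "\<forall>\<omega>\<in>space M. \<bar>\<Sum>i<n. h i \<omega> * c t i j\<bar> \<le> C"
      "\<forall>\<omega>\<in>space M. \<bar>\<Sum>i<n'. h' i \<omega> * c t' i j\<bar> \<le> C'" by blast
    have "\<bar>g j \<omega>\<bar> \<le> C + C'" if "\<omega> \<in> space M" for \<omega>
      using CC that abs_triangle_ineq4[of "\<Sum>i<n. h i \<omega> * c t i j" "\<Sum>i<n'. h' i \<omega> * c t' i j"]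
      unfolding g_def by fastforce
    then show ?thesis by blast
  qed
  have "simple_integrand F s (length xs - 1) ((!) xs) g"
    unfolding simple_integrand_def
  proof (intro conjI allI impI)
    fix j assume "j < length xs - 1"
    then have "space (F (xs ! j)) = space M" using x_in[of j] by (intro space_F) auto
    then show "\<exists>C. \<forall>\<omega>\<in>space (F (xs ! j)). \<bar>g j \<omega>\<bar> \<le> C" using g_bdd by simp
  qed (use x_in[of 0] x_in[of "length xs - 1"] len x_mono g_F in auto)
  moreover have "simple_process (length xs - 1) ((!) xs) g r \<omega> = simple_process n t h r \<omega> - simple_process n' t' h' r \<omega>" for r \<omega>
    using step x_mono D(1) D'(1) by (simp add: simple_process_step_sum)
  moreover have "simple_integral B (length xs - 1) ((!) xs) g \<omega> = simple_integral B n t h \<omega> - simple_integral B n' t' h' \<omega>" for \<omega>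
    using step by (simp add: simple_integral_step_sum)
  ultimately show ?thesis by blast
qed

end

section \<open>The Ito integral as a limit\<close>

text \<open>
  Integrands of elementary integrals have to be bounded, and sampling a continuous process only gives them a
  bound that depends on the path; hence this truncation.
\<close>

definition clip :: "real \<Rightarrow> real \<Rightarrow> real" where
  "clip C x = max (- C) (min C x)"

lemma clip_id: "\<bar>x\<bar> \<le> C \<Longrightarrow> clip C x = x"
  by (simp add: clip_def abs_le_iff max_absorb2 min_absorb2 minus_le_iff)

lemma abs_clip_le: "0 \<le> C \<Longrightarrow> \<bar>clip C x\<bar> \<le> C"
  by (auto simp: clip_def)

lemma abs_clip_le_abs: "0 \<le> C \<Longrightarrow> \<bar>clip C x\<bar> \<le> \<bar>x\<bar>"
  by (auto simp: clip_def)

lemma measurable_clip[measurable]: "clip C \<in> borel_measurable borel"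
  unfolding clip_def by measurable

lemma grid_point_mem:
  assumes "0 \<le> s" "i \<le> Suc k"
  shows "s * real i / real (Suc k) \<in> {0..s}"
proof -
  have "s * real i \<le> s * real (Suc k)" using assms by (intro mult_left_mono) auto
  then show ?thesis using assms by (simp add: divide_le_eq)
qed

text \<open>
  The left-point step functions of a bounded left-continuous \<open>g\<close>, truncated at level \<open>k\<close>. The truncation is inactive
  as soon as \<open>k \<ge> C\<close>. At \<open>r = 0\<close> the step functions are \<open>0\<close>, which is why the limit holds only almost
  everywhere.
\<close>

lemma grid_step_tendsto:
  fixes g :: "real \<Rightarrow> real"
  assumes s: "0 < s" and bnd: "\<And>r. r \<in> {0..s} \<Longrightarrow> \<bar>g r\<bar> \<le> C"
    and left: "\<And>r. 0 < r \<Longrightarrow> r \<le> s \<Longrightarrow> (g \<longlongrightarrow> g r) (at_left r)"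
  defines "S \<equiv> \<lambda>k r. \<Sum>i<Suc k. clip (real k) (g (s * real i / real (Suc k))) *
      indicator {s * real i / real (Suc k)<..s * real (Suc i) / real (Suc k)} r"
  shows "S k \<in> borel_measurable (restrict_space lborel {0..s})"
    and "r \<in> {0..s} \<Longrightarrow> \<bar>S k r\<bar> \<le> C"
    and "AE r in restrict_space lborel {0..s}. (\<lambda>k. S k r) \<longlonglongrightarrow> g r"
proof -
  have S: "S k r = clip (real k) (g (grid_left s (Suc k) r))" if "0 < r" "r \<le> s" for k r
    using sum_grid_indicator[OF that, of "Suc k" "\<lambda>x. clip (real k) (g x)"] by (simp add: S_def)
  have S0: "S k 0 = 0" for k
    unfolding S_def
    by (rule sum_grid_indicator_0) (use s in simp)
  have gl: "grid_left s (Suc k) r \<in> {0..s}" if "0 < r" "r \<le> s" for k r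
    using grid_left_bounds(1,2)[OF that, of "Suc k"] that by auto
  have "S k \<in> borel_measurable lborel" unfolding S_def
    by (intro borel_measurable_sum borel_measurable_times borel_measurable_const borel_measurable_indicator) simp
  then show "S k \<in> borel_measurable (restrict_space lborel {0..s})" by (rule measurable_restrict_space1)
  show "\<bar>S k r\<bar> \<le> C" if r: "r \<in> {0..s}"
  proof (cases "r = 0")
    case True
    then show ?thesis using S0[of k] bnd[of 0] s by auto
  next
    case False
    then have r': "0 < r" "r \<le> s" using r by auto
    have "\<bar>S k r\<bar> \<le> \<bar>g (grid_left s (Suc k) r)\<bar>"
      unfolding S[OF r'] by (rule abs_clip_le_abs) simp
    then show ?thesis using bnd[OF gl[OF r', of k]] by linarith
  qed
  have "AE r in lborel. r \<noteq> 0" by (rule AE_lborel_singleton)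
  then have "AE r in lborel. r \<in> {0..s} \<longrightarrow> (\<lambda>k. S k r) \<longlonglongrightarrow> g r"
  proof (eventually_elim, intro impI)
    fix r :: real assume "r \<noteq> 0" "r \<in> {0..s}"
    then have r: "0 < r" "r \<le> s" by auto
    have lim: "(\<lambda>k. g (grid_left s (Suc k) r)) \<longlonglongrightarrow> g r"
      by (rule filterlim_compose[OF left[OF r] filterlim_grid_left[OF r]])
    have "\<forall>\<^sub>F k in sequentially. C \<le> real k"
      by (rule eventually_ge_at_top[THEN filterlim_real_sequentially[unfolded filterlim_iff, rule_format]])
    then have "\<forall>\<^sub>F k in sequentially. g (grid_left s (Suc k) r) = S k r"
      by eventually_elim (use S[OF r] bnd[OF gl[OF r]] clip_id order_trans in metis)
    with lim show "(\<lambda>k. S k r) \<longlonglongrightarrow> g r" by (rule Lim_transform_eventually)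
  qed
  then show "AE r in restrict_space lborel {0..s}. (\<lambda>k. S k r) \<longlonglongrightarrow> g r"
    by (subst AE_restrict_space_iff) auto
qed

lemma grid_step_L2_tendsto:
  fixes g :: "real \<Rightarrow> real"
  assumes s: "0 < s" and g: "g \<in> borel_measurable (restrict_space lborel {0..s})"
    and bnd: "\<And>r. r \<in> {0..s} \<Longrightarrow> \<bar>g r\<bar> \<le> C"
    and left: "\<And>r. 0 < r \<Longrightarrow> r \<le> s \<Longrightarrow> (g \<longlongrightarrow> g r) (at_left r)"
  defines "S \<equiv> \<lambda>k r. \<Sum>i<Suc k. clip (real k) (g (s * real i / real (Suc k))) *
      indicator {s * real i / real (Suc k)<..s * real (Suc i) / real (Suc k)} r"
  shows "(\<lambda>k. \<integral>\<^sup>+r\<in>{0..s}. ennreal ((S k r - g r)\<^sup>2) \<partial>lborel) \<longlonglongrightarrow> 0"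
    and "(\<lambda>k. \<integral>\<^sup>+r\<in>{0..s}. ennreal ((S k r)\<^sup>2) \<partial>lborel) \<longlonglongrightarrow> (\<integral>\<^sup>+r\<in>{0..s}. ennreal ((g r)\<^sup>2) \<partial>lborel)"
proof -
  let ?L = "restrict_space lborel {0..s}"
  have S: "S k \<in> borel_measurable ?L" "r \<in> {0..s} \<Longrightarrow> \<bar>S k r\<bar> \<le> C" "AE r in ?L. (\<lambda>k. S k r) \<longlonglongrightarrow> g r" for k r
    unfolding S_def using grid_step_tendsto[OF s bnd left] by blast+
  have dom: "(\<lambda>k. \<integral>\<^sup>+r. ennreal ((S k r - c * g r)\<^sup>2) \<partial>?L) \<longlonglongrightarrow> (\<integral>\<^sup>+r. ennreal ((g r - c * g r)\<^sup>2) \<partial>?L)"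
    if c: "0 \<le> c" "c \<le> 1" for c
  proof (rule nn_integral_dominated_convergence[where w = "\<lambda>_. ennreal ((2 * C)\<^sup>2)"])
    show "(\<lambda>r. ennreal ((S k r - c * g r)\<^sup>2)) \<in> borel_measurable ?L" for k
      by (intro measurable_compose[OF _ measurable_ennreal] borel_measurable_power borel_measurable_diff
          borel_measurable_times borel_measurable_const S(1) g)
    show "(\<lambda>r. ennreal ((g r - c * g r)\<^sup>2)) \<in> borel_measurable ?L"
      by (intro measurable_compose[OF _ measurable_ennreal] borel_measurable_power borel_measurable_diff
          borel_measurable_times borel_measurable_const g)
    show "AE r in ?L. ennreal ((S k r - c * g r)\<^sup>2) \<le> ennreal ((2 * C)\<^sup>2)" for k
    proof (rule AE_I2)
      fix r assume "r \<in> space ?L"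
      then have r: "r \<in> {0..s}" by (auto simp: space_restrict_space)
      have "\<bar>c * g r\<bar> \<le> 1 * C" unfolding abs_mult using c bnd[OF r] by (intro mult_mono) auto
      then have "\<bar>S k r - c * g r\<bar> \<le> \<bar>2 * C\<bar>" using S(2)[OF r, of k] by linarith
      then show "ennreal ((S k r - c * g r)\<^sup>2) \<le> ennreal ((2 * C)\<^sup>2)"
        by (intro ennreal_leI) (simp only: abs_le_square_iff)
    qed
    show "(\<integral>\<^sup>+r. ennreal ((2 * C)\<^sup>2) \<partial>?L) < \<infinity>"
      using s by (simp add: emeasure_restrict_space space_restrict_space ennreal_mult_less_top)
    show "AE r in ?L. (\<lambda>k. ennreal ((S k r - c * g r)\<^sup>2)) \<longlonglongrightarrow> ennreal ((g r - c * g r)\<^sup>2)"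
      using S(3) by eventually_elim (intro tendsto_ennrealI tendsto_intros)
  qed auto
  show "(\<lambda>k. \<integral>\<^sup>+r\<in>{0..s}. ennreal ((S k r - g r)\<^sup>2) \<partial>lborel) \<longlonglongrightarrow> 0"
    using dom[of 1] by (simp add: nn_integral_restrict_space)
  show "(\<lambda>k. \<integral>\<^sup>+r\<in>{0..s}. ennreal ((S k r)\<^sup>2) \<partial>lborel) \<longlonglongrightarrow> (\<integral>\<^sup>+r\<in>{0..s}. ennreal ((g r)\<^sup>2) \<partial>lborel)"
    using dom[of 0] by (simp add: nn_integral_restrict_space)
qed

lemma nn_integral_square_triangle:
  fixes e f g :: "real \<Rightarrow> real"
  assumes [measurable]: "f \<in> borel_measurable (restrict_space lborel {0..s})" "g \<in> borel_measurable (restrict_space lborel {0..s})"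
    and le: "\<And>r. r \<in> {0..s} \<Longrightarrow> \<bar>e r\<bar> \<le> \<bar>f r\<bar> + \<bar>g r\<bar>"
  shows "(\<integral>\<^sup>+r\<in>{0..s}. ennreal ((e r)\<^sup>2) \<partial>lborel)
    \<le> ennreal 2 * (\<integral>\<^sup>+r\<in>{0..s}. ennreal ((f r)\<^sup>2) \<partial>lborel) + ennreal 2 * (\<integral>\<^sup>+r\<in>{0..s}. ennreal ((g r)\<^sup>2) \<partial>lborel)"
proof -
  let ?L = "restrict_space lborel {0..s}"
  have "(\<integral>\<^sup>+r. ennreal ((e r)\<^sup>2) \<partial>?L) \<le> (\<integral>\<^sup>+r. ennreal 2 * ennreal ((f r)\<^sup>2) + ennreal 2 * ennreal ((g r)\<^sup>2) \<partial>?L)"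
  proof (rule nn_integral_mono)
    fix r assume "r \<in> space ?L"
    then have "\<bar>e r\<bar> \<le> \<bar>\<bar>f r\<bar> + \<bar>g r\<bar>\<bar>" using le[of r] by (simp add: space_restrict_space)
    then have "(e r)\<^sup>2 \<le> (\<bar>f r\<bar> + \<bar>g r\<bar>)\<^sup>2" by (simp only: abs_le_square_iff)
    also have "\<dots> \<le> 2 * (f r)\<^sup>2 + 2 * (g r)\<^sup>2"
      using sum_squares_bound[of "\<bar>f r\<bar>" "\<bar>g r\<bar>"] by (simp add: power2_sum)
    finally show "ennreal ((e r)\<^sup>2) \<le> ennreal 2 * ennreal ((f r)\<^sup>2) + ennreal 2 * ennreal ((g r)\<^sup>2)"
      by (simp only: ennreal_mult[symmetric] ennreal_plus[symmetric] zero_le_power2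
          ennreal_leI mult_nonneg_nonneg zero_le_numeral)
  qed
  also have "\<dots> = ennreal 2 * (\<integral>\<^sup>+r. ennreal ((f r)\<^sup>2) \<partial>?L) + ennreal 2 * (\<integral>\<^sup>+r. ennreal ((g r)\<^sup>2) \<partial>?L)"
    by (subst nn_integral_add) (auto simp: nn_integral_cmult)
  finally show ?thesis by (simp add: nn_integral_restrict_space)
qed

context brownian_motion
begin

text \<open>
  Convergence of the integrands on an \<^emph>\<open>arbitrary\<close> event \<open>A\<close> carries over to the elementary integrals on
  \<open>A\<close>. The event need not be known at any particular time, because the bound in \<open>simple_integral_tail\<close> is itself
  restricted to an event.
\<close>

lemma simple_integrals_close:
  assumes S: "\<And>k. simple_integrand F s (n k) (t k) (h k)" "\<And>k. simple_integrand F s (n' k) (t' k) (h' k)"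
    and s: "0 \<le> s" and A[measurable]: "A \<in> sets M"
    and lim: "tendsto_zero_in_prob M (\<lambda>k \<omega>. (\<integral>\<^sup>+r\<in>{0..s}. ennreal ((simple_process (n k) (t k) (h k) r \<omega>
       - simple_process (n' k) (t' k) (h' k) r \<omega>)\<^sup>2) \<partial>lborel) * indicator A \<omega>)"
  shows "tendsto_zero_in_prob M (\<lambda>k \<omega>. ennreal \<bar>simple_integral B (n k) (t k) (h k) \<omega>
       - simple_integral B (n' k) (t' k) (h' k) \<omega>\<bar> * indicator A \<omega>)"
proof -
  have "\<exists>m x g. simple_integrand F s m x g \<and>
    (\<forall>r \<omega>. simple_process m x g r \<omega> = simple_process (n k) (t k) (h k) r \<omega> - simple_process (n' k) (t' k) (h' k) r \<omega>) \<and>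
    (\<forall>\<omega>. simple_integral B m x g \<omega> = simple_integral B (n k) (t k) (h k) \<omega> - simple_integral B (n' k) (t' k) (h' k) \<omega>)" for k
    by (rule simple_integrand_diff[OF S])
  then obtain m x g where D: "\<And>k. simple_integrand F s (m k) (x k) (g k)"
    "\<And>k r \<omega>. simple_process (n k) (t k) (h k) r \<omega> - simple_process (n' k) (t' k) (h' k) r \<omega> = simple_process (m k) (x k) (g k) r \<omega>"
    "\<And>k \<omega>. simple_integral B (n k) (t k) (h k) \<omega> - simple_integral B (n' k) (t' k) (h' k) \<omega> = simple_integral B (m k) (x k) (g k) \<omega>"
    by metis
  define Z where "Z k \<omega> = (\<integral>\<^sup>+r\<in>{0..s}. ennreal ((simple_process (m k) (x k) (g k) r \<omega>)\<^sup>2) \<partial>lborel)" for k \<omega>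
  have [measurable]: "Z k \<in> borel_measurable M" for k
    unfolding Z_def
    using nn_integral_path_measurable[OF measurable_compose[OF borel_measurable_power[OF simple_process_measurable[OF D(1)[of k]], of 2] measurable_ennreal]]
    by simp
  have [measurable]: "simple_integral B (m k) (x k) (g k) \<in> borel_measurable M" for k
    by (rule simple_integral_measurable[OF D(1)])
  have lim: "tendsto_zero_in_prob M (\<lambda>k \<omega>. Z k \<omega> * indicator A \<omega>)" using lim unfolding D Z_def .
  show ?thesis unfolding D
  proof (rule tendsto_zero_in_probI, rule LIMSEQ_I)
    fix \<epsilon> \<eta> :: real assume \<epsilon>: "0 < \<epsilon>" and \<eta>: "0 < \<eta>"
    let ?I = "\<lambda>k. simple_integral B (m k) (x k) (g k)"
    let ?P = "\<lambda>k. {\<omega> \<in> space M. ennreal \<epsilon> < ennreal \<bar>?I k \<omega>\<bar> * indicator A \<omega>}"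
    \<comment> \<open>then the tail bound \<open>\<eta>' / \<epsilon>\<^sup>2\<close> is \<open>\<eta> / 2\<close>\<close>
    define \<eta>' where "\<eta>' = \<eta> / 2 * \<epsilon>\<^sup>2"
    have \<eta>': "0 < \<eta>'" using \<epsilon> \<eta> by (simp add: \<eta>'_def)
    from LIMSEQ_D[OF tendsto_zero_in_probD[OF lim \<eta>'], of "\<eta> / 2"] \<eta>
    obtain k0 where k0: "\<And>k. k \<ge> k0 \<Longrightarrow> prob {\<omega> \<in> space M. ennreal \<eta>' < Z k \<omega> * indicator A \<omega>} < \<eta> / 2" by auto
    have "prob (?P k) < \<eta>" if "k \<ge> k0" for k
    proof -
      have "prob (?P k) \<le> prob ({\<omega> \<in> space M. \<epsilon> < \<bar>?I k \<omega>\<bar> \<and> Z k \<omega> \<le> ennreal \<eta>'}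
          \<union> {\<omega> \<in> space M. ennreal \<eta>' < Z k \<omega> * indicator A \<omega>})"
      proof (rule finite_measure_mono)
        show "?P k \<subseteq> {\<omega> \<in> space M. \<epsilon> < \<bar>?I k \<omega>\<bar> \<and> Z k \<omega> \<le> ennreal \<eta>'}
          \<union> {\<omega> \<in> space M. ennreal \<eta>' < Z k \<omega> * indicator A \<omega>}"
          using \<epsilon> by (auto simp: indicator_def ennreal_less_iff not_less)
      qed measurable
      also have "\<dots> \<le> prob {\<omega> \<in> space M. \<epsilon> < \<bar>?I k \<omega>\<bar> \<and> Z k \<omega> \<le> ennreal \<eta>'}
          + prob {\<omega> \<in> space M. ennreal \<eta>' < Z k \<omega> * indicator A \<omega>}"
        by (rule measure_Un_le) measurable
      also have "prob {\<omega> \<in> space M. \<epsilon> < \<bar>?I k \<omega>\<bar> \<and> Z k \<omega> \<le> ennreal \<eta>'} \<le> \<eta>' / \<epsilon>\<^sup>2"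
        unfolding Z_def by (rule simple_integral_tail[OF D(1) \<epsilon>]) (use \<eta>' in simp)
      also have "\<eta>' / \<epsilon>\<^sup>2 = \<eta> / 2" using \<epsilon> by (simp add: \<eta>'_def)
      finally show ?thesis using k0[OF that] by simp
    qed
    then show "\<exists>k0. \<forall>k\<ge>k0. norm (prob (?P k) - 0) < \<eta>" by (auto intro!: exI[of _ k0])
  qed
qed

lemma progressive_mono: "progressive F T H \<Longrightarrow> s \<le> T \<Longrightarrow> progressive F s H"
  unfolding progressive_def by auto

lemma progressive_diff:
  assumes "progressive F T H" "progressive F T H'"
  shows "progressive F T (\<lambda>r \<omega>. H r \<omega> - H' r \<omega>)"
  using assms unfolding progressive_def by (auto simp: case_prod_unfold intro!: borel_measurable_diff)

lemma has_ito_integral_diff: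
  assumes s: "0 \<le> s" and I: "has_ito_integral M F B s H Y" and I': "has_ito_integral M F B s H' Y'"
  shows "has_ito_integral M F B s (\<lambda>r \<omega>. H r \<omega> - H' r \<omega>) (\<lambda>\<omega>. Y \<omega> - Y' \<omega>)"
proof -
  from I obtain n t h where 1: "progressive F s H" "Y \<in> borel_measurable M"
    "\<And>k. simple_integrand F s (n k) (t k) (h k)"
    "tendsto_zero_in_prob M (\<lambda>k \<omega>. \<integral>\<^sup>+r\<in>{0..s}. ennreal ((simple_process (n k) (t k) (h k) r \<omega> - H r \<omega>)\<^sup>2) \<partial>lborel)"
    "tendsto_zero_in_prob M (\<lambda>k \<omega>. ennreal \<bar>simple_integral B (n k) (t k) (h k) \<omega> - Y \<omega>\<bar>)"
    unfolding has_ito_integral_def by blast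
  from I' obtain n' t' h' where 2: "progressive F s H'" "Y' \<in> borel_measurable M"
    "\<And>k. simple_integrand F s (n' k) (t' k) (h' k)"
    "tendsto_zero_in_prob M (\<lambda>k \<omega>. \<integral>\<^sup>+r\<in>{0..s}. ennreal ((simple_process (n' k) (t' k) (h' k) r \<omega> - H' r \<omega>)\<^sup>2) \<partial>lborel)"
    "tendsto_zero_in_prob M (\<lambda>k \<omega>. ennreal \<bar>simple_integral B (n' k) (t' k) (h' k) \<omega> - Y' \<omega>\<bar>)"
    unfolding has_ito_integral_def by blast
  have "\<exists>m x g. simple_integrand F s m x g \<and>
    (\<forall>r \<omega>. simple_process m x g r \<omega> = simple_process (n k) (t k) (h k) r \<omega> - simple_process (n' k) (t' k) (h' k) r \<omega>) \<and>
    (\<forall>\<omega>. simple_integral B m x g \<omega> = simple_integral B (n k) (t k) (h k) \<omega> - simple_integral B (n' k) (t' k) (h' k) \<omega>)" for k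
    by (rule simple_integrand_diff[OF 1(3) 2(3)])
  then obtain m x g where D: "\<And>k. simple_integrand F s (m k) (x k) (g k)"
    "\<And>k r \<omega>. simple_process (m k) (x k) (g k) r \<omega> = simple_process (n k) (t k) (h k) r \<omega> - simple_process (n' k) (t' k) (h' k) r \<omega>"
    "\<And>k \<omega>. simple_integral B (m k) (x k) (g k) \<omega> = simple_integral B (n k) (t k) (h k) \<omega> - simple_integral B (n' k) (t' k) (h' k) \<omega>"
    by metis
  have pd: "progressive F s (\<lambda>r \<omega>. H r \<omega> - H' r \<omega>)" by (rule progressive_diff[OF 1(1) 2(1)])
  note [measurable] = 1(2) 2(2) simple_integral_measurable[OF 1(3)] simple_integral_measurable[OF 2(3)]
    simple_integral_measurable[OF D(1)]
  have "tendsto_zero_in_prob M (\<lambda>k \<omega>. \<integral>\<^sup>+r\<in>{0..s}. ennreal ((simple_process (m k) (x k) (g k) r \<omega> - (H r \<omega> - H' r \<omega>))\<^sup>2) \<partial>lborel)"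
  proof (rule tendsto_zero_in_prob_bound)
    let ?Z = "\<lambda>k \<omega>. \<integral>\<^sup>+r\<in>{0..s}. ennreal ((simple_process (n k) (t k) (h k) r \<omega> - H r \<omega>)\<^sup>2) \<partial>lborel"
    let ?Z' = "\<lambda>k \<omega>. \<integral>\<^sup>+r\<in>{0..s}. ennreal ((simple_process (n' k) (t' k) (h' k) r \<omega> - H' r \<omega>)\<^sup>2) \<partial>lborel"
    have m[measurable]: "?Z k \<in> borel_measurable M" "?Z' k \<in> borel_measurable M" for k
      by (rule simple_error_measurable 1 2 s)+
    show "tendsto_zero_in_prob M (\<lambda>k \<omega>. ennreal 2 * ?Z k \<omega> + ennreal 2 * ?Z' k \<omega>)"
      by (intro tendsto_zero_in_prob_add tendsto_zero_in_prob_cmult 1(4) 2(4)) measurable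
    show "(\<lambda>\<omega>. ennreal 2 * ?Z k \<omega> + ennreal 2 * ?Z' k \<omega>) \<in> borel_measurable M" for k by measurable
    show "(\<lambda>\<omega>. \<integral>\<^sup>+r\<in>{0..s}. ennreal ((simple_process (m k) (x k) (g k) r \<omega> - (H r \<omega> - H' r \<omega>))\<^sup>2) \<partial>lborel) \<in> borel_measurable M" for k
      by (rule simple_error_measurable[OF D(1) pd s])
    have path_M: "(\<lambda>r. simple_process n t h r \<omega> - H r \<omega>) \<in> borel_measurable (restrict_space lborel {0..s})"
      if "simple_integrand F s n t h" "progressive F s H" "\<omega> \<in> space M" for n t h H \<omega>
      using measurable_compose[OF measurable_Pair2'[OF that(3)] borel_measurable_diff[OF
        simple_process_measurable[OF that(1)] progressive_measurable_M[OF that(2) s]]] by simp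
    show "AE \<omega> in M. (\<integral>\<^sup>+r\<in>{0..s}. ennreal ((simple_process (m k) (x k) (g k) r \<omega> - (H r \<omega> - H' r \<omega>))\<^sup>2) \<partial>lborel)
        \<le> ennreal 2 * ?Z k \<omega> + ennreal 2 * ?Z' k \<omega>" for k
      by (rule AE_I2, rule nn_integral_square_triangle)
         (auto simp: D(2) intro: path_M[OF 1(3) 1(1)] path_M[OF 2(3) 2(1)])
  qed
  moreover have "tendsto_zero_in_prob M (\<lambda>k \<omega>. ennreal \<bar>simple_integral B (m k) (x k) (g k) \<omega> - (Y \<omega> - Y' \<omega>)\<bar>)"
  proof (rule tendsto_zero_in_prob_bound[OF _ _ _ tendsto_zero_in_prob_add[OF _ _ 1(5) 2(5)]])
    fix k
    show "AE \<omega> in M. ennreal \<bar>simple_integral B (m k) (x k) (g k) \<omega> - (Y \<omega> - Y' \<omega>)\<bar>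
       \<le> ennreal \<bar>simple_integral B (n k) (t k) (h k) \<omega> - Y \<omega>\<bar> + ennreal \<bar>simple_integral B (n' k) (t' k) (h' k) \<omega> - Y' \<omega>\<bar>"
      unfolding D by (intro AE_I2) (simp add: ennreal_leI flip: ennreal_plus)
  qed measurable
  ultimately show ?thesis
    using pd D(1) unfolding has_ito_integral_def by (intro conjI exI[of _ m] exI[of _ x] exI[of _ g]) auto
qed

text \<open>
  Such a process is the limit of its left-point step processes on every \<open>[0, s]\<close>, and these are jointly measurable.
  The point \<open>r = 0\<close> lies in no interval of the grid and has to be added separately.
\<close>

lemma left_continuous_progressive:
  assumes adapted: "\<And>q. q \<in> {0..T} \<Longrightarrow> H q \<in> borel_measurable (F q)"
    and left: "\<And>\<omega> r. \<omega> \<in> space M \<Longrightarrow> 0 < r \<Longrightarrow> r \<le> T \<Longrightarrow> ((\<lambda>q. H q \<omega>) \<longlongrightarrow> H r \<omega>) (at_left r)"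
  shows "progressive F T H"
  unfolding progressive_def
proof
  fix s assume s: "s \<in> {0..T}"
  let ?N = "restrict_space borel {0..s} \<Otimes>\<^sub>M F s"
  let ?f = "\<lambda>k p. (\<Sum>i<Suc k. H (s * real i / real (Suc k)) (snd p) *
      indicator {s * real i / real (Suc k)<..s * real (Suc i) / real (Suc k)} (fst p)) + H 0 (snd p) * indicator {0} (fst p)"
  have [measurable]: "fst \<in> measurable ?N borel"
    by (rule measurable_compose[OF measurable_fst measurable_restrict_space1]) simp
  have adapted': "H q \<in> borel_measurable (F s)" if "0 \<le> q" "q \<le> s" for q
    using that s by (intro measurable_F_mono[OF _ _ adapted]) auto
  have grid: "s * real i / real (Suc k) \<le> s" if "i < Suc k" for i k
    using grid_point_mem[of s i k] s that by simp
  have "(\<lambda>p. H (fst p) (snd p)) \<in> borel_measurable ?N"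
  proof (rule borel_measurable_LIMSEQ_real)
    fix k show "?f k \<in> borel_measurable ?N"
      using s by (intro borel_measurable_add borel_measurable_sum borel_measurable_times
          measurable_compose[OF measurable_snd adapted'] borel_measurable_indicator' grid) (auto intro: measurable_compose)
  next
    fix p assume "p \<in> space ?N"
    then obtain r \<omega> where p: "p = (r, \<omega>)" and r: "0 \<le> r" "r \<le> s" and \<omega>: "\<omega> \<in> space M"
      using s by (cases p) (auto simp: space_pair_measure space_restrict_space space_F)
    show "(\<lambda>k. ?f k p) \<longlonglongrightarrow> H (fst p) (snd p)"
    proof (cases "r = 0")
      case True
      have "(\<Sum>i<Suc k. H (s * real i / real (Suc k)) \<omega> * indicator {s * real i / real (Suc k)<..s * real (Suc i) / real (Suc k)} 0) = 0" for k
        by (rule sum_grid_indicator_0) (use s in simp)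
      then show ?thesis by (simp add: p True)
    next
      case False
      then have r0: "0 < r" using r by simp
      have "(\<lambda>k. H (grid_left s (Suc k) r) \<omega>) \<longlonglongrightarrow> H r \<omega>"
        by (rule filterlim_compose[OF left[OF \<omega> r0] filterlim_grid_left[OF r0 r(2)]]) (use r s in auto)
      moreover have "?f k p = H (grid_left s (Suc k) r) \<omega>" for k
        using sum_grid_indicator[OF r0 r(2), of "Suc k" "\<lambda>q. H q \<omega>"] False by (simp add: p)
      ultimately show ?thesis by (simp add: p)
    qed
  qed
  then show "(\<lambda>(s, \<omega>). H s \<omega>) \<in> borel_measurable ?N" by (simp add: case_prod_unfold)
qed

lemma uniform_simple_integrand:
  assumes adapted: "\<And>q. q \<in> {0..s} \<Longrightarrow> H q \<in> borel_measurable (F q)" and s: "0 \<le> s"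
  shows "simple_integrand F s (Suc k) (\<lambda>i. s * real i / real (Suc k)) (\<lambda>i \<omega>. clip (real k) (H (s * real i / real (Suc k)) \<omega>))"
  unfolding simple_integrand_def
proof (intro conjI allI impI)
  fix i assume "i < Suc k"
  then have q: "s * real i / real (Suc k) \<in> {0..s}" by (intro grid_point_mem s) simp
  show "(\<lambda>\<omega>. clip (real k) (H (s * real i / real (Suc k)) \<omega>)) \<in> borel_measurable (F (s * real i / real (Suc k)))"
    by (rule measurable_compose[OF adapted[OF q] measurable_clip])
  show "\<exists>C. \<forall>\<omega>\<in>space (F (s * real i / real (Suc k))). \<bar>clip (real k) (H (s * real i / real (Suc k)) \<omega>)\<bar> \<le> C"
    using abs_clip_le[of "real k"] by (intro exI[of _ "real k"]) auto
next
  fix i assume "i < Suc k"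
  show "s * real i / real (Suc k) \<le> s * real (Suc i) / real (Suc k)"
    using s by (intro divide_right_mono mult_left_mono) auto
qed (use s in auto)

lemma uniform_simple_process_tendsto:
  assumes H: "progressive F s H" and s: "0 < s" and \<omega>: "\<omega> \<in> space M"
    and bnd: "\<And>r. r \<in> {0..s} \<Longrightarrow> \<bar>H r \<omega>\<bar> \<le> C"
    and left: "\<And>r. 0 < r \<Longrightarrow> r \<le> s \<Longrightarrow> ((\<lambda>q. H q \<omega>) \<longlongrightarrow> H r \<omega>) (at_left r)"
  defines "P \<equiv> \<lambda>k. simple_process (Suc k) (\<lambda>i. s * real i / real (Suc k))
      (\<lambda>i \<omega>. clip (real k) (H (s * real i / real (Suc k)) \<omega>))"
  shows "(\<lambda>k. \<integral>\<^sup>+r\<in>{0..s}. ennreal ((P k r \<omega> - H r \<omega>)\<^sup>2) \<partial>lborel) \<longlonglongrightarrow> 0"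
    and "(\<lambda>k. \<integral>\<^sup>+r\<in>{0..s}. ennreal ((P k r \<omega>)\<^sup>2) \<partial>lborel) \<longlonglongrightarrow> (\<integral>\<^sup>+r\<in>{0..s}. ennreal ((H r \<omega>)\<^sup>2) \<partial>lborel)"
proof -
  have "(\<lambda>r. H r \<omega>) \<in> borel_measurable (restrict_space lborel {0..s})"
    using measurable_compose[OF measurable_Pair2'[OF \<omega>] progressive_measurable_M[OF H]] s by simp
  from grid_step_L2_tendsto[OF s this bnd left]
  show "(\<lambda>k. \<integral>\<^sup>+r\<in>{0..s}. ennreal ((P k r \<omega> - H r \<omega>)\<^sup>2) \<partial>lborel) \<longlonglongrightarrow> 0"
    and "(\<lambda>k. \<integral>\<^sup>+r\<in>{0..s}. ennreal ((P k r \<omega>)\<^sup>2) \<partial>lborel) \<longlonglongrightarrow> (\<integral>\<^sup>+r\<in>{0..s}. ennreal ((H r \<omega>)\<^sup>2) \<partial>lborel)"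
    unfolding P_def simple_process_def by simp_all
qed

lemma continuous_left:
  fixes f :: "real \<Rightarrow> real"
  assumes "continuous_on {0..S} f" "0 < r" "r \<le> S"
  shows "(f \<longlongrightarrow> f r) (at_left r)"
proof -
  have "(f \<longlongrightarrow> f r) (at r within {0..S})" using assms by (auto simp: continuous_on)
  then have "(f \<longlongrightarrow> f r) (at r within {0..<r})" by (rule tendsto_within_subset) (use assms in auto)
  moreover have "at r within {0..<r} = at_left r"
    by (rule at_within_nhd[of _ "{0<..}"]) (use assms in auto)
  ultimately show ?thesis by simp
qed

text \<open>
  For continuous integrands left-point Riemann sums converge to the integral. The path is bounded but its bound is
  random, so the approximating simple processes are truncated at level \<open>k\<close>; for each path this changes only
  finitely many of the sums.
\<close>

lemma has_ito_integral_riemann: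
  assumes s: "0 < s" and adapted: "\<And>q. q \<in> {0..s} \<Longrightarrow> H q \<in> borel_measurable (F q)"
    and cont: "\<And>\<omega>. \<omega> \<in> space M \<Longrightarrow> continuous_on {0..s} (\<lambda>q. H q \<omega>)"
    and Y[measurable]: "Y \<in> borel_measurable M"
    and lim: "tendsto_zero_in_prob M (\<lambda>k \<omega>. ennreal \<bar>(\<Sum>i<Suc k. H (s * real i / real (Suc k)) \<omega> *
       (B (s * real (Suc i) / real (Suc k)) \<omega> - B (s * real i / real (Suc k)) \<omega>)) - Y \<omega>\<bar>)"
  shows "has_ito_integral M F B s H Y"
proof -
  have left: "((\<lambda>q. H q \<omega>) \<longlongrightarrow> H r \<omega>) (at_left r)" if "\<omega> \<in> space M" "0 < r" "r \<le> s" for \<omega> r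
    by (rule continuous_left[OF cont[OF that(1)] that(2,3)])
  have prog: "progressive F s H" by (rule left_continuous_progressive[OF adapted left])
  have bnd: "\<exists>C. \<forall>r\<in>{0..s}. \<bar>H r \<omega>\<bar> \<le> C" if "\<omega> \<in> space M" for \<omega>
    using compact_imp_bounded[OF compact_continuous_image[OF cont[OF that] compact_Icc]]
    unfolding bounded_iff by auto
  let ?t = "\<lambda>k i. s * real i / real (Suc k)"
  let ?h = "\<lambda>k i \<omega>. clip (real k) (H (?t k i) \<omega>)"
  let ?R = "\<lambda>k \<omega>. \<Sum>i<Suc k. H (?t k i) \<omega> * (B (?t k (Suc i)) \<omega> - B (?t k i) \<omega>)"
  have S: "simple_integrand F s (Suc k) (?t k) (?h k)" for k
    by (rule uniform_simple_integrand[OF adapted]) (use s in auto)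
  have tin: "?t k i \<in> {0..s}" if "i \<le> Suc k" for i k
    by (rule grid_point_mem) (use s that in auto)
  have [measurable]: "?R k \<in> borel_measurable M" for k
    by (intro borel_measurable_sum borel_measurable_times borel_measurable_diff measurable_B_M
        measurable_F_M[OF _ adapted]) (use s tin[of _ k] in \<open>simp_all del: of_nat_Suc\<close>)
  note [measurable] = simple_integral_measurable[OF S]
  have "tendsto_zero_in_prob M (\<lambda>k \<omega>. \<integral>\<^sup>+r\<in>{0..s}. ennreal ((simple_process (Suc k) (?t k) (?h k) r \<omega> - H r \<omega>)\<^sup>2) \<partial>lborel)"
  proof (rule tendsto_zero_in_prob_AE[OF simple_error_measurable[OF S prog]], use s in simp, rule AE_I2)
    fix \<omega> assume \<omega>: "\<omega> \<in> space M"
    from bnd[OF \<omega>] obtain C where "\<forall>r\<in>{0..s}. \<bar>H r \<omega>\<bar> \<le> C" ..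
    then show "(\<lambda>k. \<integral>\<^sup>+r\<in>{0..s}. ennreal ((simple_process (Suc k) (?t k) (?h k) r \<omega> - H r \<omega>)\<^sup>2) \<partial>lborel) \<longlonglongrightarrow> 0"
      by (intro uniform_simple_process_tendsto(1)[OF prog s \<omega>, of C] left[OF \<omega>]) auto
  qed
  moreover have "tendsto_zero_in_prob M (\<lambda>k \<omega>. ennreal \<bar>simple_integral B (Suc k) (?t k) (?h k) \<omega> - Y \<omega>\<bar>)"
  proof (rule tendsto_zero_in_prob_bound[OF _ _ _ tendsto_zero_in_prob_add[OF _ _ _ lim]])
    show "tendsto_zero_in_prob M (\<lambda>k \<omega>. ennreal \<bar>simple_integral B (Suc k) (?t k) (?h k) \<omega> - ?R k \<omega>\<bar>)"
    proof (rule tendsto_zero_in_prob_AE, measurable, rule AE_I2)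
      fix \<omega> assume \<omega>: "\<omega> \<in> space M"
      from bnd[OF \<omega>] obtain C where C: "\<forall>r\<in>{0..s}. \<bar>H r \<omega>\<bar> \<le> C" ..
      have "\<forall>\<^sub>F k in sequentially. C \<le> real k"
        by (rule eventually_ge_at_top[THEN filterlim_real_sequentially[unfolded filterlim_iff, rule_format]])
      then have "\<forall>\<^sub>F k in sequentially. ennreal \<bar>simple_integral B (Suc k) (?t k) (?h k) \<omega> - ?R k \<omega>\<bar> = 0"
      proof eventually_elim
        fix k :: nat assume k: "C \<le> real k"
        have "simple_integral B (Suc k) (?t k) (?h k) \<omega> = ?R k \<omega>"
          unfolding simple_integral_def
        proof (rule sum.cong[OF refl])
          fix i assume "i \<in> {..<Suc k}"
          then have "\<bar>H (?t k i) \<omega>\<bar> \<le> real k" using C tin[of i k] k by fastforce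
          then show "?h k i \<omega> * (B (?t k (Suc i)) \<omega> - B (?t k i) \<omega>) = H (?t k i) \<omega> * (B (?t k (Suc i)) \<omega> - B (?t k i) \<omega>)"
            by (simp add: clip_id)
        qed
        then show "ennreal \<bar>simple_integral B (Suc k) (?t k) (?h k) \<omega> - ?R k \<omega>\<bar> = 0" by simp
      qed
      then show "(\<lambda>k. ennreal \<bar>simple_integral B (Suc k) (?t k) (?h k) \<omega> - ?R k \<omega>\<bar>) \<longlonglongrightarrow> 0"
        by (rule tendsto_eventually)
    qed
    fix k show "AE \<omega> in M. ennreal \<bar>simple_integral B (Suc k) (?t k) (?h k) \<omega> - Y \<omega>\<bar>
      \<le> ennreal \<bar>simple_integral B (Suc k) (?t k) (?h k) \<omega> - ?R k \<omega>\<bar> + ennreal \<bar>?R k \<omega> - Y \<omega>\<bar>"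
      by (intro AE_I2) (simp add: ennreal_leI flip: ennreal_plus)
  qed measurable
  ultimately show ?thesis
    using prog Y S unfolding has_ito_integral_def
    by (intro conjI exI[of _ Suc] exI[of _ ?t] exI[of _ ?h]) auto
qed

end

section \<open>Pathwise expansion of the state along grids\<close>

lemma continuous_on_Icc_bounded:
  fixes f :: "real \<Rightarrow> real"
  assumes "continuous_on {a..b} f"
  shows "\<exists>C. \<forall>r\<in>{a..b}. \<bar>f r\<bar> \<le> C"
  using compact_imp_bounded[OF compact_continuous_image[OF assms compact_Icc]] by (auto simp: bounded_iff)

lemma set_integrable_continuous_mult:
  fixes f c :: "real \<Rightarrow> real"
  assumes c: "continuous_on {a..b} c" and f: "set_integrable lborel {a..b} f"
  shows "set_integrable lborel {a..b} (\<lambda>r. c r * f r)"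
proof -
  obtain C where C: "\<And>r. r \<in> {a..b} \<Longrightarrow> \<bar>c r\<bar> \<le> C"
    using continuous_on_Icc_bounded[OF c] by blast
  have eq: "indicator {a..b} r *\<^sub>R (c r * f r) = (indicator {a..b} r *\<^sub>R c r) * (indicator {a..b} r *\<^sub>R f r)" for r
    by (simp add: indicator_def)
  have cm: "(\<lambda>r. indicator {a..b} r *\<^sub>R c r) \<in> borel_measurable lborel"
    using borel_measurable_continuous_on_indicator[OF _ c] by simp
  show ?thesis
    unfolding set_integrable_def eq
  proof (rule Bochner_Integration.integrable_bound[OF integrable_mult_right[OF f[unfolded set_integrable_def], of C]])
    show "(\<lambda>r. (indicator {a..b} r *\<^sub>R c r) * (indicator {a..b} r *\<^sub>R f r)) \<in> borel_measurable lborel"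
      by (intro borel_measurable_times cm borel_measurable_integrable f[unfolded set_integrable_def])
    show "AE r in lborel. norm ((indicator {a..b} r *\<^sub>R c r) * (indicator {a..b} r *\<^sub>R f r)) \<le> norm (C * (indicator {a..b} r *\<^sub>R f r))"
    proof (rule AE_I2)
      fix r show "norm ((indicator {a..b} r *\<^sub>R c r) * (indicator {a..b} r *\<^sub>R f r)) \<le> norm (C * (indicator {a..b} r *\<^sub>R f r))"
        using C[of r] by (cases "r \<in> {a..b}") (auto simp: abs_mult intro!: mult_right_mono)
    qed
  qed
qed

text \<open>
  Weighted integrals over the intervals of a grid, written as a single integral of a step function so that
  dominated convergence becomes available.
\<close>

lemma sum_grid_integral:
  fixes f :: "real \<Rightarrow> real"
  assumes s: "0 \<le> s" and f: "set_integrable lborel {0..s} f"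
  shows "(\<Sum>i<Suc k. a i * (LBINT r:{s * real i / real (Suc k)..s * real (Suc i) / real (Suc k)}. f r)) =
    (LBINT r:{0..s}. (\<Sum>i<Suc k. a i * indicator {s * real i / real (Suc k)<..s * real (Suc i) / real (Suc k)} r) * f r)"
proof -
  let ?I = "\<lambda>i. {s * real i / real (Suc k)<..s * real (Suc i) / real (Suc k)}"
  have sub: "?I i \<subseteq> {0..s}" if "i < Suc k" for i
    using grid_point_mem[OF s, of i k] grid_point_mem[OF s, of "Suc i" k] that by auto
  have int: "integrable lborel (\<lambda>r. a i * (indicator (?I i) r * f r))" if "i < Suc k" for i
    using set_integrable_subset[OF f _ sub[OF that]] by (auto simp: set_integrable_def)
  have "(LBINT r:{s * real i / real (Suc k)..s * real (Suc i) / real (Suc k)}. f r) = (\<integral>r. indicator (?I i) r * f r \<partial>lborel)"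
    if "i < Suc k" for i
  proof -
    have ne: "AE r in lborel. r \<noteq> s * real i / real (Suc k)" by (rule AE_lborel_singleton)
    show ?thesis unfolding set_lebesgue_integral_def real_scaleR_def
    proof (intro integral_cong_AE)
      have sub': "{s * real i / real (Suc k)..s * real (Suc i) / real (Suc k)} \<subseteq> {0..s}"
        using grid_point_mem[OF s, of i k] grid_point_mem[OF s, of "Suc i" k] that by auto
      show "(\<lambda>r. indicator {s * real i / real (Suc k)..s * real (Suc i) / real (Suc k)} r * f r) \<in> borel_measurable lborel"
        using borel_measurable_integrable[OF set_integrable_subset[OF f _ sub', unfolded set_integrable_def]] by simp
      show "(\<lambda>r. indicator (?I i) r * f r) \<in> borel_measurable lborel"
        using borel_measurable_integrable[OF set_integrable_subset[OF f _ sub[OF that], unfolded set_integrable_def]] by simp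
      show "AE r in lborel. indicator {s * real i / real (Suc k)..s * real (Suc i) / real (Suc k)} r * f r
          = indicator (?I i) r * f r"
        using ne by eventually_elim (auto simp: indicator_def)
    qed
  qed
  then have "(\<Sum>i<Suc k. a i * (LBINT r:{s * real i / real (Suc k)..s * real (Suc i) / real (Suc k)}. f r))
      = (\<Sum>i<Suc k. \<integral>r. a i * (indicator (?I i) r * f r) \<partial>lborel)"
    by (intro sum.cong) auto
  also have "\<dots> = (\<integral>r. (\<Sum>i<Suc k. a i * (indicator (?I i) r * f r)) \<partial>lborel)"
    by (rule Bochner_Integration.integral_sum[symmetric]) (use int in auto)
  also have "\<dots> = (LBINT r:{0..s}. (\<Sum>i<Suc k. a i * indicator (?I i) r) * f r)"
    unfolding set_lebesgue_integral_def
  proof (rule Bochner_Integration.integral_cong[OF refl])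
    fix r
    have "(\<Sum>i<Suc k. a i * (indicator (?I i) r * f r)) = (\<Sum>i<Suc k. indicator {0..s} r * (a i * indicator (?I i) r * f r))"
    proof (rule sum.cong[OF refl])
      fix i assume "i \<in> {..<Suc k}"
      then have "r \<in> ?I i \<Longrightarrow> r \<in> {0..s}" using sub[of i] by blast
      then show "a i * (indicator (?I i) r * f r) = indicator {0..s} r * (a i * indicator (?I i) r * f r)"
        by (cases "r \<in> ?I i") (simp_all add: indicator_def)
    qed
    also have "\<dots> = indicator {0..s} r *\<^sub>R ((\<Sum>i<Suc k. a i * indicator (?I i) r) * f r)"
      by (simp only: sum_distrib_left sum_distrib_right real_scaleR_def)
    finally show "(\<Sum>i<Suc k. a i * (indicator (?I i) r * f r)) = indicator {0..s} r *\<^sub>R ((\<Sum>i<Suc k. a i * indicator (?I i) r) * f r)" .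
  qed
  finally show ?thesis .
qed

lemma grid_integral_tendsto:
  fixes f g :: "real \<Rightarrow> real" and G :: "nat \<Rightarrow> real \<Rightarrow> real"
  assumes s: "0 < s" and f: "set_integrable lborel {0..s} f" and g: "continuous_on {0..s} g"
    and bnd: "\<And>k i. i < Suc k \<Longrightarrow> \<bar>G k (s * real i / real (Suc k))\<bar> \<le> C"
    and lim: "\<And>r. 0 < r \<Longrightarrow> r \<le> s \<Longrightarrow> (\<lambda>k. G k (grid_left s (Suc k) r)) \<longlonglongrightarrow> g r"
  shows "(\<lambda>k. \<Sum>i<Suc k. G k (s * real i / real (Suc k)) *
      (LBINT r:{s * real i / real (Suc k)..s * real (Suc i) / real (Suc k)}. f r)) \<longlonglongrightarrow> (LBINT r:{0..s}. g r * f r)"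
proof -
  let ?S = "\<lambda>k r. \<Sum>i<Suc k. G k (s * real i / real (Suc k)) * indicator {s * real i / real (Suc k)<..s * real (Suc i) / real (Suc k)} r"
  have C: "0 \<le> C" using bnd[of 0 0] by simp
  have S: "?S k r = G k (grid_left s (Suc k) r)" if "0 < r" "r \<le> s" for k r
    using sum_grid_indicator[OF that, of "Suc k" "G k"] by simp
  have Sm: "?S k \<in> borel_measurable lborel" for k
    by (intro borel_measurable_sum borel_measurable_times borel_measurable_const borel_measurable_indicator) simp
  have fm: "(\<lambda>r. indicator {0..s} r *\<^sub>R f r) \<in> borel_measurable lborel"
    by (rule borel_measurable_integrable[OF f[unfolded set_integrable_def]])
  have gm: "(\<lambda>r. indicator {0..s} r *\<^sub>R g r) \<in> borel_measurable lborel"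
    using borel_measurable_continuous_on_indicator[OF _ g] by simp
  have eq: "indicator {0..s} r *\<^sub>R (x * f r) = x * (indicator {0..s} r *\<^sub>R f r)" for x r by simp
  have eqg: "indicator {0..s} r *\<^sub>R (g r * f r) = (indicator {0..s} r *\<^sub>R g r) * (indicator {0..s} r *\<^sub>R f r)" for r
    by (simp add: indicator_def)
  have bS: "\<bar>?S k r\<bar> \<le> C" if r: "r \<in> {0..s}" for k r
  proof (cases "r = 0")
    case True
    have "?S k 0 = 0" by (rule sum_grid_indicator_0) (use s in simp)
    then show ?thesis using C True by (simp del: sum.lessThan_Suc)
  next
    case False
    then have r': "0 < r" "r \<le> s" using r by auto
    obtain i where "i < Suc k" "grid_left s (Suc k) r = s * real i / real (Suc k)"
      using grid_left_bounds(4)[OF r', of "Suc k"] by auto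
    then show ?thesis unfolding S[OF r'] using bnd by simp
  qed
  have "(\<lambda>k. LBINT r:{0..s}. ?S k r * f r) \<longlonglongrightarrow> (LBINT r:{0..s}. g r * f r)"
    unfolding set_lebesgue_integral_def
  proof (rule integral_dominated_convergence[where w = "\<lambda>r. C * \<bar>indicator {0..s} r *\<^sub>R f r\<bar>"])
    show "(\<lambda>r. indicator {0..s} r *\<^sub>R (g r * f r)) \<in> borel_measurable lborel"
      unfolding eqg by (intro borel_measurable_times gm fm)
    show "(\<lambda>r. indicator {0..s} r *\<^sub>R (?S k r * f r)) \<in> borel_measurable lborel" for k
      unfolding eq by (intro borel_measurable_times Sm fm)
    show "integrable lborel (\<lambda>r. C * \<bar>indicator {0..s} r *\<^sub>R f r\<bar>)"
      by (intro integrable_mult_right integrable_abs f[unfolded set_integrable_def])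
    have "AE r in lborel. r \<noteq> (0::real)" by (rule AE_lborel_singleton)
    then show "AE r in lborel. (\<lambda>k. indicator {0..s} r *\<^sub>R (?S k r * f r)) \<longlonglongrightarrow> indicator {0..s} r *\<^sub>R (g r * f r)"
    proof eventually_elim
      fix r :: real assume "r \<noteq> 0"
      show "(\<lambda>k. indicator {0..s} r *\<^sub>R (?S k r * f r)) \<longlonglongrightarrow> indicator {0..s} r *\<^sub>R (g r * f r)"
      proof (cases "r \<in> {0..s}")
        case True
        then have r: "0 < r" "r \<le> s" using \<open>r \<noteq> 0\<close> by auto
        show ?thesis unfolding S[OF r] by (intro tendsto_intros lim r)
      qed simp
    qed
    show "AE r in lborel. norm (indicator {0..s} r *\<^sub>R (?S k r * f r)) \<le> C * \<bar>indicator {0..s} r *\<^sub>R f r\<bar>" for k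
    proof (rule AE_I2)
      fix r show "norm (indicator {0..s} r *\<^sub>R (?S k r * f r)) \<le> C * \<bar>indicator {0..s} r *\<^sub>R f r\<bar>"
        using bS[of r k] by (cases "r \<in> {0..s}") (auto simp: abs_mult intro!: mult_right_mono)
    qed
  qed
  then show ?thesis using s by (simp only: sum_grid_integral[OF less_imp_le[OF s] f])
qed

lemma difference_quotient_seq:
  fixes f :: "real \<Rightarrow> real"
  assumes "DERIV f 0 :> D" and s: "s \<noteq> 0"
  shows "(\<lambda>k. (f (s / real (Suc k)) - f 0) / (s / real (Suc k))) \<longlonglongrightarrow> D"
proof -
  have "(\<lambda>k. s * inverse (real (Suc k))) \<longlonglongrightarrow> s * 0"
    by (intro tendsto_intros LIMSEQ_inverse_real_of_nat)
  then have "filterlim (\<lambda>k. s / real (Suc k)) (at 0) sequentially"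
    using s by (auto simp: filterlim_at divide_inverse)
  moreover have "((\<lambda>h. (f h - f 0) / h) \<longlongrightarrow> D) (at 0)" using assms(1) by (simp add: DERIV_def)
  ultimately show ?thesis by (rule filterlim_compose[rotated])
qed

text \<open>
  Pathwise part of the verification that \<open>X = e V\<close> solves the state equation, for a fixed path \<open>b\<close>. On a grid
  interval of length \<open>\<Delta>\<close>, writing \<open>\<Delta>b\<close> for the increment of \<open>b\<close>, \<open>J\<close> for the increment of \<open>V\<close> and \<open>e'\<close>, \<open>X'\<close> for the
  values at the right end,
  \<open>X' - X = X \<sigma> \<Delta>b + X (exp (\<sigma> \<Delta>b - \<kappa> \<Delta>) - exp (- \<delta> \<Delta>) - \<sigma> \<Delta>b) + X (exp (- \<delta> \<Delta>) - 1) + e' J\<close>.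
  The sums of the last two terms are Riemann sums of \<open>- \<delta> X\<close> and of \<open>u\<close>. The sum of the second term
  is kept here; for Brownian paths it is small by orthogonality, not path by path.
\<close>

lemma linear_state_grid_expansion:
  fixes b u e V X :: "real \<Rightarrow> real" and \<sigma> \<delta> \<kappa> s x :: real
  assumes s: "0 < s" and b: "continuous_on {0..s} b" and u: "set_integrable lborel {0..s} u"
  defines "e \<equiv> \<lambda>r. exp (\<sigma> * b r - \<kappa> * r)"
  defines "V \<equiv> \<lambda>r. x + (LBINT q:{0..r}. u q / e q)"
  defines "X \<equiv> \<lambda>r. e r * V r"
  defines "t \<equiv> \<lambda>k i. s * real i / real (Suc k)"
  shows "(\<lambda>k. (\<Sum>i<Suc k. \<sigma> * X (t k i) * (b (t k (Suc i)) - b (t k i)))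
      + (\<Sum>i<Suc k. X (t k i) * (exp (\<sigma> * (b (t k (Suc i)) - b (t k i)) - \<kappa> * (s / real (Suc k)))
           - exp (- \<delta> * (s / real (Suc k))) - \<sigma> * (b (t k (Suc i)) - b (t k i)))))
    \<longlonglongrightarrow> X s - X 0 - (LBINT r:{0..s}. - \<delta> * X r + u r)"
    and "continuous_on {0..s} X"
proof -
  have e: "continuous_on {0..s} e" unfolding e_def by (intro continuous_intros b)
  have e_pos: "0 < e r" for r by (simp add: e_def)
  have ue: "set_integrable lborel {0..s} (\<lambda>q. u q / e q)"
  proof -
    have "continuous_on {0..s} (\<lambda>r. 1 / e r)"
      by (intro continuous_intros e) (use e_pos less_imp_neq in metis)
    from set_integrable_continuous_mult[OF this u] show ?thesis by simp
  qed
  have sub_int: "set_integrable lborel A (\<lambda>q. u q / e q)" if "A \<subseteq> {0..s}" "A \<in> sets lborel" for A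
    by (rule set_integrable_subset[OF ue that(2,1)])
  have V: "continuous_on {0..s} V"
  proof -
    have "continuous_on {0..s} (\<lambda>r. x + integral {0..r} (\<lambda>q. u q / e q))"
      by (intro continuous_intros indefinite_integral_continuous_1 set_borel_integral_eq_integral(1) ue)
    moreover have "V r = x + integral {0..r} (\<lambda>q. u q / e q)" if "r \<in> {0..s}" for r
      unfolding V_def using that by (subst set_borel_integral_eq_integral(2)) (auto intro!: sub_int)
    ultimately show ?thesis by (subst continuous_on_cong) auto
  qed
  show X: "continuous_on {0..s} X" unfolding X_def by (intro continuous_intros e V)
  have tm: "t k i \<in> {0..s}" if "i \<le> Suc k" for k i unfolding t_def by (rule grid_point_mem) (use s that in auto)
  have t_mono: "t k i \<le> t k (Suc i)" for k i unfolding t_def using s by (intro divide_right_mono mult_left_mono) auto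
  have t_step: "t k (Suc i) - t k i = s / real (Suc k)" for k i
    unfolding t_def by (simp add: diff_divide_distrib[symmetric] algebra_simps)
  have t_step': "t k (Suc i) = t k i + s / real (Suc k)" for k i using t_step[of k i] by simp
  have t_ends: "t k 0 = 0" "t k (Suc k) = s" for k unfolding t_def by (auto simp del: of_nat_Suc)
  let ?J = "\<lambda>k i. LBINT r:{t k i..t k (Suc i)}. u r / e r"
  have V_step: "V (t k (Suc i)) = V (t k i) + ?J k i" if i: "i < Suc k" for k i
  proof -
    have sp: "{0..t k (Suc i)} = {0..t k i} \<union> {t k i<..t k (Suc i)}" using t_mono[of k i] tm[of i k] i by auto
    have "(LBINT q:{0..t k (Suc i)}. u q / e q) = (LBINT q:{0..t k i}. u q / e q) + (LBINT q:{t k i<..t k (Suc i)}. u q / e q)"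
      unfolding sp by (rule set_integral_Un) (use tm[of i k] tm[of "Suc i" k] i in \<open>auto intro!: sub_int\<close>)
    moreover have "(LBINT q:{t k i<..t k (Suc i)}. u q / e q) = ?J k i"
    proof -
      have ne: "AE q in lborel. q \<noteq> t k i" by (rule AE_lborel_singleton)
      show ?thesis unfolding set_lebesgue_integral_def
      proof (intro integral_cong_AE)
        show "(\<lambda>q. indicator {t k i<..t k (Suc i)} q *\<^sub>R (u q / e q)) \<in> borel_measurable lborel"
          "(\<lambda>q. indicator {t k i..t k (Suc i)} q *\<^sub>R (u q / e q)) \<in> borel_measurable lborel"
          using tm[of i k] tm[of "Suc i" k] i
          by (intro borel_measurable_integrable[OF sub_int[unfolded set_integrable_def]]; auto)+
        show "AE q in lborel. indicator {t k i<..t k (Suc i)} q *\<^sub>R (u q / e q) = indicator {t k i..t k (Suc i)} q *\<^sub>R (u q / e q)"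
          using ne by eventually_elim (auto simp: indicator_def)
      qed
    qed
    ultimately show ?thesis by (simp add: V_def)
  qed
  let ?\<Delta> = "\<lambda>k. s / real (Suc k)"
  let ?g = "\<lambda>k y. exp (\<sigma> * y - \<kappa> * ?\<Delta> k) - exp (- \<delta> * ?\<Delta> k) - \<sigma> * y"
  let ?b = "\<lambda>k i. b (t k (Suc i)) - b (t k i)"
  have e_step: "e (t k (Suc i)) = e (t k i) * exp (\<sigma> * ?b k i - \<kappa> * ?\<Delta> k)" for k i
    unfolding e_def exp_add[symmetric] t_step[symmetric, of k i] by (simp add: algebra_simps)
  have X_step: "\<sigma> * X (t k i) * ?b k i + X (t k i) * ?g k (?b k i)
     = (X (t k (Suc i)) - X (t k i)) - ((exp (- \<delta> * ?\<Delta> k) - 1) * X (t k i) + e (t k (Suc i)) * ?J k i)"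
    if i: "i < Suc k" for k i
    unfolding X_def V_step[OF i] e_step by (simp add: algebra_simps)
  have one: "(LBINT r:{t k i..t k (Suc i)}. 1) = ?\<Delta> k" for k i
    using t_mono[of k i] t_step[of k i] by (simp add: set_lebesgue_integral_def)
  have eq: "(\<Sum>i<Suc k. \<sigma> * X (t k i) * ?b k i) + (\<Sum>i<Suc k. X (t k i) * ?g k (?b k i))
     = (X s - X 0) - ((exp (- \<delta> * ?\<Delta> k) - exp (- \<delta> * 0)) / ?\<Delta> k * (\<Sum>i<Suc k. X (t k i) * (LBINT r:{t k i..t k (Suc i)}. 1))
        + (\<Sum>i<Suc k. e (t k i + ?\<Delta> k) * ?J k i))" for k
  proof -
    have "(\<Sum>i<Suc k. \<sigma> * X (t k i) * ?b k i) + (\<Sum>i<Suc k. X (t k i) * ?g k (?b k i))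
      = (\<Sum>i<Suc k. (X (t k (Suc i)) - X (t k i)) - ((exp (- \<delta> * ?\<Delta> k) - 1) * X (t k i) + e (t k (Suc i)) * ?J k i))"
      unfolding sum.distrib[symmetric] by (rule sum.cong[OF refl]) (use X_step in auto)
    also have "\<dots> = (\<Sum>i<Suc k. X (t k (Suc i)) - X (t k i)) - ((exp (- \<delta> * ?\<Delta> k) - 1) * (\<Sum>i<Suc k. X (t k i))
        + (\<Sum>i<Suc k. e (t k (Suc i)) * ?J k i))"
      by (simp only: sum_subtractf sum.distrib sum_distrib_left)
    also have "(\<Sum>i<Suc k. X (t k (Suc i)) - X (t k i)) = X s - X 0"
      using sum_lessThan_telescope[of "\<lambda>i. X (t k i)" "Suc k"] by (simp only: t_ends)
    also have "(exp (- \<delta> * ?\<Delta> k) - 1) * (\<Sum>i<Suc k. X (t k i))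
       = (exp (- \<delta> * ?\<Delta> k) - exp (- \<delta> * 0)) / ?\<Delta> k * (\<Sum>i<Suc k. X (t k i) * (LBINT r:{t k i..t k (Suc i)}. 1))"
      unfolding one sum_distrib_right[symmetric] using s by (simp del: of_nat_Suc sum.lessThan_Suc)
    also have "(\<Sum>i<Suc k. e (t k (Suc i)) * ?J k i) = (\<Sum>i<Suc k. e (t k i + ?\<Delta> k) * ?J k i)"
      by (simp only: t_step'[symmetric])
    finally show ?thesis .
  qed
  obtain CX where CX: "\<And>r. r \<in> {0..s} \<Longrightarrow> \<bar>X r\<bar> \<le> CX"
    using continuous_on_Icc_bounded[OF X] by blast
  obtain Ce where Ce: "\<And>r. r \<in> {0..s} \<Longrightarrow> \<bar>e r\<bar> \<le> Ce"
    using continuous_on_Icc_bounded[OF e] by blast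
  have gl_lim: "(\<lambda>k. grid_left s (Suc k) r) \<longlonglongrightarrow> r" if "0 < r" "r \<le> s" for r
    using filterlim_grid_left[OF that] by (simp add: filterlim_at)
  have gl_in: "grid_left s (Suc k) r \<in> {0..s}" "grid_left s (Suc k) r + ?\<Delta> k \<in> {0..s}" if r: "0 < r" "r \<le> s" for r k
  proof -
    obtain i where i: "i < Suc k" "grid_left s (Suc k) r = t k i"
      using grid_left_bounds(4)[OF r, of "Suc k"] unfolding t_def by auto
    have "t k i + ?\<Delta> k = t k (Suc i)" using t_step[of k i] by simp
    then show "grid_left s (Suc k) r \<in> {0..s}" "grid_left s (Suc k) r + ?\<Delta> k \<in> {0..s}"
      using tm[of i k] tm[of "Suc i" k] i by auto
  qed
  have \<Delta>_lim: "?\<Delta> \<longlonglongrightarrow> 0"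
  proof -
    have "(\<lambda>k. s * inverse (real (Suc k))) \<longlonglongrightarrow> s * 0" by (intro tendsto_intros LIMSEQ_inverse_real_of_nat)
    then show ?thesis by (simp add: divide_inverse)
  qed
  have A: "(\<lambda>k. \<Sum>i<Suc k. X (t k i) * (LBINT r:{t k i..t k (Suc i)}. 1)) \<longlonglongrightarrow> (LBINT r:{0..s}. X r * 1)"
    unfolding t_def
  proof (rule grid_integral_tendsto[where G = "\<lambda>_. X" and C = CX, OF s _ X])
    show "set_integrable lborel {0..s} (\<lambda>r. 1::real)" by (rule borel_integrable_atLeastAtMost'[OF continuous_on_const])
    show "\<bar>X (s * real i / real (Suc k))\<bar> \<le> CX" if "i < Suc k" for k i
      using CX[OF tm, of i k] that unfolding t_def by simp
    show "(\<lambda>k. X (grid_left s (Suc k) r)) \<longlonglongrightarrow> X r" if "0 < r" "r \<le> s" for r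
      by (rule continuous_on_tendsto_compose[OF X gl_lim]) (use that gl_in in auto)
  qed
  have "(\<lambda>k. \<Sum>i<Suc k. e (t k i + ?\<Delta> k) * ?J k i) \<longlonglongrightarrow> (LBINT r:{0..s}. e r * (u r / e r))"
    unfolding t_def
  proof (rule grid_integral_tendsto[where G = "\<lambda>k r. e (r + ?\<Delta> k)" and C = Ce, OF s ue e])
    show "\<bar>e (s * real i / real (Suc k) + ?\<Delta> k)\<bar> \<le> Ce" if "i < Suc k" for k i
      using Ce[OF tm, of "Suc i" k] t_step[of k i] that unfolding t_def by (simp add: algebra_simps)
    show "(\<lambda>k. e (grid_left s (Suc k) r + ?\<Delta> k)) \<longlonglongrightarrow> e r" if r: "0 < r" "r \<le> s" for r
    proof (rule continuous_on_tendsto_compose[OF e])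
      show "(\<lambda>k. grid_left s (Suc k) r + ?\<Delta> k) \<longlonglongrightarrow> r" using tendsto_add[OF gl_lim[OF r] \<Delta>_lim] by simp
    qed (use r gl_in in auto)
  qed
  moreover have "e r * (u r / e r) = u r" for r using e_pos[of r] by simp
  ultimately have B: "(\<lambda>k. \<Sum>i<Suc k. e (t k i + ?\<Delta> k) * ?J k i) \<longlonglongrightarrow> (LBINT r:{0..s}. u r)" by simp
  have D: "(\<lambda>k. (exp (- \<delta> * ?\<Delta> k) - exp (- \<delta> * 0)) / ?\<Delta> k) \<longlonglongrightarrow> - \<delta>"
    by (rule difference_quotient_seq) (use s in \<open>auto intro!: derivative_eq_intros\<close>)
  have "(\<lambda>k. (X s - X 0) - ((exp (- \<delta> * ?\<Delta> k) - exp (- \<delta> * 0)) / ?\<Delta> k * (\<Sum>i<Suc k. X (t k i) * (LBINT r:{t k i..t k (Suc i)}. 1))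
        + (\<Sum>i<Suc k. e (t k i + ?\<Delta> k) * ?J k i)))
     \<longlonglongrightarrow> (X s - X 0) - (- \<delta> * (LBINT r:{0..s}. X r * 1) + (LBINT r:{0..s}. u r))"
    by (intro tendsto_intros A B D)
  moreover have "- \<delta> * (LBINT r:{0..s}. X r * 1) + (LBINT r:{0..s}. u r) = (LBINT r:{0..s}. - \<delta> * X r + u r)"
  proof -
    have "set_integrable lborel {0..s} (\<lambda>r. - \<delta> * X r)"
      by (intro set_integrable_mult_right borel_integrable_atLeastAtMost' X) 
    then have "(LBINT r:{0..s}. - \<delta> * X r + u r) = (LBINT r:{0..s}. - \<delta> * X r) + (LBINT r:{0..s}. u r)"
      by (rule set_integral_add(2)[OF _ u])
    also have "(LBINT r:{0..s}. - \<delta> * X r) = - \<delta> * (LBINT r:{0..s}. X r)" by (rule set_integral_mult_right)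
    finally show ?thesis by simp
  qed
  ultimately show "(\<lambda>k. (\<Sum>i<Suc k. \<sigma> * X (t k i) * ?b k i) + (\<Sum>i<Suc k. X (t k i) * ?g k (?b k i)))
    \<longlonglongrightarrow> X s - X 0 - (LBINT r:{0..s}. - \<delta> * X r + u r)"
    unfolding eq by simp
qed

section \<open>Linearising the stochastic exponential\<close>

text \<open>
  Only countably many times matter for a bound on a continuous path.
\<close>

lemma path_bounded_iff_grid:
  fixes x :: "real \<Rightarrow> real"
  assumes t: "0 \<le> t" and cont: "continuous_on {0..t} x"
  shows "(\<forall>r\<in>{0..t}. \<bar>x r\<bar> \<le> C) \<longleftrightarrow> (\<forall>k. \<forall>i\<in>{..Suc k}. \<bar>x (t * real i / real (Suc k))\<bar> \<le> C)"
proof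
  assume "\<forall>r\<in>{0..t}. \<bar>x r\<bar> \<le> C"
  then show "\<forall>k. \<forall>i\<in>{..Suc k}. \<bar>x (t * real i / real (Suc k))\<bar> \<le> C"
    using grid_point_mem[OF t] by blast
next
  assume *: "\<forall>k. \<forall>i\<in>{..Suc k}. \<bar>x (t * real i / real (Suc k))\<bar> \<le> C"
  show "\<forall>r\<in>{0..t}. \<bar>x r\<bar> \<le> C"
  proof
    fix r assume r: "r \<in> {0..t}"
    show "\<bar>x r\<bar> \<le> C"
    proof (cases "r = 0")
      case True
      then show ?thesis using *[rule_format, of 0 0] by simp
    next
      case False
      then have r': "0 < r" "r \<le> t" using r by auto
      have gl: "\<exists>i<Suc k. grid_left t (Suc k) r = t * real i / real (Suc k)" for k
        using grid_left_bounds(4)[OF r', of "Suc k"] by auto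
      have "(\<lambda>k. grid_left t (Suc k) r) \<longlonglongrightarrow> r" using filterlim_grid_left[OF r'] by (simp add: filterlim_at)
      moreover have "grid_left t (Suc k) r \<in> {0..t}" for k using gl[of k] grid_point_mem[OF t] by force
      ultimately have "(\<lambda>k. x (grid_left t (Suc k) r)) \<longlonglongrightarrow> x r"
        by (intro continuous_on_tendsto_compose[OF cont]) (use r in auto)
      then have "(\<lambda>k. \<bar>x (grid_left t (Suc k) r)\<bar>) \<longlonglongrightarrow> \<bar>x r\<bar>" by (rule tendsto_rabs)
      moreover have "\<bar>x (grid_left t (Suc k) r)\<bar> \<le> C" for k
      proof -
        obtain i where "i < Suc k" "grid_left t (Suc k) r = t * real i / real (Suc k)" using gl by blast
        then show ?thesis using *[rule_format, of i k] by simp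
      qed
      ultimately show ?thesis by (intro LIMSEQ_le_const2) auto
    qed
  qed
qed

lemma (in prob_space) tendsto_zero_in_prob_sqrt:
  fixes Z :: "nat \<Rightarrow> 'a \<Rightarrow> real"
  assumes "tendsto_zero_in_prob M (\<lambda>k \<omega>. ennreal ((Z k \<omega>)\<^sup>2))"
  shows "tendsto_zero_in_prob M (\<lambda>k \<omega>. ennreal \<bar>Z k \<omega>\<bar>)"
proof (rule tendsto_zero_in_probI)
  fix \<epsilon> :: real assume \<epsilon>: "0 < \<epsilon>"
  have "ennreal \<epsilon> < ennreal \<bar>z\<bar> \<longleftrightarrow> ennreal (\<epsilon>\<^sup>2) < ennreal (z\<^sup>2)" for z
    using \<epsilon> abs_le_square_iff[of z \<epsilon>] by (simp add: ennreal_less_iff not_le[symmetric])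
  then show "(\<lambda>k. prob {\<omega> \<in> space M. ennreal \<epsilon> < ennreal \<bar>Z k \<omega>\<bar>}) \<longlonglongrightarrow> 0"
    using tendsto_zero_in_probD[OF assms, of "\<epsilon>\<^sup>2"] \<epsilon> by simp
qed

context brownian_motion
begin

lemma path_bounded_event:
  fixes X :: "real \<Rightarrow> 'a \<Rightarrow> real"
  assumes t: "0 \<le> t" and adapted: "\<And>q. q \<in> {0..t} \<Longrightarrow> X q \<in> borel_measurable (F t)"
    and cont: "\<And>\<omega>. \<omega> \<in> space M \<Longrightarrow> continuous_on {0..t} (\<lambda>q. X q \<omega>)"
  shows "{\<omega> \<in> space M. \<forall>r\<in>{0..t}. \<bar>X r \<omega>\<bar> \<le> C} \<in> sets (F t)"
proof -
  have "{\<omega> \<in> space M. \<forall>r\<in>{0..t}. \<bar>X r \<omega>\<bar> \<le> C}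
     = {\<omega> \<in> space (F t). \<forall>k. \<forall>i\<in>{..Suc k}. \<bar>X (t * real i / real (Suc k)) \<omega>\<bar> \<le> C}" (is "_ = ?B")
    unfolding space_F[OF t] by (rule Collect_cong, rule conj_cong[OF refl]) (rule path_bounded_iff_grid[OF t cont])
  also have "?B \<in> sets (F t)"
  proof -
    have "X (t * real i / real (Suc k)) \<in> borel_measurable (F t)" if "i \<in> {..Suc k}" for i k
      by (rule adapted, rule grid_point_mem[OF t]) (use that in auto)
    then have "{\<omega> \<in> space (F t). \<bar>X (t * real i / real (Suc k)) \<omega>\<bar> \<le> C} \<in> sets (F t)" if "i \<in> {..Suc k}" for i k
      by (intro borel_measurable_le borel_measurable_abs borel_measurable_const) (use that in auto)
    then show ?thesis
      by (intro sets.sets_Collect_countable_All sets.sets_Collect_finite_All') auto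
  qed
  finally show ?thesis .
qed

lemma path_bounded_event_prob:
  fixes X :: "real \<Rightarrow> 'a \<Rightarrow> real"
  assumes meas: "\<And>C::nat. {\<omega> \<in> space M. \<forall>r\<in>{0..t}. \<bar>X r \<omega>\<bar> \<le> real C} \<in> events"
    and cont: "\<And>\<omega>. \<omega> \<in> space M \<Longrightarrow> continuous_on {0..t::real} (\<lambda>q. X q \<omega>)" and \<eta>: "0 < \<eta>"
  shows "\<exists>C::nat. prob (space M - {\<omega> \<in> space M. \<forall>r\<in>{0..t}. \<bar>X r \<omega>\<bar> \<le> real C}) \<le> \<eta>"
proof -
  let ?A = "\<lambda>C::nat. {\<omega> \<in> space M. \<forall>r\<in>{0..t}. \<bar>X r \<omega>\<bar> \<le> real C}"
  have "(\<lambda>C. prob (?A C)) \<longlonglongrightarrow> prob (\<Union>C. ?A C)"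
    by (rule finite_Lim_measure_incseq) (use meas in \<open>force simp: incseq_def intro: order_trans\<close>)+
  moreover have "(\<Union>C. ?A C) = space M"
  proof safe
    fix \<omega> assume \<omega>: "\<omega> \<in> space M"
    obtain K where K: "\<forall>r\<in>{0..t}. \<bar>X r \<omega>\<bar> \<le> K" using continuous_on_Icc_bounded[OF cont[OF \<omega>]] by blast
    obtain C :: nat where "K \<le> real C" using real_arch_simple by blast
    then have "\<forall>r\<in>{0..t}. \<bar>X r \<omega>\<bar> \<le> real C" using K order_trans by blast
    then show "\<omega> \<in> (\<Union>C. ?A C)" using \<omega> by blast
  qed
  ultimately have "(\<lambda>C. prob (?A C)) \<longlonglongrightarrow> 1" by (simp add: prob_space)
  from LIMSEQ_D[OF this \<eta>] obtain C where "\<bar>prob (?A C) - 1\<bar> < \<eta>" by auto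
  then show ?thesis using prob_compl[OF meas[of C]] by (intro exI[of _ C]) linarith
qed

text \<open>
  Subtracting \<open>exp (- \<delta> \<Delta>)\<close> rather than \<open>1\<close> makes the error exactly centred. Its variance is \<open>O(\<Delta>\<^sup>2)\<close>.
\<close>

lemma compensated_exponential_moments:
  fixes \<sigma> \<delta> \<Delta> :: real
  assumes p: "0 \<le> p" and q: "q = p + \<Delta>" and \<Delta>: "0 \<le> \<Delta>"
  defines "g \<equiv> \<lambda>y. exp (\<sigma> * y - (\<sigma>\<^sup>2 / 2 + \<delta>) * \<Delta>) - exp (- \<delta> * \<Delta>) - \<sigma> * y"
  shows "integrable M (\<lambda>\<omega>. (g (B q \<omega> - B p \<omega>))\<^sup>2)"
    "expectation (\<lambda>\<omega>. g (B q \<omega> - B p \<omega>)) = 0"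
    "expectation (\<lambda>\<omega>. (g (B q \<omega> - B p \<omega>))\<^sup>2) =
      exp (- 2 * \<delta> * \<Delta>) * (exp (\<sigma>\<^sup>2 * \<Delta>) - 1) - 2 * \<sigma>\<^sup>2 * \<Delta> * exp (- \<delta> * \<Delta>) + \<sigma>\<^sup>2 * \<Delta>"
proof -
  let ?D = "\<lambda>\<omega>. B q \<omega> - B p \<omega>"
  have pq: "p \<le> q" and qp: "q - p = \<Delta>" using q \<Delta> by auto
  note m = increment_moments[OF p pq, unfolded qp]
  define c where "c = exp (- ((\<sigma>\<^sup>2 / 2 + \<delta>) * \<Delta>))"
  define a where "a = exp (- \<delta> * \<Delta>)"
  have g_eq: "g y = c * exp (\<sigma> * y) - a - \<sigma> * y" for y
  proof -
    have "exp (\<sigma> * y - (\<sigma>\<^sup>2 / 2 + \<delta>) * \<Delta>) = c * exp (\<sigma> * y)"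
      unfolding c_def exp_add[symmetric] by simp
    then show ?thesis by (simp add: g_def a_def)
  qed
  have ca: "c * exp (\<sigma>\<^sup>2 * \<Delta> / 2) = a" unfolding c_def a_def exp_add[symmetric] by (simp add: algebra_simps)
  have c2: "c\<^sup>2 * exp ((2 * \<sigma>)\<^sup>2 * \<Delta> / 2) = a\<^sup>2 * exp (\<sigma>\<^sup>2 * \<Delta>)"
    unfolding c_def a_def power2_eq_square exp_add[symmetric] by (simp add: algebra_simps)
  have sq: "(g y)\<^sup>2 = c\<^sup>2 * exp ((2 * \<sigma>) * y) + a\<^sup>2 + \<sigma>\<^sup>2 * y\<^sup>2 - 2 * a * c * exp (\<sigma> * y)
      - 2 * \<sigma> * c * (exp (\<sigma> * y) * y) + 2 * a * \<sigma> * y" for y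
  proof -
    have "exp ((2 * \<sigma>) * y) = (exp (\<sigma> * y))\<^sup>2" by (simp add: power2_eq_square exp_add[symmetric])
    then show ?thesis unfolding g_eq by (simp add: power2_eq_square algebra_simps)
  qed
  show "integrable M (\<lambda>\<omega>. (g (?D \<omega>))\<^sup>2)" unfolding sq using m by auto
  show "expectation (\<lambda>\<omega>. g (?D \<omega>)) = 0" unfolding g_eq using m ca by (simp add: prob_space)
  have "expectation (\<lambda>\<omega>. (g (?D \<omega>))\<^sup>2) = c\<^sup>2 * exp ((2 * \<sigma>)\<^sup>2 * \<Delta> / 2) + a\<^sup>2 + \<sigma>\<^sup>2 * \<Delta>
      - 2 * a * (c * exp (\<sigma>\<^sup>2 * \<Delta> / 2)) - 2 * \<sigma> * (\<sigma> * \<Delta> * (c * exp (\<sigma>\<^sup>2 * \<Delta> / 2)))"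
    unfolding sq using m by (simp add: prob_space)
  also have "\<dots> = a\<^sup>2 * (exp (\<sigma>\<^sup>2 * \<Delta>) - 1) - 2 * \<sigma>\<^sup>2 * \<Delta> * a + \<sigma>\<^sup>2 * \<Delta>"
    unfolding c2 ca by (simp add: power2_eq_square algebra_simps)
  also have "a\<^sup>2 = exp (- 2 * \<delta> * \<Delta>)" unfolding a_def power2_eq_square exp_add[symmetric] by simp
  finally show "expectation (\<lambda>\<omega>. (g (?D \<omega>))\<^sup>2) =
      exp (- 2 * \<delta> * \<Delta>) * (exp (\<sigma>\<^sup>2 * \<Delta>) - 1) - 2 * \<sigma>\<^sup>2 * \<Delta> * exp (- \<delta> * \<Delta>) + \<sigma>\<^sup>2 * \<Delta>"
    by (simp add: a_def)
qed

text \<open>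
  The error committed by linearising the exponential on every interval of a grid. If \<open>X\<close> is bounded by \<open>C\<close> the
  terms are orthogonal, and with \<open>v \<Delta>\<close> the variance on an interval of length \<open>\<Delta>\<close> their sum has second moment at most
  \<open>C\<^sup>2 s v(\<Delta>) / \<Delta>\<close>, which tends to \<open>C\<^sup>2 s v'(0) = 0\<close>. The general case is reduced to this one by truncating
  \<open>X\<close>, which changes nothing on the event that its path stays below \<open>C\<close>.
\<close>

lemma compensated_exponential_sum_tendsto:
  fixes X :: "real \<Rightarrow> 'a \<Rightarrow> real" and \<sigma> \<delta> s :: real
  assumes s: "0 < s" and adapted: "\<And>q. q \<in> {0..s} \<Longrightarrow> X q \<in> borel_measurable (F q)"
    and cont: "\<And>\<omega>. \<omega> \<in> space M \<Longrightarrow> continuous_on {0..s} (\<lambda>q. X q \<omega>)"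
  defines "t \<equiv> \<lambda>k i. s * real i / real (Suc k)"
  defines "g \<equiv> \<lambda>k y. exp (\<sigma> * y - (\<sigma>\<^sup>2 / 2 + \<delta>) * (s / real (Suc k))) - exp (- \<delta> * (s / real (Suc k))) - \<sigma> * y"
  shows "tendsto_zero_in_prob M (\<lambda>k \<omega>. ennreal \<bar>\<Sum>i<Suc k. X (t k i) \<omega> * g k (B (t k (Suc i)) \<omega> - B (t k i) \<omega>)\<bar>)"
proof -
  have tm: "t k i \<in> {0..s}" if "i \<le> Suc k" for k i unfolding t_def by (rule grid_point_mem) (use s that in auto)
  have t_step: "t k (Suc i) = t k i + s / real (Suc k)" for k i
    unfolding t_def by (simp add: add_divide_distrib[symmetric] algebra_simps)
  have t_mono: "t k i \<le> t k (Suc i)" for k i using t_step[of k i] s by simp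
  have gm[measurable]: "g k \<in> borel_measurable borel" for k unfolding g_def by measurable
  have Bm: "B (t k i) \<in> borel_measurable M" if "i \<le> Suc k" for k i using tm[OF that] by (intro measurable_B_M) auto
  have XM: "X (t k i) \<in> borel_measurable M" if "i \<le> Suc k" for k i
    using tm[OF that] by (intro measurable_F_M[OF _ adapted]) auto
  have dm: "(\<lambda>\<omega>. g k (B (t k (Suc i)) \<omega> - B (t k i) \<omega>)) \<in> borel_measurable M" if "i < Suc k" for k i
    by (rule measurable_compose[OF borel_measurable_diff gm]) (use Bm[of i k] Bm[of "Suc i" k] that in auto)
  have clip_lim: "tendsto_zero_in_prob M (\<lambda>k \<omega>. ennreal \<bar>\<Sum>i<Suc k. clip C (X (t k i) \<omega>) * g k (B (t k (Suc i)) \<omega> - B (t k i) \<omega>)\<bar>)"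
    if C: "0 \<le> C" for C
  proof (rule tendsto_zero_in_prob_sqrt, rule tendsto_zero_in_prob_nn_integral)
    let ?S = "\<lambda>k \<omega>. \<Sum>i<Suc k. clip C (X (t k i) \<omega>) * g k (B (t k (Suc i)) \<omega> - B (t k i) \<omega>)"
    define v where "v h = exp (- 2 * \<delta> * h) * (exp (\<sigma>\<^sup>2 * h) - 1) - 2 * \<sigma>\<^sup>2 * h * exp (- \<delta> * h) + \<sigma>\<^sup>2 * h" for h
    have c2: "(clip C x)\<^sup>2 \<le> C\<^sup>2" for x
      using abs_clip_le[OF C, of x] C by (simp add: abs_le_square_iff[symmetric])
    have S2: "integrable M (\<lambda>\<omega>. (?S k \<omega>)\<^sup>2)" "expectation (\<lambda>\<omega>. (?S k \<omega>)\<^sup>2)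
        = (\<Sum>i<Suc k. expectation (\<lambda>\<omega>. (clip C (X (t k i) \<omega>))\<^sup>2) * v (s / real (Suc k)))" for k
    proof -
      have *: "integrable M (\<lambda>\<omega>. (g k (B (t k (Suc i)) \<omega> - B (t k i) \<omega>))\<^sup>2)"
        "expectation (\<lambda>\<omega>. g k (B (t k (Suc i)) \<omega> - B (t k i) \<omega>)) = 0"
        "expectation (\<lambda>\<omega>. (g k (B (t k (Suc i)) \<omega> - B (t k i) \<omega>))\<^sup>2) = v (s / real (Suc k))" if "i < Suc k" for i
        unfolding g_def v_def
        by (rule compensated_exponential_moments[OF _ t_step]; use tm[of i k] that s in simp)+
      have h: "(\<lambda>\<omega>. clip C (X (t k i) \<omega>)) \<in> borel_measurable (F (t k i))" if "i < Suc k" for i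
        by (rule measurable_compose[OF adapted measurable_clip]) (use tm[of i k] that in auto)
      have bdd: "\<exists>K. \<forall>\<omega>\<in>space M. \<bar>clip C (X (t k i) \<omega>)\<bar> \<le> K" for i using abs_clip_le[OF C] by blast
      have t0: "0 \<le> t k 0" by (simp add: t_def)
      show "integrable M (\<lambda>\<omega>. (?S k \<omega>)\<^sup>2)" "expectation (\<lambda>\<omega>. (?S k \<omega>)\<^sup>2)
        = (\<Sum>i<Suc k. expectation (\<lambda>\<omega>. (clip C (X (t k i) \<omega>))\<^sup>2) * v (s / real (Suc k)))"
        using sum_increments_square[where t = "t k" and n = "Suc k" and h = "\<lambda>i \<omega>. clip C (X (t k i) \<omega>)" and f = "\<lambda>_. g k"
            and v = "\<lambda>_. v (s / real (Suc k))", OF t0 t_mono h bdd gm *] by simp_all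
    qed
    show "(\<lambda>\<omega>. ennreal ((?S k \<omega>)\<^sup>2)) \<in> borel_measurable M" for k
      using S2(1)[of k] by (intro measurable_compose[OF _ measurable_ennreal]) auto
    have v0: "0 \<le> v (s / real (Suc k))" for k
    proof -
      have "v (s / real (Suc k)) = expectation (\<lambda>\<omega>. (g k (B (t k (Suc 0)) \<omega> - B (t k 0) \<omega>))\<^sup>2)"
        unfolding g_def v_def by (rule compensated_exponential_moments(3)[symmetric, OF _ t_step]) (use tm[of 0 k] s in auto)
      then show ?thesis by (simp only: integral_nonneg_AE AE_I2 zero_le_power2)
    qed
    have E_le: "expectation (\<lambda>\<omega>. (?S k \<omega>)\<^sup>2) \<le> C\<^sup>2 * s * ((v (s / real (Suc k)) - v 0) / (s / real (Suc k)))" for k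
    proof -
      have "expectation (\<lambda>\<omega>. (?S k \<omega>)\<^sup>2) \<le> (\<Sum>i<Suc k. C\<^sup>2 * v (s / real (Suc k)))"
        unfolding S2(2)
      proof (intro sum_mono mult_right_mono v0)
        fix i assume i: "i \<in> {..<Suc k}"
        have [measurable]: "(\<lambda>\<omega>. clip C (X (t k i) \<omega>)) \<in> borel_measurable M"
          by (rule measurable_compose[OF XM measurable_clip]) (use i in auto)
        have "expectation (\<lambda>\<omega>. (clip C (X (t k i) \<omega>))\<^sup>2) \<le> expectation (\<lambda>\<omega>. C\<^sup>2)"
          by (intro integral_mono integrable_const_bound[where B = "C\<^sup>2"]) (use c2 in auto)
        then show "expectation (\<lambda>\<omega>. (clip C (X (t k i) \<omega>))\<^sup>2) \<le> C\<^sup>2" by (simp add: prob_space)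
      qed
      also have "\<dots> = C\<^sup>2 * s * ((v (s / real (Suc k)) - v 0) / (s / real (Suc k)))"
        using s by (simp add: v_def[of 0] field_simps del: of_nat_Suc)
      finally show ?thesis .
    qed
    have "DERIV v 0 :> 0"
      unfolding v_def by (auto intro!: derivative_eq_intros simp: power2_eq_square)
    from difference_quotient_seq[OF this, of s] s
    have "(\<lambda>k. C\<^sup>2 * s * ((v (s / real (Suc k)) - v 0) / (s / real (Suc k)))) \<longlonglongrightarrow> C\<^sup>2 * s * 0"
      by (intro tendsto_intros) auto
    then have "(\<lambda>k. ennreal (C\<^sup>2 * s * ((v (s / real (Suc k)) - v 0) / (s / real (Suc k))))) \<longlonglongrightarrow> ennreal 0"
      by (intro tendsto_ennrealI) simp
    then have lim: "(\<lambda>k. ennreal (C\<^sup>2 * s * ((v (s / real (Suc k)) - v 0) / (s / real (Suc k))))) \<longlonglongrightarrow> 0"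
      by (simp only: ennreal_0)
    show "(\<lambda>k. \<integral>\<^sup>+\<omega>. ennreal ((?S k \<omega>)\<^sup>2) \<partial>M) \<longlonglongrightarrow> 0"
    proof (rule tendsto_sandwich[OF _ _ tendsto_const lim])
      show "\<forall>\<^sub>F k in sequentially. (\<integral>\<^sup>+\<omega>. ennreal ((?S k \<omega>)\<^sup>2) \<partial>M)
          \<le> ennreal (C\<^sup>2 * s * ((v (s / real (Suc k)) - v 0) / (s / real (Suc k))))"
      proof (intro always_eventually allI)
        fix k
        have "(\<integral>\<^sup>+\<omega>. ennreal ((?S k \<omega>)\<^sup>2) \<partial>M) = ennreal (expectation (\<lambda>\<omega>. (?S k \<omega>)\<^sup>2))"
          by (rule nn_integral_eq_integral[OF S2(1)]) (rule AE_I2, rule zero_le_power2)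
        also have "\<dots> \<le> ennreal (C\<^sup>2 * s * ((v (s / real (Suc k)) - v 0) / (s / real (Suc k))))"
          by (rule ennreal_leI[OF E_le])
        finally show "(\<integral>\<^sup>+\<omega>. ennreal ((?S k \<omega>)\<^sup>2) \<partial>M) \<le> \<dots>" .
      qed
    qed auto
  qed
  let ?R = "\<lambda>k \<omega>. \<Sum>i<Suc k. X (t k i) \<omega> * g k (B (t k (Suc i)) \<omega> - B (t k i) \<omega>)"
  have Rm: "(\<lambda>\<omega>. ennreal \<bar>?R k \<omega>\<bar>) \<in> borel_measurable M" for k
    by (intro measurable_compose[OF _ measurable_ennreal] borel_measurable_abs borel_measurable_sum borel_measurable_times XM dm) auto
  show ?thesis
  proof (rule tendsto_zero_in_prob_localize[OF Rm])
    fix \<eta> :: real assume \<eta>: "0 < \<eta>"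
    let ?A = "\<lambda>C::nat. {\<omega> \<in> space M. \<forall>r\<in>{0..s}. \<bar>X r \<omega>\<bar> \<le> real C}"
    have AF: "?A C \<in> sets (F s)" for C
      by (rule path_bounded_event[OF _ measurable_F_mono[OF _ _ adapted] cont]) (use s in auto)
    have A: "?A C \<in> events" for C using AF[of C] subalgebra_F[of s] s by (auto simp: subalgebra_def)
    obtain C where C: "prob (space M - ?A C) \<le> \<eta>" using path_bounded_event_prob[OF A cont \<eta>] by auto
    let ?S = "\<lambda>k \<omega>. \<Sum>i<Suc k. clip (real C) (X (t k i) \<omega>) * g k (B (t k (Suc i)) \<omega> - B (t k i) \<omega>)"
    have "tendsto_zero_in_prob M (\<lambda>k \<omega>. ennreal \<bar>?R k \<omega>\<bar> * indicator (?A C) \<omega>)"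
    proof (rule tendsto_zero_in_prob_bound[OF _ _ _ clip_lim[of "real C"]])
      show "(\<lambda>\<omega>. ennreal \<bar>?R k \<omega>\<bar> * indicator (?A C) \<omega>) \<in> borel_measurable M" for k
        by (intro borel_measurable_times_ennreal Rm borel_measurable_indicator A)
      show "(\<lambda>\<omega>. ennreal \<bar>?S k \<omega>\<bar>) \<in> borel_measurable M" for k
        by (intro measurable_compose[OF _ measurable_ennreal] borel_measurable_abs borel_measurable_sum borel_measurable_times
            measurable_compose[OF XM measurable_clip] dm) auto
      show "AE \<omega> in M. ennreal \<bar>?R k \<omega>\<bar> * indicator (?A C) \<omega> \<le> ennreal \<bar>?S k \<omega>\<bar>" for k
      proof (rule AE_I2)
        fix \<omega> assume "\<omega> \<in> space M"
        show "ennreal \<bar>?R k \<omega>\<bar> * indicator (?A C) \<omega> \<le> ennreal \<bar>?S k \<omega>\<bar>"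
        proof (cases "\<omega> \<in> ?A C")
          case True
          have "?R k \<omega> = ?S k \<omega>"
          proof (rule sum.cong[OF refl])
            fix i assume "i \<in> {..<Suc k}"
            then have "\<bar>X (t k i) \<omega>\<bar> \<le> real C" using True tm[of i k] by simp
            then show "X (t k i) \<omega> * g k (B (t k (Suc i)) \<omega> - B (t k i) \<omega>)
               = clip (real C) (X (t k i) \<omega>) * g k (B (t k (Suc i)) \<omega> - B (t k i) \<omega>)" by (simp add: clip_id)
          qed
          then show ?thesis using True by simp
        qed simp
      qed
    qed simp
    then show "\<exists>A\<in>events. prob (space M - A) \<le> \<eta> \<and> tendsto_zero_in_prob M (\<lambda>k \<omega>. ennreal \<bar>?R k \<omega>\<bar> * indicator A \<omega>)"
      using A C by blast
  qed
qed

end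

section \<open>Existence and mean of the controlled state\<close>

lemma lebesgue_path_measurable:
  fixes f :: "real \<times> 'a \<Rightarrow> real"
  assumes "f \<in> borel_measurable (restrict_space lborel {0..s} \<Otimes>\<^sub>M N)"
  shows "(\<lambda>\<omega>. LBINT r:{0..s}. f (r, \<omega>)) \<in> borel_measurable N"
proof -
  interpret L: finite_measure "restrict_space lborel {0..s}" by (rule finite_measure_lborel_Icc)
  have "(\<lambda>p. f (snd p, fst p)) \<in> borel_measurable (N \<Otimes>\<^sub>M restrict_space lborel {0..s})"
    using measurable_compose[OF measurable_pair_swap' assms] by (simp add: case_prod_unfold)
  then have "(\<lambda>\<omega>. \<integral>r. f (r, \<omega>) \<partial>restrict_space lborel {0..s}) \<in> borel_measurable N"
    by (intro L.borel_measurable_lebesgue_integral) (simp add: case_prod_unfold)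
  then show ?thesis
    by (simp add: integral_restrict_space set_lebesgue_integral_def)
qed

context brownian_motion
begin

text \<open>
  The Ito correction \<open>\<sigma>\<^sup>2 / 2\<close> cancels against the exponential moment of the increment, which leaves the
  rate \<open>\<delta>\<close> at which means decay.
\<close>

lemma nn_integral_exp_increment:
  assumes r: "0 \<le> r" "r \<le> s" and Z: "Z \<in> borel_measurable (F r)"
  shows "(\<integral>\<^sup>+\<omega>. ennreal (exp (\<sigma> * (B s \<omega> - B r \<omega>) - (\<sigma>\<^sup>2 / 2 + \<delta>) * (s - r))) * ennreal (Z \<omega>) \<partial>M)
    = ennreal (exp (- \<delta> * (s - r))) * (\<integral>\<^sup>+\<omega>. ennreal (Z \<omega>) \<partial>M)"
proof -
  let ?f = "\<lambda>y. ennreal (exp (\<sigma> * y - (\<sigma>\<^sup>2 / 2 + \<delta>) * (s - r)))"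
  have "indep_var borel (\<lambda>\<omega>. ennreal (Z \<omega>)) borel (\<lambda>\<omega>. ?f (B s \<omega> - B r \<omega>))"
    by (rule indep_increment_fun[OF r Z]) measurable
  from indep_var_nn_integral_mult[OF this]
  have "(\<integral>\<^sup>+\<omega>. ?f (B s \<omega> - B r \<omega>) * ennreal (Z \<omega>) \<partial>M) = (\<integral>\<^sup>+\<omega>. ?f (B s \<omega> - B r \<omega>) \<partial>M) * (\<integral>\<^sup>+\<omega>. ennreal (Z \<omega>) \<partial>M)"
    by (simp add: mult.commute)
  also have "(\<integral>\<^sup>+\<omega>. ?f (B s \<omega> - B r \<omega>) \<partial>M) = ennreal (exp (- \<delta> * (s - r)))"
  proof -
    let ?c = "exp (- ((\<sigma>\<^sup>2 / 2 + \<delta>) * (s - r)))"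
    have *: "exp (\<sigma> * y - (\<sigma>\<^sup>2 / 2 + \<delta>) * (s - r)) = ?c * exp (\<sigma> * y)" for y
      unfolding exp_add[symmetric] by simp
    have "(\<integral>\<^sup>+\<omega>. ?f (B s \<omega> - B r \<omega>) \<partial>M) = ennreal (expectation (\<lambda>\<omega>. ?c * exp (\<sigma> * (B s \<omega> - B r \<omega>))))"
      unfolding * by (rule nn_integral_eq_integral) (use increment_moments(5)[OF r] in auto)
    also have "expectation (\<lambda>\<omega>. ?c * exp (\<sigma> * (B s \<omega> - B r \<omega>))) = ?c * exp (\<sigma>\<^sup>2 * (s - r) / 2)"
      using increment_moments(6)[OF r] by simp
    also have "\<dots> = exp (- \<delta> * (s - r))" unfolding exp_add[symmetric] by (simp add: algebra_simps)
    finally show ?thesis .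
  qed
  finally show ?thesis .
qed

end

text \<open>
  The data after a modification on a null set, so that the properties of paths hold for every \<open>\<omega>\<close>. Only \<open>B\<close>
  carries the stochastic integral; \<open>b\<close> is its modification. The modified data are still adapted because
  the null sets belong to \<open>F 0\<close>.
\<close>

locale regular_state = brownian_motion M F B
  for M :: "'a measure" and F :: "real \<Rightarrow> 'a measure" and B :: "real \<Rightarrow> 'a \<Rightarrow> real" +
  fixes \<delta> \<sigma> T :: real and \<xi> :: "'a \<Rightarrow> real" and u b :: "real \<Rightarrow> 'a \<Rightarrow> real"
  assumes T: "0 < T"
    and b_adapted: "\<And>s. 0 \<le> s \<Longrightarrow> b s \<in> borel_measurable (F s)"
    and b_cont: "\<And>\<omega>. \<omega> \<in> space M \<Longrightarrow> continuous_on {0..} (\<lambda>s. b s \<omega>)"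
    and b_0: "\<And>\<omega>. \<omega> \<in> space M \<Longrightarrow> b 0 \<omega> = 0"
    and b_AE: "AE \<omega> in M. \<forall>s\<ge>0. b s \<omega> = B s \<omega>"
    and u_prog: "progressive F T u"
    and u_nn: "\<And>s \<omega>. s \<in> {0..T} \<Longrightarrow> \<omega> \<in> space M \<Longrightarrow> 0 \<le> u s \<omega>"
    and u_int: "\<And>\<omega>. \<omega> \<in> space M \<Longrightarrow> set_integrable lborel {0..T} (\<lambda>s. u s \<omega>)"
    and \<xi>_F: "\<xi> \<in> borel_measurable (F 0)"
    and \<xi>_nn: "\<And>\<omega>. \<omega> \<in> space M \<Longrightarrow> 0 \<le> \<xi> \<omega>"
begin

text \<open>
  The stochastic exponential, that is, the uncontrolled state started at \<open>1\<close>.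
\<close>

definition E :: "real \<Rightarrow> 'a \<Rightarrow> real" where
  "E s \<omega> = exp (\<sigma> * b s \<omega> - (\<sigma>\<^sup>2 / 2 + \<delta>) * s)"

definition X :: "real \<Rightarrow> 'a \<Rightarrow> real" where
  "X s \<omega> = E s \<omega> * (\<xi> \<omega> + (LBINT r:{0..s}. u r \<omega> / E r \<omega>))"

lemma E_pos: "0 < E s \<omega>" by (simp add: E_def)

lemma E_adapted: "0 \<le> s \<Longrightarrow> E s \<in> borel_measurable (F s)"
  using b_adapted[of s] unfolding E_def[abs_def] by measurable

lemma E_cont: "\<omega> \<in> space M \<Longrightarrow> A \<subseteq> {0..} \<Longrightarrow> continuous_on A (\<lambda>s. E s \<omega>)"
  unfolding E_def by (intro continuous_intros continuous_on_subset[OF b_cont]) auto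

lemma E_0: "\<omega> \<in> space M \<Longrightarrow> E 0 \<omega> = 1" by (simp add: E_def b_0)

lemma E_progressive: "progressive F T E"
  by (rule left_continuous_progressive[OF E_adapted continuous_left[OF E_cont]]) auto

lemma u_E_measurable:
  assumes "0 \<le> s" "s \<le> T"
  shows "(\<lambda>p. u (fst p) (snd p) / E (fst p) (snd p)) \<in> borel_measurable (restrict_space lborel {0..s} \<Otimes>\<^sub>M F s)"
  by (intro borel_measurable_divide progressive_measurable[OF u_prog] progressive_measurable[OF E_progressive] assms)

lemma u_int_sub: "\<omega> \<in> space M \<Longrightarrow> s \<le> T \<Longrightarrow> set_integrable lborel {0..s} (\<lambda>s. u s \<omega>)"
  by (rule set_integrable_subset[OF u_int]) auto

lemma u_E_int:
  assumes "\<omega> \<in> space M" "s \<le> T"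
  shows "set_integrable lborel {0..s} (\<lambda>r. u r \<omega> / E r \<omega>)"
proof -
  have "continuous_on {0..s} (\<lambda>r. 1 / E r \<omega>)"
    by (intro continuous_intros E_cont assms) (auto simp: E_pos[THEN less_imp_neq, symmetric])
  from set_integrable_continuous_mult[OF this u_int_sub[OF assms]] show ?thesis by simp
qed

lemma X_adapted: "0 \<le> s \<Longrightarrow> s \<le> T \<Longrightarrow> X s \<in> borel_measurable (F s)"
  unfolding X_def[abs_def]
  using lebesgue_path_measurable[OF u_E_measurable[of s]] measurable_F_mono[OF _ _ \<xi>_F, of s]
  by (intro borel_measurable_times borel_measurable_add E_adapted) auto

lemma X_cont: "\<omega> \<in> space M \<Longrightarrow> continuous_on {0..T} (\<lambda>s. X s \<omega>)"
  unfolding X_def E_def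
  by (rule linear_state_grid_expansion(2)[OF T _ u_int]) (auto intro: continuous_on_subset[OF b_cont])

lemma X_nn:
  assumes "\<omega> \<in> space M" "s \<in> {0..T}"
  shows "0 \<le> X s \<omega>"
proof -
  have "0 \<le> (LBINT r:{0..s}. u r \<omega> / E r \<omega>)"
    unfolding set_lebesgue_integral_def
  proof (rule integral_nonneg_AE, rule AE_I2)
    fix r show "0 \<le> indicator {0..s} r *\<^sub>R (u r \<omega> / E r \<omega>)"
      using u_nn[of r \<omega>] assms E_pos[of r \<omega>] by (cases "r \<in> {0..s}") auto
  qed
  then show ?thesis unfolding X_def using \<xi>_nn[OF assms(1)] E_pos less_imp_le by (intro mult_nonneg_nonneg) auto
qed

lemma X_0: "\<omega> \<in> space M \<Longrightarrow> X 0 \<omega> = \<xi> \<omega>"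
proof -
  assume \<omega>: "\<omega> \<in> space M"
  have "AE r in lborel. indicator {0..0} r *\<^sub>R (u r \<omega> / E r \<omega>) = 0"
    by (rule AE_mp[OF AE_lborel_singleton[of 0]]) auto
  then have "(LBINT r:{0..0}. u r \<omega> / E r \<omega>) = 0" unfolding set_lebesgue_integral_def by (rule integral_eq_zero_AE)
  then show ?thesis by (simp add: X_def E_0[OF \<omega>])
qed

lemma X_progressive: "progressive F T X"
  by (rule left_continuous_progressive[OF X_adapted continuous_left[OF X_cont]]) auto

text \<open>
  The stochastic integral is defined by the equation, as \<open>Y\<close>; it remains to see that the Riemann sums of \<open>\<sigma> X\<close>
  converge to \<open>Y\<close> in probability. They differ from \<open>Y\<close> by a term that vanishes pathwise and by the linearisation
  error of the exponential.
\<close>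

lemma strong_solution_X: "strong_solution M F B \<delta> \<sigma> T \<xi> u X"
  unfolding strong_solution_def
proof (intro conjI ballI)
  fix s assume s: "s \<in> {0<..T}"
  then have s0: "0 < s" "0 \<le> s" "s \<le> T" by auto
  define Y where "Y \<omega> = X s \<omega> - X 0 \<omega> - (LBINT r:{0..s}. - \<delta> * X r \<omega> + u r \<omega>)" for \<omega>
  have Y_M[measurable]: "Y \<in> borel_measurable M"
  proof -
    have "(\<lambda>\<omega>. LBINT r:{0..s}. - \<delta> * X r \<omega> + u r \<omega>) \<in> borel_measurable (F s)"
      using lebesgue_path_measurable[OF borel_measurable_add[OF borel_measurable_times[OF borel_measurable_const[of "- \<delta>"]
          progressive_measurable[OF X_progressive s0(2,3)]] progressive_measurable[OF u_prog s0(2,3)]]] by simp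
    then show ?thesis unfolding Y_def
      by (intro borel_measurable_diff measurable_F_M[OF _ X_adapted] measurable_F_M[OF s0(2)]) (use s0 in auto)
  qed
  let ?t = "\<lambda>k i. s * real i / real (Suc k)"
  let ?g = "\<lambda>k y. exp (\<sigma> * y - (\<sigma>\<^sup>2 / 2 + \<delta>) * (s / real (Suc k))) - exp (- \<delta> * (s / real (Suc k))) - \<sigma> * y"
  let ?R = "\<lambda>k \<omega>. (\<Sum>i<Suc k. \<sigma> * X (?t k i) \<omega> * (b (?t k (Suc i)) \<omega> - b (?t k i) \<omega>))
      + (\<Sum>i<Suc k. X (?t k i) \<omega> * ?g k (b (?t k (Suc i)) \<omega> - b (?t k i) \<omega>))"
  let ?I = "\<lambda>k \<omega>. \<Sum>i<Suc k. \<sigma> * X (?t k i) \<omega> * (B (?t k (Suc i)) \<omega> - B (?t k i) \<omega>)"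
  let ?G = "\<lambda>k \<omega>. \<Sum>i<Suc k. X (?t k i) \<omega> * ?g k (B (?t k (Suc i)) \<omega> - B (?t k i) \<omega>)"
  have tm: "?t k i \<in> {0..s}" if "i \<le> Suc k" for k i by (rule grid_point_mem) (use s0 that in auto)
  have t0: "0 \<le> ?t k i" for k i using s0 by (simp del: of_nat_Suc)
  have XM: "X (?t k i) \<in> borel_measurable M" if "i < Suc k" for k i
    using tm[of i k] that s0 by (intro measurable_F_M[OF _ X_adapted]) auto
  have bM: "b (?t k i) \<in> borel_measurable M" for k i by (rule measurable_F_M[OF t0 b_adapted[OF t0]])
  have gm: "?g k \<in> borel_measurable borel" for k by measurable
  have R_lim: "(\<lambda>k. ?R k \<omega>) \<longlonglongrightarrow> Y \<omega>" if \<omega>: "\<omega> \<in> space M" for \<omega>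
    unfolding X_def E_def Y_def
    by (rule linear_state_grid_expansion(1)[OF s0(1) _ u_int_sub[OF \<omega> s0(3)]])
       (auto intro: continuous_on_subset[OF b_cont[OF \<omega>]])
  have R_M[measurable]: "?R k \<in> borel_measurable M" for k
    by (intro borel_measurable_add borel_measurable_sum borel_measurable_times borel_measurable_diff
        measurable_compose[OF _ gm] borel_measurable_const XM bM) auto
  have I_M[measurable]: "?I k \<in> borel_measurable M" for k
    by (intro borel_measurable_sum borel_measurable_times borel_measurable_diff
        borel_measurable_const XM measurable_B_M t0) auto
  have G_M[measurable]: "?G k \<in> borel_measurable M" for k
    by (intro borel_measurable_sum borel_measurable_times
        measurable_compose[OF borel_measurable_diff gm] XM measurable_B_M t0) auto
  have X_cont_s: "continuous_on {0..s} (\<lambda>q. X q \<omega>)" if "\<omega> \<in> space M" for \<omega>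
    by (rule continuous_on_subset[OF X_cont[OF that]]) (use s0 in auto)
  have "has_ito_integral M F B s (\<lambda>r \<omega>. \<sigma> * X r \<omega>) Y"
  proof (rule has_ito_integral_riemann[OF s0(1) _ _ Y_M])
    show "(\<lambda>\<omega>. \<sigma> * X q \<omega>) \<in> borel_measurable (F q)" if "q \<in> {0..s}" for q
      using X_adapted[of q] that s0 by auto
    show "continuous_on {0..s} (\<lambda>q. \<sigma> * X q \<omega>)" if "\<omega> \<in> space M" for \<omega>
      by (intro continuous_intros X_cont_s that)
    have 1: "tendsto_zero_in_prob M (\<lambda>k \<omega>. ennreal \<bar>?R k \<omega> - Y \<omega>\<bar>)"
    proof (rule tendsto_zero_in_prob_AE, measurable, rule AE_I2)
      fix \<omega> assume "\<omega> \<in> space M"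
      from R_lim[OF this] have "(\<lambda>k. \<bar>?R k \<omega> - Y \<omega>\<bar>) \<longlonglongrightarrow> \<bar>Y \<omega> - Y \<omega>\<bar>"
        by (intro tendsto_intros)
      then show "(\<lambda>k. ennreal \<bar>?R k \<omega> - Y \<omega>\<bar>) \<longlonglongrightarrow> 0"
        using tendsto_ennrealI by fastforce
    qed
    have 2: "tendsto_zero_in_prob M (\<lambda>k \<omega>. ennreal \<bar>?G k \<omega>\<bar>)"
      by (rule compensated_exponential_sum_tendsto[OF s0(1) X_adapted X_cont_s]) (use s0 in auto)
    show "tendsto_zero_in_prob M (\<lambda>k \<omega>. ennreal \<bar>?I k \<omega> - Y \<omega>\<bar>)"
    proof (rule tendsto_zero_in_prob_bound[OF _ _ _ tendsto_zero_in_prob_add[OF _ _ 1 2]])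
      show "AE \<omega> in M. ennreal \<bar>?I k \<omega> - Y \<omega>\<bar> \<le> ennreal \<bar>?R k \<omega> - Y \<omega>\<bar> + ennreal \<bar>?G k \<omega>\<bar>" for k
        using b_AE
      proof eventually_elim
        fix \<omega> assume eq: "\<forall>s\<ge>0. b s \<omega> = B s \<omega>"
        have "b (?t k i) \<omega> = B (?t k i) \<omega>" for i using eq t0 by blast
        then have "?R k \<omega> = ?I k \<omega> + ?G k \<omega>" by (simp only:)
        then show "ennreal \<bar>?I k \<omega> - Y \<omega>\<bar> \<le> ennreal \<bar>?R k \<omega> - Y \<omega>\<bar> + ennreal \<bar>?G k \<omega>\<bar>"
          by (simp only: ennreal_plus[symmetric] abs_ge_zero) (rule ennreal_leI, linarith)
      qed
    qed measurable
  qed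
  moreover have "AE \<omega> in M. X s \<omega> = \<xi> \<omega> + (LBINT r:{0..s}. - \<delta> * X r \<omega> + u r \<omega>) + Y \<omega>"
    by (rule AE_I2) (simp add: Y_def X_0)
  ultimately show "\<exists>Y. has_ito_integral M F B s (\<lambda>r \<omega>. \<sigma> * X r \<omega>) Y \<and>
      (AE \<omega> in M. X s \<omega> = \<xi> \<omega> + (LBINT r:{0..s}. - \<delta> * X r \<omega> + u r \<omega>) + Y \<omega>)" by blast
qed (use X_adapted X_cont X_0 in auto)

text \<open>
  Write \<open>X s\<close> as \<open>(E s / E 0) \<xi>\<close> plus the integral of \<open>(E s / E r) (u r)\<close>. In each product the first factor is
  independent of the second one, which is known at time \<open>r\<close>. All terms are nonnegative, so no moment of
  \<open>\<xi>\<close> or \<open>X\<close> has to be known in advance.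
\<close>

lemma nn_integral_X:
  assumes s: "s \<in> {0..T}"
  shows "(\<integral>\<^sup>+\<omega>. ennreal (X s \<omega>) \<partial>M) = ennreal (exp (- \<delta> * s)) * (\<integral>\<^sup>+\<omega>. ennreal (\<xi> \<omega>) \<partial>M)
     + (\<integral>\<^sup>+r\<in>{0..s}. ennreal (exp (- \<delta> * (s - r))) * (\<integral>\<^sup>+\<omega>. ennreal (u r \<omega>) \<partial>M) \<partial>lborel)"
proof -
  have s0: "0 \<le> s" "s \<le> T" using s by auto
  let ?L = "restrict_space lborel {0..s}"
  interpret L: finite_measure ?L by (rule finite_measure_lborel_Icc)
  interpret P: pair_sigma_finite ?L M ..
  have ratio: "AE \<omega> in M. E s \<omega> / E r \<omega> = exp (\<sigma> * (B s \<omega> - B r \<omega>) - (\<sigma>\<^sup>2 / 2 + \<delta>) * (s - r))" if "0 \<le> r" for r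
    using b_AE
  proof eventually_elim
    fix \<omega> assume "\<forall>s\<ge>0. b s \<omega> = B s \<omega>"
    then show "E s \<omega> / E r \<omega> = exp (\<sigma> * (B s \<omega> - B r \<omega>) - (\<sigma>\<^sup>2 / 2 + \<delta>) * (s - r))"
      using that s0 unfolding E_def exp_diff[symmetric] by (simp add: field_simps)
  qed
  have u_r: "u r \<in> borel_measurable (F r)" if "r \<in> {0..T}" for r
  proof -
    have "(\<lambda>p. u (fst p) (snd p)) \<in> borel_measurable (restrict_space lborel {0..r} \<Otimes>\<^sub>M F r)"
      by (rule progressive_measurable[OF u_prog]) (use that in auto)
    from measurable_compose[OF measurable_Pair1' this, of r] that
    show ?thesis by (simp add: space_restrict_space)
  qed
  have factor: "(\<integral>\<^sup>+\<omega>. ennreal (E s \<omega> / E r \<omega>) * ennreal (Z \<omega>) \<partial>M) = ennreal (exp (- \<delta> * (s - r))) * (\<integral>\<^sup>+\<omega>. ennreal (Z \<omega>) \<partial>M)"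
    if r: "0 \<le> r" "r \<le> s" and Z: "Z \<in> borel_measurable (F r)" for r Z
  proof -
    have "(\<integral>\<^sup>+\<omega>. ennreal (E s \<omega> / E r \<omega>) * ennreal (Z \<omega>) \<partial>M)
       = (\<integral>\<^sup>+\<omega>. ennreal (exp (\<sigma> * (B s \<omega> - B r \<omega>) - (\<sigma>\<^sup>2 / 2 + \<delta>) * (s - r))) * ennreal (Z \<omega>) \<partial>M)"
      by (rule nn_integral_cong_AE) (use ratio[OF r(1)] in eventually_elim, simp)
    then show ?thesis unfolding nn_integral_exp_increment[OF r Z] .
  qed
  let ?f = "\<lambda>r \<omega>. ennreal (E s \<omega> / E r \<omega>) * ennreal (u r \<omega>)"
  have sub_M: "f \<in> borel_measurable (?L \<Otimes>\<^sub>M M)" if "f \<in> borel_measurable (?L \<Otimes>\<^sub>M F s)" for f :: "_ \<Rightarrow> real"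
  proof (rule measurable_compose[OF _ that])
    have "(\<lambda>x. x) \<in> measurable M (F s)"
      using subalgebra_F[OF s0(1)] by (auto simp: measurable_def subalgebra_def sets.sets_into_space Int_absorb2)
    then show "(\<lambda>p. p) \<in> measurable (?L \<Otimes>\<^sub>M M) (?L \<Otimes>\<^sub>M F s)"
      by (intro measurable_pair) (auto simp: comp_def intro: measurable_compose[OF measurable_snd])
  qed
  have f_M: "(\<lambda>p. ?f (fst p) (snd p)) \<in> borel_measurable (?L \<Otimes>\<^sub>M M)"
    by (intro borel_measurable_times_ennreal measurable_compose[OF _ measurable_ennreal] sub_M borel_measurable_divide
        progressive_measurable[OF u_prog] progressive_measurable[OF E_progressive] measurable_compose[OF measurable_snd E_adapted] s0)
  have E_M: "E s \<in> borel_measurable M" by (rule measurable_F_M[OF s0(1) E_adapted[OF s0(1)]])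
  have \<xi>_M: "\<xi> \<in> borel_measurable M" by (rule measurable_F_M[OF order_refl \<xi>_F])
  have X_eq: "ennreal (X s \<omega>) = ennreal (E s \<omega> / E 0 \<omega>) * ennreal (\<xi> \<omega>) + (\<integral>\<^sup>+r. ?f r \<omega> \<partial>?L)" if \<omega>: "\<omega> \<in> space M" for \<omega>
  proof -
    have "set_integrable lborel {0..s} (\<lambda>r. E s \<omega> * (u r \<omega> / E r \<omega>))"
      using u_E_int[OF \<omega> s0(2)] by (rule set_integrable_mult_right)
    then have int: "integrable ?L (\<lambda>r. E s \<omega> * (u r \<omega> / E r \<omega>))"
      by (simp add: integrable_restrict_space set_integrable_def)
    have nn: "0 \<le> u r \<omega> / E r \<omega>" if "r \<in> {0..s}" for r
      using u_nn[of r \<omega>] E_pos[of r \<omega>] that s0 \<omega> by simp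
    have "(\<integral>\<^sup>+r. ?f r \<omega> \<partial>?L) = (\<integral>\<^sup>+r. ennreal (E s \<omega> * (u r \<omega> / E r \<omega>)) \<partial>?L)"
    proof (rule nn_integral_cong)
      fix r assume "r \<in> space ?L"
      then show "?f r \<omega> = ennreal (E s \<omega> * (u r \<omega> / E r \<omega>))"
        using u_nn[of r \<omega>] E_pos[of r \<omega>] E_pos[of s \<omega>] s0 \<omega>
        by (subst ennreal_mult[symmetric]) (auto simp: space_restrict_space)
    qed
    also have "\<dots> = ennreal (\<integral>r. E s \<omega> * (u r \<omega> / E r \<omega>) \<partial>?L)"
    proof (rule nn_integral_eq_integral[OF int], rule AE_I2)
      fix r assume "r \<in> space ?L"
      then show "0 \<le> E s \<omega> * (u r \<omega> / E r \<omega>)"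
        by (intro mult_nonneg_nonneg nn less_imp_le[OF E_pos]) (auto simp: space_restrict_space)
    qed
    also have "(\<integral>r. E s \<omega> * (u r \<omega> / E r \<omega>) \<partial>?L) = E s \<omega> * (\<integral>r. u r \<omega> / E r \<omega> \<partial>?L)"
      by (rule integral_mult_right_zero)
    also have "(\<integral>r. u r \<omega> / E r \<omega> \<partial>?L) = (LBINT r:{0..s}. u r \<omega> / E r \<omega>)"
      by (simp add: integral_restrict_space set_lebesgue_integral_def)
    finally have I: "(\<integral>\<^sup>+r. ?f r \<omega> \<partial>?L) = ennreal (E s \<omega> * (LBINT r:{0..s}. u r \<omega> / E r \<omega>))" .
    have nnI: "0 \<le> (LBINT r:{0..s}. u r \<omega> / E r \<omega>)"
      unfolding set_lebesgue_integral_def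
      by (rule integral_nonneg_AE, rule AE_I2) (use nn in \<open>auto simp: indicator_def\<close>)
    have "ennreal (E s \<omega> / E 0 \<omega>) * ennreal (\<xi> \<omega>) = ennreal (E s \<omega> * \<xi> \<omega>)"
      using E_pos[of s \<omega>] \<xi>_nn[OF \<omega>] by (simp add: E_0[OF \<omega>] ennreal_mult)
    then show ?thesis unfolding I X_def distrib_left using E_pos[of s \<omega>] \<xi>_nn[OF \<omega>] nnI
      by (simp add: ennreal_plus)
  qed
  have "(\<integral>\<^sup>+\<omega>. ennreal (X s \<omega>) \<partial>M) = (\<integral>\<^sup>+\<omega>. ennreal (E s \<omega> / E 0 \<omega>) * ennreal (\<xi> \<omega>) + (\<integral>\<^sup>+r. ?f r \<omega> \<partial>?L) \<partial>M)"
    by (rule nn_integral_cong) (rule X_eq)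
  also have "\<dots> = (\<integral>\<^sup>+\<omega>. ennreal (E s \<omega> / E 0 \<omega>) * ennreal (\<xi> \<omega>) \<partial>M) + (\<integral>\<^sup>+\<omega>. \<integral>\<^sup>+r. ?f r \<omega> \<partial>?L \<partial>M)"
  proof (rule nn_integral_add)
    show "(\<lambda>\<omega>. ennreal (E s \<omega> / E 0 \<omega>) * ennreal (\<xi> \<omega>)) \<in> borel_measurable M"
      using E_M \<xi>_M measurable_F_M[OF order_refl E_adapted[OF order_refl]]
      by (intro borel_measurable_times_ennreal measurable_compose[OF _ measurable_ennreal] borel_measurable_divide)
    show "(\<lambda>\<omega>. \<integral>\<^sup>+r. ?f r \<omega> \<partial>?L) \<in> borel_measurable M"
      using nn_integral_path_measurable[OF f_M] by (simp add: nn_integral_restrict_space)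
  qed
  also have "(\<integral>\<^sup>+\<omega>. ennreal (E s \<omega> / E 0 \<omega>) * ennreal (\<xi> \<omega>) \<partial>M) = ennreal (exp (- \<delta> * s)) * (\<integral>\<^sup>+\<omega>. ennreal (\<xi> \<omega>) \<partial>M)"
    using factor[OF order_refl s0(1) \<xi>_F] by simp
  also have "(\<integral>\<^sup>+\<omega>. \<integral>\<^sup>+r. ?f r \<omega> \<partial>?L \<partial>M) = (\<integral>\<^sup>+r. \<integral>\<^sup>+\<omega>. ?f r \<omega> \<partial>M \<partial>?L)"
    using P.Fubini[OF f_M] by simp
  also have "\<dots> = (\<integral>\<^sup>+r. ennreal (exp (- \<delta> * (s - r))) * (\<integral>\<^sup>+\<omega>. ennreal (u r \<omega>) \<partial>M) \<partial>?L)"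
    by (rule nn_integral_cong, rule factor) (use s0 u_r in \<open>auto simp: space_restrict_space\<close>)
  also have "\<dots> = (\<integral>\<^sup>+r\<in>{0..s}. ennreal (exp (- \<delta> * (s - r))) * (\<integral>\<^sup>+\<omega>. ennreal (u r \<omega>) \<partial>M) \<partial>lborel)"
    by (simp add: nn_integral_restrict_space)
  finally show ?thesis .
qed

end

context brownian_motion
begin

lemma admissible_path_integrable:
  assumes T: "0 \<le> T" and u: "u \<in> admissible M F T"
  shows "AE \<omega> in M. set_integrable lborel {0..T} (\<lambda>s. u s \<omega>)"
proof -
  have u_prog: "progressive F T u"
    and u2: "(\<integral>\<^sup>+\<omega>. (\<integral>\<^sup>+s\<in>{0..T}. ennreal ((u s \<omega>)\<^sup>2) \<partial>lborel) \<partial>M) < \<infinity>"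
    using u by (auto simp: admissible_def)
  have uM: "(\<lambda>p. u (fst p) (snd p)) \<in> borel_measurable (restrict_space lborel {0..T} \<Otimes>\<^sub>M M)"
    using progressive_measurable_M[OF u_prog] T by simp
  have "(\<lambda>\<omega>. \<integral>\<^sup>+s\<in>{0..T}. ennreal ((u s \<omega>)\<^sup>2) \<partial>lborel) \<in> borel_measurable M"
    using nn_integral_path_measurable[OF measurable_compose[OF borel_measurable_power[OF uM, of 2] measurable_ennreal]] by simp
  then have "AE \<omega> in M. (\<integral>\<^sup>+s\<in>{0..T}. ennreal ((u s \<omega>)\<^sup>2) \<partial>lborel) \<noteq> \<infinity>"
    by (rule nn_integral_PInf_AE) (use u2 in auto)
  then show "AE \<omega> in M. set_integrable lborel {0..T} (\<lambda>s. u s \<omega>)"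
    using AE_space
  proof eventually_elim
    fix \<omega> assume fin: "(\<integral>\<^sup>+s\<in>{0..T}. ennreal ((u s \<omega>)\<^sup>2) \<partial>lborel) \<noteq> \<infinity>" and \<omega>: "\<omega> \<in> space M"
    interpret L: finite_measure "restrict_space lborel {0..T}" by (rule finite_measure_lborel_Icc)
    have um[measurable]: "(\<lambda>s. u s \<omega>) \<in> borel_measurable (restrict_space lborel {0..T})"
      using measurable_compose[OF measurable_Pair2'[OF \<omega>] uM] by simp
    have "integrable (restrict_space lborel {0..T}) (\<lambda>s. (u s \<omega>)\<^sup>2)"
      using fin by (intro integrableI_nonneg) (auto simp: nn_integral_restrict_space less_top)
    then have "integrable (restrict_space lborel {0..T}) (\<lambda>s. u s \<omega>)"
      by (rule L.square_integrable_imp_integrable[rotated]) measurable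
    then show "set_integrable lborel {0..T} (\<lambda>s. u s \<omega>)"
      by (simp add: integrable_restrict_space set_integrable_def)
  qed
qed

theorem strong_solution_exists:
  assumes T: "0 < T" and u: "u \<in> admissible M F T" and \<xi>: "\<xi> \<in> borel_measurable (F 0)" "AE \<omega> in M. 0 < \<xi> \<omega>"
  shows "\<exists>X. strong_solution M F B \<delta> \<sigma> T \<xi> u X \<and> (\<forall>s\<in>{0..T}. \<forall>\<omega>\<in>space M. 0 \<le> X s \<omega>) \<and>
    (\<forall>s\<in>{0..T}. (\<integral>\<^sup>+\<omega>. ennreal (X s \<omega>) \<partial>M) = ennreal (exp (- \<delta> * s)) * (\<integral>\<^sup>+\<omega>. ennreal (\<xi> \<omega>) \<partial>M)
     + (\<integral>\<^sup>+r\<in>{0..s}. ennreal (exp (- \<delta> * (s - r))) * (\<integral>\<^sup>+\<omega>. ennreal (u r \<omega>) \<partial>M) \<partial>lborel))"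
proof -
  have u_prog: "progressive F T u" and u_nn: "\<And>s \<omega>. s \<in> {0..T} \<Longrightarrow> \<omega> \<in> space M \<Longrightarrow> 0 \<le> u s \<omega>"
    using u by (auto simp: admissible_def)
  note u_int_AE = admissible_path_integrable[OF less_imp_le[OF T] u]
  have "AE \<omega> in M. B 0 \<omega> = 0 \<and> continuous_on {0..} (\<lambda>s. B s \<omega>) \<and> 0 < \<xi> \<omega> \<and> set_integrable lborel {0..T} (\<lambda>s. u s \<omega>)"
    using B_0 continuous_B \<xi>(2) u_int_AE by eventually_elim auto
  then obtain N where N: "N \<in> null_sets M" "{\<omega> \<in> space M. \<not> (B 0 \<omega> = 0 \<and> continuous_on {0..} (\<lambda>s. B s \<omega>) \<and> 0 < \<xi> \<omega> \<and>
      set_integrable lborel {0..T} (\<lambda>s. u s \<omega>))} \<subseteq> N"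
    by (elim AE_E) (auto simp: null_sets_def)
  \<comment> \<open>outside the null set \<open>N\<close> all path properties hold; \<open>G\<close> belongs to every \<open>F s\<close> as \<open>N\<close> does\<close>
  define G where "G = space M - N"
  have G_in: "B 0 \<omega> = 0" "continuous_on {0..} (\<lambda>s. B s \<omega>)" "0 < \<xi> \<omega>" "set_integrable lborel {0..T} (\<lambda>s. u s \<omega>)"
    if "\<omega> \<in> G" for \<omega> using that N(2) unfolding G_def by auto
  have G_AE: "AE \<omega> in M. \<omega> \<in> G" using AE_not_in[OF N(1)] AE_space by eventually_elim (auto simp: G_def)
  have G_F: "G \<in> sets (F s)" if "0 \<le> s" for s
  proof -
    have "N \<in> sets (F s)" using N(1) null_sets_F mono_F[of 0 s] that by auto
    then show ?thesis unfolding G_def space_F[OF that, symmetric] by auto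
  qed
  have ind: "(indicator G :: 'a \<Rightarrow> real) \<in> borel_measurable (F s)" if "0 \<le> s" for s
    using G_F[OF that] by simp
  define b where "b s \<omega> = indicator G \<omega> * B s \<omega>" for s \<omega>
  define u' where "u' s \<omega> = indicator G \<omega> * u s \<omega>" for s \<omega>
  define \<xi>' where "\<xi>' \<omega> = indicator G \<omega> * \<xi> \<omega>" for \<omega>
  interpret R: regular_state M F B \<delta> \<sigma> T \<xi>' u' b
  proof
    show "0 < T" by (rule T)
    show "b s \<in> borel_measurable (F s)" if "0 \<le> s" for s
      unfolding b_def[abs_def] by (intro borel_measurable_times ind adapted_B that)
    show "continuous_on {0..} (\<lambda>s. b s \<omega>)" for \<omega>
      unfolding b_def using G_in(2)[of \<omega>] by (cases "\<omega> \<in> G") auto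
    show "b 0 \<omega> = 0" for \<omega> unfolding b_def using G_in(1)[of \<omega>] by (cases "\<omega> \<in> G") auto
    show "AE \<omega> in M. \<forall>s\<ge>0. b s \<omega> = B s \<omega>" using G_AE by eventually_elim (simp add: b_def)
    show "progressive F T u'"
      unfolding progressive_def
    proof
      fix t assume t: "t \<in> {0..T}"
      have "(\<lambda>p. indicator G (snd p) * u (fst p) (snd p)) \<in> borel_measurable (restrict_space borel {0..t} \<Otimes>\<^sub>M F t)"
        using u_prog t unfolding progressive_def
        by (intro borel_measurable_times measurable_compose[OF measurable_snd ind]) (auto simp: case_prod_unfold)
      then show "(\<lambda>(s, \<omega>). u' s \<omega>) \<in> borel_measurable (restrict_space borel {0..t} \<Otimes>\<^sub>M F t)"
        by (simp add: u'_def case_prod_unfold)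
    qed
    show "0 \<le> u' s \<omega>" if "s \<in> {0..T}" "\<omega> \<in> space M" for s \<omega> using u_nn[OF that] by (simp add: u'_def)
    show "set_integrable lborel {0..T} (\<lambda>s. u' s \<omega>)" for \<omega>
      unfolding u'_def using G_in(4)[of \<omega>] by (cases "\<omega> \<in> G") (auto simp: set_integrable_def)
    show "\<xi>' \<in> borel_measurable (F 0)"
      unfolding \<xi>'_def[abs_def] by (intro borel_measurable_times ind \<xi>) simp
    show "0 \<le> \<xi>' \<omega>" for \<omega> unfolding \<xi>'_def using G_in(3)[of \<omega>] by (cases "\<omega> \<in> G") auto
  qed
  have eq: "AE \<omega> in M. \<xi>' \<omega> = \<xi> \<omega> \<and> (\<forall>s. u' s \<omega> = u s \<omega>)"
    using G_AE by eventually_elim (simp add: \<xi>'_def u'_def)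
  have "strong_solution M F B \<delta> \<sigma> T \<xi> u R.X"
    unfolding strong_solution_def
  proof (intro conjI ballI)
    note S = R.strong_solution_X[unfolded strong_solution_def]
    show "R.X s \<in> borel_measurable (F s)" if "s \<in> {0..T}" for s using S that by blast
    show "continuous_on {0..T} (\<lambda>s. R.X s \<omega>)" if "\<omega> \<in> space M" for \<omega> using S that by blast
    have "AE \<omega> in M. R.X 0 \<omega> = \<xi>' \<omega>" using S by blast
    then show "AE \<omega> in M. R.X 0 \<omega> = \<xi> \<omega>" using eq by eventually_elim simp
    fix s assume "s \<in> {0<..T}"
    then obtain Y where Y: "has_ito_integral M F B s (\<lambda>r \<omega>. \<sigma> * R.X r \<omega>) Y"
      "AE \<omega> in M. R.X s \<omega> = \<xi>' \<omega> + (LBINT r:{0..s}. - \<delta> * R.X r \<omega> + u' r \<omega>) + Y \<omega>" using S by blast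
    have "AE \<omega> in M. R.X s \<omega> = \<xi> \<omega> + (LBINT r:{0..s}. - \<delta> * R.X r \<omega> + u r \<omega>) + Y \<omega>"
      using Y(2) eq by eventually_elim simp
    with Y(1) show "\<exists>Y. has_ito_integral M F B s (\<lambda>r \<omega>. \<sigma> * R.X r \<omega>) Y \<and>
       (AE \<omega> in M. R.X s \<omega> = \<xi> \<omega> + (LBINT r:{0..s}. - \<delta> * R.X r \<omega> + u r \<omega>) + Y \<omega>)" by blast
  qed
  moreover have "(\<integral>\<^sup>+\<omega>. ennreal (\<xi>' \<omega>) \<partial>M) = (\<integral>\<^sup>+\<omega>. ennreal (\<xi> \<omega>) \<partial>M)"
    by (rule nn_integral_cong_AE) (use eq in eventually_elim, simp)
  moreover have "(\<integral>\<^sup>+\<omega>. ennreal (u' r \<omega>) \<partial>M) = (\<integral>\<^sup>+\<omega>. ennreal (u r \<omega>) \<partial>M)" for r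
    by (rule nn_integral_cong_AE) (use eq in eventually_elim, simp)
  ultimately show ?thesis using R.X_nn R.nn_integral_X by (intro exI[of _ R.X]) simp
qed

end

section \<open>The localised isometry\<close>

context brownian_motion
begin

lemma simple_integral_isometry:
  assumes S: "simple_integrand F s n t h"
  shows "(\<integral>\<^sup>+\<omega>. ennreal ((simple_integral B n t h \<omega>)\<^sup>2) \<partial>M) =
    (\<integral>\<^sup>+\<omega>. (\<integral>\<^sup>+r\<in>{0..s}. ennreal ((simple_process n t h r \<omega>)\<^sup>2) \<partial>lborel) \<partial>M)"
proof -
  note D = simple_integrandD[OF S]
  have iso: "integrable M (\<lambda>\<omega>. (simple_integral B n t h \<omega>)\<^sup>2)"
    "expectation (\<lambda>\<omega>. (simple_integral B n t h \<omega>)\<^sup>2) = (\<Sum>i<n. expectation (\<lambda>\<omega>. (h i \<omega>)\<^sup>2) * (t (Suc i) - t i))"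
    using sum_increments_square[of t n h "\<lambda>_ x. x" "\<lambda>i. t (Suc i) - t i"] D simple_integrand_measurable(2)[OF S]
      increment_moments(1-4) unfolding simple_integral_def by auto
  have h2: "integrable M (\<lambda>\<omega>. (h i \<omega>)\<^sup>2)" if i: "i < n" for i
    by (rule integrable_square_bounded[OF simple_integrand_measurable[OF S i]])
  have "(\<integral>\<^sup>+\<omega>. ennreal ((simple_integral B n t h \<omega>)\<^sup>2) \<partial>M) = ennreal (\<Sum>i<n. expectation (\<lambda>\<omega>. (h i \<omega>)\<^sup>2) * (t (Suc i) - t i))"
    unfolding iso(2)[symmetric] by (rule nn_integral_eq_integral[OF iso(1)]) simp
  also have "(\<Sum>i<n. expectation (\<lambda>\<omega>. (h i \<omega>)\<^sup>2) * (t (Suc i) - t i)) = expectation (\<lambda>\<omega>. \<Sum>i<n. (h i \<omega>)\<^sup>2 * (t (Suc i) - t i))"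
    using h2 by (subst Bochner_Integration.integral_sum) auto
  also have "ennreal \<dots> = (\<integral>\<^sup>+\<omega>. ennreal (\<Sum>i<n. (h i \<omega>)\<^sup>2 * (t (Suc i) - t i)) \<partial>M)"
    by (rule nn_integral_eq_integral[symmetric]) (use h2 D(1) in \<open>auto intro!: AE_I2 sum_nonneg\<close>)
  finally show ?thesis unfolding nn_integral_simple_process_square[OF S] .
qed

text \<open>
  Cutting a continuous path off when it first exceeds \<open>C\<close> keeps it left-continuous: the times at which
  \<open>\<bar>x\<bar>\<close> exceeds \<open>C\<close> form a relatively open set, so up to and including their infimum nothing is changed.
\<close>

lemma path_bounded_indicator_left_continuous:
  fixes x :: "real \<Rightarrow> real"
  assumes x: "continuous_on {0..s} x" and r: "0 < r" "r \<le> s"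
  shows "((\<lambda>q. if \<forall>p\<in>{0..q}. \<bar>x p\<bar> \<le> C then x q else 0) \<longlongrightarrow> (if \<forall>p\<in>{0..r}. \<bar>x p\<bar> \<le> C then x r else 0)) (at_left r)"
proof (cases "\<forall>p\<in>{0..r}. \<bar>x p\<bar> \<le> C")
  case True
  have "\<forall>\<^sub>F q in at_left r. x q = (if \<forall>p\<in>{0..q}. \<bar>x p\<bar> \<le> C then x q else 0)"
    by (rule eventually_mono[OF eventually_at_left_real[OF r(1)]]) (use True in auto)
  then show ?thesis using continuous_left[OF x r] True by (simp add: Lim_transform_eventually)
next
  case False
  then obtain p where p: "0 \<le> p" "p \<le> r" "C < \<bar>x p\<bar>" by (auto simp: not_le)
  \<comment> \<open>by continuity the bound is violated strictly before \<open>r\<close>\<close>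
  have "\<exists>p'. 0 \<le> p' \<and> p' < r \<and> C < \<bar>x p'\<bar>"
  proof (cases "p = r")
    case True
    have "((\<lambda>q. \<bar>x q\<bar>) \<longlongrightarrow> \<bar>x r\<bar>) (at_left r)" by (intro tendsto_rabs continuous_left[OF x r])
    then have "\<forall>\<^sub>F q in at_left r. C < \<bar>x q\<bar>" by (rule order_tendstoD) (use p True in simp)
    then have "\<forall>\<^sub>F q in at_left r. C < \<bar>x q\<bar> \<and> q \<in> {0<..<r}"
      using eventually_at_left_real[OF r(1)] by eventually_elim auto
    from eventually_happens'[OF trivial_limit_at_left_real this]
    obtain q where "C < \<bar>x q\<bar> \<and> q \<in> {0<..<r}" by (elim exE)
    then show ?thesis by (intro exI[of _ q]) auto
  qed (use p in auto)
  then obtain p' where p': "0 \<le> p'" "p' < r" "C < \<bar>x p'\<bar>" by blast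
  have "\<forall>\<^sub>F q in at_left r. (if \<forall>p\<in>{0..q}. \<bar>x p\<bar> \<le> C then x q else 0) = 0"
    by (rule eventually_mono[OF eventually_at_left_real[OF p'(2)]]) (use p' in \<open>auto simp: not_le[symmetric]\<close>)
  then show ?thesis using False by (simp only: if_False tendsto_eventually)
qed

text \<open>
  The Ito isometry as an inequality, on the event that the integrand stays bounded by \<open>C\<close>. The process \<open>G\<close> is \<open>H\<close>
  cut off when it exceeds \<open>C\<close>; it is bounded and left-continuous, so its left-point sums approximate it. On the
  event the two integrands agree, hence so do their integrals in the limit
  (\<open>simple_integrals_close\<close>); the isometry for the sums and Fatou's lemma give the inequality.
\<close>

lemma ito_integral_local_bound:
  assumes s: "0 < s" and adapted: "\<And>q. q \<in> {0..s} \<Longrightarrow> H q \<in> borel_measurable (F q)"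
    and cont: "\<And>\<omega>. \<omega> \<in> space M \<Longrightarrow> continuous_on {0..s} (\<lambda>q. H q \<omega>)"
    and C: "0 \<le> C" and W: "has_ito_integral M F B s H W"
  defines "G \<equiv> \<lambda>r \<omega>. if \<forall>p\<in>{0..r}. \<bar>H p \<omega>\<bar> \<le> C then H r \<omega> else 0"
  shows "progressive F s G"
    and "(\<integral>\<^sup>+\<omega>. ennreal ((W \<omega>)\<^sup>2) * indicator {\<omega> \<in> space M. \<forall>p\<in>{0..s}. \<bar>H p \<omega>\<bar> \<le> C} \<omega> \<partial>M)
      \<le> (\<integral>\<^sup>+\<omega>. (\<integral>\<^sup>+r\<in>{0..s}. ennreal ((G r \<omega>)\<^sup>2) \<partial>lborel) \<partial>M)"
proof -
  have cont': "continuous_on {0..q} (\<lambda>q. H q \<omega>)" if "\<omega> \<in> space M" "q \<in> {0..s}" for \<omega> q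
    by (rule continuous_on_subset[OF cont[OF that(1)]]) (use that in auto)
  have A_F: "{\<omega> \<in> space M. \<forall>p\<in>{0..q}. \<bar>H p \<omega>\<bar> \<le> C} \<in> sets (F q)" if "q \<in> {0..s}" for q
    by (rule path_bounded_event[OF _ measurable_F_mono[OF _ _ adapted] cont']) (use that in auto)
  have G_adapted: "G q \<in> borel_measurable (F q)" if "q \<in> {0..s}" for q
  proof -
    have "{\<omega> \<in> space (F q). \<forall>p\<in>{0..q}. \<bar>H p \<omega>\<bar> \<le> C} \<in> sets (F q)"
      using A_F[OF that] space_F[of q] that by simp
    then show ?thesis unfolding G_def using adapted[OF that] by (intro measurable_If) auto
  qed
  have G_left: "((\<lambda>q. G q \<omega>) \<longlongrightarrow> G r \<omega>) (at_left r)" if "\<omega> \<in> space M" "0 < r" "r \<le> s" for \<omega> r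
    unfolding G_def by (rule path_bounded_indicator_left_continuous[OF cont[OF that(1)] that(2,3)])
  show prog: "progressive F s G" by (rule left_continuous_progressive[OF G_adapted G_left])
  have G_bnd: "\<bar>G r \<omega>\<bar> \<le> C" if "r \<in> {0..s}" for r \<omega> using that C by (auto simp: G_def)
  let ?A = "{\<omega> \<in> space M. \<forall>p\<in>{0..s}. \<bar>H p \<omega>\<bar> \<le> C}"
  have A[measurable]: "?A \<in> events"
    using A_F[of s] subalgebra_F[of s] s by (auto simp: subalgebra_def)
  from W obtain n t h where W_M[measurable]: "W \<in> borel_measurable M" and H_prog: "progressive F s H"
    and S: "\<And>k. simple_integrand F s (n k) (t k) (h k)"
    and lim1: "tendsto_zero_in_prob M (\<lambda>k \<omega>. \<integral>\<^sup>+r\<in>{0..s}. ennreal ((simple_process (n k) (t k) (h k) r \<omega> - H r \<omega>)\<^sup>2) \<partial>lborel)"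
    and lim2: "tendsto_zero_in_prob M (\<lambda>k \<omega>. ennreal \<bar>simple_integral B (n k) (t k) (h k) \<omega> - W \<omega>\<bar>)"
    unfolding has_ito_integral_def by blast
  define x where "x k i = s * real i / real (Suc k)" for k i
  define g where "g k i \<omega> = clip (real k) (G (x k i) \<omega>)" for k i \<omega>
  have S': "simple_integrand F s (Suc k) (x k) (g k)" for k
    unfolding x_def[abs_def] g_def[abs_def] using uniform_simple_integrand[OF G_adapted] s by (simp add: x_def)
  define P where "P k = simple_process (Suc k) (x k) (g k)" for k
  have P_lim: "(\<lambda>k. \<integral>\<^sup>+r\<in>{0..s}. ennreal ((P k r \<omega> - G r \<omega>)\<^sup>2) \<partial>lborel) \<longlonglongrightarrow> 0"
    "(\<lambda>k. \<integral>\<^sup>+r\<in>{0..s}. ennreal ((P k r \<omega>)\<^sup>2) \<partial>lborel) \<longlonglongrightarrow> (\<integral>\<^sup>+r\<in>{0..s}. ennreal ((G r \<omega>)\<^sup>2) \<partial>lborel)"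
    if "\<omega> \<in> space M" for \<omega>
    using uniform_simple_process_tendsto[OF prog s that G_bnd G_left[OF that]]
    unfolding P_def x_def[abs_def] g_def[abs_def] by blast+
  have err_M[measurable]: "(\<lambda>\<omega>. \<integral>\<^sup>+r\<in>{0..s}. ennreal ((simple_process (n k) (t k) (h k) r \<omega> - H r \<omega>)\<^sup>2) \<partial>lborel) \<in> borel_measurable M" for k
    by (rule simple_error_measurable[OF S H_prog]) (use s in simp)
  have errP_M[measurable]: "(\<lambda>\<omega>. \<integral>\<^sup>+r\<in>{0..s}. ennreal ((P k r \<omega> - G r \<omega>)\<^sup>2) \<partial>lborel) \<in> borel_measurable M" for k
    unfolding P_def by (rule simple_error_measurable[OF S' prog]) (use s in simp)
  note [measurable] = simple_integral_measurable[OF S] simple_integral_measurable[OF S']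
  have jm: "(\<lambda>p. P k (fst p) (snd p)) \<in> borel_measurable (restrict_space lborel {0..s} \<Otimes>\<^sub>M M)"
    "(\<lambda>p. simple_process (n k) (t k) (h k) (fst p) (snd p)) \<in> borel_measurable (restrict_space lborel {0..s} \<Otimes>\<^sub>M M)"
    "(\<lambda>p. G (fst p) (snd p)) \<in> borel_measurable (restrict_space lborel {0..s} \<Otimes>\<^sub>M M)"
    "(\<lambda>p. H (fst p) (snd p)) \<in> borel_measurable (restrict_space lborel {0..s} \<Otimes>\<^sub>M M)" for k
    unfolding P_def using simple_process_measurable[OF S] simple_process_measurable[OF S'] progressive_measurable_M[OF prog]
      progressive_measurable_M[OF H_prog] s by auto
  have path_M: "(\<lambda>r. f r \<omega> - g r \<omega>) \<in> borel_measurable (restrict_space lborel {0..s})"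
    if "(\<lambda>p. f (fst p) (snd p)) \<in> borel_measurable (restrict_space lborel {0..s} \<Otimes>\<^sub>M M)"
      "(\<lambda>p. g (fst p) (snd p)) \<in> borel_measurable (restrict_space lborel {0..s} \<Otimes>\<^sub>M M)" "\<omega> \<in> space M"
    for f g :: "real \<Rightarrow> 'a \<Rightarrow> real" and \<omega>
    using measurable_compose[OF measurable_Pair2'[OF that(3)] borel_measurable_diff[OF that(1,2)]] by simp
  have "tendsto_zero_in_prob M (\<lambda>k \<omega>. (\<integral>\<^sup>+r\<in>{0..s}. ennreal ((simple_process (n k) (t k) (h k) r \<omega>
       - simple_process (Suc k) (x k) (g k) r \<omega>)\<^sup>2) \<partial>lborel) * indicator ?A \<omega>)"
  proof (rule tendsto_zero_in_prob_bound)
    let ?Z = "\<lambda>k \<omega>. \<integral>\<^sup>+r\<in>{0..s}. ennreal ((simple_process (n k) (t k) (h k) r \<omega> - H r \<omega>)\<^sup>2) \<partial>lborel"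
    let ?Z' = "\<lambda>k \<omega>. \<integral>\<^sup>+r\<in>{0..s}. ennreal ((P k r \<omega> - G r \<omega>)\<^sup>2) \<partial>lborel"
    have lim3: "tendsto_zero_in_prob M ?Z'" by (rule tendsto_zero_in_prob_AE[OF errP_M AE_I2]) (rule P_lim)
    show "tendsto_zero_in_prob M (\<lambda>k \<omega>. ennreal 2 * ?Z k \<omega> + ennreal 2 * ?Z' k \<omega>)"
      by (intro tendsto_zero_in_prob_add tendsto_zero_in_prob_cmult lim1 lim3) measurable
    show "(\<lambda>\<omega>. ennreal 2 * ?Z k \<omega> + ennreal 2 * ?Z' k \<omega>) \<in> borel_measurable M" for k by measurable
    have "(\<lambda>\<omega>. \<integral>\<^sup>+r\<in>{0..s}. ennreal ((simple_process (n k) (t k) (h k) r \<omega> - P k r \<omega>)\<^sup>2) \<partial>lborel) \<in> borel_measurable M" for k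
      using nn_integral_path_measurable[OF measurable_compose[OF borel_measurable_power[OF borel_measurable_diff[OF
        jm(2)[of k] jm(1)[of k]], of 2] measurable_ennreal]] by simp
    then show "(\<lambda>\<omega>. (\<integral>\<^sup>+r\<in>{0..s}. ennreal ((simple_process (n k) (t k) (h k) r \<omega>
       - simple_process (Suc k) (x k) (g k) r \<omega>)\<^sup>2) \<partial>lborel) * indicator ?A \<omega>) \<in> borel_measurable M" for k
      unfolding P_def[symmetric] by measurable
    show "AE \<omega> in M. (\<integral>\<^sup>+r\<in>{0..s}. ennreal ((simple_process (n k) (t k) (h k) r \<omega>
       - simple_process (Suc k) (x k) (g k) r \<omega>)\<^sup>2) \<partial>lborel) * indicator ?A \<omega> \<le> ennreal 2 * ?Z k \<omega> + ennreal 2 * ?Z' k \<omega>" for k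
    proof (rule AE_I2)
      fix \<omega> assume \<omega>: "\<omega> \<in> space M"
      show "(\<integral>\<^sup>+r\<in>{0..s}. ennreal ((simple_process (n k) (t k) (h k) r \<omega>
       - simple_process (Suc k) (x k) (g k) r \<omega>)\<^sup>2) \<partial>lborel) * indicator ?A \<omega> \<le> ennreal 2 * ?Z k \<omega> + ennreal 2 * ?Z' k \<omega>"
      proof (cases "\<omega> \<in> ?A")
        case True
        have GH: "G r \<omega> = H r \<omega>" if "r \<in> {0..s}" for r using True that by (auto simp: G_def)
        have "(\<integral>\<^sup>+r\<in>{0..s}. ennreal ((simple_process (n k) (t k) (h k) r \<omega> - P k r \<omega>)\<^sup>2) \<partial>lborel)
          \<le> ennreal 2 * ?Z k \<omega> + ennreal 2 * ?Z' k \<omega>"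
          by (rule nn_integral_square_triangle[OF path_M[OF jm(2) jm(4) \<omega>] path_M[OF jm(1) jm(3) \<omega>]])
             (use GH in \<open>fastforce simp: abs_if\<close>)
        then show ?thesis using True by (simp add: P_def)
      qed simp
    qed
  qed
  from simple_integrals_close[OF S S' less_imp_le[OF s] A this]
  have lim4: "tendsto_zero_in_prob M (\<lambda>k \<omega>. ennreal \<bar>simple_integral B (n k) (t k) (h k) \<omega> - simple_integral B (Suc k) (x k) (g k) \<omega>\<bar> * indicator ?A \<omega>)" .
  define Z where "Z k \<omega> = (simple_integral B (Suc k) (x k) (g k) \<omega> - W \<omega>) * indicator ?A \<omega>" for k \<omega>
  have Z_M: "Z k \<in> borel_measurable M" for k unfolding Z_def by measurable
  have "tendsto_zero_in_prob M (\<lambda>k \<omega>. ennreal \<bar>Z k \<omega>\<bar>)"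
  proof (rule tendsto_zero_in_prob_bound[OF _ _ _ tendsto_zero_in_prob_add[OF _ _ lim4 lim2]])
    show "(\<lambda>\<omega>. ennreal \<bar>Z k \<omega>\<bar>) \<in> borel_measurable M" for k using Z_M[of k] by measurable
    show "AE \<omega> in M. ennreal \<bar>Z k \<omega>\<bar> \<le> ennreal \<bar>simple_integral B (n k) (t k) (h k) \<omega> - simple_integral B (Suc k) (x k) (g k) \<omega>\<bar> * indicator ?A \<omega>
       + ennreal \<bar>simple_integral B (n k) (t k) (h k) \<omega> - W \<omega>\<bar>" for k
    proof (rule AE_I2)
      fix \<omega>
      show "ennreal \<bar>Z k \<omega>\<bar> \<le> ennreal \<bar>simple_integral B (n k) (t k) (h k) \<omega> - simple_integral B (Suc k) (x k) (g k) \<omega>\<bar> * indicator ?A \<omega>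
         + ennreal \<bar>simple_integral B (n k) (t k) (h k) \<omega> - W \<omega>\<bar>"
      proof (cases "\<omega> \<in> ?A")
        case True
        then have "ennreal \<bar>Z k \<omega>\<bar> = ennreal \<bar>simple_integral B (Suc k) (x k) (g k) \<omega> - W \<omega>\<bar>" by (simp add: Z_def)
        also have "\<dots> \<le> ennreal (\<bar>simple_integral B (n k) (t k) (h k) \<omega> - simple_integral B (Suc k) (x k) (g k) \<omega>\<bar>
           + \<bar>simple_integral B (n k) (t k) (h k) \<omega> - W \<omega>\<bar>)" by (rule ennreal_leI) linarith
        finally show ?thesis using True by (simp add: ennreal_plus)
      qed (simp add: Z_def)
    qed
  qed measurable
  from tendsto_zero_in_prob_AE_subseq[OF Z_M this]
  obtain r where r: "strict_mono r" "AE \<omega> in M. (\<lambda>k. Z (r k) \<omega>) \<longlonglongrightarrow> 0" by blast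
  let ?I = "\<lambda>k \<omega>. simple_integral B (Suc k) (x k) (g k) \<omega>"
  have "(\<integral>\<^sup>+\<omega>. ennreal ((W \<omega>)\<^sup>2) * indicator ?A \<omega> \<partial>M) \<le> (\<integral>\<^sup>+\<omega>. liminf (\<lambda>k. ennreal ((?I (r k) \<omega>)\<^sup>2)) \<partial>M)"
  proof (rule nn_integral_mono_AE)
    show "AE \<omega> in M. ennreal ((W \<omega>)\<^sup>2) * indicator ?A \<omega> \<le> liminf (\<lambda>k. ennreal ((?I (r k) \<omega>)\<^sup>2))"
      using r(2)
    proof eventually_elim
      fix \<omega> assume Z0: "(\<lambda>k. Z (r k) \<omega>) \<longlonglongrightarrow> 0"
      show "ennreal ((W \<omega>)\<^sup>2) * indicator ?A \<omega> \<le> liminf (\<lambda>k. ennreal ((?I (r k) \<omega>)\<^sup>2))"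
      proof (cases "\<omega> \<in> ?A")
        case True
        have "(\<lambda>k. Z (r k) \<omega> + W \<omega>) \<longlonglongrightarrow> 0 + W \<omega>" by (intro tendsto_intros Z0)
        then have "(\<lambda>k. ?I (r k) \<omega>) \<longlonglongrightarrow> W \<omega>" using True by (simp add: Z_def)
        then have "(\<lambda>k. ennreal ((?I (r k) \<omega>)\<^sup>2)) \<longlonglongrightarrow> ennreal ((W \<omega>)\<^sup>2)"
          by (intro tendsto_ennrealI tendsto_intros)
        then have "liminf (\<lambda>k. ennreal ((?I (r k) \<omega>)\<^sup>2)) = ennreal ((W \<omega>)\<^sup>2)" by (intro lim_imp_Liminf) auto
        then show ?thesis using True by simp
      qed simp
    qed
  qed
  also have "\<dots> \<le> liminf (\<lambda>k. \<integral>\<^sup>+\<omega>. ennreal ((?I (r k) \<omega>)\<^sup>2) \<partial>M)"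
    by (rule nn_integral_liminf) measurable
  also have "\<dots> = liminf (\<lambda>k. \<integral>\<^sup>+\<omega>. (\<integral>\<^sup>+q\<in>{0..s}. ennreal ((P (r k) q \<omega>)\<^sup>2) \<partial>lborel) \<partial>M)"
    unfolding simple_integral_isometry[OF S'] P_def ..
  also have "\<dots> = (\<integral>\<^sup>+\<omega>. (\<integral>\<^sup>+q\<in>{0..s}. ennreal ((G q \<omega>)\<^sup>2) \<partial>lborel) \<partial>M)"
  proof (rule lim_imp_Liminf[OF sequentially_bot])
    have P_bnd: "\<bar>P k q \<omega>\<bar> \<le> C" if "q \<in> {0..s}" "\<omega> \<in> space M" for k q \<omega>
      using grid_step_tendsto(2)[OF s G_bnd G_left[OF that(2)] that(1), of k]
      unfolding P_def simple_process_def g_def x_def by simp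
    have "(\<lambda>k. \<integral>\<^sup>+\<omega>. (\<integral>\<^sup>+q\<in>{0..s}. ennreal ((P k q \<omega>)\<^sup>2) \<partial>lborel) \<partial>M) \<longlonglongrightarrow> (\<integral>\<^sup>+\<omega>. (\<integral>\<^sup>+q\<in>{0..s}. ennreal ((G q \<omega>)\<^sup>2) \<partial>lborel) \<partial>M)"
    proof (rule nn_integral_dominated_convergence[where w = "\<lambda>_. ennreal (C\<^sup>2 * s)"])
      show "(\<lambda>\<omega>. \<integral>\<^sup>+q\<in>{0..s}. ennreal ((P k q \<omega>)\<^sup>2) \<partial>lborel) \<in> borel_measurable M" for k
        using nn_integral_path_measurable[OF measurable_compose[OF borel_measurable_power[OF jm(1)[of k], of 2] measurable_ennreal]] by simp
      show "(\<lambda>\<omega>. \<integral>\<^sup>+q\<in>{0..s}. ennreal ((G q \<omega>)\<^sup>2) \<partial>lborel) \<in> borel_measurable M"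
        using nn_integral_path_measurable[OF measurable_compose[OF borel_measurable_power[OF jm(3), of 2] measurable_ennreal]] by simp
      show "AE \<omega> in M. (\<integral>\<^sup>+q\<in>{0..s}. ennreal ((P k q \<omega>)\<^sup>2) \<partial>lborel) \<le> ennreal (C\<^sup>2 * s)" for k
      proof (rule AE_I2)
        fix \<omega> assume \<omega>: "\<omega> \<in> space M"
        have "(\<integral>\<^sup>+q\<in>{0..s}. ennreal ((P k q \<omega>)\<^sup>2) \<partial>lborel) \<le> (\<integral>\<^sup>+q\<in>{0..s}. ennreal (C\<^sup>2) \<partial>lborel)"
        proof (rule nn_integral_mono)
          fix q
          have "(P k q \<omega>)\<^sup>2 \<le> C\<^sup>2" if "q \<in> {0..s}"
            using P_bnd[OF that \<omega>, of k] C by (simp add: abs_le_square_iff[symmetric])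
          then show "ennreal ((P k q \<omega>)\<^sup>2) * indicator {0..s} q \<le> ennreal (C\<^sup>2) * indicator {0..s} q"
            by (auto simp: indicator_def ennreal_leI)
        qed
        also have "\<dots> = ennreal (C\<^sup>2 * s)" using s by (simp add: nn_integral_cmult_indicator ennreal_mult)
        finally show "(\<integral>\<^sup>+q\<in>{0..s}. ennreal ((P k q \<omega>)\<^sup>2) \<partial>lborel) \<le> ennreal (C\<^sup>2 * s)" .
      qed
      show "AE \<omega> in M. (\<lambda>k. \<integral>\<^sup>+q\<in>{0..s}. ennreal ((P k q \<omega>)\<^sup>2) \<partial>lborel) \<longlonglongrightarrow> (\<integral>\<^sup>+q\<in>{0..s}. ennreal ((G q \<omega>)\<^sup>2) \<partial>lborel)"
        by (rule AE_I2) (rule P_lim)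
    qed (auto simp: emeasure_space_1)
    from LIMSEQ_subseq_LIMSEQ[OF this r(1)]
    show "(\<lambda>k. \<integral>\<^sup>+\<omega>. (\<integral>\<^sup>+q\<in>{0..s}. ennreal ((P (r k) q \<omega>)\<^sup>2) \<partial>lborel) \<partial>M) \<longlonglongrightarrow> (\<integral>\<^sup>+\<omega>. (\<integral>\<^sup>+q\<in>{0..s}. ennreal ((G q \<omega>)\<^sup>2) \<partial>lborel) \<partial>M)"
      by (simp add: comp_def)
  qed
  finally show "(\<integral>\<^sup>+\<omega>. ennreal ((W \<omega>)\<^sup>2) * indicator ?A \<omega> \<partial>M) \<le> (\<integral>\<^sup>+\<omega>. (\<integral>\<^sup>+r\<in>{0..s}. ennreal ((G r \<omega>)\<^sup>2) \<partial>lborel) \<partial>M)" .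
qed

end

section \<open>Uniqueness of the controlled state\<close>

text \<open>
  Iterating the hypothesis halves the constant in the bound \<open>f t \<le> K exp (2 C t)\<close> each time. Unlike the usual
  iteration with \<open>t ^ n / n!\<close>, this involves the integral of a single function.
\<close>

lemma gronwall_zero_ennreal:
  fixes f :: "real \<Rightarrow> ennreal"
  assumes C: "0 < C" and K: "\<And>t. t \<in> {0..T} \<Longrightarrow> f t \<le> ennreal K" "0 \<le> K"
    and ineq: "\<And>t. t \<in> {0..T} \<Longrightarrow> f t \<le> ennreal C * (\<integral>\<^sup>+r\<in>{0..t}. f r \<partial>lborel)"
    and t: "t \<in> {0..T}"
  shows "f t = 0"
proof -
  have *: "f t \<le> ennreal (K / 2 ^ n * exp (2 * C * t))" if "t \<in> {0..T}" for n t
    using that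
  proof (induction n arbitrary: t)
    case 0
    have "K * 1 \<le> K * exp (2 * C * t)" using 0 C K(2) by (intro mult_left_mono) auto
    then show ?case using order_trans[OF K(1)[OF 0] ennreal_leI] by simp
  next
    case (Suc n)
    let ?k = "K / 2 ^ n"
    have k: "0 \<le> ?k" using K(2) by simp
    have "(\<integral>\<^sup>+r\<in>{0..t}. f r \<partial>lborel) \<le> (\<integral>\<^sup>+r\<in>{0..t}. ennreal (?k * exp (2 * C * r)) \<partial>lborel)"
      by (rule nn_integral_mono) (use Suc in \<open>auto simp: indicator_def\<close>)
    also have "\<dots> = ennreal (?k * exp (2 * C * t) / (2 * C) - ?k * exp (2 * C * 0) / (2 * C))"
      by (rule nn_integral_FTC_Icc)
         (use Suc.prems C k in \<open>auto intro!: derivative_eq_intros simp: field_simps\<close>)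
    also have "\<dots> \<le> ennreal (?k * exp (2 * C * t) / (2 * C))"
      using K(2) C by (intro ennreal_leI) simp
    finally have "ennreal C * (\<integral>\<^sup>+r\<in>{0..t}. f r \<partial>lborel) \<le> ennreal C * ennreal (?k * exp (2 * C * t) / (2 * C))"
      by (rule mult_left_mono) simp
    also have "\<dots> = ennreal (K / 2 ^ Suc n * exp (2 * C * t))"
    proof -
      have "0 \<le> ?k * exp (2 * C * t) / (2 * C)" using C K(2) by (intro divide_nonneg_nonneg mult_nonneg_nonneg) auto
      then have "ennreal C * ennreal (?k * exp (2 * C * t) / (2 * C)) = ennreal (C * (?k * exp (2 * C * t) / (2 * C)))"
        using C by (intro ennreal_mult[symmetric]) auto
      also have "C * (?k * exp (2 * C * t) / (2 * C)) = K / 2 ^ Suc n * exp (2 * C * t)" using C by (simp add: field_simps)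
      finally show ?thesis .
    qed
    finally show ?case using ineq[OF Suc.prems] by (rule order_trans[rotated])
  qed
  have "(\<lambda>n. K * exp (2 * C * t) * (1 / 2) ^ n) \<longlonglongrightarrow> K * exp (2 * C * t) * 0"
    by (intro tendsto_intros LIMSEQ_power_zero) simp
  then have "(\<lambda>n. ennreal (K / 2 ^ n * exp (2 * C * t))) \<longlonglongrightarrow> ennreal 0"
    by (intro tendsto_ennrealI) (simp add: power_divide mult_ac)
  from LIMSEQ_le_const[OF this] *[OF t] show ?thesis by (metis ennreal_0 le_zero_eq)
qed

text \<open>
  Cauchy--Schwarz against the constant \<open>1\<close>, from the nonnegativity of the integral of \<open>(h - m)\<^sup>2\<close> with \<open>m\<close> the mean.
\<close>

lemma integral_square_le:
  fixes h :: "real \<Rightarrow> real"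
  assumes t: "0 < t" and h: "continuous_on {0..t} h"
  shows "(LBINT r:{0..t}. h r)\<^sup>2 \<le> t * (LBINT r:{0..t}. (h r)\<^sup>2)"
proof -
  define m where "m = (LBINT r:{0..t}. h r) / t"
  have i1: "set_integrable lborel {0..t} h" and i2: "set_integrable lborel {0..t} (\<lambda>r. (h r)\<^sup>2)"
    and i3: "set_integrable lborel {0..t} (\<lambda>r. 2 * m * h r)" and i4: "set_integrable lborel {0..t} (\<lambda>r. m\<^sup>2)"
    by (intro borel_integrable_atLeastAtMost' continuous_intros h)+
  have "0 \<le> (LBINT r:{0..t}. (h r - m)\<^sup>2)"
    unfolding set_lebesgue_integral_def by (rule integral_nonneg_AE, rule AE_I2) (simp add: indicator_def)
  also have "(\<lambda>r. (h r - m)\<^sup>2) = (\<lambda>r. ((h r)\<^sup>2 - 2 * m * h r) + m\<^sup>2)"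
    by (auto simp: power2_eq_square algebra_simps)
  also have "(LBINT r:{0..t}. ((h r)\<^sup>2 - 2 * m * h r) + m\<^sup>2)
      = (LBINT r:{0..t}. (h r)\<^sup>2) - (LBINT r:{0..t}. 2 * m * h r) + (LBINT r:{0..t}. m\<^sup>2)"
    using set_integral_add(2)[OF set_integral_diff(1)[OF i2 i3] i4] set_integral_diff(2)[OF i2 i3] by simp
  also have "(LBINT r:{0..t}. 2 * m * h r) = 2 * m * (m * t)" using t by (simp add: m_def)
  also have "(LBINT r:{0..t}. m\<^sup>2) = m\<^sup>2 * t" using t by (simp add: set_lebesgue_integral_def)
  finally have "m\<^sup>2 * t \<le> (LBINT r:{0..t}. (h r)\<^sup>2)" by (simp add: power2_eq_square algebra_simps)
  then have "t * (m\<^sup>2 * t) \<le> t * (LBINT r:{0..t}. (h r)\<^sup>2)" using t by (intro mult_left_mono) auto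
  moreover have "t * (m\<^sup>2 * t) = (LBINT r:{0..t}. h r)\<^sup>2" using t by (simp add: m_def power2_eq_square)
  ultimately show ?thesis by simp
qed

lemma nn_integral_Icc_continuous:
  fixes h :: "real \<Rightarrow> real"
  assumes h: "continuous_on {a..b} h" and nn: "\<And>r. r \<in> {a..b} \<Longrightarrow> 0 \<le> h r"
  shows "(\<integral>\<^sup>+r\<in>{a..b}. ennreal (h r) \<partial>lborel) = ennreal (LBINT r:{a..b}. h r)"
proof -
  have "(\<integral>\<^sup>+r\<in>{a..b}. ennreal (h r) \<partial>lborel) = (\<integral>\<^sup>+r. ennreal (indicator {a..b} r *\<^sub>R h r) \<partial>lborel)"
    by (rule nn_integral_cong) (auto simp: indicator_def)
  also have "\<dots> = ennreal (LBINT r:{a..b}. h r)"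
    unfolding set_lebesgue_integral_def
    by (rule nn_integral_eq_integral[OF borel_integrable_atLeastAtMost'[OF h, unfolded set_integrable_def]])
       (use nn in \<open>auto intro!: AE_I2 simp: indicator_def\<close>)
  finally show ?thesis .
qed

context brownian_motion
begin

text \<open>
  Let \<open>G N\<close> be \<open>H\<close> cut off when it exceeds \<open>N\<close>. On the event that \<open>H\<close> has stayed below \<open>N\<close> up to time \<open>t\<close>
  the equation and \<open>ito_integral_local_bound\<close> bound the second moment \<open>f t\<close> of \<open>G N t\<close> by a multiple of \<open>\<integral>\<^sub>0\<^sup>t f\<close>; off this event
  \<open>G N t\<close> is \<open>0\<close>. As \<open>f\<close> is bounded by \<open>N\<^sup>2\<close>, Gronwall's lemma gives \<open>f = 0\<close>. Each path stays below some \<open>N\<close>,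
  and by continuity the points of all grids suffice.
\<close>

lemma linear_sde_zero:
  fixes H :: "real \<Rightarrow> 'a \<Rightarrow> real"
  assumes T: "0 < T" and adapted: "\<And>q. q \<in> {0..T} \<Longrightarrow> H q \<in> borel_measurable (F q)"
    and cont: "\<And>\<omega>. \<omega> \<in> space M \<Longrightarrow> continuous_on {0..T} (\<lambda>q. H q \<omega>)"
    and init: "AE \<omega> in M. H 0 \<omega> = 0"
    and sde: "\<And>t. t \<in> {0<..T} \<Longrightarrow> \<exists>W. has_ito_integral M F B t H W \<and>
        (AE \<omega> in M. H t \<omega> = - \<delta> * (LBINT r:{0..t}. H r \<omega>) + \<sigma> * W \<omega>)"
  shows "AE \<omega> in M. \<forall>t\<in>{0..T}. H t \<omega> = 0"
proof -
  define G where "G N r \<omega> = (if \<forall>p\<in>{0..r}. \<bar>H p \<omega>\<bar> \<le> real N then H r \<omega> else 0)" for N :: nat and r \<omega>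
  \<comment> \<open>from \<open>(a + b)\<^sup>2 \<le> 2 a\<^sup>2 + 2 b\<^sup>2\<close>; the summand \<open>1\<close> only makes \<open>C\<close> positive when \<open>\<delta> = \<sigma> = 0\<close>\<close>
  define C where "C = 2 * \<delta>\<^sup>2 * T + 2 * \<sigma>\<^sup>2 + 1"
  have C: "0 < C" unfolding C_def using T by (simp add: add_nonneg_pos)
  have G_zero: "AE \<omega> in M. G N t \<omega> = 0" if t: "t \<in> {0..T}" for N t
  proof -
    have ad: "\<And>q. q \<in> {0..t} \<Longrightarrow> H q \<in> borel_measurable (F q)" if "t \<le> T" for t using that adapted by auto
    have ct: "\<And>\<omega>. \<omega> \<in> space M \<Longrightarrow> continuous_on {0..t} (\<lambda>q. H q \<omega>)" if "t \<le> T" for t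
      by (rule continuous_on_subset[OF cont]) (use that in auto)
    obtain W where W: "has_ito_integral M F B T H W" using sde[of T] T by auto
    have prog: "progressive F T (G N)"
      using ito_integral_local_bound(1)[OF T adapted cont _ W, of "real N"] unfolding G_def[abs_def] by simp
    have G_M: "(\<lambda>p. G N (fst p) (snd p)) \<in> borel_measurable (restrict_space lborel {0..t} \<Otimes>\<^sub>M M)" if "t \<in> {0..T}" for t
      using progressive_measurable_M[OF progressive_mono[OF prog]] that by auto
    have G_tM: "G N t \<in> borel_measurable M" if t: "t \<in> {0..T}" for t
      using measurable_compose[OF measurable_Pair1' G_M[OF t], of t] t by (simp add: space_restrict_space)
    define f where "f t = (\<integral>\<^sup>+\<omega>. ennreal ((G N t \<omega>)\<^sup>2) \<partial>M)" for t
    have "f t = 0" if t: "t \<in> {0..T}" for t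
    proof (rule gronwall_zero_ennreal[OF C _ _ _ t])
      fix t assume t: "t \<in> {0..T}"
      have "f t \<le> (\<integral>\<^sup>+\<omega>. ennreal ((real N)\<^sup>2) \<partial>M)"
        unfolding f_def
      proof (rule nn_integral_mono, rule ennreal_leI)
        fix \<omega> have "\<bar>G N t \<omega>\<bar> \<le> \<bar>real N\<bar>" using t by (auto simp: G_def)
        then show "(G N t \<omega>)\<^sup>2 \<le> (real N)\<^sup>2" by (simp only: abs_le_square_iff)
      qed
      then show "f t \<le> ennreal ((real N)\<^sup>2)" by (simp add: emeasure_space_1)
      show "f t \<le> ennreal C * (\<integral>\<^sup>+r\<in>{0..t}. f r \<partial>lborel)"
      proof (cases "t = 0")
        case True
        have "f t = (\<integral>\<^sup>+\<omega>. 0 \<partial>M)"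
          unfolding f_def True by (rule nn_integral_cong_AE) (use init in eventually_elim, simp add: G_def)
        then show ?thesis by simp
      next
        case False
        then have t0: "0 < t" "t \<le> T" using t by auto
        let ?A = "{\<omega> \<in> space M. \<forall>p\<in>{0..t}. \<bar>H p \<omega>\<bar> \<le> real N}"
        let ?L = "restrict_space lborel {0..t}"
        obtain W where W: "has_ito_integral M F B t H W"
          and eq: "AE \<omega> in M. H t \<omega> = - \<delta> * (LBINT r:{0..t}. H r \<omega>) + \<sigma> * W \<omega>"
          using sde[of t] t0 by auto
        have W_M: "W \<in> borel_measurable M" using W by (simp add: has_ito_integral_def)
        have A_F: "?A \<in> sets (F t)"
          by (rule path_bounded_event[OF _ measurable_F_mono[OF _ _ ad[OF t0(2)]] ct[OF t0(2)]]) (use t0 in auto)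
        have "sets (F t) \<subseteq> events" using subalgebra_F[of t] t0 unfolding subalgebra_def by simp
        then have A_M: "?A \<in> events" using A_F by (rule subsetD)
        let ?S = "\<lambda>\<omega>. \<integral>\<^sup>+r\<in>{0..t}. ennreal ((G N r \<omega>)\<^sup>2) \<partial>lborel"
        have S_M: "?S \<in> borel_measurable M"
          using nn_integral_path_measurable[OF measurable_compose[OF borel_measurable_power[OF G_M[OF t], of 2] measurable_ennreal]] by simp
        have "f t \<le> (\<integral>\<^sup>+\<omega>. ennreal (2 * \<delta>\<^sup>2 * T) * ?S \<omega> + ennreal (2 * \<sigma>\<^sup>2) * (ennreal ((W \<omega>)\<^sup>2) * indicator ?A \<omega>) \<partial>M)"
          unfolding f_def
        proof (rule nn_integral_mono_AE)
          show "AE \<omega> in M. ennreal ((G N t \<omega>)\<^sup>2)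
             \<le> ennreal (2 * \<delta>\<^sup>2 * T) * ?S \<omega> + ennreal (2 * \<sigma>\<^sup>2) * (ennreal ((W \<omega>)\<^sup>2) * indicator ?A \<omega>)"
            using eq AE_space
          proof eventually_elim
            fix \<omega> assume eq: "H t \<omega> = - \<delta> * (LBINT r:{0..t}. H r \<omega>) + \<sigma> * W \<omega>" and \<omega>: "\<omega> \<in> space M"
            show "ennreal ((G N t \<omega>)\<^sup>2) \<le> ennreal (2 * \<delta>\<^sup>2 * T) * ?S \<omega> + ennreal (2 * \<sigma>\<^sup>2) * (ennreal ((W \<omega>)\<^sup>2) * indicator ?A \<omega>)"
            proof (cases "\<omega> \<in> ?A")
              case True
              have GH: "G N r \<omega> = H r \<omega>" if "r \<in> {0..t}" for r using True that by (auto simp: G_def)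
              let ?I = "LBINT r:{0..t}. (H r \<omega>)\<^sup>2"
              have S_eq: "?S \<omega> = ennreal ?I"
              proof -
                have "?S \<omega> = (\<integral>\<^sup>+r\<in>{0..t}. ennreal ((H r \<omega>)\<^sup>2) \<partial>lborel)"
                  by (rule nn_integral_cong) (use GH in \<open>auto simp: indicator_def\<close>)
                also have "\<dots> = ennreal ?I"
                  by (rule nn_integral_Icc_continuous) (auto intro!: continuous_intros ct[OF t0(2) \<omega>])
                finally show ?thesis .
              qed
              have I_nn: "0 \<le> ?I" unfolding set_lebesgue_integral_def
                by (rule integral_nonneg_AE, rule AE_I2) (simp add: indicator_def)
              have "(H t \<omega>)\<^sup>2 \<le> 2 * \<delta>\<^sup>2 * (LBINT r:{0..t}. H r \<omega>)\<^sup>2 + 2 * \<sigma>\<^sup>2 * (W \<omega>)\<^sup>2"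
                unfolding eq using zero_le_power2[of "\<delta> * (LBINT r:{0..t}. H r \<omega>) + \<sigma> * W \<omega>"]
                by (simp add: power2_eq_square algebra_simps)
              also have "2 * \<delta>\<^sup>2 * (LBINT r:{0..t}. H r \<omega>)\<^sup>2 \<le> 2 * \<delta>\<^sup>2 * (t * ?I)"
                by (intro mult_left_mono integral_square_le t0(1) ct[OF t0(2) \<omega>]) simp
              also have "\<dots> \<le> 2 * \<delta>\<^sup>2 * (T * ?I)" using t0 I_nn by (intro mult_left_mono mult_right_mono) auto
              finally have "(H t \<omega>)\<^sup>2 \<le> 2 * \<delta>\<^sup>2 * T * ?I + 2 * \<sigma>\<^sup>2 * (W \<omega>)\<^sup>2" by (simp add: mult.assoc)
              then have "ennreal ((H t \<omega>)\<^sup>2) \<le> ennreal (2 * \<delta>\<^sup>2 * T * ?I + 2 * \<sigma>\<^sup>2 * (W \<omega>)\<^sup>2)" by (rule ennreal_leI)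
              also have "\<dots> = ennreal (2 * \<delta>\<^sup>2 * T) * ennreal ?I + ennreal (2 * \<sigma>\<^sup>2) * ennreal ((W \<omega>)\<^sup>2)"
                using I_nn T by (simp add: ennreal_mult ennreal_plus)
              finally show ?thesis using True GH[of t] t0 unfolding S_eq by simp
            next
              case False
              then have "\<not> (\<forall>p\<in>{0..t}. \<bar>H p \<omega>\<bar> \<le> real N)" using \<omega> by blast
              then have "G N t \<omega> = 0" by (simp only: G_def if_False)
              then show ?thesis by simp
            qed
          qed
        qed
        also have "\<dots> = ennreal (2 * \<delta>\<^sup>2 * T) * (\<integral>\<^sup>+\<omega>. ?S \<omega> \<partial>M)
            + ennreal (2 * \<sigma>\<^sup>2) * (\<integral>\<^sup>+\<omega>. ennreal ((W \<omega>)\<^sup>2) * indicator ?A \<omega> \<partial>M)"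
        proof -
          have m2: "(\<lambda>\<omega>. ennreal ((W \<omega>)\<^sup>2) * indicator ?A \<omega>) \<in> borel_measurable M"
            using W_M A_M by measurable
          show ?thesis using S_M m2 by (subst nn_integral_add) (auto simp: nn_integral_cmult)
        qed
        also have "\<dots> \<le> ennreal (2 * \<delta>\<^sup>2 * T) * (\<integral>\<^sup>+\<omega>. ?S \<omega> \<partial>M) + ennreal (2 * \<sigma>\<^sup>2) * (\<integral>\<^sup>+\<omega>. ?S \<omega> \<partial>M)"
          using ito_integral_local_bound(2)[OF t0(1) ad[OF t0(2)] ct[OF t0(2)] _ W, of "real N"]
          unfolding G_def by (intro add_left_mono mult_left_mono) auto
        also have "\<dots> = ennreal (2 * \<delta>\<^sup>2 * T + 2 * \<sigma>\<^sup>2) * (\<integral>\<^sup>+\<omega>. ?S \<omega> \<partial>M)"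
          using T by (simp add: ennreal_plus distrib_right)
        also have "\<dots> \<le> ennreal C * (\<integral>\<^sup>+\<omega>. ?S \<omega> \<partial>M)"
          unfolding C_def by (intro mult_right_mono ennreal_leI) auto
        also have "(\<integral>\<^sup>+\<omega>. ?S \<omega> \<partial>M) = (\<integral>\<^sup>+r\<in>{0..t}. f r \<partial>lborel)"
        proof -
          interpret L: finite_measure ?L by (rule finite_measure_lborel_Icc)
          interpret P: pair_sigma_finite ?L M ..
          have "(\<integral>\<^sup>+\<omega>. (\<integral>\<^sup>+r. ennreal ((G N r \<omega>)\<^sup>2) \<partial>?L) \<partial>M) = (\<integral>\<^sup>+r. (\<integral>\<^sup>+\<omega>. ennreal ((G N r \<omega>)\<^sup>2) \<partial>M) \<partial>?L)"
            using P.Fubini[OF measurable_compose[OF borel_measurable_power[OF G_M[OF t], of 2] measurable_ennreal]] by simp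
          then show ?thesis by (simp add: nn_integral_restrict_space f_def)
        qed
        finally show ?thesis .
      qed
    qed simp
    from this[OF t] have "(\<integral>\<^sup>+\<omega>. ennreal ((G N t \<omega>)\<^sup>2) \<partial>M) = 0" by (simp add: f_def)
    moreover have "(\<lambda>\<omega>. ennreal ((G N t \<omega>)\<^sup>2)) \<in> borel_measurable M"
      by (intro measurable_compose[OF _ measurable_ennreal] borel_measurable_power G_tM t)
    ultimately have "AE \<omega> in M. ennreal ((G N t \<omega>)\<^sup>2) = 0" by (simp add: nn_integral_0_iff_AE)
    then show ?thesis by eventually_elim simp
  qed
  have "AE \<omega> in M. \<forall>N k. \<forall>i\<in>{..Suc k}. G N (T * real i / real (Suc k)) \<omega> = 0"
    unfolding AE_all_countable
    by (intro allI AE_finite_allI G_zero grid_point_mem) (use T in auto)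
  then show ?thesis
    using AE_space
  proof eventually_elim
    fix \<omega> assume G0: "\<forall>N k. \<forall>i\<in>{..Suc k}. G N (T * real i / real (Suc k)) \<omega> = 0" and \<omega>: "\<omega> \<in> space M"
    obtain K where K: "\<forall>r\<in>{0..T}. \<bar>H r \<omega>\<bar> \<le> K" using continuous_on_Icc_bounded[OF cont[OF \<omega>]] by blast
    obtain N :: nat where N: "K \<le> real N" using real_arch_simple by blast
    have "\<bar>H (T * real i / real (Suc k)) \<omega>\<bar> \<le> 0" if i: "i \<in> {..Suc k}" for k i
    proof -
      have q: "T * real i / real (Suc k) \<in> {0..T}" by (rule grid_point_mem) (use T i in auto)
      have "\<forall>p\<in>{0..T * real i / real (Suc k)}. \<bar>H p \<omega>\<bar> \<le> real N"
        using K N q by (meson atLeastAtMost_iff order_trans)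
      then show ?thesis using G0[rule_format, OF i, of N] by (simp add: G_def)
    qed
    then have "\<forall>r\<in>{0..T}. \<bar>H r \<omega>\<bar> \<le> 0"
      using path_bounded_iff_grid[OF less_imp_le[OF T] cont[OF \<omega>], of 0] by blast
    then show "\<forall>t\<in>{0..T}. H t \<omega> = 0" by simp
  qed
qed

text \<open>
  Scaled by \<open>\<sigma>\<close>, the difference of two solutions solves the homogeneous equation with zero initial value. The initial
  value, which need not be square integrable, and the control have dropped out.
\<close>

theorem strong_solution_unique:
  assumes T: "0 < T" and \<sigma>: "0 < \<sigma>" and u: "u \<in> admissible M F T"
    and X: "strong_solution M F B \<delta> \<sigma> T \<xi> u X" and X': "strong_solution M F B \<delta> \<sigma> T \<xi> u X'"
  shows "AE \<omega> in M. \<forall>s\<in>{0..T}. X s \<omega> = X' s \<omega>"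
proof -
  note X = X[unfolded strong_solution_def] and X' = X'[unfolded strong_solution_def]
  let ?H = "\<lambda>r \<omega>. \<sigma> * X r \<omega> - \<sigma> * X' r \<omega>"
  have "AE \<omega> in M. \<forall>t\<in>{0..T}. ?H t \<omega> = 0"
  proof (rule linear_sde_zero[OF T])
    show "?H q \<in> borel_measurable (F q)" if "q \<in> {0..T}" for q
    proof -
      have "X q \<in> borel_measurable (F q)" "X' q \<in> borel_measurable (F q)" using X X' that by auto
      then show ?thesis by measurable
    qed
    have c: "continuous_on {0..T} (\<lambda>q. X q \<omega>)" "continuous_on {0..T} (\<lambda>q. X' q \<omega>)" if "\<omega> \<in> space M" for \<omega>
      using X X' that by auto
    show "continuous_on {0..T} (\<lambda>q. ?H q \<omega>)" if "\<omega> \<in> space M" for \<omega>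
      by (intro continuous_intros c that)
    have "AE \<omega> in M. X 0 \<omega> = \<xi> \<omega>" "AE \<omega> in M. X' 0 \<omega> = \<xi> \<omega>" using X X' by auto
    then show "AE \<omega> in M. ?H 0 \<omega> = 0" by eventually_elim simp
    fix t assume t: "t \<in> {0<..T}"
    obtain Y where Y: "has_ito_integral M F B t (\<lambda>r \<omega>. \<sigma> * X r \<omega>) Y"
      "AE \<omega> in M. X t \<omega> = \<xi> \<omega> + (LBINT r:{0..t}. - \<delta> * X r \<omega> + u r \<omega>) + Y \<omega>" using X t by blast
    obtain Y' where Y': "has_ito_integral M F B t (\<lambda>r \<omega>. \<sigma> * X' r \<omega>) Y'"
      "AE \<omega> in M. X' t \<omega> = \<xi> \<omega> + (LBINT r:{0..t}. - \<delta> * X' r \<omega> + u r \<omega>) + Y' \<omega>" using X' t by blast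
    have "has_ito_integral M F B t ?H (\<lambda>\<omega>. Y \<omega> - Y' \<omega>)"
      by (rule has_ito_integral_diff[OF _ Y(1) Y'(1)]) (use t in auto)
    moreover have "AE \<omega> in M. ?H t \<omega> = - \<delta> * (LBINT r:{0..t}. ?H r \<omega>) + \<sigma> * (Y \<omega> - Y' \<omega>)"
      using Y(2) Y'(2) admissible_path_integrable[OF less_imp_le[OF T] u] AE_space
    proof eventually_elim
      fix \<omega> assume eq: "X t \<omega> = \<xi> \<omega> + (LBINT r:{0..t}. - \<delta> * X r \<omega> + u r \<omega>) + Y \<omega>"
        "X' t \<omega> = \<xi> \<omega> + (LBINT r:{0..t}. - \<delta> * X' r \<omega> + u r \<omega>) + Y' \<omega>"
        and ui: "set_integrable lborel {0..T} (\<lambda>s. u s \<omega>)" and \<omega>: "\<omega> \<in> space M"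
      have u_int: "set_integrable lborel {0..t} (\<lambda>s. u s \<omega>)" by (rule set_integrable_subset[OF ui]) (use t in auto)
      have x_int: "set_integrable lborel {0..t} (\<lambda>r. X r \<omega>)" "set_integrable lborel {0..t} (\<lambda>r. X' r \<omega>)"
        by (rule borel_integrable_atLeastAtMost', rule continuous_on_subset[OF c(1)[OF \<omega>]], use t in auto)
           (rule borel_integrable_atLeastAtMost', rule continuous_on_subset[OF c(2)[OF \<omega>]], use t in auto)
      have lin: "(LBINT r:{0..t}. - \<delta> * x r + u r \<omega>) = - \<delta> * (LBINT r:{0..t}. x r) + (LBINT r:{0..t}. u r \<omega>)"
        if "set_integrable lborel {0..t} x" for x
      proof -
        have "set_integrable lborel {0..t} (\<lambda>r. - \<delta> * x r)" using that by (rule set_integrable_mult_right)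
        then have "(LBINT r:{0..t}. - \<delta> * x r + u r \<omega>) = (LBINT r:{0..t}. - \<delta> * x r) + (LBINT r:{0..t}. u r \<omega>)"
          by (rule set_integral_add(2)[OF _ u_int])
        then show ?thesis by (simp only: set_integral_mult_right)
      qed
      have I: "(LBINT r:{0..t}. ?H r \<omega>) = \<sigma> * (LBINT r:{0..t}. X r \<omega>) - \<sigma> * (LBINT r:{0..t}. X' r \<omega>)"
        using set_integral_diff(2)[OF set_integrable_mult_right[OF x_int(1)] set_integrable_mult_right[OF x_int(2)], of \<sigma> \<sigma>]
        by (simp only: set_integral_mult_right)
      show "?H t \<omega> = - \<delta> * (LBINT r:{0..t}. ?H r \<omega>) + \<sigma> * (Y \<omega> - Y' \<omega>)"
        unfolding I eq lin[OF x_int(1)] lin[OF x_int(2)] by (simp add: algebra_simps)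
    qed
    ultimately show "\<exists>W. has_ito_integral M F B t ?H W \<and>
        (AE \<omega> in M. ?H t \<omega> = - \<delta> * (LBINT r:{0..t}. ?H r \<omega>) + \<sigma> * W \<omega>)"
      by (intro exI[of _ "\<lambda>\<omega>. Y \<omega> - Y' \<omega>"]) simp
  qed
  then show ?thesis by eventually_elim (use \<sigma> in auto)
qed

end

section \<open>The objective and the equilibria\<close>

lemma quasi_integral_AE_cong:
  assumes "AE x in N. f x = g x"
  shows "quasi_integral N f = quasi_integral N g"
proof -
  have "(\<integral>\<^sup>+x. e2ennreal (f x) \<partial>N) = (\<integral>\<^sup>+x. e2ennreal (g x) \<partial>N)"
    by (rule nn_integral_cong_AE) (use assms in eventually_elim, simp)
  moreover have "(\<integral>\<^sup>+x. e2ennreal (- f x) \<partial>N) = (\<integral>\<^sup>+x. e2ennreal (- g x) \<partial>N)"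
    by (rule nn_integral_cong_AE) (use assms in eventually_elim, simp)
  ultimately show ?thesis by (simp add: quasi_integral_def)
qed

lemma quasi_integral_integrable:
  fixes f :: "'b \<Rightarrow> real"
  assumes f: "integrable N f"
  shows "quasi_integral N (\<lambda>x. ereal (f x)) = ereal (\<integral>x. f x \<partial>N)"
proof -
  have e: "e2ennreal (ereal x) = ennreal x" "e2ennreal (- ereal x) = ennreal (- x)" for x
    by (simp_all add: ennreal.rep_eq e2ennreal_def ennreal_def max_def)
  have fin: "(\<integral>\<^sup>+x. ennreal (f x) \<partial>N) \<noteq> \<infinity>" "(\<integral>\<^sup>+x. ennreal (- f x) \<partial>N) \<noteq> \<infinity>"
    using f by (auto simp: real_integrable_def)
  have en: "enn2ereal x = ereal (enn2real x)" if "x \<noteq> \<infinity>" for x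
    using that by (cases x) (auto simp: enn2ereal_ennreal)
  show ?thesis
    unfolding quasi_integral_def e en[OF fin(1)] en[OF fin(2)] using real_lebesgue_integral_def[OF f] by simp
qed

text \<open>
  For integrable functions the iterated extended-valued integral in the definition of the objective is
  Fubini's theorem.
\<close>

lemma (in pair_sigma_finite) quasi_integral_iterated:
  fixes f :: "'a \<times> 'b \<Rightarrow> real"
  assumes f: "integrable (M1 \<Otimes>\<^sub>M M2) f"
  shows "quasi_integral M1 (\<lambda>x. quasi_integral M2 (\<lambda>y. ereal (f (x, y)))) = ereal (\<integral>p. f p \<partial>(M1 \<Otimes>\<^sub>M M2))"
proof -
  have "AE x in M1. quasi_integral M2 (\<lambda>y. ereal (f (x, y))) = ereal (\<integral>y. f (x, y) \<partial>M2)"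
    using AE_integrable_fst'[OF f] by eventually_elim (rule quasi_integral_integrable)
  then have "quasi_integral M1 (\<lambda>x. quasi_integral M2 (\<lambda>y. ereal (f (x, y))))
     = quasi_integral M1 (\<lambda>x. ereal (\<integral>y. f (x, y) \<partial>M2))"
    by (rule quasi_integral_AE_cong)
  also have "\<dots> = ereal (\<integral>x. \<integral>y. f (x, y) \<partial>M2 \<partial>M1)"
    by (rule quasi_integral_integrable[OF integrable_fst'[OF f]])
  finally show ?thesis by (simp add: integral_fst'[OF f])
qed

lemma Q_classD:
  assumes q: "q \<in> Q_class \<beta> T"
  shows "\<And>s. s \<in> {0..T} \<Longrightarrow> 0 < q s"
    and "(\<lambda>s. q s powr (- \<beta>)) \<in> borel_measurable (restrict_space lborel {0..T})"
    and "set_integrable lborel {0..T} (\<lambda>s. q s powr (- \<beta>))"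
proof -
  show "\<And>s. s \<in> {0..T} \<Longrightarrow> 0 < q s" using q by (auto simp: Q_class_def positive_measurable_def)
  have "q \<in> borel_measurable (restrict_space borel {0..T})" using q by (auto simp: Q_class_def positive_measurable_def)
  moreover have "sets (restrict_space borel {0..T}) = sets (restrict_space lborel {0..T})"
    by (rule sets_restrict_space_cong) simp
  ultimately have "q \<in> borel_measurable (restrict_space lborel {0..T})" by (simp cong: measurable_cong_sets)
  then show m: "(\<lambda>s. q s powr (- \<beta>)) \<in> borel_measurable (restrict_space lborel {0..T})" by measurable
  have i: "integrable lborel (\<lambda>s. indicator {0<..T} s *\<^sub>R q s powr (- \<beta>))"
    using q by (auto simp: Q_class_def set_integrable_def)
  have m': "(\<lambda>s. indicator {0..T} s *\<^sub>R q s powr (- \<beta>)) \<in> borel_measurable lborel"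
    using m by (subst (asm) borel_measurable_restrict_space_iff) auto
  have "AE s in lborel. s \<noteq> (0::real)" by (rule AE_lborel_singleton)
  then have "AE s in lborel. indicator {0<..T} s *\<^sub>R q s powr (- \<beta>) = indicator {0..T} s *\<^sub>R q s powr (- \<beta>)"
    by eventually_elim (auto simp: indicator_def)
  then show "set_integrable lborel {0..T} (\<lambda>s. q s powr (- \<beta>))"
    unfolding set_integrable_def by (rule integrable_cong_AE_imp[OF i m'])
qed

text \<open>
  For \<open>q\<close> in \<open>Q_class\<close> the price is merely integrable; this still gives a continuous, hence bounded, \<open>z\<close>.
\<close>

lemma z_control_Q_class:
  assumes q: "q \<in> Q_class \<beta> T"
  shows "continuous_on {0..T} (z_control \<delta> \<rho> \<beta> T q)"
    and "s \<in> {0..T} \<Longrightarrow> set_integrable lborel {s..T} (\<lambda>r. exp (- (\<rho> + \<delta>) * (r - s)) * q r powr (- \<beta>))"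
    and "0 \<le> z_control \<delta> \<rho> \<beta> T q s"
proof -
  let ?g = "\<lambda>r. exp (- (\<rho> + \<delta>) * r) * q r powr (- \<beta>)"
  have g: "set_integrable lborel {0..T} ?g"
    by (rule set_integrable_continuous_mult[OF _ Q_classD(3)[OF q]]) (intro continuous_intros)
  have "continuous_on {0..T} (\<lambda>s. exp ((\<rho> + \<delta>) * s) * integral {s..T} ?g)"
    by (intro continuous_intros indefinite_integral_continuous_1' set_borel_integral_eq_integral(1)[OF g])
  moreover have "z_control \<delta> \<rho> \<beta> T q s = exp ((\<rho> + \<delta>) * s) * integral {s..T} ?g" if "s \<in> {0..T}" for s
    unfolding z_control_eq using that set_integrable_subset[OF g, of "{s..T}"]
    by (subst set_borel_integral_eq_integral(2)) auto
  ultimately show "continuous_on {0..T} (z_control \<delta> \<rho> \<beta> T q)" by (subst continuous_on_cong) auto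
  show "set_integrable lborel {s..T} (\<lambda>r. exp (- (\<rho> + \<delta>) * (r - s)) * q r powr (- \<beta>))" if "s \<in> {0..T}"
    by (rule set_integrable_continuous_mult[OF _ set_integrable_subset[OF Q_classD(3)[OF q]]])
       (use that in \<open>auto intro!: continuous_intros\<close>)
  show "0 \<le> z_control \<delta> \<rho> \<beta> T q s"
    unfolding z_control_def set_lebesgue_integral_def by (rule integral_nonneg_AE, rule AE_I2) (simp add: indicator_def)
qed

context brownian_motion
begin

lemma progressive_measurable_swap:
  assumes "progressive F T H" "0 \<le> T"
  shows "(\<lambda>p. H (snd p) (fst p)) \<in> borel_measurable (M \<Otimes>\<^sub>M restrict_space lborel {0..T})"
  using measurable_compose[OF measurable_pair_swap' progressive_measurable_M[OF assms]] by (simp add: case_prod_unfold)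

lemma z_control_admissible:
  assumes q: "q \<in> Q_class \<beta> T" and T: "0 < T"
  shows "(\<lambda>s \<omega>. z_control \<delta> \<rho> \<beta> T q s) \<in> admissible M F T"
proof -
  let ?z = "z_control \<delta> \<rho> \<beta> T q"
  note z = z_control_Q_class[OF q]
  have prog: "progressive F T (\<lambda>s \<omega>. ?z s)"
    by (rule left_continuous_progressive) (use z(1) in \<open>auto intro: continuous_left\<close>)
  obtain C where C: "\<forall>r\<in>{0..T}. \<bar>?z r\<bar> \<le> C" using continuous_on_Icc_bounded[OF z(1)] by blast
  have "(\<integral>\<^sup>+s\<in>{0..T}. ennreal ((?z s)\<^sup>2) \<partial>lborel) \<le> (\<integral>\<^sup>+s\<in>{0..T}. ennreal (C\<^sup>2) \<partial>lborel)"
  proof (rule nn_integral_mono)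
    fix s have "(?z s)\<^sup>2 \<le> C\<^sup>2" if "s \<in> {0..T}"
      using C that abs_le_square_iff[of "?z s" C] by fastforce
    then show "ennreal ((?z s)\<^sup>2) * indicator {0..T} s \<le> ennreal (C\<^sup>2) * indicator {0..T} s"
      by (auto simp: indicator_def ennreal_leI)
  qed
  also have "\<dots> < \<infinity>" using T by (simp add: nn_integral_cmult_indicator ennreal_mult_less_top)
  finally have "(\<integral>\<^sup>+\<omega>. (\<integral>\<^sup>+s\<in>{0..T}. ennreal ((?z s)\<^sup>2) \<partial>lborel) \<partial>M) < \<infinity>"
    by (simp add: emeasure_space_1)
  then show ?thesis using prog z(3) by (simp add: admissible_def)
qed

end

locale mean_field_game = brownian_motion M F B
  for M :: "'a measure" and F :: "real \<Rightarrow> 'a measure" and B :: "real \<Rightarrow> 'a \<Rightarrow> real" +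
  fixes \<delta> \<sigma> \<rho> \<beta> T :: real and \<xi> :: "'a \<Rightarrow> real"
  assumes \<delta>: "0 < \<delta>" and \<sigma>: "0 < \<sigma>" and \<rho>: "0 < \<rho>" and \<beta>: "0 < \<beta>" and T: "0 < T"
    and \<xi>_F: "\<xi> \<in> borel_measurable (F 0)"
    and \<xi>_pos: "AE \<omega> in M. 0 < \<xi> \<omega>"
    and \<xi>_int: "integrable M \<xi>"
begin

abbreviation "\<Lambda> \<equiv> restrict_space lborel {0..T}"

sublocale \<Lambda>: finite_measure \<Lambda> by (rule finite_measure_lborel_Icc)
sublocale P: pair_sigma_finite M \<Lambda> ..
sublocale P': pair_sigma_finite \<Lambda> M ..
sublocale PP: pair_sigma_finite \<Lambda> \<Lambda> ..

abbreviation "x\<^sub>0 \<equiv> expectation \<xi>"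
abbreviation "state u \<equiv> controlled_state M F B \<delta> \<sigma> T \<xi> u"

lemma nn_integral_\<xi>: "(\<integral>\<^sup>+\<omega>. ennreal (\<xi> \<omega>) \<partial>M) = ennreal x\<^sub>0"
  by (rule nn_integral_eq_integral[OF \<xi>_int]) (use \<xi>_pos in eventually_elim, simp)

lemma x0_nn: "0 \<le> x\<^sub>0"
  by (rule integral_nonneg_AE) (use \<xi>_pos in eventually_elim, simp)

text \<open>
  The properties of the explicit solution transfer to whichever strong solution \<open>controlled_state\<close> selects.
\<close>

lemma state_facts:
  assumes u: "u \<in> admissible M F T"
  shows "progressive F T (state u)" "\<And>s. s \<in> {0..T} \<Longrightarrow> state u s \<in> borel_measurable M"
    "AE \<omega> in M. \<forall>s\<in>{0..T}. 0 \<le> state u s \<omega>"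
    "\<And>s. s \<in> {0..T} \<Longrightarrow> (\<integral>\<^sup>+\<omega>. ennreal (state u s \<omega>) \<partial>M) = ennreal (exp (- \<delta> * s) * x\<^sub>0)
       + (\<integral>\<^sup>+r\<in>{0..s}. ennreal (exp (- \<delta> * (s - r))) * (\<integral>\<^sup>+\<omega>. ennreal (u r \<omega>) \<partial>M) \<partial>lborel)"
proof -
  obtain X where X: "strong_solution M F B \<delta> \<sigma> T \<xi> u X" "\<forall>s\<in>{0..T}. \<forall>\<omega>\<in>space M. 0 \<le> X s \<omega>"
    "\<forall>s\<in>{0..T}. (\<integral>\<^sup>+\<omega>. ennreal (X s \<omega>) \<partial>M) = ennreal (exp (- \<delta> * s)) * (\<integral>\<^sup>+\<omega>. ennreal (\<xi> \<omega>) \<partial>M)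
     + (\<integral>\<^sup>+r\<in>{0..s}. ennreal (exp (- \<delta> * (s - r))) * (\<integral>\<^sup>+\<omega>. ennreal (u r \<omega>) \<partial>M) \<partial>lborel)"
    using strong_solution_exists[OF T u \<xi>_F \<xi>_pos] by blast
  have S: "strong_solution M F B \<delta> \<sigma> T \<xi> u (state u)"
    unfolding controlled_state_def by (rule someI[of "strong_solution M F B \<delta> \<sigma> T \<xi> u", OF X(1)])
  have eq: "AE \<omega> in M. \<forall>s\<in>{0..T}. state u s \<omega> = X s \<omega>"
    by (rule strong_solution_unique[OF T \<sigma> u S X(1)])
  have ad: "\<And>s. s \<in> {0..T} \<Longrightarrow> state u s \<in> borel_measurable (F s)"
    and ct: "\<And>\<omega>. \<omega> \<in> space M \<Longrightarrow> continuous_on {0..T} (\<lambda>s. state u s \<omega>)"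
    using S by (auto simp: strong_solution_def)
  show "progressive F T (state u)" by (rule left_continuous_progressive[OF ad continuous_left[OF ct]])
  show "state u s \<in> borel_measurable M" if "s \<in> {0..T}" for s
    by (rule measurable_F_M[OF _ ad[OF that]]) (use that in auto)
  show "AE \<omega> in M. \<forall>s\<in>{0..T}. 0 \<le> state u s \<omega>"
    using eq AE_space by eventually_elim (use X(2) in auto)
  fix s assume s: "s \<in> {0..T}"
  have "(\<integral>\<^sup>+\<omega>. ennreal (state u s \<omega>) \<partial>M) = (\<integral>\<^sup>+\<omega>. ennreal (X s \<omega>) \<partial>M)"
    by (rule nn_integral_cong_AE) (use eq in eventually_elim, use s in simp)
  then show "(\<integral>\<^sup>+\<omega>. ennreal (state u s \<omega>) \<partial>M) = ennreal (exp (- \<delta> * s) * x\<^sub>0)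
       + (\<integral>\<^sup>+r\<in>{0..s}. ennreal (exp (- \<delta> * (s - r))) * (\<integral>\<^sup>+\<omega>. ennreal (u r \<omega>) \<partial>M) \<partial>lborel)"
    using X(3)[rule_format, OF s] x0_nn by (simp add: nn_integral_\<xi> ennreal_mult)
qed

lemma admissible_joint:
  assumes u: "u \<in> admissible M F T"
  shows "(\<lambda>p. u (snd p) (fst p)) \<in> borel_measurable (M \<Otimes>\<^sub>M \<Lambda>)"
    and "integrable (M \<Otimes>\<^sub>M \<Lambda>) (\<lambda>p. (u (snd p) (fst p))\<^sup>2)"
    and "(\<lambda>r. \<integral>\<^sup>+\<omega>. ennreal (u r \<omega>) \<partial>M) \<in> borel_measurable \<Lambda>"
proof -
  have prog: "progressive F T u" and fin: "(\<integral>\<^sup>+\<omega>. (\<integral>\<^sup>+s\<in>{0..T}. ennreal ((u s \<omega>)\<^sup>2) \<partial>lborel) \<partial>M) < \<infinity>"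
    using u by (auto simp: admissible_def)
  show m: "(\<lambda>p. u (snd p) (fst p)) \<in> borel_measurable (M \<Otimes>\<^sub>M \<Lambda>)"
    by (rule progressive_measurable_swap[OF prog]) (use T in simp)
  have m2: "(\<lambda>p. (u (snd p) (fst p))\<^sup>2) \<in> borel_measurable (M \<Otimes>\<^sub>M \<Lambda>)" using m by measurable
  have "(\<integral>\<^sup>+p. ennreal ((u (snd p) (fst p))\<^sup>2) \<partial>(M \<Otimes>\<^sub>M \<Lambda>)) = (\<integral>\<^sup>+\<omega>. \<integral>\<^sup>+s. ennreal ((u s \<omega>)\<^sup>2) \<partial>\<Lambda> \<partial>M)"
    using \<Lambda>.nn_integral_fst[OF measurable_compose[OF m2 measurable_ennreal]] by simp
  also have "\<dots> < \<infinity>" using fin by (simp add: nn_integral_restrict_space)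
  finally show "integrable (M \<Otimes>\<^sub>M \<Lambda>) (\<lambda>p. (u (snd p) (fst p))\<^sup>2)"
    using m2 by (intro integrableI_nonneg) auto
  have "(\<lambda>p. ennreal (u (fst p) (snd p))) \<in> borel_measurable (\<Lambda> \<Otimes>\<^sub>M M)"
    using progressive_measurable_M[OF prog] T by (intro measurable_compose[OF _ measurable_ennreal]) simp
  from borel_measurable_nn_integral_fst[OF this]
  show "(\<lambda>r. \<integral>\<^sup>+\<omega>. ennreal (u r \<omega>) \<partial>M) \<in> borel_measurable \<Lambda>" by simp
qed

lemma continuous_measurable_\<Lambda>:
  fixes z :: "real \<Rightarrow> real"
  assumes z: "continuous_on {0..T} z"
  shows "z \<in> borel_measurable \<Lambda>" "(\<lambda>p. z (snd p)) \<in> borel_measurable (M \<Otimes>\<^sub>M \<Lambda>)"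
proof -
  have "(\<lambda>s. indicator {0..T} s *\<^sub>R z s) \<in> borel_measurable borel"
    by (rule borel_measurable_continuous_on_indicator[OF _ z]) simp
  then show m: "z \<in> borel_measurable \<Lambda>"
    by (subst borel_measurable_restrict_space_iff) auto
  show "(\<lambda>p. z (snd p)) \<in> borel_measurable (M \<Otimes>\<^sub>M \<Lambda>)"
    by (rule measurable_compose[OF measurable_snd m])
qed

text \<open>
  A unit of effort at time \<open>r\<close> raises the mean state at a later time \<open>s\<close> by \<open>exp (- \<delta> (s - r))\<close>. Exchanging
  the integrals over \<open>r \<le> s\<close> therefore collects the discounted value of all later prices in the factor of the effort at \<open>r\<close>,
  and this value is \<open>exp (- \<rho> r) (z r)\<close>: \<open>z\<close> is the shadow price of the state.
\<close>

lemma nn_integral_revenue: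
  assumes q: "q \<in> Q_class \<beta> T" and u: "u \<in> admissible M F T"
  defines "z \<equiv> z_control \<delta> \<rho> \<beta> T q"
  shows "(\<integral>\<^sup>+s. ennreal (exp (- \<rho> * s) * q s powr (- \<beta>)) * (\<integral>\<^sup>+\<omega>. ennreal (state u s \<omega>) \<partial>M) \<partial>\<Lambda>)
    = (\<integral>\<^sup>+s. ennreal (exp (- \<rho> * s) * q s powr (- \<beta>)) * ennreal (exp (- \<delta> * s) * x\<^sub>0) \<partial>\<Lambda>)
      + (\<integral>\<^sup>+r. ennreal (exp (- \<rho> * r) * z r) * (\<integral>\<^sup>+\<omega>. ennreal (u r \<omega>) \<partial>M) \<partial>\<Lambda>)"
proof -
  define w where "w s = exp (- \<rho> * s) * q s powr (- \<beta>)" for s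
  define U where "U r = (\<integral>\<^sup>+\<omega>. ennreal (u r \<omega>) \<partial>M)" for r
  have qm: "(\<lambda>s. q s powr (- \<beta>)) \<in> borel_measurable \<Lambda>" by (rule Q_classD(2)[OF q])
  have idm: "(\<lambda>s. s) \<in> borel_measurable \<Lambda>" by (rule measurable_restrict_space1) simp
  have wm[measurable]: "w \<in> borel_measurable \<Lambda>"
    unfolding w_def by (intro borel_measurable_times qm measurable_compose[OF idm]) simp
  have Um[measurable]: "U \<in> borel_measurable \<Lambda>" unfolding U_def by (rule admissible_joint(3)[OF u])
  have fm: "fst \<in> borel_measurable (\<Lambda> \<Otimes>\<^sub>M \<Lambda>)" "snd \<in> borel_measurable (\<Lambda> \<Otimes>\<^sub>M \<Lambda>)"
    by (rule measurable_compose[OF measurable_fst idm] measurable_compose[OF measurable_snd idm])+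
  note [measurable] = fm
  define K where "K p = ennreal (w (fst p)) * (ennreal (exp (- \<delta> * (fst p - snd p))) * U (snd p)) * indicator {p. snd p \<le> fst p} p"
    for p :: "real \<times> real"
  have Km: "K \<in> borel_measurable (\<Lambda> \<Otimes>\<^sub>M \<Lambda>)"
  proof -
    have 1: "(\<lambda>p. ennreal (w (fst p))) \<in> borel_measurable (\<Lambda> \<Otimes>\<^sub>M \<Lambda>)" "(\<lambda>p. U (snd p)) \<in> borel_measurable (\<Lambda> \<Otimes>\<^sub>M \<Lambda>)"
      using measurable_compose[OF measurable_fst wm] measurable_compose[OF measurable_snd Um] by auto
    have 2: "(\<lambda>p. ennreal (exp (- \<delta> * (fst p - snd p)))) \<in> borel_measurable (\<Lambda> \<Otimes>\<^sub>M \<Lambda>)" by measurable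
    have 3: "(\<lambda>p. indicator {p. snd p \<le> fst p} p :: ennreal) \<in> borel_measurable (\<Lambda> \<Otimes>\<^sub>M \<Lambda>)"
      by (rule borel_measurable_indicator') (use fm in measurable)
    show ?thesis unfolding K_def[abs_def] by (intro borel_measurable_times_ennreal 1 2 3)
  qed
  have inner1: "ennreal (w s) * (\<integral>\<^sup>+r\<in>{0..s}. ennreal (exp (- \<delta> * (s - r))) * U r \<partial>lborel) = (\<integral>\<^sup>+r. K (s, r) \<partial>\<Lambda>)"
    if s: "s \<in> {0..T}" for s
  proof -
    have em: "(\<lambda>r. ennreal (exp (- \<delta> * (s - r))) * U r * indicator {..s} r) \<in> borel_measurable \<Lambda>"
      by (intro borel_measurable_times_ennreal Um measurable_restrict_space1) auto
    have "(\<integral>\<^sup>+r. K (s, r) \<partial>\<Lambda>) = (\<integral>\<^sup>+r. ennreal (w s) * (ennreal (exp (- \<delta> * (s - r))) * U r * indicator {..s} r) \<partial>\<Lambda>)"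
      by (rule nn_integral_cong) (auto simp: K_def indicator_def)
    also have "\<dots> = ennreal (w s) * (\<integral>\<^sup>+r. ennreal (exp (- \<delta> * (s - r))) * U r * indicator {..s} r \<partial>\<Lambda>)"
      by (rule nn_integral_cmult[OF em])
    also have "(\<integral>\<^sup>+r. ennreal (exp (- \<delta> * (s - r))) * U r * indicator {..s} r \<partial>\<Lambda>)
        = (\<integral>\<^sup>+r\<in>{0..s}. ennreal (exp (- \<delta> * (s - r))) * U r \<partial>lborel)"
      using s by (subst nn_integral_restrict_space) (auto intro!: nn_integral_cong simp: indicator_def)
    finally show ?thesis by simp
  qed
  have inner2: "(\<integral>\<^sup>+s. K (s, r) \<partial>\<Lambda>) = ennreal (exp (- \<rho> * r) * z r) * U r" if r: "r \<in> {0..T}" for r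
  proof -
    let ?f = "\<lambda>s. exp (- (\<rho> + \<delta>) * (s - r)) * q s powr (- \<beta>)"
    have fi: "integrable lborel (\<lambda>s. indicator {r..T} s *\<^sub>R ?f s)"
      using z_control_Q_class(2)[OF q r] by (simp add: set_integrable_def)
    have "(\<integral>\<^sup>+s. K (s, r) \<partial>\<Lambda>) = (\<integral>\<^sup>+s. ennreal (exp (- \<rho> * r)) * U r * ennreal (indicator {r..T} s *\<^sub>R ?f s) \<partial>lborel)"
    proof (subst nn_integral_restrict_space, simp, rule nn_integral_cong)
      fix s
      have "exp (- \<rho> * s) * exp (- \<delta> * (s - r)) = exp (- \<rho> * r) * exp (- (\<rho> + \<delta>) * (s - r))"
        unfolding exp_add[symmetric] by (simp add: algebra_simps)
      then have "w s * exp (- \<delta> * (s - r)) = exp (- \<rho> * r) * ?f s" unfolding w_def by (metis mult.assoc mult.commute)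
      then have "ennreal (w s) * ennreal (exp (- \<delta> * (s - r))) = ennreal (exp (- \<rho> * r)) * ennreal (?f s)"
        by (simp add: ennreal_mult'[symmetric] ennreal_mult[symmetric] w_def)
      then show "K (s, r) * indicator {0..T} s = ennreal (exp (- \<rho> * r)) * U r * ennreal (indicator {r..T} s *\<^sub>R ?f s)"
        using r by (cases "s \<in> {r..T}") (auto simp: K_def indicator_def mult_ac)
    qed
    also have "\<dots> = ennreal (exp (- \<rho> * r)) * U r * (\<integral>\<^sup>+s. ennreal (indicator {r..T} s *\<^sub>R ?f s) \<partial>lborel)"
      by (rule nn_integral_cmult) (use fi in measurable)
    also have "(\<integral>\<^sup>+s. ennreal (indicator {r..T} s *\<^sub>R ?f s) \<partial>lborel) = ennreal (z r)"
      unfolding z_def z_control_def set_lebesgue_integral_def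
      by (rule nn_integral_eq_integral[OF fi]) (auto intro!: AE_I2 simp: indicator_def)
    finally show ?thesis using z_control_Q_class(3)[OF q, of \<delta> \<rho> r] by (simp add: ennreal_mult z_def mult_ac)
  qed
  have "(\<integral>\<^sup>+s. ennreal (w s) * (\<integral>\<^sup>+\<omega>. ennreal (state u s \<omega>) \<partial>M) \<partial>\<Lambda>)
      = (\<integral>\<^sup>+s. ennreal (w s) * ennreal (exp (- \<delta> * s) * x\<^sub>0) + (\<integral>\<^sup>+r. K (s, r) \<partial>\<Lambda>) \<partial>\<Lambda>)"
  proof (rule nn_integral_cong)
    fix s assume "s \<in> space \<Lambda>"
    then have s: "s \<in> {0..T}" by (simp add: space_restrict_space)
    show "ennreal (w s) * (\<integral>\<^sup>+\<omega>. ennreal (state u s \<omega>) \<partial>M) = ennreal (w s) * ennreal (exp (- \<delta> * s) * x\<^sub>0) + (\<integral>\<^sup>+r. K (s, r) \<partial>\<Lambda>)"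
      unfolding state_facts(4)[OF u s] inner1[OF s, symmetric] U_def by (rule distrib_left)
  qed
  also have "\<dots> = (\<integral>\<^sup>+s. ennreal (w s) * ennreal (exp (- \<delta> * s) * x\<^sub>0) \<partial>\<Lambda>) + (\<integral>\<^sup>+s. \<integral>\<^sup>+r. K (s, r) \<partial>\<Lambda> \<partial>\<Lambda>)"
  proof (rule nn_integral_add)
    show "(\<lambda>s. ennreal (w s) * ennreal (exp (- \<delta> * s) * x\<^sub>0)) \<in> borel_measurable \<Lambda>"
      using idm wm by measurable
    show "(\<lambda>s. \<integral>\<^sup>+r. K (s, r) \<partial>\<Lambda>) \<in> borel_measurable \<Lambda>" by (rule \<Lambda>.borel_measurable_nn_integral_fst[OF Km])
  qed
  also have "(\<integral>\<^sup>+s. \<integral>\<^sup>+r. K (s, r) \<partial>\<Lambda> \<partial>\<Lambda>) = (\<integral>\<^sup>+r. \<integral>\<^sup>+s. K (s, r) \<partial>\<Lambda> \<partial>\<Lambda>)"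
    using PP.Fubini[OF Km] by simp
  also have "\<dots> = (\<integral>\<^sup>+r. ennreal (exp (- \<rho> * r) * z r) * U r \<partial>\<Lambda>)"
    by (rule nn_integral_cong) (simp add: inner2 space_restrict_space)
  finally show ?thesis unfolding w_def U_def .
qed

text \<open>
  By \<open>nn_integral_revenue\<close> the objective is a constant plus the expected integral of \<open>exp (- \<rho> s) (z u - u\<^sup>2 / 2)\<close>;
  complete the square.
\<close>

lemma objective_eq_square:
  assumes q: "q \<in> Q_class \<beta> T"
  defines "z \<equiv> z_control \<delta> \<rho> \<beta> T q"
  shows "\<exists>c. \<forall>u\<in>admissible M F T.
    integrable (M \<Otimes>\<^sub>M \<Lambda>) (\<lambda>p. exp (- \<rho> * snd p) / 2 * (u (snd p) (fst p) - z (snd p))\<^sup>2) \<and>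
    objective M F B \<delta> \<sigma> \<rho> \<beta> T q \<xi> u =
      ereal (c - (\<integral>p. exp (- \<rho> * snd p) / 2 * (u (snd p) (fst p) - z (snd p))\<^sup>2 \<partial>(M \<Otimes>\<^sub>M \<Lambda>)))"
proof -
  let ?P = "M \<Otimes>\<^sub>M \<Lambda>"
  interpret MP: finite_measure ?P by (rule finite_measure_pair_measure) unfold_locales
  have idm: "(\<lambda>s. s) \<in> borel_measurable \<Lambda>" by (rule measurable_restrict_space1) simp
  have sndm[measurable]: "snd \<in> borel_measurable ?P" by (rule measurable_compose[OF measurable_snd idm])
  have qm: "(\<lambda>s. q s powr (- \<beta>)) \<in> borel_measurable \<Lambda>" by (rule Q_classD(2)[OF q])
  have qmP[measurable]: "(\<lambda>p. q (snd p) powr (- \<beta>)) \<in> borel_measurable ?P" by (rule measurable_compose[OF measurable_snd qm])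
  have zm[measurable]: "(\<lambda>p. z (snd p)) \<in> borel_measurable ?P" unfolding z_def by (rule continuous_measurable_\<Lambda>(2)[OF z_control_Q_class(1)[OF q]])
  have z_nn: "0 \<le> z s" for s unfolding z_def by (rule z_control_Q_class(3)[OF q])
  obtain Z where Z: "\<And>r. r \<in> {0..T} \<Longrightarrow> \<bar>z r\<bar> \<le> Z"
    using continuous_on_Icc_bounded[OF z_control_Q_class(1)[OF q]] unfolding z_def by blast
  have sp: "snd p \<in> {0..T}" "fst p \<in> space M" if "p \<in> space ?P" for p
    using that by (auto simp: space_pair_measure space_restrict_space)
  have e_le: "\<bar>exp (- \<rho> * snd p)\<bar> \<le> 1" if "p \<in> space ?P" for p
    using sp(1)[OF that] \<rho> by simp
  have mult_e: "integrable ?P (\<lambda>p. exp (- \<rho> * snd p) * f p)" if "integrable ?P f" for f :: "_ \<Rightarrow> real"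
  proof (rule Bochner_Integration.integrable_bound[OF that])
    show "(\<lambda>p. exp (- \<rho> * snd p) * f p) \<in> borel_measurable ?P" using that by measurable
    show "AE p in ?P. norm (exp (- \<rho> * snd p) * f p) \<le> norm (f p)"
      using e_le by (auto intro!: AE_I2 simp: abs_mult mult_left_le_one_le)
  qed
  have z2: "integrable ?P (\<lambda>p. (z (snd p))\<^sup>2)"
  proof (rule MP.integrable_const_bound[where B = "Z\<^sup>2"])
    show "AE p in ?P. norm ((z (snd p))\<^sup>2) \<le> Z\<^sup>2"
    proof (rule AE_I2)
      fix p assume "p \<in> space ?P"
      then have "\<bar>z (snd p)\<bar> \<le> \<bar>Z\<bar>" using Z[OF sp(1)] by fastforce
      then show "norm ((z (snd p))\<^sup>2) \<le> Z\<^sup>2" by (simp add: abs_le_square_iff)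
    qed
  qed measurable
  \<comment> \<open>the revenue of the uncontrolled state\<close>
  define a where "a = (\<integral>s. exp (- \<rho> * s) * q s powr (- \<beta>) * (exp (- \<delta> * s) * x\<^sub>0) \<partial>\<Lambda>)"
  have a_int: "integrable \<Lambda> (\<lambda>s. exp (- \<rho> * s) * q s powr (- \<beta>) * (exp (- \<delta> * s) * x\<^sub>0))"
  proof -
    have "set_integrable lborel {0..T} (\<lambda>s. (exp (- \<rho> * s) * (exp (- \<delta> * s) * x\<^sub>0)) * q s powr (- \<beta>))"
      by (rule set_integrable_continuous_mult[OF _ Q_classD(3)[OF q]]) (intro continuous_intros)
    then show ?thesis by (simp add: integrable_restrict_space set_integrable_def mult_ac)
  qed
  define c where "c = a + (\<integral>p. exp (- \<rho> * snd p) / 2 * (z (snd p))\<^sup>2 \<partial>?P)"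
  show ?thesis
  proof (intro exI[of _ c] ballI)
    fix u assume u: "u \<in> admissible M F T"
    note um[measurable] = admissible_joint(1)[OF u]
    note u2 = admissible_joint(2)[OF u]
    have u_nn: "0 \<le> u (snd p) (fst p)" if "p \<in> space ?P" for p
      using u sp[OF that] by (auto simp: admissible_def)
    have zu: "integrable ?P (\<lambda>p. z (snd p) * u (snd p) (fst p))"
    proof (rule Bochner_Integration.integrable_bound[OF Bochner_Integration.integrable_add[OF z2 u2]])
      show "AE p in ?P. norm (z (snd p) * u (snd p) (fst p)) \<le> norm ((z (snd p))\<^sup>2 + (u (snd p) (fst p))\<^sup>2)"
      proof (rule AE_I2)
        fix p
        have "2 * (\<bar>z (snd p)\<bar> * \<bar>u (snd p) (fst p)\<bar>) \<le> (z (snd p))\<^sup>2 + (u (snd p) (fst p))\<^sup>2"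
          using sum_squares_bound[of "\<bar>z (snd p)\<bar>" "\<bar>u (snd p) (fst p)\<bar>"] by simp
        moreover have "0 \<le> \<bar>z (snd p)\<bar> * \<bar>u (snd p) (fst p)\<bar>" by simp
        moreover have "norm ((z (snd p))\<^sup>2 + (u (snd p) (fst p))\<^sup>2) = (z (snd p))\<^sup>2 + (u (snd p) (fst p))\<^sup>2" by simp
        ultimately show "norm (z (snd p) * u (snd p) (fst p)) \<le> norm ((z (snd p))\<^sup>2 + (u (snd p) (fst p))\<^sup>2)"
          by (simp only: real_norm_def abs_mult)
      qed
    qed measurable
    let ?\<phi>1 = "\<lambda>p. exp (- \<rho> * snd p) * (state u (snd p) (fst p) * q (snd p) powr (- \<beta>))"
    let ?\<phi>2 = "\<lambda>p. exp (- \<rho> * snd p) * (z (snd p) * u (snd p) (fst p))"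
    let ?\<phi>3 = "\<lambda>p. exp (- \<rho> * snd p) * ((u (snd p) (fst p))\<^sup>2 / 2)"
    have \<phi>2: "integrable ?P ?\<phi>2" by (rule mult_e[OF zu])
    have \<phi>3: "integrable ?P ?\<phi>3" by (rule mult_e) (use u2 in simp)
    have sm[measurable]: "(\<lambda>p. state u (snd p) (fst p)) \<in> borel_measurable ?P"
      by (rule progressive_measurable_swap[OF state_facts(1)[OF u]]) (use T in simp)
    have \<phi>1m: "?\<phi>1 \<in> borel_measurable ?P" by measurable
    have \<phi>1_nn: "AE p in ?P. 0 \<le> ?\<phi>1 p"
    proof -
      have "AE \<omega> in M. AE s in \<Lambda>. 0 \<le> ?\<phi>1 (\<omega>, s)"
        using state_facts(3)[OF u] by eventually_elim (auto intro!: AE_I2 simp: space_restrict_space)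
      moreover have "{p \<in> space ?P. 0 \<le> ?\<phi>1 p} \<in> sets ?P" using \<phi>1m by measurable
      ultimately show ?thesis by (rule P.AE_pair_measure[rotated])
    qed
    have "(\<integral>\<^sup>+p. ennreal (?\<phi>1 p) \<partial>?P) = (\<integral>\<^sup>+s. \<integral>\<^sup>+\<omega>. ennreal (?\<phi>1 (\<omega>, s)) \<partial>M \<partial>\<Lambda>)"
      by (rule P.nn_integral_snd[symmetric]) (rule measurable_compose[OF \<phi>1m measurable_ennreal])
    also have "\<dots> = (\<integral>\<^sup>+s. ennreal (exp (- \<rho> * s) * q s powr (- \<beta>)) * (\<integral>\<^sup>+\<omega>. ennreal (state u s \<omega>) \<partial>M) \<partial>\<Lambda>)"
    proof (rule nn_integral_cong)
      fix s assume "s \<in> space \<Lambda>"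
      then have s: "s \<in> {0..T}" by (simp add: space_restrict_space)
      have "(\<integral>\<^sup>+\<omega>. ennreal (?\<phi>1 (\<omega>, s)) \<partial>M) = (\<integral>\<^sup>+\<omega>. ennreal (exp (- \<rho> * s) * q s powr (- \<beta>)) * ennreal (state u s \<omega>) \<partial>M)"
        by (rule nn_integral_cong) (subst ennreal_mult'[symmetric], simp_all add: mult_ac)
      also have "\<dots> = ennreal (exp (- \<rho> * s) * q s powr (- \<beta>)) * (\<integral>\<^sup>+\<omega>. ennreal (state u s \<omega>) \<partial>M)"
        by (rule nn_integral_cmult) (rule measurable_compose[OF state_facts(2)[OF u s] measurable_ennreal])
      finally show "(\<integral>\<^sup>+\<omega>. ennreal (?\<phi>1 (\<omega>, s)) \<partial>M) = \<dots>" .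
    qed
    also have "\<dots> = (\<integral>\<^sup>+s. ennreal (exp (- \<rho> * s) * q s powr (- \<beta>)) * ennreal (exp (- \<delta> * s) * x\<^sub>0) \<partial>\<Lambda>)
      + (\<integral>\<^sup>+r. ennreal (exp (- \<rho> * r) * z r) * (\<integral>\<^sup>+\<omega>. ennreal (u r \<omega>) \<partial>M) \<partial>\<Lambda>)"
      unfolding z_def by (rule nn_integral_revenue[OF q u])
    also have "(\<integral>\<^sup>+s. ennreal (exp (- \<rho> * s) * q s powr (- \<beta>)) * ennreal (exp (- \<delta> * s) * x\<^sub>0) \<partial>\<Lambda>) = ennreal a"
    proof -
      have "(\<integral>\<^sup>+s. ennreal (exp (- \<rho> * s) * q s powr (- \<beta>)) * ennreal (exp (- \<delta> * s) * x\<^sub>0) \<partial>\<Lambda>)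
         = (\<integral>\<^sup>+s. ennreal (exp (- \<rho> * s) * q s powr (- \<beta>) * (exp (- \<delta> * s) * x\<^sub>0)) \<partial>\<Lambda>)"
        using x0_nn by (intro nn_integral_cong ennreal_mult[symmetric]) auto
      also have "\<dots> = ennreal a" unfolding a_def
        by (rule nn_integral_eq_integral[OF a_int]) (use x0_nn in auto)
      finally show ?thesis .
    qed
    also have "(\<integral>\<^sup>+r. ennreal (exp (- \<rho> * r) * z r) * (\<integral>\<^sup>+\<omega>. ennreal (u r \<omega>) \<partial>M) \<partial>\<Lambda>) = (\<integral>\<^sup>+p. ennreal (?\<phi>2 p) \<partial>?P)"
    proof -
      have "(\<integral>\<^sup>+p. ennreal (?\<phi>2 p) \<partial>?P) = (\<integral>\<^sup>+s. \<integral>\<^sup>+\<omega>. ennreal (?\<phi>2 (\<omega>, s)) \<partial>M \<partial>\<Lambda>)"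
        by (rule P.nn_integral_snd[symmetric]) measurable
      also have "\<dots> = (\<integral>\<^sup>+r. ennreal (exp (- \<rho> * r) * z r) * (\<integral>\<^sup>+\<omega>. ennreal (u r \<omega>) \<partial>M) \<partial>\<Lambda>)"
      proof (rule nn_integral_cong)
        fix s assume s: "s \<in> space \<Lambda>"
        have us: "u s \<in> borel_measurable M" using measurable_compose[OF measurable_Pair1'[OF _] um] measurable_compose[OF measurable_Pair2'[OF s] um]
          by simp
        have "(\<integral>\<^sup>+\<omega>. ennreal (?\<phi>2 (\<omega>, s)) \<partial>M) = (\<integral>\<^sup>+\<omega>. ennreal (exp (- \<rho> * s) * z s) * ennreal (u s \<omega>) \<partial>M)"
          using z_nn[of s] by (intro nn_integral_cong) (subst ennreal_mult'[symmetric], simp_all add: mult_ac)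
        also have "\<dots> = ennreal (exp (- \<rho> * s) * z s) * (\<integral>\<^sup>+\<omega>. ennreal (u s \<omega>) \<partial>M)"
          by (rule nn_integral_cmult) (rule measurable_compose[OF us measurable_ennreal])
        finally show "(\<integral>\<^sup>+\<omega>. ennreal (?\<phi>2 (\<omega>, s)) \<partial>M) = \<dots>" .
      qed
      finally show ?thesis by simp
    qed
    also have "(\<integral>\<^sup>+p. ennreal (?\<phi>2 p) \<partial>?P) = ennreal (\<integral>p. ?\<phi>2 p \<partial>?P)"
      by (rule nn_integral_eq_integral[OF \<phi>2]) (use z_nn u_nn in \<open>auto intro!: AE_I2\<close>)
    finally have \<phi>1_nnint: "(\<integral>\<^sup>+p. ennreal (?\<phi>1 p) \<partial>?P) = ennreal a + ennreal (\<integral>p. ?\<phi>2 p \<partial>?P)" .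
    have a_nn: "0 \<le> a" unfolding a_def by (rule integral_nonneg_AE) (use x0_nn in auto)
    have i2_nn: "0 \<le> (\<integral>p. ?\<phi>2 p \<partial>?P)" by (rule integral_nonneg_AE) (use z_nn u_nn in \<open>auto intro!: AE_I2\<close>)
    have \<phi>1: "integrable ?P ?\<phi>1"
      by (rule integrableI_nonneg[OF \<phi>1m \<phi>1_nn], subst \<phi>1_nnint) simp
    have \<phi>1_eq: "(\<integral>p. ?\<phi>1 p \<partial>?P) = a + (\<integral>p. ?\<phi>2 p \<partial>?P)"
      unfolding integral_eq_nn_integral[OF \<phi>1m \<phi>1_nn] \<phi>1_nnint using a_nn i2_nn by (simp flip: ennreal_plus)
    have z2e: "integrable ?P (\<lambda>p. exp (- \<rho> * snd p) / 2 * (z (snd p))\<^sup>2)"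
      using mult_e[OF integrable_divide[OF z2, of 2]] by simp
    have sq: "(\<lambda>p. exp (- \<rho> * snd p) / 2 * (u (snd p) (fst p) - z (snd p))\<^sup>2)
        = (\<lambda>p. exp (- \<rho> * snd p) / 2 * (z (snd p))\<^sup>2 - (?\<phi>2 p - ?\<phi>3 p))"
      by (auto simp: power2_eq_square field_simps)
    have sq_int: "integrable ?P (\<lambda>p. exp (- \<rho> * snd p) / 2 * (u (snd p) (fst p) - z (snd p))\<^sup>2)"
      unfolding sq by (intro Bochner_Integration.integrable_diff z2e \<phi>2 \<phi>3)
    have sq_eq: "(\<integral>p. exp (- \<rho> * snd p) / 2 * (u (snd p) (fst p) - z (snd p))\<^sup>2 \<partial>?P)
        = (\<integral>p. exp (- \<rho> * snd p) / 2 * (z (snd p))\<^sup>2 \<partial>?P) - ((\<integral>p. ?\<phi>2 p \<partial>?P) - (\<integral>p. ?\<phi>3 p \<partial>?P))"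
      unfolding sq by (simp only: Bochner_Integration.integral_diff z2e \<phi>2 \<phi>3 Bochner_Integration.integrable_diff)
    have "objective M F B \<delta> \<sigma> \<rho> \<beta> T q \<xi> u = quasi_integral M (\<lambda>\<omega>. quasi_integral \<Lambda> (\<lambda>s. ereal (?\<phi>1 (\<omega>, s) - ?\<phi>3 (\<omega>, s))))"
      unfolding objective_def by (simp add: right_diff_distrib)
    also have "\<dots> = ereal (\<integral>p. ?\<phi>1 p - ?\<phi>3 p \<partial>?P)"
      by (rule P.quasi_integral_iterated) (intro Bochner_Integration.integrable_diff \<phi>1 \<phi>3)
    also have "(\<integral>p. ?\<phi>1 p - ?\<phi>3 p \<partial>?P) = c - (\<integral>p. exp (- \<rho> * snd p) / 2 * (u (snd p) (fst p) - z (snd p))\<^sup>2 \<partial>?P)"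
      unfolding sq_eq c_def Bochner_Integration.integral_diff[OF \<phi>1 \<phi>3] \<phi>1_eq by simp
    finally show "integrable ?P (\<lambda>p. exp (- \<rho> * snd p) / 2 * (u (snd p) (fst p) - z (snd p))\<^sup>2) \<and>
      objective M F B \<delta> \<sigma> \<rho> \<beta> T q \<xi> u =
      ereal (c - (\<integral>p. exp (- \<rho> * snd p) / 2 * (u (snd p) (fst p) - z (snd p))\<^sup>2 \<partial>?P))"
      using sq_int by blast
  qed
qed

text \<open>
  As \<open>z\<close> is itself admissible, the maximum is attained exactly when the integral of the square vanishes.
\<close>

lemma optimal_iff:
  assumes q: "q \<in> Q_class \<beta> T" and u: "u \<in> admissible M F T"
  shows "(\<forall>v\<in>admissible M F T. objective M F B \<delta> \<sigma> \<rho> \<beta> T q \<xi> v \<le> objective M F B \<delta> \<sigma> \<rho> \<beta> T q \<xi> u)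
    \<longleftrightarrow> control_eq M T u (\<lambda>s \<omega>. z_control \<delta> \<rho> \<beta> T q s)"
proof -
  let ?P = "M \<Otimes>\<^sub>M \<Lambda>" and ?z = "z_control \<delta> \<rho> \<beta> T q"
  let ?D = "\<lambda>u p. exp (- \<rho> * snd p) / 2 * (u (snd p) (fst p) - ?z (snd p))\<^sup>2"
  obtain c where c: "\<And>v. v \<in> admissible M F T \<Longrightarrow> integrable ?P (?D v)"
    "\<And>v. v \<in> admissible M F T \<Longrightarrow> objective M F B \<delta> \<sigma> \<rho> \<beta> T q \<xi> v = ereal (c - (\<integral>p. ?D v p \<partial>?P))"
    using objective_eq_square[OF q] by blast
  have D_nn: "0 \<le> (\<integral>p. ?D v p \<partial>?P)" for v by (rule integral_nonneg_AE) auto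
  have z: "(\<lambda>s \<omega>. ?z s) \<in> admissible M F T" by (rule z_control_admissible[OF q T])
  have zero: "(\<integral>p. ?D v p \<partial>?P) = 0 \<longleftrightarrow> control_eq M T v (\<lambda>s \<omega>. ?z s)" if "v \<in> admissible M F T" for v
    unfolding control_eq_def using integral_nonneg_eq_0_iff_AE[OF c(1)[OF that]] by simp
  show ?thesis
  proof
    assume "\<forall>v\<in>admissible M F T. objective M F B \<delta> \<sigma> \<rho> \<beta> T q \<xi> v \<le> objective M F B \<delta> \<sigma> \<rho> \<beta> T q \<xi> u"
    from bspec[OF this z] have "(\<integral>p. ?D u p \<partial>?P) \<le> 0" unfolding c(2)[OF z] c(2)[OF u] by simp
    then have "(\<integral>p. ?D u p \<partial>?P) = 0" using D_nn[of u] by (rule antisym)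
    then show "control_eq M T u (\<lambda>s \<omega>. ?z s)" by (rule zero[OF u, THEN iffD1])
  next
    assume "control_eq M T u (\<lambda>s \<omega>. ?z s)"
    then have "(\<integral>p. ?D u p \<partial>?P) = 0" by (rule zero[OF u, THEN iffD2])
    then show "\<forall>v\<in>admissible M F T. objective M F B \<delta> \<sigma> \<rho> \<beta> T q \<xi> v \<le> objective M F B \<delta> \<sigma> \<rho> \<beta> T q \<xi> u"
      using D_nn by (auto simp: c(2) u)
  qed
qed

lemma expectation_state:
  assumes u: "u \<in> admissible M F T" and eq: "control_eq M T u (\<lambda>s \<omega>. z s)"
    and z: "continuous_on {0..T} z" "\<And>s. s \<in> {0..T} \<Longrightarrow> 0 \<le> z s" and s: "s \<in> {0..T}"
  shows "expectation (state u s) = exp (- \<delta> * s) * x\<^sub>0 + (LBINT r:{0..s}. exp (- \<delta> * (s - r)) * z r)"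
proof -
  have "AE p in M \<Otimes>\<^sub>M \<Lambda>. u (snd p) (fst p) = z (snd p)" using eq by (simp add: control_eq_def)
  from P.AE_pair[OF this] have "AE \<omega> in M. AE r in \<Lambda>. u r \<omega> = z r" by simp
  moreover have "{p \<in> space (M \<Otimes>\<^sub>M \<Lambda>). u (snd p) (fst p) = z (snd p)} \<in> sets (M \<Otimes>\<^sub>M \<Lambda>)"
    using admissible_joint(1)[OF u] continuous_measurable_\<Lambda>(2)[OF z(1)] by measurable
  ultimately have "AE r in \<Lambda>. AE \<omega> in M. u r \<omega> = z r"
    by (subst (asm) P.AE_commute)
  then have "AE r in \<Lambda>. (\<integral>\<^sup>+\<omega>. ennreal (u r \<omega>) \<partial>M) = ennreal (z r)"
  proof eventually_elim
    fix r assume eq: "AE \<omega> in M. u r \<omega> = z r"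
    have "(\<integral>\<^sup>+\<omega>. ennreal (u r \<omega>) \<partial>M) = (\<integral>\<^sup>+\<omega>. ennreal (z r) \<partial>M)"
      by (rule nn_integral_cong_AE) (use eq in eventually_elim, simp)
    then show "(\<integral>\<^sup>+\<omega>. ennreal (u r \<omega>) \<partial>M) = ennreal (z r)" by (simp add: emeasure_space_1)
  qed
  then have U: "AE r in lborel. r \<in> {0..T} \<longrightarrow> (\<integral>\<^sup>+\<omega>. ennreal (u r \<omega>) \<partial>M) = ennreal (z r)"
    by (subst (asm) AE_restrict_space_iff) auto
  have cont: "continuous_on {0..s} (\<lambda>r. exp (- \<delta> * (s - r)) * z r)"
    by (intro continuous_intros continuous_on_subset[OF z(1)]) (use s in auto)
  have nn: "0 \<le> exp (- \<delta> * (s - r)) * z r" if "r \<in> {0..s}" for r using z(2)[of r] that s by simp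
  have "(\<integral>\<^sup>+r\<in>{0..s}. ennreal (exp (- \<delta> * (s - r))) * (\<integral>\<^sup>+\<omega>. ennreal (u r \<omega>) \<partial>M) \<partial>lborel)
      = (\<integral>\<^sup>+r\<in>{0..s}. ennreal (exp (- \<delta> * (s - r)) * z r) \<partial>lborel)"
  proof (rule nn_integral_cong_AE)
    show "AE r in lborel. ennreal (exp (- \<delta> * (s - r))) * (\<integral>\<^sup>+\<omega>. ennreal (u r \<omega>) \<partial>M) * indicator {0..s} r
      = ennreal (exp (- \<delta> * (s - r)) * z r) * indicator {0..s} r"
      using U by eventually_elim (use s in \<open>auto simp: indicator_def ennreal_mult'\<close>)
  qed
  also have "\<dots> = ennreal (LBINT r:{0..s}. exp (- \<delta> * (s - r)) * z r)"
    by (rule nn_integral_Icc_continuous[OF cont nn])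
  finally have I: "(\<integral>\<^sup>+\<omega>. ennreal (state u s \<omega>) \<partial>M)
      = ennreal (exp (- \<delta> * s) * x\<^sub>0) + ennreal (LBINT r:{0..s}. exp (- \<delta> * (s - r)) * z r)"
    unfolding state_facts(4)[OF u s] by simp
  have L_nn: "0 \<le> (LBINT r:{0..s}. exp (- \<delta> * (s - r)) * z r)"
    unfolding set_lebesgue_integral_def by (rule integral_nonneg_AE, rule AE_I2) (use nn in \<open>auto simp: indicator_def\<close>)
  have "AE \<omega> in M. 0 \<le> state u s \<omega>" using state_facts(3)[OF u] by eventually_elim (use s in auto)
  from integral_eq_nn_integral[OF state_facts(2)[OF u s] this]
  show ?thesis unfolding I using x0_nn L_nn by (simp flip: ennreal_plus)
qed

lemma ide_solution_mild:
  assumes z: "continuous_on {0..T} (z_control \<delta> \<rho> \<beta> T y)" and pos: "\<And>s. s \<in> {0..T} \<Longrightarrow> 0 < y s"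
  shows "ide_solution \<delta> \<rho> \<beta> T x y \<longleftrightarrow>
    (\<forall>s\<in>{0..T}. y s = exp (- \<delta> * s) * x + (LBINT r:{0..s}. exp (- \<delta> * (s - r)) * z_control \<delta> \<rho> \<beta> T y r))"
    (is "_ \<longleftrightarrow> ?mild")
proof
  assume "ide_solution \<delta> \<rho> \<beta> T x y"
  from ide_solutionD[OF this] show ?mild
    using linear_ode_solution[OF z, of y \<delta>] by simp
next
  assume mild: ?mild
  have "AE r in lborel. indicator {0..0} r *\<^sub>R (exp (- \<delta> * (0 - r)) * z_control \<delta> \<rho> \<beta> T y r) = 0"
    by (rule AE_mp[OF AE_lborel_singleton[of 0]]) auto
  then have "(LBINT r:{0..0}. exp (- \<delta> * (0 - r)) * z_control \<delta> \<rho> \<beta> T y r) = 0"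
    unfolding set_lebesgue_integral_def by (rule integral_eq_zero_AE)
  then have y0: "y 0 = x" using bspec[OF mild, of 0] T by simp
  have d: "\<forall>s\<in>{0..T}. (y has_real_derivative - \<delta> * y s + z_control \<delta> \<rho> \<beta> T y s) (at s within {0..T})"
    unfolding linear_ode_solution[OF z, of y \<delta>] y0 by (rule mild)
  then have "continuous_on {0..T} y" by (intro DERIV_continuous_on) auto
  then show "ide_solution \<delta> \<rho> \<beta> T x y"
    unfolding ide_solution_def z_control_def[symmetric]
    using pos y0 d by (intro conjI exI[of _ "\<lambda>s. - \<delta> * y s + z_control \<delta> \<rho> \<beta> T y s"] continuous_intros z) auto
qed

lemma equilibrium_iff:
  assumes q: "q \<in> Q_class \<beta> T"
  shows "equilibrium M F B \<delta> \<sigma> \<rho> \<beta> T \<xi> u q \<longleftrightarrow>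
    u \<in> admissible M F T \<and> control_eq M T u (\<lambda>s \<omega>. z_control \<delta> \<rho> \<beta> T q s) \<and> ide_solution \<delta> \<rho> \<beta> T x\<^sub>0 q"
proof -
  note z = z_control_Q_class[OF q]
  have "q \<in> positive_measurable T" using q by (simp add: Q_class_def)
  moreover have "(\<forall>s\<in>{0..T}. q s = expectation (state u s)) \<longleftrightarrow> ide_solution \<delta> \<rho> \<beta> T x\<^sub>0 q"
    if u: "u \<in> admissible M F T" "control_eq M T u (\<lambda>s \<omega>. z_control \<delta> \<rho> \<beta> T q s)"
  proof -
    have "ide_solution \<delta> \<rho> \<beta> T x\<^sub>0 q \<longleftrightarrow> (\<forall>s\<in>{0..T}. q s = exp (- \<delta> * s) * x\<^sub>0
        + (LBINT r:{0..s}. exp (- \<delta> * (s - r)) * z_control \<delta> \<rho> \<beta> T q r))"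
      by (rule ide_solution_mild[OF z(1)]) (rule Q_classD(1)[OF q])
    moreover have "expectation (state u s) = exp (- \<delta> * s) * x\<^sub>0
        + (LBINT r:{0..s}. exp (- \<delta> * (s - r)) * z_control \<delta> \<rho> \<beta> T q r)" if "s \<in> {0..T}" for s
      by (rule expectation_state[OF u z(1) z(3) that])
    ultimately show ?thesis by simp
  qed
  ultimately show ?thesis
    unfolding equilibrium_def using optimal_iff[OF q] by blast
qed

text \<open>
  A solution is continuous and positive on a compact interval, so its price is bounded.
\<close>

lemma ide_solution_Q_class:
  assumes "ide_solution \<delta> \<rho> \<beta> T x y"
  shows "y \<in> Q_class \<beta> T"
proof -
  note y = ide_solutionD[OF assms]
  have "y \<in> borel_measurable (restrict_space borel {0..T})"
    by (rule borel_measurable_continuous_on_restrict[OF y(4)])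
  moreover have "set_integrable lborel {0..T} (\<lambda>s. y s powr (- \<beta>))"
    by (rule borel_integrable_atLeastAtMost') (use y(1) in \<open>force intro!: continuous_intros y(4)\<close>)
  then have "set_integrable lborel {0<..T} (\<lambda>s. y s powr (- \<beta>))"
    by (rule set_integrable_subset) auto
  ultimately show ?thesis using y(1) by (auto simp: Q_class_def positive_measurable_def)
qed

text \<open>
  By \<open>equilibrium_iff\<close> the equilibria are the pairs of a solution of the equation and its best reply, so everything
  follows from unique solvability.
\<close>

theorem unique_equilibrium:
  assumes x0: "0 < x\<^sub>0"
  shows "\<exists>u q. q \<in> Q_class \<beta> T \<and> equilibrium M F B \<delta> \<sigma> \<rho> \<beta> T \<xi> u q \<and>
    (\<forall>v p. p \<in> Q_class \<beta> T \<and> equilibrium M F B \<delta> \<sigma> \<rho> \<beta> T \<xi> v p \<longrightarrow>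
       control_eq M T v u \<and> (\<forall>s\<in>{0..T}. p s = q s)) \<and>
    control_eq M T u (\<lambda>s \<omega>. z_control \<delta> \<rho> \<beta> T q s) \<and>
    ide_solution \<delta> \<rho> \<beta> T x\<^sub>0 q \<and>
    (\<forall>y. ide_solution \<delta> \<rho> \<beta> T x\<^sub>0 y \<longrightarrow> (\<forall>s\<in>{0..T}. y s = q s))"
proof -
  obtain q where q: "ide_solution \<delta> \<rho> \<beta> T x\<^sub>0 q" using ide_solution_exists[OF \<delta> \<rho> \<beta> T x0] by blast
  have qQ: "q \<in> Q_class \<beta> T" by (rule ide_solution_Q_class[OF q])
  let ?u = "\<lambda>s (\<omega>::'a). z_control \<delta> \<rho> \<beta> T q s"
  have u: "?u \<in> admissible M F T" by (rule z_control_admissible[OF qQ T])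
  have u_eq: "control_eq M T ?u ?u" by (simp add: control_eq_def)
  have unique: "\<forall>s\<in>{0..T}. y s = q s" if "ide_solution \<delta> \<rho> \<beta> T x\<^sub>0 y" for y
    using ide_solution_unique[OF \<beta> T that q] by blast
  have "control_eq M T v ?u \<and> (\<forall>s\<in>{0..T}. p s = q s)"
    if p: "p \<in> Q_class \<beta> T" and e: "equilibrium M F B \<delta> \<sigma> \<rho> \<beta> T \<xi> v p" for v p
  proof
    have v: "control_eq M T v (\<lambda>s \<omega>. z_control \<delta> \<rho> \<beta> T p s)" and pide: "ide_solution \<delta> \<rho> \<beta> T x\<^sub>0 p"
      using e unfolding equilibrium_iff[OF p] by auto
    show pq: "\<forall>s\<in>{0..T}. p s = q s" by (rule unique[OF pide])
    have "z_control \<delta> \<rho> \<beta> T p s = z_control \<delta> \<rho> \<beta> T q s" if "s \<in> {0..T}" for s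
      unfolding z_control_def by (rule set_lebesgue_integral_cong) (use that pq in auto)
    then show "control_eq M T v ?u"
      using v AE_space unfolding control_eq_def
      by (elim AE_mp) (auto intro!: AE_I2 simp: space_pair_measure space_restrict_space)
  qed
  then show ?thesis
    using qQ equilibrium_iff[OF qQ, of ?u] u u_eq q unique by (intro exI[of _ ?u] exI[of _ q]) blast
qed

end

theorem theorem4p9:
  fixes M :: "'a measure" and F :: "real \<Rightarrow> 'a measure" and B :: "real \<Rightarrow> 'a \<Rightarrow> real"
    and \<delta> \<sigma> \<rho> \<beta> T :: real and \<xi> :: "'a \<Rightarrow> real"
  assumes "brownian_motion M F B"
    and "0 < \<delta>" and "0 < \<sigma>" and "0 < \<rho>" and "0 < \<beta>" and "0 < T"
    and "\<xi> \<in> borel_measurable (F 0)"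
    and "AE \<omega> in M. 0 < \<xi> \<omega>"
    and "integrable M \<xi>" and "0 < (\<integral>\<omega>. \<xi> \<omega> \<partial>M)"
  shows "\<exists>u q. q \<in> Q_class \<beta> T \<and> equilibrium M F B \<delta> \<sigma> \<rho> \<beta> T \<xi> u q \<and>
    (\<forall>v p. p \<in> Q_class \<beta> T \<and> equilibrium M F B \<delta> \<sigma> \<rho> \<beta> T \<xi> v p \<longrightarrow>
       control_eq M T v u \<and> (\<forall>s\<in>{0..T}. p s = q s)) \<and>
    control_eq M T u (\<lambda>s \<omega>. z_control \<delta> \<rho> \<beta> T q s) \<and>
    ide_solution \<delta> \<rho> \<beta> T (\<integral>\<omega>. \<xi> \<omega> \<partial>M) q \<and>
    (\<forall>y. ide_solution \<delta> \<rho> \<beta> T (\<integral>\<omega>. \<xi> \<omega> \<partial>M) y \<longrightarrow> (\<forall>s\<in>{0..T}. y s = q s))"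
proof -
  interpret brownian_motion M F B by fact
  interpret mean_field_game M F B \<delta> \<sigma> \<rho> \<beta> T \<xi> by unfold_locales fact+
  show ?thesis by (rule unique_equilibrium) fact
qed

end
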